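(* Fix a positive integer $k$. There is a randomised algorithm that, given a set $Z=\{z_1,\ldots,z_n\}\subseteq\mathbb{N}$ of $n$ positive integers, targets $t_1,\ldots,t_k$, cardinalities $c_1,\ldots,c_k$ with $\sum_i c_i\le n$, and an error probability $\delta\in(0,1/2^{k+1}]$, decides $k$-Subset Sum with cardinality constraints on this input with probability at least $1-\delta$ in time $\tilde{O}(n+t^k c^k)$, where $t=\max\{t_1,\ldots,t_k\}$ and $c=\max\{c_1,\ldots,c_k\}$.
   Context: $k$-Subset Sum with cardinality constraints: given a set $Z$ of $n$ positive integers, targets $t_1,\ldots,t_k$ and cardinalities $c_1,\ldots,c_k$, determine whether there exist pairwise disjoint subsets $Z_1,\ldots,Z_k\subseteq Z$ with $\Sigma(Z_i)=t_i$ and $|Z_i|=c_i$ for $i=1,\ldots,k$, where $\Sigma(X)=\sum_{x\in X}x$. The notation $\tilde{O}(\cdot)$ suppresses polylogarithmic factors. *)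

theory Defs
  imports "HOL-Probability.Probability_Mass_Function" "HOL-Library.Disjoint_Sets"
begin

definition k_subset_sum_card :: "nat \<Rightarrow> nat set \<Rightarrow> nat list \<Rightarrow> nat list \<Rightarrow> bool" where
  "k_subset_sum_card k Z ts cs \<longleftrightarrow>
     (\<exists>S :: nat \<Rightarrow> nat set.
        disjoint_family_on S {..<k} \<and>
        (\<forall>i<k. S i \<subseteq> Z \<and> \<Sum>(S i) = ts ! i \<and> card (S i) = cs ! i))"

text \<open>
  The model of computation is a unit-cost randomised word RAM with word length \<open>w\<close>.
  A program mentions finitely many registers; memory is addressed by register contents.
  All values that are computed are reduced modulo \<open>2 ^ w\<close>, so that a single
  instruction cannot operate on numbers of more than \<open>w\<close> bits. Subtraction is truncated
  at 0 (which also provides comparison), and \<open>Flip\<close> is one fair coin toss.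
  Control flow is structured: a block is a list of commands, and the tests
  of \<open>IfNZ\<close> and \<open>WhileNZ\<close> ask whether a register is nonzero.
\<close>

type_synonym reg = nat

datatype arith = Plus | Minus | Times | Div | Mod

datatype com =
    Const reg nat
  | Arith arith reg reg reg
  | Load reg reg
  | Store reg reg
  | Flip reg
  | IfNZ reg "com list" "com list"
  | WhileNZ reg "com list"

fun arith_val :: "arith \<Rightarrow> nat \<Rightarrow> nat \<Rightarrow> nat" where
  "arith_val Plus x y = x + y"
| "arith_val Minus x y = x - y"
| "arith_val Times x y = x * y"
| "arith_val Div x y = x div y"
| "arith_val Mod x y = x mod y"

text \<open>
  A configuration consists of the commands still to be executed, the registers, and the memory.
  It is halted if no command is left; halted configurations are fixed points of \<open>step\<close>.
\<close>

type_synonym config = "com list \<times> (reg \<Rightarrow> nat) \<times> (nat \<Rightarrow> nat)"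

fun step :: "nat \<Rightarrow> config \<Rightarrow> config pmf" where
  "step w ([], r, m) = return_pmf ([], r, m)"
| "step w (Const a v # K, r, m) = return_pmf (K, r(a := v mod 2 ^ w), m)"
| "step w (Arith f a b c # K, r, m) =
     return_pmf (K, r(a := arith_val f (r b) (r c) mod 2 ^ w), m)"
| "step w (Load a b # K, r, m) = return_pmf (K, r(a := m (r b) mod 2 ^ w), m)"
| "step w (Store a b # K, r, m) = return_pmf (K, r, m(r a := r b))"
| "step w (Flip a # K, r, m) =
     map_pmf (\<lambda>x. (K, r(a := of_bool x mod 2 ^ w), m)) (bernoulli_pmf (1 / 2))"
| "step w (IfNZ a B1 B2 # K, r, m) =
     return_pmf ((if r a \<noteq> 0 then B1 else B2) @ K, r, m)"
| "step w (WhileNZ a B # K, r, m) =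
     return_pmf (if r a \<noteq> 0 then B @ WhileNZ a B # K else K, r, m)"

definition run :: "nat \<Rightarrow> nat \<Rightarrow> config \<Rightarrow> config pmf" where
  "run w T cfg = ((\<lambda>p. bind_pmf p (step w)) ^^ T) (return_pmf cfg)"

definition initial :: "com list \<Rightarrow> nat list \<Rightarrow> config" where
  "initial P xs = (P, \<lambda>_. 0, \<lambda>i. if i < length xs then xs ! i else 0)"

definition halted :: "config \<Rightarrow> bool" where
  "halted cfg \<longleftrightarrow> fst cfg = []"

text \<open>The answer is read off register 0, where nonzero means yes.\<close>

definition answer :: "config \<Rightarrow> bool" where
  "answer cfg \<longleftrightarrow> fst (snd cfg) 0 \<noteq> 0"

text \<open>
  \<open>T\<close> bounds the running time for every outcome of the coin tosses, and \<open>b\<close> is the correct answer.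
\<close>

definition answers_within ::
  "nat \<Rightarrow> com list \<Rightarrow> nat list \<Rightarrow> bool \<Rightarrow> real \<Rightarrow> nat \<Rightarrow> bool" where
  "answers_within w P xs b p T \<longleftrightarrow>
     (\<forall>cfg \<in> set_pmf (run w T (initial P xs)). halted cfg) \<and>
     measure_pmf.prob (run w T (initial P xs)) {cfg. answer cfg = b} \<ge> p"

text \<open>
  The set \<open>Z\<close> is presented by a duplicate-free list \<open>zs\<close> in arbitrary order. A real error probability
  \<open>\<delta>\<close> is presented to the machine by the integer \<open>\<lceil>1/\<delta>\<rceil>\<close>.
\<close>

definition encode :: "nat list \<Rightarrow> nat list \<Rightarrow> nat list \<Rightarrow> real \<Rightarrow> nat list" where
  "encode zs ts cs \<delta> = length zs # nat \<lceil>1 / \<delta>\<rceil> # ts @ cs @ zs"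

text \<open>
  Words have \<open>\<Omega>(log N)\<close> bits, with constant \<open>e\<close>, where \<open>N\<close> is the largest number in the input.
\<close>

definition word_length_ok :: "nat \<Rightarrow> nat \<Rightarrow> nat list \<Rightarrow> bool" where
  "word_length_ok e w xs \<longleftrightarrow> Max (set xs) ^ e \<le> 2 ^ w"

text \<open>
  The bound \<open>C * (1 + f) * polylog\<close>, where \<open>x\<close> collects the quantities whose
  polylogarithms are suppressed. The summands 1 and 2 only matter in degenerate cases
  (for example an empty set \<open>Z\<close>), where the bound would otherwise vanish.
\<close>

definition soft_O_bound :: "real \<Rightarrow> nat \<Rightarrow> real \<Rightarrow> real \<Rightarrow> real" where
  "soft_O_bound C d x f = C * (1 + f) * log 2 (2 + x) ^ d"

end

theory Submission
  imports Defs "HOL-Library.Poly_Mapping" "HOL-Library.Function_Algebras" "HOL-Computational_Algebra.Polynomial" "HOL-Number_Theory.Cong"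
begin

text \<open>
  Give every pair of an element $z_j$ and a class $i < k$ a random weight $w_{j,i}$, and consider
  $F = \prod_j (1 + \sum_i w_{j,i} y_i x_i^{z_j})$ over a prime field. The coefficient of $\prod_i y_i^{c_i} x_i^{t_i}$
  is a sum of distinct multilinear monomials in the weights, one for each solution, so by the
  Schwartz--Zippel lemma it vanishes with probability at most one half if there is a solution, and always
  if there is none. Repeating $\log (1/\delta)$ times gives the error bound.

  The exponents are packed into one number (Kronecker substitution), with radix twice as large as needed so that
  digits that overflow are recognised and stay wrong. The derivation that multiplies a monomial
  by its code turns $F$ into $G F$, where the logarithmic derivative $G$ is a sum of $n$
  series with one simple recurrence each, and only the at most $t$ elements below $t$ matter. The equation
  $m F_m = \sum_{l < m} F_l G_{m - l}$ is solved online, in blocks whose length is the largest power of two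
  dividing the current index, with Nussbaumer's convolution, which needs no roots of unity
  and hence works for every odd prime. A prime just above the size of the table is found with a sieve;
  Chebyshev's estimate guarantees one that is larger by at most a logarithmic factor.

  The algorithm is written in a small structured language with arrays, verified there by weakest
  preconditions, and compiled to the word RAM.
\<close>

subsection \<open>Machine runs as functions of the coin tosses\<close>

text \<open>Multiplying \<open>F\<close> out factor by factor would cost the size of the coefficient
  table once per item. The logarithmic derivative replaces the product by a sum, and this sum is
  cheap: in the series of item \<open>j\<close> the exponents of the \<open>x\<close>-variables are
  \<open>z j\<close> times those of the \<open>y\<close>-variables, so its terms are indexed by the
  latter alone, which leaves \<open>(2 * c + 2) ^ k\<close> of them. With at most \<open>t\<close>
  relevant items the total is at most the table size. The price is the division by \<open>m\<close>
  in the recurrence; a prime above the table size \<open>2 ^ \<sigma>\<close> makes every index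
  invertible. As \<open>2 ^ \<sigma>\<close> is also at least twice the degree bound
  \<open>k * c\<close>, weights of \<open>\<sigma>\<close> bits suffice for failure probability one
  half.

  Series are truncated by calculating modulo the ideal of monomials with an exponent out of range.
  The identities of the convolution are proved for integers, via values at complex roots, and are
  read modulo the prime only in the program; there just 2 has to be inverted.\<close>

fun dstep :: "nat \<Rightarrow> config \<times> bool list \<Rightarrow> config \<times> bool list" where
  "dstep w (([], r, m), bs) = (([], r, m), bs)"
| "dstep w ((Const a v # K, r, m), bs) = ((K, r(a := v mod 2 ^ w), m), bs)"
| "dstep w ((Arith f a b c # K, r, m), bs) = ((K, r(a := arith_val f (r b) (r c) mod 2 ^ w), m), bs)"
| "dstep w ((Load a b # K, r, m), bs) = ((K, r(a := m (r b) mod 2 ^ w), m), bs)"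
| "dstep w ((Store a b # K, r, m), bs) = ((K, r, m(r a := r b)), bs)"
| "dstep w ((Flip a # K, r, m), bs) = ((K, r(a := of_bool (hd bs) mod 2 ^ w), m), tl bs)"
| "dstep w ((IfNZ a B1 B2 # K, r, m), bs) = (((if r a \<noteq> 0 then B1 else B2) @ K, r, m), bs)"
| "dstep w ((WhileNZ a B # K, r, m), bs) = ((if r a \<noteq> 0 then B @ WhileNZ a B # K else K, r, m), bs)"

lemma step_cases:
  "(\<exists>a K r m. cfg = (Flip a # K, r, m)) \<or>
   (\<exists>cfg'. step w cfg = return_pmf cfg' \<and> (\<forall>bs. dstep w (cfg, bs) = (cfg', bs)))"
proof -
  obtain K r m where cfg: "cfg = (K, r, m)" by (cases cfg) auto
  show ?thesis
  proof (cases K)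
    case (Cons a K')
    then show ?thesis using cfg by (cases a) auto
  qed (use cfg in auto)
qed

lemma funpow_bind_pmf:
  fixes f :: "'a \<Rightarrow> 'a pmf"
  shows "((\<lambda>p. bind_pmf p f) ^^ T) (bind_pmf q g) = bind_pmf q (\<lambda>x. ((\<lambda>p. bind_pmf p f) ^^ T) (g x))"
  by (induction T) (simp_all add: bind_assoc_pmf)

lemma run_Suc: "run w (Suc T) cfg = bind_pmf (step w cfg) (run w T)"
proof -
  have "run w (Suc T) cfg = ((\<lambda>p. bind_pmf p (step w)) ^^ T) (step w cfg)"
    unfolding run_def by (simp add: funpow_Suc_right bind_return_pmf del: funpow.simps)
  also have "\<dots> = bind_pmf (step w cfg) (run w T)"
    unfolding run_def using funpow_bind_pmf[of T "step w" "step w cfg" return_pmf]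
    by (simp add: bind_return_pmf')
  finally show ?thesis .
qed

abbreviation coins :: "nat \<Rightarrow> bool list pmf" where
  "coins n \<equiv> replicate_pmf n (bernoulli_pmf (1 / 2))"

lemma run_eq_coins:
  "T \<le> n \<Longrightarrow> run w T cfg = map_pmf (\<lambda>bs. fst ((dstep w ^^ T) (cfg, bs))) (coins n)"
proof (induction T arbitrary: n cfg)
  case 0
  then show ?case by (simp add: run_def map_pmf_def)
next
  case (Suc T)
  from step_cases[of cfg w] show ?case
  proof
    assume "\<exists>a K r m. cfg = (Flip a # K, r, m)"
    then obtain a K r m where cfg: "cfg = (Flip a # K, r, m)" by blast
    from Suc.prems obtain n' where n: "n = Suc n'" "T \<le> n'" by (cases n) auto
    have "run w (Suc T) cfg = bind_pmf (bernoulli_pmf (1/2))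
        (\<lambda>b. run w T (K, r(a := of_bool b mod 2 ^ w), m))"
      by (simp add: run_Suc cfg bind_map_pmf)
    also have "\<dots> = bind_pmf (bernoulli_pmf (1/2)) (\<lambda>b. bind_pmf (coins n') (\<lambda>bs.
        return_pmf (fst ((dstep w ^^ T) ((K, r(a := of_bool b mod 2 ^ w), m), bs)))))"
      using Suc.IH[OF n(2)] by (simp add: map_pmf_def)
    also have "\<dots> = map_pmf (\<lambda>bs. fst ((dstep w ^^ Suc T) (cfg, bs))) (coins n)"
      by (simp add: n cfg map_bind_pmf funpow_swap1)
    finally show ?thesis .
  next
    assume "\<exists>cfg'. step w cfg = return_pmf cfg' \<and> (\<forall>bs. dstep w (cfg, bs) = (cfg', bs))"
    then obtain cfg' where c: "step w cfg = return_pmf cfg'" "\<And>bs. dstep w (cfg, bs) = (cfg', bs)" by blast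
    have "run w (Suc T) cfg = run w T cfg'" by (simp add: run_Suc c bind_return_pmf)
    also have "\<dots> = map_pmf (\<lambda>bs. fst ((dstep w ^^ T) (cfg', bs))) (coins n)"
      using Suc.IH Suc.prems by simp
    finally show ?thesis by (simp add: c funpow_swap1)
  qed
qed

lemma finite_bool_lists: "finite {bs :: bool list. length bs = n}"
  using finite_lists_length_eq[of "UNIV :: bool set" n] by simp

lemma card_bool_lists: "card {bs :: bool list. length bs = n} = 2 ^ n"
  using card_lists_length_eq[of "UNIV :: bool set" n] by simp

lemma pmf_coins: "pmf (coins n) bs = (if length bs = n then (1 / 2) ^ n else 0)"
proof (induction n arbitrary: bs)
  case 0
  then show ?case by (cases bs) (auto simp: pmf_return)
next
  case (Suc n)
  have eq: "coins (Suc n) = bind_pmf (bernoulli_pmf (1/2)) (\<lambda>b. map_pmf (Cons b) (coins n))"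
    by (simp add: map_pmf_def)
  show ?case
  proof (cases bs)
    case Nil
    have "pmf (map_pmf (Cons b) (coins n)) [] = 0" for b :: bool
      by (rule pmf_map_outside) auto
    then show ?thesis unfolding eq Nil by (simp add: pmf_bind)
  next
    case (Cons a bs')
    have "pmf (map_pmf (Cons b) (coins n)) (a # bs') = (if a = b then pmf (coins n) bs' else 0)" for b
    proof (cases "a = b")
      case True
      then show ?thesis using pmf_map_inj'[of "Cons b" "coins n" bs'] by (simp add: inj_def)
    next
      case False
      then have "pmf (map_pmf (Cons b) (coins n)) (a # bs') = 0" by (intro pmf_map_outside) auto
      then show ?thesis using False by simp
    qed
    then show ?thesis unfolding eq Cons by (cases a) (simp_all add: pmf_bind Suc)
  qed
qed

lemma coins_eq_uniform: "coins n = pmf_of_set {bs. length bs = n}"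
proof (rule pmf_eqI)
  have ne: "{bs :: bool list. length bs = n} \<noteq> {}" using Ex_list_of_length by auto
  fix bs show "pmf (coins n) bs = pmf (pmf_of_set {bs. length bs = n}) bs"
    unfolding pmf_coins pmf_of_set[OF ne finite_bool_lists]
    by (simp add: card_bool_lists power_one_over indicator_def)
qed

text \<open>From here on probabilities are handled as cardinalities of sets of bit lists of a fixed
  length.\<close>

lemma prob_coins: "measure_pmf.prob (coins n) X = card {bs. length bs = n \<and> bs \<in> X} / 2 ^ n"
proof -
  have ne: "{bs :: bool list. length bs = n} \<noteq> {}" using Ex_list_of_length by auto
  have "{bs. length bs = n} \<inter> X = {bs. length bs = n \<and> bs \<in> X}" by auto
  then show ?thesis unfolding coins_eq_uniform measure_pmf_of_set[OF ne finite_bool_lists] card_bool_lists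
    by simp
qed

subsection \<open>Nussbaumer's convolution\<close>

text \<open>Complex values stand in for residues: at a root of \<open>y ^ B = -1\<close> the value
  only depends on the polynomial modulo \<open>y ^ B + 1\<close>, so no quotient ring has to be
  constructed.\<close>

definition ev :: "nat \<Rightarrow> (nat \<Rightarrow> int) \<Rightarrow> nat \<Rightarrow> complex \<Rightarrow> complex" where
  "ev B X o' y = (\<Sum>l<B. of_int (X (o' + l)) * y ^ l)"

text \<open>\<open>x\<close> and \<open>y\<close> are independent variables here; offsets such as
  \<open>q\<close> count blocks of length \<open>B\<close>, that is, elements of
  \<open>R\<close>.\<close>

definition bv :: "nat \<Rightarrow> (nat \<Rightarrow> int) \<Rightarrow> nat \<Rightarrow> nat \<Rightarrow> complex \<Rightarrow> complex \<Rightarrow> complex" where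
  "bv B X q L x y = (\<Sum>r<L. ev B X ((q + r) * B) y * x ^ r)"

text \<open>
  Several polynomials of length $MB$ modulo $x^{MB} + 1$ are stored one after the other. \<open>pSplit\<close> writes
  each as a polynomial of length $M$ in $x$ over $R = \mathbb{Z}[y]/(y^B + 1)$, where $y = x^M$, padded to length
  $2M$. \<open>pFwd\<close> and \<open>pInv\<close> are single butterfly passes of the Fourier transform over $R$, whose
  roots of unity are powers of $y$, so that multiplication by them is a cyclic shift with a change of sign.
  \<open>pDec\<close> substitutes $y = x^M$ again.
\<close>

definition pSplit :: "nat \<Rightarrow> nat \<Rightarrow> (nat \<Rightarrow> int) \<Rightarrow> nat \<Rightarrow> int" where
  "pSplit M B X j = (let l = j mod B; q = j div B; \<kappa> = q div (2 * M); pos = q mod (2 * M) in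
     if pos < M then X (\<kappa> * (M * B) + pos + M * l) else 0)"

definition pFwd :: "nat \<Rightarrow> nat \<Rightarrow> nat \<Rightarrow> nat \<Rightarrow> (nat \<Rightarrow> int) \<Rightarrow> nat \<Rightarrow> int" where
  "pFwd M B nb h X j = (let l = j mod B; q = j div B; \<kappa> = q div (2 * M); pos = q mod (2 * M);
     \<beta>' = pos div h; r = pos mod h; \<beta> = \<beta>' mod nb; e = \<beta>' div nb;
     o' = \<kappa> * (2 * M) + \<beta> * (2 * h) + r; c = (B * \<beta>) div nb; l' = l + B - c in
     if (l' div B + e) mod 2 = 1 then X (o' * B + l) + X ((o' + h) * B + l' mod B)
     else X (o' * B + l) - X ((o' + h) * B + l' mod B))"

definition pInv :: "nat \<Rightarrow> nat \<Rightarrow> nat \<Rightarrow> nat \<Rightarrow> (nat \<Rightarrow> int) \<Rightarrow> nat \<Rightarrow> int" where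
  "pInv M B nb h X j = (let l = j mod B; q = j div B; \<kappa> = q div (2 * M); pos = q mod (2 * M);
     \<beta> = pos div (2 * h); rr = pos mod (2 * h); e = rr div h; r = rr mod h;
     u = \<kappa> * (2 * M) + \<beta> * h + r; v = u + nb * h; c = (B * \<beta>) div nb in
     if e = 0 then X (u * B + l) + X (v * B + l)
     else if (l + c) div B = 0 then X (u * B + (l + c) mod B) - X (v * B + (l + c) mod B)
     else X (v * B + (l + c) mod B) - X (u * B + (l + c) mod B))"

definition pDec :: "nat \<Rightarrow> nat \<Rightarrow> (nat \<Rightarrow> int) \<Rightarrow> nat \<Rightarrow> int" where
  "pDec M B X j = (let i = j mod (M * B); \<kappa> = j div (M * B); i0 = i mod M; i1 = i div M;
     o' = \<kappa> * (2 * M) + i0 in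
     if i1 = 0 then X (o' * B + i1) - X ((o' + M) * B + (B - 1))
     else X (o' * B + i1) + X ((o' + M) * B + (i1 - 1)))"

text \<open>Multiplication of Gaussian integers, that is, of residues modulo
  \<open>x ^ 2 + 1\<close>; corresponding factors lie \<open>T\<close> cells apart.\<close>

definition pBase :: "nat \<Rightarrow> (nat \<Rightarrow> int) \<Rightarrow> nat \<Rightarrow> int" where
  "pBase T X j = (let z = j - j mod 2 in
     if j mod 2 = 0 then X z * X (z + T) - X (z + 1) * X (z + 1 + T)
     else X z * X (z + 1 + T) + X (z + 1) * X (z + T))"

section \<open>Regrouping of exponents and multiplication by powers of \<open>y\<close> as signed
  rotation\<close>

lemma sum_split_mod:
  fixes f :: "nat \<Rightarrow> 'a::comm_monoid_add"
  shows "(\<Sum>i<M * B. f i) = (\<Sum>r<M. \<Sum>l<B. f (r + M * l))"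
proof -
  have "(\<Sum>i<M * B. f i) = (\<Sum>l<B. \<Sum>i = l * M..<l * M + M. f i)"
    using sum.nat_group[of f M B] by (simp add: mult.commute)
  also have "\<dots> = (\<Sum>l<B. \<Sum>r<M. f (r + M * l))"
  proof (rule sum.cong[OF refl])
    fix l
    show "(\<Sum>i = l * M..<l * M + M. f i) = (\<Sum>r<M. f (r + M * l))"
      using sum.shift_bounds_nat_ivl[of f 0 "l * M" M] by (simp add: lessThan_atLeast0 add.commute mult.commute)
  qed
  also have "\<dots> = (\<Sum>r<M. \<Sum>l<B. f (r + M * l))" by (rule sum.swap)
  finally show ?thesis .
qed

lemma ev_split_mod:
  "ev (M * B) X o' x = (\<Sum>r<M. (\<Sum>l<B. of_int (X (o' + r + M * l)) * (x ^ M) ^ l) * x ^ r)"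
  unfolding ev_def sum_split_mod sum_distrib_right
  by (intro sum.cong refl) (simp add: power_add power_mult add.assoc)

text \<open>The reduction behind a butterfly: where \<open>x ^ h\<close> is a known power of
  \<open>y\<close> up to sign, length \<open>2 * h\<close> collapses to length
  \<open>h\<close>.\<close>

lemma bv_double:
  "bv B X q (2 * h) x y = (\<Sum>r<h. (ev B X ((q + r) * B) y + x ^ h * ev B X ((q + r + h) * B) y) * x ^ r)"
proof -
  have "bv B X q (2 * h) x y = (\<Sum>r<h. ev B X ((q + r) * B) y * x ^ r) + (\<Sum>r=h..<2*h. ev B X ((q + r) * B) y * x ^ r)"
    unfolding bv_def lessThan_atLeast0 by (rule sum.atLeastLessThan_concat[symmetric]) auto
  also have "(\<Sum>r=h..<2*h. ev B X ((q + r) * B) y * x ^ r) = (\<Sum>r<h. ev B X ((q + (r + h)) * B) y * x ^ (r + h))"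
    using sum.shift_bounds_nat_ivl[of "\<lambda>r. ev B X ((q + r) * B) y * x ^ r" 0 h h]
    by (simp add: lessThan_atLeast0 mult_2)
  finally show ?thesis
    by (simp add: sum.distrib[symmetric] algebra_simps power_add)
qed

lemma shift_bij: "c < B \<Longrightarrow> bij_betw (\<lambda>l. (l + c) mod B) {..<B} {..<B::nat}"
proof (rule bij_betw_byWitness[where f' = "\<lambda>l. (l + B - c) mod B"])
  assume c: "c < B"
  show "\<forall>l\<in>{..<B}. ((l + c) mod B + B - c) mod B = l"
  proof
    fix l assume l: "l \<in> {..<B}"
    show "((l + c) mod B + B - c) mod B = l"
    proof (cases "l + c < B")
      case False
      then have "(l + c) mod B = l + c - B" using l c by (simp add: le_mod_geq)
      then show ?thesis using l c False by simp
    qed (use l in simp)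
  qed
  show "\<forall>l\<in>{..<B}. ((l + B - c) mod B + c) mod B = l"
  proof
    fix l assume l: "l \<in> {..<B}"
    show "((l + B - c) mod B + c) mod B = l"
    proof (cases "l < c")
      case False
      then have "(l + B - c) mod B = l - c" using l c by (simp add: le_mod_geq)
      then show ?thesis using l c False by simp
    qed (use l c in simp)
  qed
qed (auto intro!: mod_less_divisor)

text \<open>Reading the coefficients from index \<open>l + c\<close> on divides by
  \<open>y ^ c\<close>; those that wrap around pick up the sign \<open>y ^ B = -1\<close>. The
  multiplied-out form avoids negative powers.\<close>

lemma shift_up:
  fixes f :: "nat \<Rightarrow> complex"
  assumes "c < B" "y ^ B = -1"
  shows "(\<Sum>l<B. (if (l + c) div B = 0 then f ((l + c) mod B) else - f ((l + c) mod B)) * y ^ l) * y ^ c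
    = (\<Sum>l<B. f l * y ^ l)"
proof -
  have "(\<Sum>l<B. f l * y ^ l) = (\<Sum>l<B. f ((l + c) mod B) * y ^ ((l + c) mod B))"
    using sum.reindex_bij_betw[OF shift_bij[OF assms(1)], of "\<lambda>l. f l * y ^ l"] by simp
  also have "\<dots> = (\<Sum>l<B. (if (l + c) div B = 0 then f ((l + c) mod B) else - f ((l + c) mod B)) * y ^ l * y ^ c)"
  proof (rule sum.cong[OF refl])
    fix l assume l: "l \<in> {..<B}"
    show "f ((l + c) mod B) * y ^ ((l + c) mod B) =
      (if (l + c) div B = 0 then f ((l + c) mod B) else - f ((l + c) mod B)) * y ^ l * y ^ c"
    proof (cases "l + c < B")
      case True
      then show ?thesis by (simp add: power_add)
    next
      case False
      then have m: "(l + c) mod B = l + c - B" using l assms by (simp add: le_mod_geq)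
      have "y ^ (l + c) = y ^ (l + c - B) * y ^ B" using False by (simp add: power_add[symmetric])
      then have "y ^ (l + c - B) = - (y ^ l * y ^ c)" using assms(2) by (simp add: power_add)
      moreover have "(l + c) div B \<noteq> 0" using False l by (auto simp: div_eq_0_iff)
      ultimately show ?thesis using m by simp
    qed
  qed
  finally show ?thesis by (simp add: sum_distrib_right)
qed

text \<open>The opposite rotation is \<open>shift_up\<close> by \<open>B - c\<close>, because
  \<open>y ^ c * y ^ (B - c) = -1\<close>. The quotient \<open>(l + B - c) div B\<close> is 1
  exactly if nothing wraps around. For \<open>c = 0\<close> the rotation by \<open>B\<close> is not
  a proper one, hence the separate case.\<close>

lemma shift_down:
  fixes f :: "nat \<Rightarrow> complex"
  assumes "c < B" "y ^ B = -1"
  shows "(\<Sum>l<B. (if (l + B - c) div B = 1 then f ((l + B - c) mod B) else - f ((l + B - c) mod B)) * y ^ l)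
    = y ^ c * (\<Sum>l<B. f l * y ^ l)"
proof (cases "c = 0")
  case True
  have "(l + B) div B = 1" "(l + B) mod B = l" if "l < B" for l using that by auto
  then have "(\<Sum>l<B. (if (l + B - c) div B = 1 then f ((l + B - c) mod B) else - f ((l + B - c) mod B)) * y ^ l) = (\<Sum>l<B. f l * y ^ l)"
    unfolding True by (intro sum.cong refl) simp
  then show ?thesis unfolding True by simp
next
  case False
  have y: "y \<noteq> 0" using assms by (cases "y = 0") (auto simp: power_0_left)
  have "y ^ c * y ^ (B - c) = -1" using assms by (simp add: power_add[symmetric])
  then have e: "y ^ c * (y ^ (B - c) * z) = - z" for z by (simp add: mult.assoc[symmetric])
  have q: "(\<Sum>l<B. f l * y ^ l) = (\<Sum>l<B. (if (l + (B - c)) div B = 0 then f ((l + (B - c)) mod B) else - f ((l + (B - c)) mod B)) * y ^ l) * y ^ (B - c)"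
    using False assms by (intro shift_up[symmetric]) auto
  have "y ^ c * (\<Sum>l<B. f l * y ^ l) = - (\<Sum>l<B. (if (l + (B - c)) div B = 0 then f ((l + (B - c)) mod B) else - f ((l + (B - c)) mod B)) * y ^ l)"
    unfolding q by (simp only: mult.commute[of _ "y ^ (B - c)"] e)
  also have "\<dots> = (\<Sum>l<B. (if (l + B - c) div B = 1 then f ((l + B - c) mod B) else - f ((l + B - c) mod B)) * y ^ l)"
    unfolding sum_negf[symmetric]
  proof (rule sum.cong[OF refl])
    fix l assume l: "l \<in> {..<B}"
    have ld: "l + (B - c) = l + B - c" using assms by simp
    have "(l + B - c) div B < 2" using l assms by (intro less_mult_imp_div_less) simp
    then have "(l + B - c) div B = 0 \<or> (l + B - c) div B = 1" by linarith
    then show "- ((if (l + (B - c)) div B = 0 then f ((l + (B - c)) mod B) else - f ((l + (B - c)) mod B)) * y ^ l)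
      = (if (l + B - c) div B = 1 then f ((l + B - c) mod B) else - f ((l + B - c) mod B)) * y ^ l"
      unfolding ld by auto
  qed
  finally show ?thesis by simp
qed

section \<open>Effect of the single passes on the represented values\<close>

lemma idx_decode:
  assumes "(l::nat) < B" "pos < M2"
  shows "((\<kappa> * M2 + pos) * B + l) mod B = l" "((\<kappa> * M2 + pos) * B + l) div B = \<kappa> * M2 + pos"
    "(\<kappa> * M2 + pos) div M2 = \<kappa>" "(\<kappa> * M2 + pos) mod M2 = pos"
  using assms by auto

lemma blk_less: "(\<beta>::nat) < n \<Longrightarrow> r < h \<Longrightarrow> \<beta> * h + r < n * h"
proof -
  assume "\<beta> < n" "r < h"
  then have "\<beta> * h + r < Suc \<beta> * h" by simp
  also have "\<dots> \<le> n * h" using \<open>\<beta> < n\<close> by (intro mult_le_mono1) simp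
  finally show ?thesis .
qed

lemma bv_pSplit:
  assumes "0 < M" "0 < B"
  shows "bv B (pSplit M B X) (\<kappa> * (2 * M)) (2 * M) x y =
    (\<Sum>r<M. (\<Sum>l<B. of_int (X (\<kappa> * (M * B) + r + M * l)) * y ^ l) * x ^ r)"
proof -
  have e: "ev B (pSplit M B X) ((\<kappa> * (2 * M) + pos) * B) y =
    (if pos < M then (\<Sum>l<B. of_int (X (\<kappa> * (M * B) + pos + M * l)) * y ^ l) else 0)" if pos: "pos < 2 * M" for pos
  proof -
    have "pSplit M B X ((\<kappa> * (2 * M) + pos) * B + l) = (if pos < M then X (\<kappa> * (M * B) + pos + M * l) else 0)"
      if l: "l < B" for l
      unfolding pSplit_def Let_def by (simp only: idx_decode[OF l pos])
    then show ?thesis unfolding ev_def by (auto intro!: sum.cong sum.neutral)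
  qed
  have "bv B (pSplit M B X) (\<kappa> * (2 * M)) (2 * M) x y =
    (\<Sum>r<2 * M. if r < M then (\<Sum>l<B. of_int (X (\<kappa> * (M * B) + r + M * l)) * y ^ l) * x ^ r else 0)"
    unfolding bv_def by (intro sum.cong refl) (simp add: e)
  also have "\<dots> = (\<Sum>r\<in>{..<2 * M} \<inter> {r. r < M}. (\<Sum>l<B. of_int (X (\<kappa> * (M * B) + r + M * l)) * y ^ l) * x ^ r)"
    by (rule sum.inter_restrict[symmetric, where g="\<lambda>r. (\<Sum>l<B. of_int (X (\<kappa> * (M * B) + r + M * l)) * y ^ l) * x ^ r" and B="{r. r < M}" and A="{..<2 * M}", simplified])
  also have "{..<2 * M} \<inter> {r. r < M} = {..<M}" by auto
  finally show ?thesis .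
qed

text \<open>A node whose roots satisfy \<open>x ^ (2 * h) = y ^ (2 * c)\<close> is split into
  residues for \<open>x ^ h = y ^ c\<close> and for \<open>x ^ h = - (y ^ c)\<close>. The children
  of \<open>\<beta>\<close> are stored at \<open>\<beta>\<close> and \<open>\<beta> + nb\<close>,
  which leaves the final values in the natural order of their exponents, so that no bit reversal is
  needed.\<close>

lemma bv_pFwd:
  assumes y: "y ^ B = -1" and M: "nb * h = M" "0 < nb" "0 < h" "0 < B" and b: "\<beta> < nb" "e < 2"
    and x: "x ^ h = y ^ (B * \<beta> div nb) * (-1) ^ e"
  shows "bv B (pFwd M B nb h X) (\<kappa> * (2 * M) + (\<beta> + nb * e) * h) h x y =
    bv B X (\<kappa> * (2 * M) + \<beta> * (2 * h)) (2 * h) x y"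
proof -
  define c where "c = B * \<beta> div nb"
  have cB: "c < B" unfolding c_def using b M(4) by (simp add: div_less_iff_less_mult M(2))
  have "\<beta> + nb * e < 2 * nb" using b by (cases e) (auto simp: less_Suc_eq numeral_2_eq_2)
  have key: "ev B (pFwd M B nb h X) ((\<kappa> * (2 * M) + (\<beta> + nb * e) * h + r) * B) y =
     ev B X ((\<kappa> * (2 * M) + \<beta> * (2 * h) + r) * B) y +
     x ^ h * ev B X ((\<kappa> * (2 * M) + \<beta> * (2 * h) + r + h) * B) y" if r: "r < h" for r
  proof -
    let ?o = "\<kappa> * (2 * M) + \<beta> * (2 * h) + r"
    let ?f = "\<lambda>l. of_int (X ((?o + h) * B + l)) :: complex"
    have pos: "(\<beta> + nb * e) * h + r < 2 * M"
      using blk_less[OF \<open>\<beta> + nb * e < 2 * nb\<close> r] M(1) by (simp add: mult.assoc)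
    have pd: "((\<beta> + nb * e) * h + r) div h = \<beta> + nb * e" "((\<beta> + nb * e) * h + r) mod h = r"
      "(\<beta> + nb * e) mod nb = \<beta>" "(\<beta> + nb * e) div nb = e"
      using r b M by auto
    have w: "pFwd M B nb h X ((\<kappa> * (2 * M) + ((\<beta> + nb * e) * h + r)) * B + l) =
       (if ((l + B - c) div B + e) mod 2 = 1 then X (?o * B + l) + X ((?o + h) * B + (l + B - c) mod B)
        else X (?o * B + l) - X ((?o + h) * B + (l + B - c) mod B))" if l: "l < B" for l
      unfolding pFwd_def Let_def idx_decode[OF l pos] pd c_def by simp
    have "ev B (pFwd M B nb h X) ((\<kappa> * (2 * M) + ((\<beta> + nb * e) * h + r)) * B) y =
      (\<Sum>l<B. of_int (X (?o * B + l)) * y ^ l +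
        (-1) ^ e * ((if (l + B - c) div B = 1 then ?f ((l + B - c) mod B) else - ?f ((l + B - c) mod B)) * y ^ l))"
      unfolding ev_def
    proof (rule sum.cong[OF refl])
      fix l assume l: "l \<in> {..<B}"
      have "(l + B - c) div B < 2" using l cB by (intro less_mult_imp_div_less) simp
      then have "(l + B - c) div B = 0 \<or> (l + B - c) div B = 1" by linarith
      moreover have "e = 0 \<or> e = 1" using b by auto
      ultimately show "of_int (pFwd M B nb h X ((\<kappa> * (2 * M) + ((\<beta> + nb * e) * h + r)) * B + l)) * y ^ l =
        of_int (X (?o * B + l)) * y ^ l +
        (-1) ^ e * ((if (l + B - c) div B = 1 then ?f ((l + B - c) mod B) else - ?f ((l + B - c) mod B)) * y ^ l)"
        using w[of l] l by (auto simp: algebra_simps)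
    qed
    also have "\<dots> = ev B X (?o * B) y + (-1) ^ e * (y ^ c * (\<Sum>l<B. ?f l * y ^ l))"
      unfolding sum.distrib sum_distrib_left[symmetric] ev_def using shift_down[OF cB y, of ?f] by simp
    also have "\<dots> = ev B X (?o * B) y + x ^ h * ev B X ((?o + h) * B) y"
      using x unfolding ev_def c_def by (simp add: mult_ac)
    finally show ?thesis by (simp add: add.assoc)
  qed
  show ?thesis unfolding bv_double unfolding bv_def
    by (intro sum.cong refl) (simp add: key)
qed

text \<open>Chinese remaindering for one node: the sum of the two children is twice the lower half,
  their difference divided by \<open>y ^ c\<close> twice the upper half, and the factor 2 is left
  in. A root of the parent is a root of one of the children, so it is enough that each child has the
  values of \<open>R\<close> at its own roots.\<close>

lemma bv_pInv:
  assumes y: "y ^ B = -1" and M: "nb * h = M" "0 < nb" "0 < h" "0 < B" and b: "\<beta> < nb"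
    and c: "c = B * \<beta> div nb"
    and U: "\<And>x. x ^ h = y ^ c \<Longrightarrow> bv B X (\<kappa> * (2 * M) + \<beta> * h) h x y = R x"
    and V: "\<And>x. x ^ h = - (y ^ c) \<Longrightarrow> bv B X (\<kappa> * (2 * M) + (\<beta> + nb) * h) h x y = R x"
    and x: "x ^ (2 * h) = y ^ (2 * c)"
  shows "bv B (pInv M B nb h X) (\<kappa> * (2 * M) + \<beta> * (2 * h)) (2 * h) x y = 2 * R x"
proof -
  have cB: "c < B" unfolding c using b M(4) by (simp add: div_less_iff_less_mult M(2))
  have y0: "y \<noteq> 0" using y M(4) by (cases "y = 0") (auto simp: power_0_left)
  let ?q = "\<kappa> * (2 * M) + \<beta> * (2 * h)"
  let ?u = "\<lambda>r. ev B X ((\<kappa> * (2 * M) + \<beta> * h + r) * B) y"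
  let ?v = "\<lambda>r. ev B X ((\<kappa> * (2 * M) + (\<beta> + nb) * h + r) * B) y"
  have dec: "pInv M B nb h X ((?q + (e * h + r)) * B + l) =
     (if e = 0 then X ((\<kappa> * (2 * M) + \<beta> * h + r) * B + l) + X ((\<kappa> * (2 * M) + (\<beta> + nb) * h + r) * B + l)
      else if (l + c) div B = 0 then X ((\<kappa> * (2 * M) + \<beta> * h + r) * B + (l + c) mod B) - X ((\<kappa> * (2 * M) + (\<beta> + nb) * h + r) * B + (l + c) mod B)
      else X ((\<kappa> * (2 * M) + (\<beta> + nb) * h + r) * B + (l + c) mod B) - X ((\<kappa> * (2 * M) + \<beta> * h + r) * B + (l + c) mod B))"
    if r: "r < h" and e: "e < 2" and l: "l < B" for r e l
  proof -
    have eh: "e * h + r < 2 * h" using blk_less[OF e r] .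
    have pos: "\<beta> * (2 * h) + (e * h + r) < 2 * M" using blk_less[OF b eh] M(1) by (simp add: mult_ac)
    have pd: "(\<beta> * (2 * h) + (e * h + r)) div (2 * h) = \<beta>" "(\<beta> * (2 * h) + (e * h + r)) mod (2 * h) = e * h + r"
      "(e * h + r) div h = e" "(e * h + r) mod h = r"
      using eh r by auto
    have ar: "\<kappa> * (2 * M) + \<beta> * h + r + nb * h = \<kappa> * (2 * M) + (\<beta> + nb) * h + r" by (simp add: algebra_simps)
    have "?q + (e * h + r) = \<kappa> * (2 * M) + (\<beta> * (2 * h) + (e * h + r))" by simp
    then show ?thesis
      unfolding pInv_def Let_def by (simp only: idx_decode[OF l pos] pd ar c[symmetric])
  qed
  have k0: "ev B (pInv M B nb h X) ((?q + r) * B) y = ?u r + ?v r" if r: "r < h" for r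
    unfolding ev_def sum.distrib[symmetric]
    using dec[OF r, of 0] by (intro sum.cong refl) (simp add: algebra_simps)
  have k1: "ev B (pInv M B nb h X) ((?q + r + h) * B) y * y ^ c = ?u r - ?v r" if r: "r < h" for r
  proof -
    let ?f = "\<lambda>l. of_int (X ((\<kappa> * (2 * M) + \<beta> * h + r) * B + l)) - of_int (X ((\<kappa> * (2 * M) + (\<beta> + nb) * h + r) * B + l)) :: complex"
    have "?q + r + h = ?q + (1 * h + r)" by simp
    then have "ev B (pInv M B nb h X) ((?q + r + h) * B) y =
       (\<Sum>l<B. (if (l + c) div B = 0 then ?f ((l + c) mod B) else - ?f ((l + c) mod B)) * y ^ l)"
      unfolding ev_def using dec[OF r, of 1] by (intro sum.cong refl) (simp only:, simp)
    then show ?thesis unfolding shift_up[OF cB y, of ?f, symmetric]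
      by (simp add: shift_up[OF cB y, of ?f]) (simp add: ev_def left_diff_distrib sum_subtractf)
  qed
  have "(x ^ h) ^ 2 = (y ^ c) ^ 2" using x by (simp add: power_mult[symmetric] mult.commute)
  then have "x ^ h = y ^ c \<or> x ^ h = - (y ^ c)" by (simp add: power2_eq_iff)
  moreover have "bv B (pInv M B nb h X) ?q (2 * h) x y = 2 * bv B X (\<kappa> * (2 * M) + \<beta> * h) h x y" if "x ^ h = y ^ c"
  proof -
    have "ev B (pInv M B nb h X) ((?q + r) * B) y + x ^ h * ev B (pInv M B nb h X) ((?q + r + h) * B) y = 2 * ?u r"
      if "r < h" for r
      using k0[OF that] k1[OF that] \<open>x ^ h = y ^ c\<close> by (simp add: mult.commute)
    then show ?thesis unfolding bv_double unfolding bv_def sum_distrib_left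
      by (intro sum.cong refl) (simp add: mult.assoc)
  qed
  moreover have "bv B (pInv M B nb h X) ?q (2 * h) x y = 2 * bv B X (\<kappa> * (2 * M) + (\<beta> + nb) * h) h x y" if "x ^ h = - (y ^ c)"
  proof -
    have "ev B (pInv M B nb h X) ((?q + r) * B) y + x ^ h * ev B (pInv M B nb h X) ((?q + r + h) * B) y = 2 * ?v r"
      if "r < h" for r
      using k0[OF that] k1[OF that] \<open>x ^ h = - (y ^ c)\<close> by (simp add: mult.commute)
    then show ?thesis unfolding bv_double unfolding bv_def sum_distrib_left
      by (intro sum.cong refl) (simp add: mult.assoc)
  qed
  ultimately show ?thesis using U V by metis
qed

lemma ev_wrap:
  assumes "y ^ Suc B = -1"
  shows "- of_int (X (q + B)) + (\<Sum>l<B. of_int (X (q + l)) * y ^ (l + 1)) = y * ev (Suc B) X q y"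
proof -
  have e: "y * (y ^ B * z) = - z" for z using assms by (simp add: mult.assoc[symmetric])
  show ?thesis unfolding ev_def by (simp add: distrib_left sum_distrib_left mult_ac e)
qed

text \<open>Under \<open>y = x ^ M\<close> the upper half of the padded polynomial carries the
  factor \<open>x ^ M = y\<close>, a rotation by one place in \<open>R\<close>. This explains the
  index \<open>i1 - 1\<close> and the sign of the coefficient that re-enters at
  \<open>i1 = 0\<close>.\<close>

lemma ev_pDec:
  assumes "0 < M" "0 < B" and x: "x ^ (M * B) = -1"
  shows "ev (M * B) (pDec M B X) (\<kappa> * (M * B)) x = bv B X (\<kappa> * (2 * M)) (2 * M) x (x ^ M)"
proof -
  let ?y = "x ^ M"
  have y: "?y ^ B = -1" using x by (simp add: power_mult)
  have "ev (M * B) (pDec M B X) (\<kappa> * (M * B)) x =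
    (\<Sum>r<M. (\<Sum>l<B. of_int (pDec M B X (\<kappa> * (M * B) + r + M * l)) * ?y ^ l) * x ^ r)"
    by (rule ev_split_mod)
  also have "\<dots> = (\<Sum>r<M. (ev B X ((\<kappa> * (2 * M) + r) * B) ?y + x ^ M * ev B X ((\<kappa> * (2 * M) + r + M) * B) ?y) * x ^ r)"
  proof (rule sum.cong[OF refl])
    fix r assume r: "r \<in> {..<M}"
    let ?o = "\<kappa> * (2 * M) + r"
    have d: "pDec M B X (\<kappa> * (M * B) + r + M * l) =
      (if l = 0 then X (?o * B + l) - X ((?o + M) * B + (B - 1)) else X (?o * B + l) + X ((?o + M) * B + (l - 1)))"
      if l: "l < B" for l
    proof -
      have lt: "r + M * l < M * B" using blk_less[OF l, of r M] r by (simp add: mult.commute add.commute)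
      have "(\<kappa> * (M * B) + r + M * l) mod (M * B) = r + M * l" "(\<kappa> * (M * B) + r + M * l) div (M * B) = \<kappa>"
        "(r + M * l) mod M = r" "(r + M * l) div M = l"
        using lt r assms by (simp_all add: add.assoc)
      then show ?thesis unfolding pDec_def Let_def by (simp only:)
    qed
    have aux: "of_int (if P then a - b else a + c) * z = of_int a * z + (if P then - of_int b else of_int c) * z"
      for P a b c and z :: complex by (simp add: algebra_simps)
    obtain B' where B': "B = Suc B'" using assms by (cases B) auto
    have "(\<Sum>l<B. of_int (pDec M B X (\<kappa> * (M * B) + r + M * l)) * ?y ^ l) =
       (\<Sum>l<B. of_int (X (?o * B + l)) * ?y ^ l) +
       (\<Sum>l<B. (if l = 0 then - of_int (X ((?o + M) * B + (B - 1))) else of_int (X ((?o + M) * B + (l - 1)))) * ?y ^ l)"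
      unfolding sum.distrib[symmetric] by (intro sum.cong refl) (simp only: d lessThan_iff aux)
    also have "(\<Sum>l<B. (if l = 0 then - of_int (X ((?o + M) * B + (B - 1))) else of_int (X ((?o + M) * B + (l - 1)))) * ?y ^ l)
      = - of_int (X ((?o + M) * B + B')) + (\<Sum>l<B'. of_int (X ((?o + M) * B + l)) * ?y ^ (l + 1))"
      unfolding B' sum.lessThan_Suc_shift by simp
    also have "\<dots> = ?y * ev B X ((?o + M) * B) ?y"
      using ev_wrap[of ?y B' X "(?o + M) * B"] y by (simp only: B')
    finally show "(\<Sum>l<B. of_int (pDec M B X (\<kappa> * (M * B) + r + M * l)) * ?y ^ l) * x ^ r =
      (ev B X (?o * B) ?y + x ^ M * ev B X ((?o + M) * B) ?y) * x ^ r"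
      by (simp add: ev_def)
  qed
  finally show ?thesis by (simp add: bv_double)
qed


section \<open>Complete transforms and the recursive multiplication\<close>

fun fwdL :: "nat \<Rightarrow> nat \<Rightarrow> nat \<Rightarrow> (nat \<Rightarrow> int) \<Rightarrow> nat \<Rightarrow> int" where
  "fwdL m b 0 X = pSplit (2 ^ m) (2 ^ b) X"
| "fwdL m b (Suc i) X = pFwd (2 ^ m) (2 ^ b) (2 ^ i) (2 ^ (m - i)) (fwdL m b i X)"

text \<open>Before pass \<open>i\<close> of \<open>invL\<close> a node has length
  \<open>2 ^ i\<close>, before pass \<open>i\<close> of \<open>fwdL\<close> there are
  \<open>2 ^ i\<close> nodes; the inverse runs through the same levels backwards, with the roles of
  the two parameters exchanged.\<close>

fun invL :: "nat \<Rightarrow> nat \<Rightarrow> nat \<Rightarrow> (nat \<Rightarrow> int) \<Rightarrow> nat \<Rightarrow> int" where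
  "invL m b 0 X = X"
| "invL m b (Suc i) X = pInv (2 ^ m) (2 ^ b) (2 ^ (m - i)) (2 ^ i) (invL m b i X)"

text \<open>
  Products modulo $x^N + 1$ are expressed by values at the complex roots of $x^N = -1$. The scale \<open>S\<close>
  is the power of two that accumulates because the inverse transforms are not normalised; it is divided out modulo \<open>p\<close>
  at the end.
\<close>

definition mulp :: "nat \<Rightarrow> nat \<Rightarrow> nat \<Rightarrow> (nat \<Rightarrow> int) \<Rightarrow> (nat \<Rightarrow> int) \<Rightarrow> bool" where
  "mulp S s K X Z \<longleftrightarrow> (\<forall>\<kappa><K. \<forall>x. x ^ (2 ^ s) = -1 \<longrightarrow>
     ev (2 ^ s) Z (\<kappa> * 2 ^ s) x = of_nat S * ev (2 ^ s) X (\<kappa> * 2 ^ s) x * ev (2 ^ s) X ((\<kappa> + K) * 2 ^ s) x)"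

text \<open>The value that a node has to represent: input polynomial number \<open>\<kappa>\<close>
  in its two-variable form, for arbitrary \<open>x\<close> and \<open>y\<close> and not only for
  \<open>y = x ^ M\<close>.\<close>

definition avl :: "nat \<Rightarrow> nat \<Rightarrow> (nat \<Rightarrow> int) \<Rightarrow> nat \<Rightarrow> complex \<Rightarrow> complex \<Rightarrow> complex" where
  "avl M B X \<kappa> x y = (\<Sum>r<M. (\<Sum>l<B. of_int (X (\<kappa> * (M * B) + r + M * l)) * y ^ l) * x ^ r)"

text \<open>The divisions are exact since \<open>2 ^ i\<close> divides \<open>2 ^ b\<close>. This is
  what \<open>m \<le> b\<close> is for in the lemmas below: \<open>R\<close> has to contain a root
  of unity of order \<open>2 * 2 ^ m\<close>, and \<open>y\<close> has order
  \<open>2 * 2 ^ b\<close>.\<close>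

lemma exp_double:
  assumes "i \<le> b" "e < (2 :: nat)"
  shows "2 * 2 ^ b * (\<beta> + 2 ^ i * e) div 2 ^ Suc i = 2 ^ b * \<beta> div 2 ^ i + (2 ^ b * e :: nat)"
    and "2 * 2 ^ b * \<beta> div 2 ^ i = 2 * (2 ^ b * \<beta> div (2 ^ i :: nat))"
proof -
  obtain a where "b = i + a" using assms le_Suc_ex by blast
  then have b: "2 ^ b = 2 ^ i * (2 ^ a :: nat)" by (simp add: power_add)
  have "2 * 2 ^ b * (\<beta> + 2 ^ i * e) = 2 ^ Suc i * (2 ^ a * (\<beta> + 2 ^ i * e))" by (simp add: b)
  then have "2 * 2 ^ b * (\<beta> + 2 ^ i * e) div 2 ^ Suc i = 2 ^ a * (\<beta> + 2 ^ i * e)"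
    by (metis nonzero_mult_div_cancel_left power_not_zero zero_neq_numeral)
  also have "\<dots> = 2 ^ b * \<beta> div 2 ^ i + 2 ^ b * e" by (simp add: b mult.assoc distrib_left mult_ac)
  finally show "2 * 2 ^ b * (\<beta> + 2 ^ i * e) div 2 ^ Suc i = 2 ^ b * \<beta> div 2 ^ i + (2 ^ b * e :: nat)" .
  have "2 * 2 ^ b * \<beta> = 2 ^ i * (2 * 2 ^ a * \<beta>)" by (simp add: b)
  then have "2 * 2 ^ b * \<beta> div 2 ^ i = 2 * 2 ^ a * \<beta>"
    by (metis nonzero_mult_div_cancel_left power_not_zero zero_neq_numeral)
  then show "2 * 2 ^ b * \<beta> div 2 ^ i = 2 * (2 ^ b * \<beta> div (2 ^ i :: nat))" by (simp add: b mult.assoc)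
qed

text \<open>A node keeps the values of the input at its own roots. After the last pass its length is
  one, so the root is a power of \<open>y\<close> and the node is a value of the polynomial in
  \<open>R\<close>.\<close>

lemma fwdL_correct:
  assumes "m \<le> b" "i \<le> m + 1" "y ^ (2 ^ b) = -1" "\<beta> < 2 ^ i"
    "x ^ (2 ^ (m + 1 - i)) = y ^ (2 * 2 ^ b * \<beta> div 2 ^ i)"
  shows "bv (2 ^ b) (fwdL m b i X) (\<kappa> * (2 * 2 ^ m) + \<beta> * 2 ^ (m + 1 - i)) (2 ^ (m + 1 - i)) x y =
    avl (2 ^ m) (2 ^ b) X \<kappa> x y"
  using assms(2-)
proof (induction i arbitrary: \<beta>)
  case 0
  then show ?case using bv_pSplit[of "2 ^ m" "2 ^ b" X \<kappa> x y] by (simp add: avl_def)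
next
  case (Suc i)
  define \<beta>' e where "\<beta>' = \<beta> mod 2 ^ i" and "e = \<beta> div 2 ^ i"
  have be: "\<beta> = \<beta>' + 2 ^ i * e" "\<beta>' < 2 ^ i" unfolding \<beta>'_def e_def by simp_all
  have e: "e < 2" unfolding e_def using Suc.prems(3) by (simp add: less_mult_imp_div_less mult.commute)
  have im: "i \<le> m" "i \<le> b" using Suc.prems assms(1) by auto
  let ?c = "2 ^ b * \<beta>' div 2 ^ i"
  have xh: "x ^ (2 ^ (m - i)) = y ^ ?c * (-1) ^ e"
    using Suc.prems(4) exp_double(1)[OF im(2) e, of \<beta>'] Suc.prems(2)
    unfolding be(1) by (simp add: power_add power_mult)
  have "x ^ (2 * 2 ^ (m - i)) = (x ^ (2 ^ (m - i))) ^ 2" by (simp only: power_mult[symmetric] mult.commute)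
  also have "\<dots> = (y ^ ?c * (-1) ^ e) ^ 2" unfolding xh ..
  also have "\<dots> = y ^ (2 * ?c)" by (simp add: power_mult_distrib power_mult[symmetric] mult.commute)
  finally have x2: "x ^ (2 ^ (m + 1 - i)) = y ^ (2 * 2 ^ b * \<beta>' div 2 ^ i)"
    using im exp_double(2)[OF im(2), of 0 \<beta>'] by (simp add: Suc_diff_le)
  have "2 ^ i * 2 ^ (m - i) = (2 ^ m :: nat)" using im by (simp add: power_add[symmetric])
  from bv_pFwd[OF Suc.prems(2) this _ _ _ be(2) e xh, of "fwdL m b i X" \<kappa>]
  have "bv (2 ^ b) (fwdL m b (Suc i) X) (\<kappa> * (2 * 2 ^ m) + \<beta> * 2 ^ (m - i)) (2 ^ (m - i)) x y =
    bv (2 ^ b) (fwdL m b i X) (\<kappa> * (2 * 2 ^ m) + \<beta>' * (2 * 2 ^ (m - i))) (2 * 2 ^ (m - i)) x y"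
    using be by simp
  also have "\<dots> = avl (2 ^ m) (2 ^ b) X \<kappa> x y"
    using Suc.IH[of \<beta>'] Suc.prems be x2 im by (simp add: Suc_diff_le)
  finally show ?case by simp
qed

text \<open>Only the leaves are assumed to have the values \<open>R x\<close>; each level passes
  them to its parents and doubles them once.\<close>

lemma invL_correct:
  assumes "m \<le> b" "i \<le> m + 1" "y ^ (2 ^ b) = -1" "\<beta> < 2 ^ (m + 1 - i)"
    "x ^ (2 ^ i) = y ^ (2 * 2 ^ b * \<beta> div 2 ^ (m + 1 - i))"
    "\<And>x \<beta>. \<beta> < 2 * 2 ^ m \<Longrightarrow> x = y ^ (2 ^ b * \<beta> div 2 ^ m) \<Longrightarrow>
      ev (2 ^ b) Z ((\<kappa> * (2 * 2 ^ m) + \<beta>) * 2 ^ b) y = R x"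
  shows "bv (2 ^ b) (invL m b i Z) (\<kappa> * (2 * 2 ^ m) + \<beta> * 2 ^ i) (2 ^ i) x y = 2 ^ i * R x"
  using assms(2,4,5)
proof (induction i arbitrary: \<beta> x)
  case 0
  then show ?case using assms(6)[of \<beta> x] by (simp add: bv_def)
next
  case (Suc i)
  let ?nb = "2 ^ (m - i) :: nat"
  define c where "c = 2 ^ b * \<beta> div ?nb"
  have im: "i \<le> m" "m - i \<le> b" "m + 1 - i = Suc (m - i)" using Suc.prems assms(1) by auto
  have nb: "?nb * 2 ^ i = 2 ^ m" using im by (simp add: power_add[symmetric])
  have b: "\<beta> < ?nb" using Suc.prems by simp
  have x: "x ^ (2 * 2 ^ i) = y ^ (2 * c)"
    using Suc.prems exp_double(2)[OF im(2), of 0 \<beta>] by (simp add: c_def)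
  have U: "bv (2 ^ b) (invL m b i Z) (\<kappa> * (2 * 2 ^ m) + \<beta> * 2 ^ i) (2 ^ i) x y = 2 ^ i * R x" if "x ^ (2 ^ i) = y ^ c" for x
    using Suc.IH[of \<beta> x] that im b exp_double(1)[OF im(2), of 0 \<beta>] Suc.prems by (simp add: c_def)
  have V: "bv (2 ^ b) (invL m b i Z) (\<kappa> * (2 * 2 ^ m) + (\<beta> + ?nb) * 2 ^ i) (2 ^ i) x y = 2 ^ i * R x"
    if "x ^ (2 ^ i) = - (y ^ c)" for x
    using Suc.IH[of "\<beta> + ?nb" x] that im b exp_double(1)[OF im(2), of 1 \<beta>] Suc.prems assms(3)
    by (simp add: c_def power_add)
  have "bv (2 ^ b) (pInv (2 ^ m) (2 ^ b) ?nb (2 ^ i) (invL m b i Z)) (\<kappa> * (2 * 2 ^ m) + \<beta> * (2 * 2 ^ i)) (2 * 2 ^ i) x y = 2 * (2 ^ i * R x)"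
    by (rule bv_pInv[OF assms(3) nb _ _ _ b c_def U V x]) auto
  then show ?case by simp
qed

text \<open>The product has degree at most \<open>2 * M - 2\<close>, so the \<open>2 * M\<close>
  roots of unity determine it. The step is needed because the inverse transform controls only
  \<open>x\<close> with \<open>x ^ (2 * M) = 1\<close>, while \<open>pDec\<close> is evaluated at
  roots of \<open>x ^ (M * B) = -1\<close>.\<close>

lemma poly_sum_eq_everywhere:
  fixes a b c :: "nat \<Rightarrow> complex"
  assumes "0 < M" "\<And>x. x ^ (2 * M) = 1 \<Longrightarrow> (\<Sum>r<2 * M. a r * x ^ r) = S * ((\<Sum>r<M. b r * x ^ r) * (\<Sum>r<M. c r * x ^ r))"
  shows "(\<Sum>r<2 * M. a r * x ^ r) = S * ((\<Sum>r<M. b r * x ^ r) * (\<Sum>r<M. c r * x ^ r))"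
proof -
  define P where "P n f = (\<Sum>r<n. monom (f r :: complex) r)" for n f
  have P: "poly (P n f) x = (\<Sum>r<n. f r * x ^ r)" for n f x
    by (simp add: P_def poly_sum poly_monom)
  have d: "degree (P n f) \<le> n - 1" for n f
    unfolding P_def by (intro degree_sum_le) (auto intro: order_trans[OF degree_monom_le])
  have "degree (smult S (P M b * P M c)) \<le> degree (P M b * P M c)" by (rule degree_smult_le)
  also have "\<dots> \<le> degree (P M b) + degree (P M c)" by (rule degree_mult_le)
  also have "\<dots> < 2 * M" using d[of M b] d[of M c] assms(1) by linarith
  finally have d2: "degree (smult S (P M b * P M c)) < 2 * M" .
  have "P (2 * M) a = smult S (P M b * P M c)"
  proof (rule poly_eqI_degree[where A = "{x. x ^ (2 * M) = 1}"])
    show "poly (P (2 * M) a) x = poly (smult S (P M b * P M c)) x" if "x \<in> {x. x ^ (2 * M) = 1}" for x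
      using that assms(2) by (simp add: P)
    have "card {x :: complex. x ^ (2 * M) = 1} = 2 * M" using assms(1) by (intro card_nth_roots) auto
    then show "card {x :: complex. x ^ (2 * M) = 1} > degree (P (2 * M) a)"
      "card {x :: complex. x ^ (2 * M) = 1} > degree (smult S (P M b * P M c))"
      using d2 d[of "2 * M" a] assms(1) by linarith+
  qed
  then have "poly (P (2 * M) a) x = poly (smult S (P M b * P M c)) x" by simp
  then show ?thesis by (simp add: P)
qed

text \<open>Pointwise multiplication of the transforms is the same problem again, with more and
  shorter products. All polynomials are treated alike, so second factors stay at a fixed distance
  from the first ones. The factor \<open>2 * 2 ^ m\<close> comes from the \<open>m + 1\<close>
  inverse passes that are not normalised.\<close>

lemma mulp_level:
  assumes "m \<le> b" and Z: "mulp S b (K * (2 * 2 ^ m)) (fwdL m b (m + 1) X) Z"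
  shows "mulp (S * (2 * 2 ^ m)) (m + b) K X (pDec (2 ^ m) (2 ^ b) (invL m b (m + 1) Z))"
  unfolding mulp_def
proof (intro allI impI)
  fix \<kappa> x assume k: "\<kappa> < K" and x: "x ^ (2 ^ (m + b)) = (-1 :: complex)"
  let ?M = "2 ^ m :: nat" and ?B = "2 ^ b :: nat"
  define y where "y = x ^ ?M"
  have y: "y ^ ?B = -1" using x by (simp add: y_def power_mult[symmetric] power_add)
  let ?R = "\<lambda>x. of_nat S * (avl ?M ?B X \<kappa> x y * avl ?M ?B X (\<kappa> + K) x y)"
  have Zr: "ev ?B Z ((\<kappa> * (2 * ?M) + \<beta>) * ?B) y = ?R x" if \<beta>: "\<beta> < 2 * ?M" and "x = y ^ (?B * \<beta> div ?M)" for x \<beta>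
  proof -
    have F: "ev ?B (fwdL m b (m + 1) X) ((\<kappa>' * (2 * ?M) + \<beta>) * ?B) y = avl ?M ?B X \<kappa>' x y" for \<kappa>'
      using fwdL_correct[OF assms(1), of "m + 1" y \<beta> x X \<kappa>'] \<beta> y that by (simp add: bv_def)
    have "\<kappa> * (2 * ?M) + \<beta> < K * (2 * ?M)" using blk_less[OF k \<beta>] .
    then have "ev ?B Z ((\<kappa> * (2 * ?M) + \<beta>) * ?B) y =
      of_nat S * ev ?B (fwdL m b (m + 1) X) ((\<kappa> * (2 * ?M) + \<beta>) * ?B) y *
      ev ?B (fwdL m b (m + 1) X) ((\<kappa> * (2 * ?M) + \<beta> + K * (2 * ?M)) * ?B) y"
      using Z y unfolding mulp_def by blast
    moreover have "\<kappa> * (2 * ?M) + \<beta> + K * (2 * ?M) = (\<kappa> + K) * (2 * ?M) + \<beta>" by (simp add: algebra_simps)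
    ultimately show ?thesis by (simp only: F mult.assoc)
  qed
  have "bv ?B (invL m b (m + 1) Z) (\<kappa> * (2 * ?M)) (2 * ?M) x' y = 2 ^ (m + 1) * ?R x'" if "x' ^ (2 * ?M) = 1" for x'
  proof -
    have "bv ?B (invL m b (m + 1) Z) (\<kappa> * (2 * ?M) + 0 * 2 ^ (m + 1)) (2 ^ (m + 1)) x' y = 2 ^ (m + 1) * ?R x'"
      by (rule invL_correct[OF assms(1) order_refl y]) (use Zr that in simp_all)
    then show ?thesis by simp
  qed
  then have E: "bv ?B (invL m b (m + 1) Z) (\<kappa> * (2 * ?M)) (2 * ?M) x' y =
      2 ^ (m + 1) * of_nat S * (avl ?M ?B X \<kappa> x' y * avl ?M ?B X (\<kappa> + K) x' y)" if "x' ^ (2 * ?M) = 1" for x'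
    using that by (simp only: mult.assoc)
  have "bv ?B (invL m b (m + 1) Z) (\<kappa> * (2 * ?M)) (2 * ?M) x y = 2 ^ (m + 1) * of_nat S * (avl ?M ?B X \<kappa> x y * avl ?M ?B X (\<kappa> + K) x y)"
    unfolding bv_def avl_def by (rule poly_sum_eq_everywhere[OF _ E[unfolded bv_def avl_def]]) simp
  moreover have "ev (?M * ?B) (pDec ?M ?B (invL m b (m + 1) Z)) (\<kappa> * (?M * ?B)) x = bv ?B (invL m b (m + 1) Z) (\<kappa> * (2 * ?M)) (2 * ?M) x y"
    unfolding y_def by (rule ev_pDec) (use x in \<open>simp_all add: power_add\<close>)
  moreover have "ev (?M * ?B) X (\<kappa>' * (?M * ?B)) x = avl ?M ?B X \<kappa>' x y" for \<kappa>'
    unfolding ev_split_mod avl_def y_def ..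
  ultimately show "ev (2 ^ (m + b)) (pDec ?M ?B (invL m b (m + 1) Z)) (\<kappa> * 2 ^ (m + b)) x =
      of_nat (S * (2 * ?M)) * ev (2 ^ (m + b)) X (\<kappa> * 2 ^ (m + b)) x * ev (2 ^ (m + b)) X ((\<kappa> + K) * 2 ^ (m + b)) x"
    by (simp add: power_add mult_ac)
qed

lemma mulp_base: "mulp 1 1 K X (pBase (2 * K) X)"
  unfolding mulp_def
proof (intro allI impI)
  fix \<kappa> and x :: complex assume "x ^ 2 ^ 1 = -1"
  then have x: "x * x = -1" by (simp add: power2_eq_square)
  have e: "ev (2 ^ 1) Y q x = of_int (Y q) + of_int (Y (q + 1)) * x" for Y q
    by (simp add: ev_def numeral_2_eq_2)
  have "pBase (2 * K) X (\<kappa> * 2 ^ 1) = X (\<kappa> * 2) * X (\<kappa> * 2 + 2 * K) - X (\<kappa> * 2 + 1) * X (\<kappa> * 2 + 1 + 2 * K)"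
    "pBase (2 * K) X (\<kappa> * 2 ^ 1 + 1) = X (\<kappa> * 2) * X (\<kappa> * 2 + 1 + 2 * K) + X (\<kappa> * 2 + 1) * X (\<kappa> * 2 + 2 * K)"
    using mod_mult_self1[of 1 \<kappa> "2::nat"] by (simp_all add: pBase_def Let_def mult.commute)
  moreover have "(\<kappa> + K) * 2 ^ 1 = \<kappa> * 2 + 2 * K" "\<kappa> * 2 + 2 * K + 1 = \<kappa> * 2 + 1 + 2 * K" by simp_all
  moreover have "(a + c * x) * (p + q * x) = (a * p - c * q) + (a * q + c * p) * x" for a c p q
  proof -
    have "c * x * (q * x) = c * q * (x * x)" by (simp add: mult_ac)
    then show ?thesis using x by (simp add: algebra_simps)
  qed
  ultimately show "ev (2 ^ 1) (pBase (2 * K) X) (\<kappa> * 2 ^ 1) x =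
      of_nat 1 * ev (2 ^ 1) X (\<kappa> * 2 ^ 1) x * ev (2 ^ 1) X ((\<kappa> + K) * 2 ^ 1) x"
    unfolding e by (simp only: power_one_right of_nat_1 mult_1_left of_int_diff of_int_add of_int_mult)
qed

text \<open>The way back from complex values to integers: \<open>x ^ N = -1\<close> has
  \<open>N\<close> distinct roots and both polynomials have degree below \<open>N\<close>.\<close>

lemma int_seq_eqI:
  assumes "0 < N" "\<And>x. x ^ N = -1 \<Longrightarrow> (\<Sum>n<N. of_int (a n) * x ^ n) = (\<Sum>n<N. of_int (b n) * x ^ n :: complex)" "n < N"
  shows "a n = b n"
proof -
  define P where "P f = (\<Sum>r<N. monom (of_int (f r) :: complex) r)" for f
  have P: "poly (P f) x = (\<Sum>r<N. of_int (f r) * x ^ r)" for f x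
    by (simp add: P_def poly_sum poly_monom)
  have d: "degree (P f) \<le> N - 1" for f
    unfolding P_def by (intro degree_sum_le) (auto intro: order_trans[OF degree_monom_le])
  have "P a = P b"
  proof (rule poly_eqI_degree[where A = "{x. x ^ N = -1}"])
    show "poly (P a) x = poly (P b) x" if "x \<in> {x. x ^ N = -1}" for x using that assms(2) by (simp add: P)
    have "card {x :: complex. x ^ N = -1} = N" using assms(1) by (intro card_nth_roots) auto
    then show "card {x :: complex. x ^ N = -1} > degree (P a)" "card {x :: complex. x ^ N = -1} > degree (P b)"
      using d[of a] d[of b] assms(1) by linarith+
  qed
  moreover have "poly.coeff (P f) n = of_int (f n)" for f
    using assms(3) by (simp add: P_def coeff_sum)
  ultimately show ?thesis by (metis of_int_eq_iff)
qed

text \<open>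
  The wrap-around of the negacyclic product only reaches the lower half of the indices,
  because the first factor vanishes on its upper half.
\<close>

lemma mulp_upper_half:
  assumes "mulp S (Suc q) 1 X Z" "\<And>j. 2 ^ q \<le> j \<Longrightarrow> j < 2 ^ Suc q \<Longrightarrow> X j = 0" "n < 2 ^ q"
  shows "Z (2 ^ q + n) = int S * (\<Sum>j<2 ^ q. X j * X (2 ^ Suc q + (2 ^ q + n - j)))"
proof -
  let ?Q = "2 ^ q :: nat" let ?N = "2 ^ Suc q :: nat"
  define Y where "Y i = X (?N + i)" for i
  \<comment> \<open>The negacyclic convolution, written out; the first case collects the terms that
    do not wrap around.\<close>
  define W where "W n = (\<Sum>j<?N. if j \<le> n then X j * Y (n - j) else - (X j * Y (n + ?N - j)))" for n
  have W: "(\<Sum>n<?N. of_int (W n) * x ^ n) = ev ?N X 0 x * ev ?N X ?N x" if x: "x ^ ?N = -1" for x :: complex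
  proof -
    have "(\<Sum>n<?N. of_int (W n) * x ^ n) =
       (\<Sum>j<?N. \<Sum>n<?N. of_int (if j \<le> n then X j * Y (n - j) else - (X j * Y (n + ?N - j))) * x ^ n)"
      unfolding W_def of_int_sum sum_distrib_right by (rule sum.swap)
    also have "\<dots> = (\<Sum>j<?N. of_int (X j) * (x ^ j * (\<Sum>i<?N. of_int (Y i) * x ^ i)))"
    proof (rule sum.cong[OF refl])
      fix j assume j: "j \<in> {..<?N}"
      have "of_int (X j) * (x ^ j * (\<Sum>i<?N. of_int (Y i) * x ^ i)) = of_int (X j) *
        (\<Sum>l<?N. (if (l + ?N - j) div ?N = 1 then of_int (Y ((l + ?N - j) mod ?N)) else - of_int (Y ((l + ?N - j) mod ?N))) * x ^ l)"
        using shift_down[of j ?N x "\<lambda>i. of_int (Y i)"] j x by simp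
      also have "\<dots> = (\<Sum>n<?N. of_int (if j \<le> n then X j * Y (n - j) else - (X j * Y (n + ?N - j))) * x ^ n)"
        unfolding sum_distrib_left
      proof (rule sum.cong[OF refl])
        fix l assume l: "l \<in> {..<?N}"
        show "of_int (X j) * ((if (l + ?N - j) div ?N = 1 then of_int (Y ((l + ?N - j) mod ?N)) else - of_int (Y ((l + ?N - j) mod ?N))) * x ^ l) =
          of_int (if j \<le> l then X j * Y (l - j) else - (X j * Y (l + ?N - j))) * x ^ l"
        proof (cases "j \<le> l")
          case True
          then have "l + ?N - j = (l - j) + ?N" by simp
          moreover have "l - j < ?N" using l by auto
          ultimately have "(l + ?N - j) div ?N = 1" "(l + ?N - j) mod ?N = l - j" by (metis add.commute add_diff_cancel_right' div_add_self2 div_less mod_add_self2 mod_less nat_less_le not_add_less2 plus_nat.add_0 One_nat_def add_Suc)+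
          then show ?thesis using True by simp
        next
          case False
          then have "l + ?N - j < ?N" using j by auto
          then show ?thesis using False by simp
        qed
      qed
      finally show "(\<Sum>n<?N. of_int (if j \<le> n then X j * Y (n - j) else - (X j * Y (n + ?N - j))) * x ^ n) =
        of_int (X j) * (x ^ j * (\<Sum>i<?N. of_int (Y i) * x ^ i))" by simp
    qed
    also have "\<dots> = ev ?N X 0 x * ev ?N X ?N x"
      unfolding ev_def Y_def sum_distrib_right by (simp add: mult.assoc)
    finally show ?thesis .
  qed
  have "Z (?Q + n) = int S * W (?Q + n)"
  proof (rule int_seq_eqI[of ?N])
    fix x :: complex assume x: "x ^ ?N = -1"
    have "(\<Sum>n<?N. of_int (Z n) * x ^ n) = of_nat S * (ev ?N X 0 x * ev ?N X ?N x)"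
      using assms(1) x unfolding mulp_def ev_def[of _ Z] by (auto simp: mult.assoc)
    also have "\<dots> = of_nat S * (\<Sum>n<?N. of_int (W n) * x ^ n)" by (simp only: W[OF x])
    finally show "(\<Sum>n<?N. of_int (Z n) * x ^ n) = (\<Sum>n<?N. of_int (int S * W n) * x ^ n)"
      by (simp add: sum_distrib_left mult.assoc)
  qed (use assms(3) in auto)
  also have "W (?Q + n) = (\<Sum>j<?Q. X j * Y (?Q + n - j))"
    unfolding W_def using assms(2) by (intro sum.mono_neutral_cong_right) auto
  finally show ?thesis by (simp add: Y_def)
qed

subsection \<open>Primes\<close>

text \<open>The numbers \<open>1 / ((n + 1) * (n choose k))\<close> form the Leibniz harmonic
  triangle. Each entry is the difference of its upper left and its left neighbour, so all of them
  are integer combinations of the first column \<open>1, 1/2, ..., 1/(n + 1)\<close>, and a common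
  multiple clears all denominators at once.\<close>

lemma leibniz_triangle:
  fixes l :: nat
  shows "k \<le> n \<Longrightarrow> (\<And>i. 1 \<le> i \<Longrightarrow> i \<le> n + 1 \<Longrightarrow> i dvd l) \<Longrightarrow> real l / real ((n + 1) * (n choose k)) \<in> \<int>"
proof (induction k arbitrary: n)
  case 0
  then have "n + 1 dvd l" by simp
  then obtain q where "l = (n + 1) * q" by (elim dvdE)
  then have "real l / real ((n + 1) * (n choose 0)) = of_nat q" by (simp add: field_simps)
  then show ?case by simp
next
  case (Suc k)
  then obtain m where n: "n = Suc m" by (cases n) auto
  have km: "k \<le> m" using Suc.prems n by simp
  let ?c = "real (m choose k)"
  have c: "?c > 0" using km by simp
  have "real (Suc k) * real (Suc m choose Suc k) = real (Suc m) * ?c"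
    using Suc_times_binomial[of k m] by (metis of_nat_mult)
  then have a: "real (Suc m choose Suc k) = real (Suc m) * ?c / real (Suc k)" by (simp add: field_simps del: of_nat_Suc)
  have "real (Suc m - k) * real (Suc m choose k) = real (Suc m) * ?c"
    using binomial_absorb_comp[of "Suc m" k] by (metis diff_Suc_1 of_nat_mult)
  moreover have d: "real (Suc m - k) = real m + 1 - real k" "real m + 1 - real k > 0" using km by auto
  ultimately have b: "real (Suc m choose k) = real (Suc m) * ?c / (real m + 1 - real k)" by (simp add: field_simps)
  have frac: "L / (Y * (X * c / K)) = L / (X * c) - L / (Y * (X * c / (Y - K)))"
    if "0 < Y" "0 < X" "0 < c" "0 < K" "0 < Y - K" for L Y X c K :: real
    using that by (simp add: field_simps)
  have "real l / real ((n + 1) * (n choose Suc k)) =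
     real l / real ((m + 1) * (m choose k)) - real l / real ((n + 1) * (n choose k))"
    using frac[of "real (n + 1)" "real (Suc m)" ?c "real (Suc k)" "real l"] c d(2)
    unfolding n of_nat_mult a b by (simp add: algebra_simps)
  moreover have "real l / real ((m + 1) * (m choose k)) \<in> \<int>" using Suc.IH[OF km] Suc.prems n by simp
  moreover have "real l / real ((n + 1) * (n choose k)) \<in> \<int>" using Suc.IH[of n] Suc.prems by simp
  ultimately show ?case by (simp only: Ints_diff)
qed

text \<open>Nair's argument at the central entry: \<open>(2 * a + 1) * (2 * a choose a)\<close>
  divides \<open>l\<close>, and it is at least the sum \<open>4 ^ a\<close> of the
  \<open>2 * a + 1\<close> binomial coefficients of its row.\<close>

lemma four_power_le_common_multiple:
  fixes l :: nat
  assumes "\<And>i. 1 \<le> i \<Longrightarrow> i \<le> 2 * a + 1 \<Longrightarrow> i dvd l" "0 < l"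
  shows "4 ^ a \<le> l"
proof -
  let ?q = "(2 * a + 1) * (2 * a choose a)"
  have q0: "real ?q > 0" unfolding of_nat_0_less_iff by simp
  have "real l / real ?q \<in> \<int>" using leibniz_triangle[of a "2 * a" l] assms by simp
  then obtain z where z: "real l / real ?q = of_int z" by (elim Ints_cases)
  have "z > 0" using z q0 assms(2) by (metis divide_pos_pos of_int_0_less_iff of_nat_0_less_iff)
  then have "1 \<le> real l / real ?q" using z by simp
  then have "?q \<le> l" using q0 by (simp add: le_divide_eq del: of_nat_mult)
  moreover have "4 ^ a \<le> ?q"
  proof -
    have "(4::nat) ^ a = (\<Sum>i\<le>2 * a. 2 * a choose i)" by (simp add: choose_row_sum power_mult)
    also have "\<dots> \<le> (\<Sum>i\<le>2 * a. 2 * a choose a)" using binomial_maximum'[of a] by (intro sum_mono) simp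
    finally show ?thesis by simp
  qed
  ultimately show ?thesis by linarith
qed

text \<open>The product of the largest powers of the primes that do not exceed \<open>M\<close> is a
  common multiple of \<open>1, ..., 2 * a + 1\<close>, and each of its factors is at most
  \<open>M\<close>.\<close>

lemma four_power_le_power_primes:
  assumes "2 * a + 1 \<le> M"
  shows "4 ^ a \<le> M ^ card {p. prime p \<and> p \<le> M}"
proof -
  let ?P = "{p :: nat. prime p \<and> p \<le> M}"
  have fin: "finite ?P" by (rule finite_subset[of _ "{..M}"]) auto
  define e where "e p = Max {e. p ^ e \<le> M}" for p :: nat
  have fe: "finite {e. p ^ e \<le> M}" if "prime p" for p
  proof (rule finite_subset[of _ "{..M}"])
    show "{e. p ^ e \<le> M} \<subseteq> {..M}"
    proof
      fix e assume "e \<in> {e. p ^ e \<le> M}"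
      moreover have "e < p ^ e" using prime_ge_2_nat[OF that] by (intro power_gt_expt) simp
      ultimately show "e \<in> {..M}" by simp
    qed
  qed simp
  have M: "0 < M" using assms by simp
  have le: "p ^ e p \<le> M" if "prime p" for p
  proof -
    have "0 \<in> {e. p ^ e \<le> M}" using M by simp
    then have "{e. p ^ e \<le> M} \<noteq> {}" by blast
    from Max_in[OF fe[OF that] this] show ?thesis unfolding e_def by simp
  qed
  define l where "l = (\<Prod>p\<in>?P. p ^ e p)"
  have l0: "0 < l" unfolding l_def using fin by (intro prod_pos) (auto simp: prime_gt_0_nat)
  have "i dvd l" if i: "1 \<le> i" "i \<le> 2 * a + 1" for i
  proof (rule multiplicity_le_imp_dvd)
    show "i \<noteq> 0" using i by simp
    fix p :: nat assume p: "prime p"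
    have "p ^ multiplicity p i dvd i" by (rule multiplicity_dvd)
    then have pm: "p ^ multiplicity p i \<le> M" using dvd_imp_le[of "p ^ multiplicity p i" i] i assms by linarith
    show "multiplicity p i \<le> multiplicity p l"
    proof (cases "p \<le> M")
      case True
      have "multiplicity p l = e p" unfolding l_def
        using multiplicity_prod_prime_powers[OF fin _ p, of e] p True by simp
      then show ?thesis using Max_ge[OF fe[OF p]] pm unfolding e_def by simp
    next
      case False
      have "\<not> p dvd i" using dvd_imp_le[of p i] i assms False by auto
      then show ?thesis by (simp add: not_dvd_imp_multiplicity_0)
    qed
  qed
  then have "4 ^ a \<le> l" using l0 by (rule four_power_le_common_multiple)
  also have "l \<le> (\<Prod>p\<in>?P. M)" unfolding l_def using le by (intro prod_mono) auto
  finally show ?thesis by simp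
qed

text \<open>Without such a prime there are at most \<open>2 ^ s\<close> primes up to
  \<open>4 * s * 2 ^ s\<close>, a number bounded by \<open>2 ^ (2 * s + 1)\<close>. Then a power of
  two with exponent about \<open>4 * s * 2 ^ s\<close> would be at most one with exponent
  \<open>(2 * s + 1) * 2 ^ s\<close>, which is impossible from \<open>s = 2\<close> on.\<close>

lemma prime_between:
  assumes "2 \<le> s"
  shows "\<exists>p. prime p \<and> 2 ^ s < p \<and> p \<le> 4 * s * (2 ^ s :: nat)"
proof (rule ccontr)
  let ?N = "2 ^ s :: nat" let ?M = "4 * s * ?N" let ?a = "2 * s * ?N - 1"
  assume "\<not> ?thesis"
  then have "{p. prime p \<and> p \<le> ?M} \<subseteq> {1..?N}"
    using prime_ge_1_nat by (metis (mono_tags, lifting) atLeastAtMost_iff mem_Collect_eq not_le subsetI)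
  then have c: "card {p. prime p \<and> p \<le> ?M} \<le> ?N" using card_mono[of "{1..?N}"] by fastforce
  have pos: "1 \<le> 2 * s * ?N" using assms by simp
  have "4 ^ ?a \<le> ?M ^ card {p. prime p \<and> p \<le> ?M}" using pos by (intro four_power_le_power_primes) linarith
  also have "\<dots> \<le> ?M ^ ?N" using assms c by (intro power_increasing) auto
  also have "\<dots> \<le> (2 ^ (2 * s + 1)) ^ ?N"
  proof (rule power_mono)
    have "s < 2 ^ s" by (rule less_exp)
    have "2 * s \<le> 2 ^ s" using assms by (induction s rule: dec_induct) auto
    then have "4 * s * ?N \<le> 2 * ?N * ?N" by (intro mult_right_mono) auto
    also have "\<dots> = 2 ^ (2 * s + 1)" by (simp add: power_add mult_2 distrib_right)
    finally show "?M \<le> 2 ^ (2 * s + 1)" .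
  qed simp
  finally have "(4::nat) ^ ?a \<le> (2 ^ (2 * s + 1)) ^ ?N" .
  moreover have "(4::nat) ^ ?a = 2 ^ (2 * ?a)" by (simp add: power_mult)
  ultimately have "2 ^ (2 * ?a) \<le> (2::nat) ^ ((2 * s + 1) * ?N)" by (simp only: power_mult)
  then have "2 * ?a \<le> (2 * s + 1) * ?N" by (simp add: power_increasing_iff)
  then have "4 * s * ?N \<le> (2 * s + 1) * ?N + 2" using pos by (simp add: algebra_simps)
  moreover have "(2 * s + 1) * ?N + 3 * ?N \<le> 4 * s * ?N" using assms
    unfolding distrib_right[symmetric] by (intro mult_right_mono) auto
  moreover have "2 ^ 2 \<le> ?N" using assms by (intro power_increasing) auto
  then have "4 \<le> ?N" by simp
  ultimately show False by linarith
qed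

subsection \<open>Dyadic blocks\<close>

abbreviation v2 :: "nat \<Rightarrow> nat" where "v2 i \<equiv> multiplicity 2 i"

lemma v2_ge: "0 < i \<Longrightarrow> 2 ^ q dvd i \<longleftrightarrow> q \<le> v2 i"
  by (simp add: power_dvd_iff_le_multiplicity)

lemma v2_block:
  assumes "0 < i" "i < j" "j < i + 2 ^ v2 i"
  shows "v2 j < v2 i"
proof (rule ccontr)
  assume "\<not> ?thesis"
  then have "2 ^ v2 i dvd j" using v2_ge[of j "v2 i"] assms by simp
  moreover have "2 ^ v2 i dvd i" by (rule multiplicity_dvd)
  ultimately have "2 ^ v2 i dvd j - i" by simp
  then show False using assms dvd_imp_le[of "2 ^ v2 i" "j - i"] by simp
qed

lemma v2_block_left:
  assumes "0 < i" "j < i" "i - 2 ^ v2 i < j"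
  shows "v2 j < v2 i"
proof (rule ccontr)
  assume "\<not> ?thesis"
  then have "2 ^ v2 i dvd j" using v2_ge[of j "v2 i"] assms by simp
  moreover have "2 ^ v2 i dvd i" by (rule multiplicity_dvd)
  ultimately have "2 ^ v2 i dvd i - j" by simp
  then show False using assms dvd_imp_le[of "2 ^ v2 i" "i - j"] by simp
qed

text \<open>The odd cofactor of \<open>2 ^ v2 i\<close> becomes even when one is added or
  subtracted.\<close>

lemma v2_shift:
  assumes "0 < i"
  shows "0 < i - 2 ^ v2 i \<Longrightarrow> v2 i < v2 (i - 2 ^ v2 i)" "v2 i < v2 (i + 2 ^ v2 i)"
proof -
  obtain a where a: "i = 2 ^ v2 i * a" using multiplicity_dvd[of 2 i] by (elim dvdE)
  have "\<not> 2 ^ Suc (v2 i) dvd i" using v2_ge[OF assms, of "Suc (v2 i)"] by simp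
  then have "odd a" using a by (metis dvd_refl mult_dvd_mono power_Suc2)
  have "i - 2 ^ v2 i = 2 ^ v2 i * (a - 1)" "i + 2 ^ v2 i = 2 ^ v2 i * (a + 1)"
    using a by (simp_all add: diff_mult_distrib2)
  moreover have "even (a - 1)" "even (a + 1)" using \<open>odd a\<close> by simp_all
  moreover have "2 ^ v2 i * 2 dvd 2 ^ v2 i * (a - 1)" "2 ^ v2 i * 2 dvd 2 ^ v2 i * (a + 1)"
    using \<open>even (a - 1)\<close> \<open>even (a + 1)\<close> by (intro mult_dvd_mono dvd_refl; simp)+
  ultimately have "2 ^ Suc (v2 i) dvd i - 2 ^ v2 i" "2 ^ Suc (v2 i) dvd i + 2 ^ v2 i"
    by (simp_all only: power_Suc2)
  then show "0 < i - 2 ^ v2 i \<Longrightarrow> v2 i < v2 (i - 2 ^ v2 i)" "v2 i < v2 (i + 2 ^ v2 i)"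
    using v2_ge[of "i - 2 ^ v2 i" "Suc (v2 i)"] v2_ge[of "i + 2 ^ v2 i" "Suc (v2 i)"] assms by auto
qed

text \<open>The witness is the index of largest valuation in \<open>{m<..n}\<close>. Its neighbours
  at distance \<open>2 ^ v2 i\<close> have larger valuation and hence lie outside, which gives both
  inequalities. Of two such indices each would have smaller valuation than the other.\<close>

lemma dyadic_block_unique:
  assumes "m < n"
  shows "\<exists>!i. m < i \<and> i \<le> n \<and> i - 2 ^ v2 i \<le> m \<and> n < i + 2 ^ v2 i"
proof -
  let ?V = "v2 ` {m<..n}"
  have V: "finite ?V" "?V \<noteq> {}" using assms by auto
  obtain i where i: "i \<in> {m<..n}" "v2 i = Max ?V" using Max_in[OF V] by fastforce
  have mx: "v2 j \<le> v2 i" if "j \<in> {m<..n}" for j using Max_ge[OF V(1)] that i(2) by auto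
  have i0: "0 < i" using i by auto
  have A: "i - 2 ^ v2 i \<le> m"
  proof (rule ccontr)
    assume a: "\<not> ?thesis"
    then have "0 < i - 2 ^ v2 i" "i - 2 ^ v2 i \<in> {m<..n}" using i(1) by auto
    then show False using v2_shift(1)[OF i0] mx[of "i - 2 ^ v2 i"] by auto
  qed
  have B: "n < i + 2 ^ v2 i"
  proof (rule ccontr)
    assume a: "\<not> ?thesis"
    then show False using v2_shift(2)[OF i0] mx[of "i + 2 ^ v2 i"] i(1) by auto
  qed
  show ?thesis
  proof (rule ex1I[of _ i])
    show "m < i \<and> i \<le> n \<and> i - 2 ^ v2 i \<le> m \<and> n < i + 2 ^ v2 i" using i A B by auto
    fix j assume j: "m < j \<and> j \<le> n \<and> j - 2 ^ v2 j \<le> m \<and> n < j + 2 ^ v2 j"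
    show "j = i"
    proof (rule linorder_cases[of j i])
      assume "j < i"
      then have "v2 i < v2 j" "v2 j < v2 i" using v2_block[of j i] v2_block_left[of i j] i j A by auto
      then show ?thesis by simp
    next
      assume "i < j"
      then have "v2 i < v2 j" "v2 j < v2 i" using v2_block[of i j] v2_block_left[of j i] i j B i0 by auto
      then show ?thesis by simp
    qed
  qed
qed

text \<open>Correctness of the online scheme: round \<open>i\<close> sends the block before
  \<open>i\<close> to the targets in the block after \<open>i\<close>, and the blocks that have
  reached \<open>n\<close> by round \<open>n\<close> partition \<open>{..<n}\<close>.\<close>

lemma sum_dyadic_blocks:
  fixes f :: "nat \<Rightarrow> 'a::comm_monoid_add"
  shows "(\<Sum>i=1..n. if n < i + 2 ^ v2 i then (\<Sum>m=i - 2 ^ v2 i..<i. f m) else 0) = (\<Sum>m<n. f m)"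
proof -
  let ?c = "\<lambda>i m. m < i \<and> i \<le> n \<and> i - 2 ^ v2 i \<le> m \<and> n < i + 2 ^ v2 i"
  have "(\<Sum>i=1..n. if n < i + 2 ^ v2 i then (\<Sum>m=i - 2 ^ v2 i..<i. f m) else 0) =
    (\<Sum>i=1..n. \<Sum>m<n. if ?c i m then f m else 0)"
  proof (rule sum.cong[OF refl])
    fix i assume i: "i \<in> {1..n}"
    have "(\<Sum>m<n. if ?c i m then f m else 0) = (\<Sum>m\<in>{m\<in>{..<n}. ?c i m}. f m)"
      by (rule sum.inter_filter[symmetric]) simp
    also have "{m\<in>{..<n}. ?c i m} = (if n < i + 2 ^ v2 i then {i - 2 ^ v2 i..<i} else {})" using i by auto
    finally show "(if n < i + 2 ^ v2 i then (\<Sum>m=i - 2 ^ v2 i..<i. f m) else 0) = (\<Sum>m<n. if ?c i m then f m else 0)"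
      by simp
  qed
  also have "\<dots> = (\<Sum>m<n. \<Sum>i=1..n. if ?c i m then f m else 0)" by (rule sum.swap)
  also have "\<dots> = (\<Sum>m<n. f m)"
  proof (rule sum.cong[OF refl])
    fix m assume "m \<in> {..<n}"
    then obtain i where i: "?c i m" "\<And>j. ?c j m \<Longrightarrow> j = i" using dyadic_block_unique[of m n] by auto
    have "(\<Sum>j=1..n. if ?c j m then f m else 0) = (\<Sum>j\<in>{j\<in>{1..n}. ?c j m}. f m)"
      by (rule sum.inter_filter[symmetric]) simp
    also have "{j\<in>{1..n}. ?c j m} = {i}"
    proof -
      have "i \<in> {1..n}" using i(1) by auto
      then show ?thesis using i by blast
    qed
    finally show "(\<Sum>j=1..n. if ?c j m then f m else 0) = f m" by simp
  qed
  finally show ?thesis .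
qed

lemma v2_less: "0 < i \<Longrightarrow> i < 2 ^ s \<Longrightarrow> v2 i < s"
proof (rule ccontr)
  assume "0 < i" "i < 2 ^ s" "\<not> v2 i < s"
  then have "2 ^ s dvd i" using v2_ge by simp
  then show False using \<open>0 < i\<close> \<open>i < 2 ^ s\<close> dvd_imp_le by fastforce
qed

text \<open>The table size is a multiple of the block length too, so no target block leaves the
  table.\<close>

lemma v2_block_end: "0 < i \<Longrightarrow> i < 2 ^ s \<Longrightarrow> i + 2 ^ v2 i \<le> 2 ^ s"
proof -
  assume i: "0 < i" "i < 2 ^ s"
  then have "2 ^ v2 i dvd 2 ^ s - i" using v2_less[OF i] by (intro dvd_diff_nat le_imp_power_dvd multiplicity_dvd) auto
  then have "2 ^ v2 i \<le> 2 ^ s - i" using i by (intro dvd_imp_le) auto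
  then show ?thesis using i by simp
qed

lemma v2_le: "0 < i \<Longrightarrow> 2 ^ v2 i \<le> i"
  using multiplicity_dvd dvd_imp_le by blast

text \<open>The total length of all blocks, and thus the overhead of working online: one factor
  \<open>s\<close>. Doubling the range doubles the old sum at the even indices and adds one for
  every odd index.\<close>

lemma sum_power_v2: "(\<Sum>i=1..<2 ^ s. 2 ^ v2 i) \<le> s * (2 ^ s :: nat)"
proof (induction s)
  case (Suc s)
  let ?e = "(\<lambda>i. 2 * i) ` {1..<2 ^ s :: nat}" let ?o = "(\<lambda>i. 2 * i + 1) ` {0..<2 ^ s :: nat}"
  have "{1..<2 ^ Suc s :: nat} = ?e \<union> ?o"
  proof (intro Set.set_eqI iffI)
    fix x :: nat assume x: "x \<in> {1..<2 ^ Suc s}"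
    show "x \<in> ?e \<union> ?o"
    proof (cases "even x")
      case True
      then show ?thesis using x by (auto elim!: evenE)
    next
      case False
      then obtain y where "x = 2 * y + 1" by (elim oddE)
      then show ?thesis using x by auto
    qed
  qed auto
  moreover have "?e \<inter> ?o = {}" by (auto, presburger)
  ultimately have "(\<Sum>i=1..<2 ^ Suc s. 2 ^ v2 i) = (\<Sum>i\<in>?e. 2 ^ v2 i) + (\<Sum>i\<in>?o. (2::nat) ^ v2 i)"
    by (simp add: sum.union_disjoint)
  also have "(\<Sum>i\<in>?e. 2 ^ v2 i) = (\<Sum>i=1..<2 ^ s. 2 * (2::nat) ^ v2 i)"
    by (subst sum.reindex) (auto simp: inj_on_def multiplicity_times_same intro!: sum.cong)
  also have "(\<Sum>i\<in>?o. (2::nat) ^ v2 i) = (\<Sum>i=0..<2 ^ s :: nat. 1)"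
    by (subst sum.reindex) (auto simp: inj_on_def not_dvd_imp_multiplicity_0 intro!: sum.cong)
  finally have "(\<Sum>i=1..<2 ^ Suc s. 2 ^ v2 i) = 2 * (\<Sum>i=1..<2 ^ s. (2::nat) ^ v2 i) + 2 ^ s"
    by (simp add: sum_distrib_left)
  then show ?case using Suc by simp
qed simp

subsection \<open>Random weights\<close>

text \<open>Most significant bit first, as the program reads its coins.\<close>

definition bval :: "bool list \<Rightarrow> nat" where
  "bval bs = foldl (\<lambda>v b. 2 * v + of_bool b) 0 bs"

lemma bval_snoc: "bval (bs @ [b]) = 2 * bval bs + of_bool b" by (simp add: bval_def)

lemma bval_less: "bval bs < 2 ^ length bs"
  by (induction bs rule: rev_induct) (auto simp: bval_snoc bval_def split: if_splits)

lemma bval_inj: "length bs = length bs' \<Longrightarrow> bval bs = bval bs' \<Longrightarrow> bs = bs'"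
proof (induction bs arbitrary: bs' rule: rev_induct)
  case (snoc b bs)
  then obtain c cs where cs: "bs' = cs @ [c]" by (metis length_append_singleton length_0_conv nat.simps(3) rev_exhaust)
  have e: "2 * bval bs + of_bool b = 2 * bval cs + of_bool c" using snoc cs by (simp add: bval_snoc)
  then have "b = c" "bval bs = bval cs" by (cases b; cases c; simp; presburger)+
  then show ?case using snoc cs by simp
qed simp

lemma card_append_lists:
  assumes "\<And>a. a \<in> A \<Longrightarrow> length a = n"
  shows "card {a @ b | a b. a \<in> A \<and> b \<in> B} = card A * card B"
proof -
  have "{a @ b | a b. a \<in> A \<and> b \<in> B} = (\<lambda>(a, b). a @ b) ` (A \<times> B)" by auto
  moreover have "inj_on (\<lambda>(a, b). a @ b) (A \<times> B)" using assms by (auto simp: inj_on_def)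
  ultimately show ?thesis by (simp add: card_image card_cartesian_product)
qed

text \<open>A multilinear polynomial with coefficients one, given by its monomials as sets of
  variables. As these form a set, no two of them can coincide and add up to zero modulo
  \<open>p\<close>.\<close>

definition mlin :: "nat set set \<Rightarrow> (nat \<Rightarrow> int) \<Rightarrow> int" where
  "mlin \<M> w = (\<Sum>A\<in>\<M>. \<Prod>v\<in>A. w v)"

definition wt :: "nat \<Rightarrow> bool list \<Rightarrow> nat \<Rightarrow> int" where
  "wt s bs v = int (bval (take s (drop (v * s) bs)))"

lemma wt_append: "length a = V * s \<Longrightarrow> v < V \<Longrightarrow> wt s (a @ b) v = wt s a v"
proof -
  assume a: "length a = V * s" "v < V"
  have "v * s + s \<le> V * s" using a(2) by (metis Suc_leI add.commute mult_Suc mult_le_mono1)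
  then show ?thesis unfolding wt_def using a by simp
qed

lemma mlin_cong: "(\<And>A. A \<in> \<M> \<Longrightarrow> \<forall>v\<in>A. w v = w' v) \<Longrightarrow> mlin \<M> w = mlin \<M> w'"
  unfolding mlin_def by (intro sum.cong prod.cong refl) auto

text \<open>Schwartz--Zippel by counting, with one variable split off at a time. Where the cofactor
  \<open>\<M>1\<close> of the last variable is nonzero modulo \<open>p\<close>, at most one value of
  that variable gives zero, because numbers of \<open>s\<close> bits are distinct modulo
  \<open>p\<close>; where it vanishes, the induction hypothesis for degree \<open>d - 1\<close>
  applies.\<close>

lemma schwartz_zippel_bits:
  assumes "prime (p::nat)" "2 ^ s \<le> p"
  shows "\<M> \<subseteq> Pow {..<V} \<Longrightarrow> \<M> \<noteq> {} \<Longrightarrow> (\<And>A. A \<in> \<M> \<Longrightarrow> card A \<le> d) \<Longrightarrow>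
    card {bs. length bs = V * s \<and> int p dvd mlin \<M> (wt s bs)} * 2 ^ s \<le> d * 2 ^ (V * s)"
proof (induction V arbitrary: \<M> d)
  case 0
  then have "\<M> = {{}}" by auto
  then have "mlin \<M> w = 1" for w by (simp add: mlin_def)
  then show ?case using assms(1) by (simp add: prime_nat_iff)
next
  case (Suc V)
  let ?L = "\<lambda>n. {bs :: bool list. length bs = n}"
  let ?Bad = "\<lambda>\<M>. {bs. length bs = V * s \<and> int p dvd mlin \<M> (wt s bs)}"
  let ?B = "{bs. length bs = Suc V * s \<and> int p dvd mlin \<M> (wt s bs)}"
  define \<M>0 where "\<M>0 = {A\<in>\<M>. V \<notin> A}"
  define \<M>1 where "\<M>1 = (\<lambda>A. A - {V}) ` {A\<in>\<M>. V \<in> A}"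
  have bd: "v < V \<or> v = V" if "A \<in> \<M>" "v \<in> A" for A v using Suc.prems(1) that less_Suc_eq by blast
  have sub: "\<M>0 \<subseteq> Pow {..<V}" "\<M>1 \<subseteq> Pow {..<V}" using bd by (fastforce simp: \<M>0_def \<M>1_def)+
  have fin: "finite \<M>" using Suc.prems(1) finite_subset by blast
  have finA: "finite A" if "A \<in> \<M>" for A using Suc.prems(1) that finite_subset by blast
  have inj: "inj_on (\<lambda>A. A - {V}) {A\<in>\<M>. V \<in> A}" by (auto simp: inj_on_def)
  have split: "mlin \<M> w = mlin \<M>0 w + w V * mlin \<M>1 w" for w
  proof -
    have "mlin \<M> w = mlin \<M>0 w + (\<Sum>A\<in>{A\<in>\<M>. V \<in> A}. \<Prod>v\<in>A. w v)"
      unfolding mlin_def \<M>0_def using fin by (subst sum.union_disjoint[symmetric]) (auto intro!: sum.cong)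
    also have "(\<Sum>A\<in>{A\<in>\<M>. V \<in> A}. \<Prod>v\<in>A. w v) = (\<Sum>A\<in>{A\<in>\<M>. V \<in> A}. w V * (\<Prod>v\<in>A - {V}. w v))"
      using finA by (intro sum.cong refl prod.remove) auto
    also have "\<dots> = w V * mlin \<M>1 w"
      unfolding mlin_def \<M>1_def sum.reindex[OF inj] by (simp add: sum_distrib_left)
    finally show ?thesis .
  qed
  have dec: "\<exists>a b. bs = a @ b \<and> length a = V * s \<and> length b = s" if "length bs = Suc V * s" for bs :: "bool list"
    using that by (intro exI[of _ "take (V * s) bs"] exI[of _ "drop (V * s) bs"]) simp
  have wtV: "wt s (a @ b) V = int (bval b)" if "length a = V * s" "length b = s" for a b
    using that by (simp add: wt_def)
  have m: "mlin \<M>0 (wt s (a @ b)) = mlin \<M>0 (wt s a)" "mlin \<M>1 (wt s (a @ b)) = mlin \<M>1 (wt s a)"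
    if "length a = V * s" for a b
    by (rule mlin_cong, use sub wt_append[OF that] in blast)+
  show ?case
  proof (cases "\<M>1 = {}")
    case True
    then have "\<M>0 = \<M>" by (auto simp: \<M>0_def \<M>1_def)
    have "?B \<subseteq> {a @ b | a b. a \<in> ?Bad \<M>0 \<and> b \<in> ?L s}"
    proof
      fix bs assume bs: "bs \<in> ?B"
      then obtain a b where ab: "bs = a @ b" "length a = V * s" "length b = s" using dec by blast
      then show "bs \<in> {a @ b | a b. a \<in> ?Bad \<M>0 \<and> b \<in> ?L s}"
        using bs m(1)[OF ab(2), of b] \<open>\<M>0 = \<M>\<close> by auto
    qed
    moreover have "finite {a @ b | a b. a \<in> ?Bad \<M>0 \<and> b \<in> ?L s}"
      by (rule finite_subset[OF _ finite_bool_lists[of "V * s + s"]]) auto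
    ultimately have "card ?B \<le> card {a @ b | a b. a \<in> ?Bad \<M>0 \<and> b \<in> ?L s}" by (intro card_mono)
    also have "\<dots> = card (?Bad \<M>0) * 2 ^ s" by (subst card_append_lists[where n="V * s"]) (auto simp: card_bool_lists)
    finally have "card ?B * 2 ^ s \<le> (card (?Bad \<M>0) * 2 ^ s) * 2 ^ s" by simp
    also have "\<dots> \<le> (d * 2 ^ (V * s)) * 2 ^ s"
      using Suc.IH[OF sub(1), of d] Suc.prems \<open>\<M>0 = \<M>\<close> by (intro mult_right_mono) auto
    finally show ?thesis by (simp add: power_add mult_ac)
  next
    case False
    have c1: "card A \<le> d - 1 \<and> 1 \<le> d" if A1: "A \<in> \<M>1" for A
    proof -
      obtain A' where A': "A' \<in> \<M>" "V \<in> A'" "A = A' - {V}" using A1 unfolding \<M>1_def by blast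
      then have "card A = card A' - 1" "card A' \<ge> 1" using finA[OF A'(1)] by (auto simp: Suc_le_eq card_gt_0_iff)
      then show ?thesis using Suc.prems(3)[OF A'(1)] by linarith
    qed
    then have d1: "1 \<le> d" using False by auto
    let ?S1 = "{a @ b | a b. a \<in> ?Bad \<M>1 \<and> b \<in> ?L s}"
    let ?S2 = "{a @ b | a b. length a = V * s \<and> length b = s \<and> \<not> int p dvd mlin \<M>1 (wt s a) \<and>
      int p dvd mlin \<M>0 (wt s a) + int (bval b) * mlin \<M>1 (wt s a)}"
    have "?B \<subseteq> ?S1 \<union> ?S2"
    proof
      fix bs assume bs: "bs \<in> ?B"
      then obtain a b where ab: "bs = a @ b" "length a = V * s" "length b = s" using dec by blast
      then show "bs \<in> ?S1 \<union> ?S2"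
        using bs m[OF ab(2), of b] wtV[OF ab(2,3)] split[of "wt s bs"] by auto
    qed
    moreover have f: "finite ?S1" "finite ?S2"
      by (rule finite_subset[OF _ finite_bool_lists[of "V * s + s"]], auto)+
    ultimately have "card ?B \<le> card ?S1 + card ?S2" by (meson card_Un_le card_mono finite_UnI le_trans)
    also have "card ?S1 = card (?Bad \<M>1) * 2 ^ s" by (subst card_append_lists[where n="V * s"]) (auto simp: card_bool_lists)
    \<comment> \<open>The last weight is determined by the others, so a list in \<open>?S2\<close>
      is determined by its prefix.\<close>
    also have "card ?S2 \<le> card (?L (V * s))"
    proof (rule card_inj_on_le[where f = "take (V * s)"])
      show "inj_on (take (V * s)) ?S2"
      proof (rule inj_onI)
        fix x y assume "x \<in> ?S2" "y \<in> ?S2" and t: "take (V * s) x = take (V * s) y"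
        then obtain a b a' b' where x: "x = a @ b" "length a = V * s" "length b = s" "\<not> int p dvd mlin \<M>1 (wt s a)"
            "int p dvd mlin \<M>0 (wt s a) + int (bval b) * mlin \<M>1 (wt s a)"
          and y: "y = a' @ b'" "length a' = V * s" "length b' = s"
            "int p dvd mlin \<M>0 (wt s a') + int (bval b') * mlin \<M>1 (wt s a')" by auto
        have "a = a'" using t x(1,2) y(1,2) by simp
        then have "int p dvd (int (bval b) - int (bval b')) * mlin \<M>1 (wt s a)"
          using dvd_diff[OF x(5) y(4)] by (simp add: algebra_simps)
        then have "int p dvd int (bval b) - int (bval b')"
          using x(4) assms(1) prime_dvd_mult_iff[of "int p"] by auto
        moreover have "\<bar>int (bval b) - int (bval b')\<bar> < int p"
          using bval_less[of b] bval_less[of b'] x(3) y(3) assms(2) by auto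
        ultimately have "int (bval b) - int (bval b') = 0" using zdvd_not_zless zdvd_imp_le by (metis dvd_abs_iff zero_less_abs_iff)
        then have "b = b'" using bval_inj[of b b'] x(3) y(3) by simp
        then show "x = y" using \<open>a = a'\<close> x y by simp
      qed
    qed (use finite_bool_lists[of "V * s"] in auto)
    finally have "card ?B \<le> card (?Bad \<M>1) * 2 ^ s + 2 ^ (V * s)" by (simp add: card_bool_lists)
    then have "card ?B * 2 ^ s \<le> (card (?Bad \<M>1) * 2 ^ s + 2 ^ (V * s)) * 2 ^ s" by (rule mult_right_mono) simp
    also have "\<dots> = (card (?Bad \<M>1) * 2 ^ s) * 2 ^ s + 2 ^ (V * s) * 2 ^ s" by (rule distrib_right)
    finally have "card ?B * 2 ^ s \<le> (card (?Bad \<M>1) * 2 ^ s) * 2 ^ s + 2 ^ (V * s) * 2 ^ s" .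
    also have "\<dots> \<le> ((d - 1) * 2 ^ (V * s)) * 2 ^ s + 2 ^ (V * s) * 2 ^ s"
      using Suc.IH[OF sub(2) False, of "d - 1"] c1 by (intro add_mono mult_right_mono) auto
    also have "\<dots> = (d - 1 + 1) * (2 ^ (V * s) * 2 ^ s)" by (simp add: algebra_simps)
    finally show ?thesis using d1 by (simp add: power_add mult_ac)
  qed
qed

text \<open>Disjoint segments of the coin list are independent, so their failure rates multiply;
  coins after the last segment are free.\<close>

lemma card_repeat_failures:
  fixes Bad :: "bool list set"
  assumes "2 * card {bs. length bs = L \<and> bs \<in> Bad} \<le> 2 ^ L"
  shows "R * L \<le> T \<Longrightarrow> card {bs. length bs = T \<and> (\<forall>\<rho><R. take L (drop (\<rho> * L) bs) \<in> Bad)} * 2 ^ R \<le> 2 ^ T"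
proof (induction R arbitrary: T)
  case 0
  then show ?case by (simp add: card_bool_lists)
next
  case (Suc R)
  then have T: "R * L \<le> T - L" "L \<le> T" by auto
  let ?B = "{bs. length bs = L \<and> bs \<in> Bad}"
  let ?C = "{bs. length bs = T - L \<and> (\<forall>\<rho><R. take L (drop (\<rho> * L) bs) \<in> Bad)}"
  let ?D = "{bs. length bs = T \<and> (\<forall>\<rho><Suc R. take L (drop (\<rho> * L) bs) \<in> Bad)}"
  have "?D \<subseteq> {a @ b | a b. a \<in> ?B \<and> b \<in> ?C}"
  proof
    fix bs assume bs: "bs \<in> ?D"
    have a: "take L bs \<in> ?B" using bs T by auto
    have "take L (drop (\<rho> * L) (drop L bs)) \<in> Bad" if "\<rho> < R" for \<rho>
    proof -
      have "take L (drop (Suc \<rho> * L) bs) \<in> Bad" using bs that by blast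
      then show ?thesis by (simp add: add.commute)
    qed
    then have b: "drop L bs \<in> ?C" using bs T by auto
    have "bs = take L bs @ drop L bs" by simp
    then show "bs \<in> {a @ b | a b. a \<in> ?B \<and> b \<in> ?C}" using a b by blast
  qed
  moreover have "finite {a @ b | a b. a \<in> ?B \<and> b \<in> ?C}"
    by (rule finite_subset[OF _ finite_bool_lists[of "L + (T - L)"]]) auto
  ultimately have "card ?D \<le> card {a @ b | a b. a \<in> ?B \<and> b \<in> ?C}" by (intro card_mono)
  also have "\<dots> = card ?B * card ?C" by (rule card_append_lists[where n=L]) auto
  finally have "card ?D * 2 ^ Suc R \<le> (2 * card ?B) * (card ?C * 2 ^ R)" by simp
  also have "\<dots> \<le> 2 ^ L * 2 ^ (T - L)" using assms Suc.IH[OF T(1)] by (rule mult_le_mono)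
  also have "\<dots> = 2 ^ T" using T(2) by (simp add: power_add[symmetric])
  finally show ?case .
qed

subsection \<open>Mixed radix codes\<close>

definition radix :: "(nat \<Rightarrow> nat) \<Rightarrow> nat \<Rightarrow> nat" where
  "radix \<beta> d = (\<Prod>i<d. \<beta> i)"

definition code :: "(nat \<Rightarrow> nat) \<Rightarrow> nat \<Rightarrow> (nat \<Rightarrow> nat) \<Rightarrow> nat" where
  "code \<beta> m \<kappa> = (\<Sum>d<m. \<kappa> d * radix \<beta> d)"

definition dgt :: "(nat \<Rightarrow> nat) \<Rightarrow> nat \<Rightarrow> nat \<Rightarrow> nat" where
  "dgt \<beta> n d = (n div radix \<beta> d) mod \<beta> d"

lemma radix_Suc: "radix \<beta> (Suc d) = radix \<beta> d * \<beta> d" by (simp add: radix_def)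

lemma radix_0 [simp]: "radix \<beta> 0 = 1" by (simp add: radix_def)

lemma code_dgt: "code \<beta> m (dgt \<beta> n) = n mod radix \<beta> m"
proof (induction m)
  case (Suc m)
  have "code \<beta> (Suc m) (dgt \<beta> n) = code \<beta> m (dgt \<beta> n) + dgt \<beta> n m * radix \<beta> m" by (simp add: code_def)
  then show ?case unfolding Suc radix_Suc mod_mult2_eq dgt_def by simp
qed (simp add: code_def)

lemma code_less: "(\<And>d. d < m \<Longrightarrow> \<kappa> d < \<beta> d) \<Longrightarrow> code \<beta> m \<kappa> < radix \<beta> m"
proof (induction m)
  case (Suc m)
  then have "code \<beta> m \<kappa> < radix \<beta> m" by simp
  then have "code \<beta> (Suc m) \<kappa> < Suc (\<kappa> m) * radix \<beta> m" by (simp add: code_def)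
  also have "\<dots> \<le> \<beta> m * radix \<beta> m" using Suc.prems[of m] by (intro mult_le_mono1) simp
  finally show ?case by (simp add: radix_Suc mult.commute)
qed (simp add: code_def)

lemma radix_dvd: "d \<le> m \<Longrightarrow> radix \<beta> d dvd radix \<beta> m"
  unfolding radix_def by (rule prod_dvd_prod_subset) auto

lemma dgt_code:
  assumes "\<And>d. d < m \<Longrightarrow> \<kappa> d < \<beta> d" "d < m"
  shows "dgt \<beta> (code \<beta> m \<kappa>) d = \<kappa> d"
  using assms
proof (induction m)
  case (Suc m)
  have pos: "0 < radix \<beta> i" if "i \<le> Suc m" for i
    unfolding radix_def using Suc.prems(1) that by (intro prod_pos) (metis gr_zeroI lessThan_iff not_less_zero order_less_le_trans)
  have l: "code \<beta> m \<kappa> < radix \<beta> m" using Suc.prems by (intro code_less) simp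
  have c: "code \<beta> (Suc m) \<kappa> = code \<beta> m \<kappa> + \<kappa> m * radix \<beta> m" by (simp add: code_def)
  show ?case
  proof (cases "d = m")
    case True
    then show ?thesis using l Suc.prems(1)[of m] pos[of m] unfolding c dgt_def by simp
  next
    case False
    then have d: "d < m" using Suc.prems by simp
    then obtain R where R: "radix \<beta> m = radix \<beta> (Suc d) * R" using radix_dvd[of "Suc d" m] by (auto elim: dvdE)
    have "code \<beta> (Suc m) \<kappa> div radix \<beta> d = code \<beta> m \<kappa> div radix \<beta> d + \<kappa> m * (\<beta> d * R)"
    proof -
      have "code \<beta> (Suc m) \<kappa> = code \<beta> m \<kappa> + radix \<beta> d * (\<kappa> m * (\<beta> d * R))"
        unfolding c R radix_Suc by (simp add: mult_ac)
      then show ?thesis using pos[of d] d by simp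
    qed
    then have "dgt \<beta> (code \<beta> (Suc m) \<kappa>) d = dgt \<beta> (code \<beta> m \<kappa>) d"
      unfolding dgt_def by (simp add: mult.left_commute[of _ "\<beta> d"])
    then show ?thesis using Suc d by simp
  qed
qed simp

section \<open>Derivations of multivariate polynomials\<close>

lemma sum_fun_apply: "(\<Sum>x\<in>A. f x) d = (\<Sum>x\<in>A. (f x d :: 'a :: comm_monoid_add))"
  by (induction A rule: infinite_finite_induct) auto

lemma prod_single: "finite A \<Longrightarrow> (\<Prod>x\<in>A. Poly_Mapping.single (f x) (g x :: int)) = Poly_Mapping.single (\<Sum>x\<in>A. f x) (\<Prod>x\<in>A. g x)"
  by (induction A rule: finite_induct) (simp_all add: mult_single)

lift_definition theta :: "('k \<Rightarrow> nat) \<Rightarrow> ('k \<Rightarrow>\<^sub>0 int) \<Rightarrow> ('k \<Rightarrow>\<^sub>0 int)" is "\<lambda>c f \<kappa>. int (c \<kappa>) * f \<kappa>"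
  by (rule rev_finite_subset) auto

lemma lookup_theta: "Poly_Mapping.lookup (theta c p) \<kappa> = int (c \<kappa>) * Poly_Mapping.lookup p \<kappa>"
  by (simp add: theta.rep_eq)

lemma theta_add: "theta c (p + q) = theta c p + theta c q"
  by (rule poly_mapping_eqI) (simp add: lookup_theta lookup_add distrib_left)

lemma theta_sum: "theta c (\<Sum>x\<in>A. p x) = (\<Sum>x\<in>A. theta c (p x))"
  by (rule poly_mapping_eqI) (simp add: lookup_theta lookup_sum sum_distrib_left)

lemma theta_single: "theta c (Poly_Mapping.single \<kappa> a) = Poly_Mapping.single \<kappa> (int (c \<kappa>) * a)"
  by (rule poly_mapping_eqI) (simp add: lookup_theta lookup_single when_def)

text \<open>Leaves the choice of the index set open; in \<open>Fc_rec\<close> it is the image of a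
  set of codes.\<close>

lemma lookup_mult_finite:
  assumes "finite S" "\<And>a b. a + b = \<kappa> \<Longrightarrow> (a, b) \<in> S" "\<And>a b. (a, b) \<in> S \<Longrightarrow> a + b = \<kappa>"
  shows "Poly_Mapping.lookup (p * q) \<kappa> = (\<Sum>(a, b)\<in>S. Poly_Mapping.lookup p a * (Poly_Mapping.lookup q b :: int))"
proof -
  have "Poly_Mapping.lookup (p * q) \<kappa> = (\<Sum>(a, b). Poly_Mapping.lookup p a * Poly_Mapping.lookup q b when \<kappa> = a + b)"
    by (subst times_poly_mapping.rep_eq) (simp add: prod_fun_unfold_prod)
  also have "\<dots> = (\<Sum>(a, b)\<in>S. Poly_Mapping.lookup p a * Poly_Mapping.lookup q b when \<kappa> = a + b)"
  proof (rule Sum_any.expand_superset[OF assms(1)], rule subsetI)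
    fix x assume x: "x \<in> {x. (case x of (a, b) \<Rightarrow> Poly_Mapping.lookup p a * Poly_Mapping.lookup q b when \<kappa> = a + b) \<noteq> 0}"
    obtain a b where ab: "x = (a, b)" by (cases x)
    then have "a + b = \<kappa>" using x by (auto simp: when_def split: if_splits)
    then show "x \<in> S" unfolding ab by (rule assms(2))
  qed
  also have "\<dots> = (\<Sum>(a, b)\<in>S. Poly_Mapping.lookup p a * Poly_Mapping.lookup q b)"
    by (intro sum.cong refl) (use assms(3) in \<open>fastforce simp: when_def\<close>)
  finally show ?thesis .
qed

lemma lookup_mult_keys:
  assumes "finite A" "finite B" "Poly_Mapping.keys p \<subseteq> A" "Poly_Mapping.keys q \<subseteq> B"
  shows "Poly_Mapping.lookup (p * q) \<kappa> = (\<Sum>(a, b)\<in>A \<times> B. if a + b = \<kappa> then Poly_Mapping.lookup p a * (Poly_Mapping.lookup q b :: int) else 0)"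
proof -
  have "Poly_Mapping.lookup (p * q) \<kappa> = (\<Sum>(a, b). Poly_Mapping.lookup p a * Poly_Mapping.lookup q b when \<kappa> = a + b)"
    by (subst times_poly_mapping.rep_eq) (simp add: prod_fun_unfold_prod)
  also have "\<dots> = (\<Sum>(a, b)\<in>A \<times> B. Poly_Mapping.lookup p a * Poly_Mapping.lookup q b when \<kappa> = a + b)"
    using assms by (intro Sum_any.expand_superset) (auto simp: in_keys_iff)
  also have "\<dots> = (\<Sum>(a, b)\<in>A \<times> B. if a + b = \<kappa> then Poly_Mapping.lookup p a * Poly_Mapping.lookup q b else 0)"
    by (intro sum.cong) (auto simp: when_def)
  finally show ?thesis .
qed

lemma keys_theta: "Poly_Mapping.keys (theta c p) \<subseteq> Poly_Mapping.keys p"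
  by (auto simp: in_keys_iff lookup_theta)

text \<open>Additivity of the factor \<open>c\<close> is the Leibniz rule on monomials.\<close>

lemma theta_mult:
  assumes "\<And>a b. c (a + b) = c a + c b"
  shows "theta c (p * q) = theta c p * q + p * theta c (q :: 'k::comm_monoid_add \<Rightarrow>\<^sub>0 int)"
proof (rule poly_mapping_eqI)
  fix \<kappa>
  note L = lookup_mult_keys[OF finite_keys finite_keys]
  have "Poly_Mapping.lookup (theta c p * q + p * theta c q) \<kappa> =
    (\<Sum>(a, b)\<in>Poly_Mapping.keys p \<times> Poly_Mapping.keys q. int (c \<kappa>) * (if a + b = \<kappa> then Poly_Mapping.lookup p a * Poly_Mapping.lookup q b else 0))"
    unfolding lookup_add L[OF keys_theta order_refl] L[OF order_refl keys_theta] sum.distrib[symmetric]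
    by (rule sum.cong) (auto simp: lookup_theta assms algebra_simps)
  then show "Poly_Mapping.lookup (theta c (p * q)) \<kappa> = Poly_Mapping.lookup (theta c p * q + p * theta c q) \<kappa>"
    unfolding lookup_theta L[OF order_refl order_refl] sum_distrib_left by (simp add: case_prod_unfold)
qed

lemma theta_prod:
  assumes "\<And>a b. c (a + b) = c a + c b" "finite A"
  shows "theta c (\<Prod>x\<in>A. f x) = (\<Sum>x\<in>A. theta c (f x) * (\<Prod>y\<in>A - {x}. f y :: 'k::comm_monoid_add \<Rightarrow>\<^sub>0 int))"
  using assms(2)
proof (induction A rule: finite_induct)
  case empty
  have "c 0 = 0" using assms(1)[of 0 0] by simp
  have "theta c 1 = (0 :: 'k \<Rightarrow>\<^sub>0 int)"
    using \<open>c 0 = 0\<close> by (intro poly_mapping_eqI) (simp add: lookup_theta lookup_one when_def)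
  then show ?case by simp
next
  case (insert x A)
  have "theta c (\<Prod>y\<in>insert x A. f y) = theta c (f x) * prod f A + f x * (\<Sum>y\<in>A. theta c (f y) * prod f (A - {y}))"
    using insert by (simp add: theta_mult[OF assms(1)])
  also have "f x * (\<Sum>y\<in>A. theta c (f y) * prod f (A - {y})) = (\<Sum>y\<in>A. theta c (f y) * prod f (insert x A - {y}))"
    unfolding sum_distrib_left
  proof (rule sum.cong[OF refl])
    fix y assume y: "y \<in> A"
    then have "insert x A - {y} = insert x (A - {y})" using insert by auto
    then show "f x * (theta c (f y) * prod f (A - {y})) = theta c (f y) * prod f (insert x A - {y})"
      using insert by (simp add: mult.left_commute)
  qed
  also have "prod f A = prod f (insert x A - {x})" using insert by simp
  finally show ?case using insert by simp
qed

subsection \<open>The generating function of the solutions\<close>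

abbreviation "lk \<equiv> Poly_Mapping.lookup"
abbreviation "sg \<equiv> Poly_Mapping.single"

text \<open>There are \<open>k\<close> classes and an item \<open>j \<in> J\<close> of size
  \<open>z j\<close>; \<open>w (j * k + i)\<close> is the weight of putting it into class
  \<open>i\<close>. Exponents \<open>d < k\<close> count the elements of class \<open>d\<close>, and
  exponent \<open>k + i\<close> is the sum of class \<open>i\<close>; \<open>lam d\<close> is the
  largest exponent of interest.\<close>

locale gf =
  fixes k :: nat and lam :: "nat \<Rightarrow> nat" and J :: "nat set" and z :: "nat \<Rightarrow> nat" and w :: "nat \<Rightarrow> int"
  assumes finJ: "finite J"
begin

text \<open>
  With radix \<open>2 * lam d + 2\<close> a sum of two valid digits does not carry, so that every overflow is visible in its digit.
\<close>

definition \<beta> :: "nat \<Rightarrow> nat" where "\<beta> d = 2 * lam d + 2"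
abbreviation W :: "nat \<Rightarrow> nat" where "W \<equiv> radix \<beta>"
abbreviation cd :: "(nat \<Rightarrow> nat) \<Rightarrow> nat" where "cd \<equiv> code \<beta> (2 * k)"

text \<open>Exponent vectors are functions on all naturals; requiring zero beyond
  \<open>2 * k\<close> makes the representation unique.\<close>

definition vk :: "(nat \<Rightarrow> nat) \<Rightarrow> bool" where
  "vk \<kappa> \<longleftrightarrow> (\<forall>d<2 * k. \<kappa> d \<le> lam d) \<and> (\<forall>d\<ge>2 * k. \<kappa> d = 0)"

definition okc :: "nat \<Rightarrow> bool" where
  "okc n \<longleftrightarrow> n < W (2 * k) \<and> (\<forall>d<2 * k. dgt \<beta> n d \<le> lam d)"

definition dec :: "nat \<Rightarrow> nat \<Rightarrow> nat" where
  "dec n d = (if d < 2 * k then dgt \<beta> n d else 0)"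

definition ek :: "nat \<Rightarrow> nat \<Rightarrow> nat \<Rightarrow> nat" where
  "ek j i d = (if d = i then 1 else if d = k + i then z j else 0)"

definition sc :: "nat \<Rightarrow> nat \<Rightarrow> nat" where "sc j i = W i + z j * W (k + i)"

text \<open>The multi-index of the monomial with exponents \<open>a\<^sub>i = dgt \<beta> u i\<close> of the terms \<open>x\<^sub>i ^ z j * y\<^sub>i\<close>.\<close>

definition ku :: "nat \<Rightarrow> nat \<Rightarrow> nat \<Rightarrow> nat" where
  "ku j u d = (if d < k then dgt \<beta> u d else if d < 2 * k then dgt \<beta> u (d - k) * z j else 0)"

lemma W_pos: "0 < W d" by (simp add: radix_def prod_pos \<beta>_def)

lemma dgt_less: "dgt \<beta> n d < \<beta> d" by (simp add: dgt_def \<beta>_def)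

lemma dgt_pos: "0 < dgt \<beta> u i \<Longrightarrow> W i \<le> u \<and> 0 < u"
  using W_pos[of i] by (cases "u < W i") (auto simp: dgt_def)

lemma cd_dec: "n < W (2 * k) \<Longrightarrow> cd (dec n) = n"
  using code_dgt[of \<beta> "2 * k" n] by (simp add: code_def dec_def)

lemma dec_cd: "(\<And>d. d < 2 * k \<Longrightarrow> \<kappa> d < \<beta> d) \<Longrightarrow> (\<And>d. 2 * k \<le> d \<Longrightarrow> \<kappa> d = 0) \<Longrightarrow> dec (cd \<kappa>) = \<kappa>"
  by (rule ext) (auto simp: dec_def dgt_code not_less)

lemma vk_cd: "vk \<kappa> \<Longrightarrow> dec (cd \<kappa>) = \<kappa> \<and> okc (cd \<kappa>)"
proof -
  assume v: "vk \<kappa>"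
  have l: "\<kappa> d < \<beta> d" if "d < 2 * k" for d 
  proof -
    have "\<kappa> d \<le> lam d" using v that by (simp add: vk_def)
    then show ?thesis by (simp add: \<beta>_def)
  qed
  then have "dec (cd \<kappa>) = \<kappa>" using v by (intro dec_cd) (auto simp: vk_def)
  moreover have "cd \<kappa> < W (2 * k)" using l by (rule code_less)
  moreover have "dgt \<beta> (cd \<kappa>) d \<le> lam d" if "d < 2 * k" for d
    using dgt_code[of "2 * k" \<kappa> \<beta> d] l that v by (simp add: vk_def)
  ultimately show ?thesis by (simp add: okc_def)
qed

lemma vk_dec: "okc n \<Longrightarrow> vk (dec n)"
  by (auto simp: okc_def vk_def dec_def)

lemma cd_add: "cd (a + b) = cd a + cd b"
  by (simp add: code_def distrib_right sum.distrib)

text \<open>Divisors of valid monomials are valid, which is why the invalid ones span an ideal and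
  \<open>eqv_mult\<close> holds.\<close>

lemma vk_addD: "vk (a + b) \<Longrightarrow> vk a \<and> vk b"
  unfolding vk_def by (metis add_leD1 add_leD2 add_is_0 plus_fun_apply)

text \<open>\<open>h j\<close> and \<open>g j\<close> are the coefficients of $1 / f_j$ and of the logarithmic derivative of $f_j$.\<close>

function h :: "nat \<Rightarrow> nat \<Rightarrow> int" where
  "h j u = (if u = 0 then 1 else 0) - (\<Sum>i<k. if 0 < dgt \<beta> u i then w (j * k + i) * h j (u - W i) else 0)"
  by auto
termination
proof (relation "Wellfounded.measure snd")
  fix j u i assume "0 < dgt \<beta> u i"
  then show "((j, u - W i), j, u) \<in> Wellfounded.measure snd" using dgt_pos[of u i] W_pos[of i] by auto
qed simp

declare h.simps [simp del]

definition g :: "nat \<Rightarrow> nat \<Rightarrow> int" where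
  "g j u = (\<Sum>i<k. if 0 < dgt \<beta> u i then int (sc j i) * w (j * k + i) * h j (u - W i) else 0)"

definition fp :: "nat \<Rightarrow> (nat \<Rightarrow> nat) \<Rightarrow>\<^sub>0 int" where
  "fp j = 1 + (\<Sum>i<k. sg (ek j i) (w (j * k + i)))"

definition Hp :: "nat \<Rightarrow> (nat \<Rightarrow> nat) \<Rightarrow>\<^sub>0 int" where
  "Hp j = (\<Sum>u<W k. sg (ku j u) (h j u))"

definition Gp :: "nat \<Rightarrow> (nat \<Rightarrow> nat) \<Rightarrow>\<^sub>0 int" where
  "Gp j = (\<Sum>u<W k. sg (ku j u) (g j u))"

definition Fp :: "(nat \<Rightarrow> nat) \<Rightarrow>\<^sub>0 int" where "Fp = (\<Prod>j\<in>J. fp j)"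

text \<open>The monomials outside the box of valid exponents span an ideal; this is equality modulo that ideal.\<close>

definition eqv :: "((nat \<Rightarrow> nat) \<Rightarrow>\<^sub>0 int) \<Rightarrow> ((nat \<Rightarrow> nat) \<Rightarrow>\<^sub>0 int) \<Rightarrow> bool" (infix "\<doteq>" 50) where
  "p \<doteq> q \<longleftrightarrow> (\<forall>\<kappa>. vk \<kappa> \<longrightarrow> lk p \<kappa> = lk q \<kappa>)"

section \<open>Calculus modulo the ideal of invalid monomials\<close>

lemma eqv_refl: "p \<doteq> p" by (simp add: eqv_def)

lemma eqv_trans [trans]: "p \<doteq> q \<Longrightarrow> q \<doteq> r \<Longrightarrow> p \<doteq> r" by (simp add: eqv_def)

lemma eqv_eq_trans [trans]: "p \<doteq> q \<Longrightarrow> q = r \<Longrightarrow> p \<doteq> r" by simp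

lemma eq_eqv_trans [trans]: "p = q \<Longrightarrow> q \<doteq> r \<Longrightarrow> p \<doteq> r" by simp

lemma eqv_sym: "p \<doteq> q \<Longrightarrow> q \<doteq> p" by (simp add: eqv_def)

lemma eqv_add: "p \<doteq> q \<Longrightarrow> p' \<doteq> q' \<Longrightarrow> p + p' \<doteq> q + q'" by (simp add: eqv_def lookup_add)

lemma eqv_sum: "(\<And>x. x \<in> A \<Longrightarrow> p x \<doteq> q x) \<Longrightarrow> (\<Sum>x\<in>A. p x) \<doteq> (\<Sum>x\<in>A. q x)"
  by (auto simp: eqv_def lookup_sum intro!: sum.cong)

lemma eqv_mult: "p \<doteq> q \<Longrightarrow> p * r \<doteq> q * r"
  unfolding eqv_def
proof (intro allI impI)
  fix \<kappa> assume pq: "\<forall>\<kappa>. vk \<kappa> \<longrightarrow> lk p \<kappa> = lk q \<kappa>" and v: "vk \<kappa>"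
  let ?A = "Poly_Mapping.keys p \<union> Poly_Mapping.keys q" and ?B = "Poly_Mapping.keys r"
  have "lk p a * lk r b = lk q a * lk r b" if "a + b = \<kappa>" for a b
    using pq v vk_addD[of a b] that by simp
  then show "lk (p * r) \<kappa> = lk (q * r) \<kappa>"
    by (subst (1 2) lookup_mult_keys[of ?A ?B]) (auto intro!: sum.cong)
qed

lemma eqv_single_invalid: "\<not> vk \<kappa> \<Longrightarrow> sg \<kappa> a \<doteq> 0"
  by (auto simp: eqv_def lookup_single when_def)

lemma dgt_add:
  assumes "i < k" "u < W k" "dgt \<beta> u i + 1 < \<beta> i"
  shows "u + W i < W k" "\<And>d. d < k \<Longrightarrow> dgt \<beta> (u + W i) d = dgt \<beta> u d + (if d = i then 1 else 0)"
proof -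
  let ?\<kappa> = "\<lambda>d. dgt \<beta> u d + (if d = i then 1 else 0)"
  have l: "?\<kappa> d < \<beta> d" if "d < k" for d using assms(3) dgt_less[of u d] by auto
  have "code \<beta> k ?\<kappa> = code \<beta> k (dgt \<beta> u) + (\<Sum>d<k. if d = i then W d else 0)"
    unfolding code_def sum.distrib[symmetric] by (intro sum.cong refl) auto
  also have "\<dots> = u + W i" using code_dgt[of \<beta> k u] assms(1,2) by simp
  finally have c: "code \<beta> k ?\<kappa> = u + W i" .
  show "u + W i < W k" using code_less[of k ?\<kappa> \<beta>] l c by simp
  show "dgt \<beta> (u + W i) d = ?\<kappa> d" if "d < k" for d
    using dgt_code[of k ?\<kappa> \<beta> d] l that c by simp
qed

lemma dgt_sub:
  assumes "i < k" "u < W k" "0 < dgt \<beta> u i"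
  shows "dgt \<beta> (u - W i) i + 1 < \<beta> i" "u - W i < W k" "u - W i + W i = u"
proof -
  let ?\<kappa> = "\<lambda>d. dgt \<beta> u d - (if d = i then 1 else 0)"
  have l: "?\<kappa> d < \<beta> d" for d using dgt_less[of u d] by auto
  have u: "W i \<le> u" using dgt_pos[OF assms(3)] by simp
  have "code \<beta> k ?\<kappa> + (\<Sum>d<k. if d = i then W d else 0) = code \<beta> k (dgt \<beta> u)"
    unfolding code_def sum.distrib[symmetric]
    by (intro sum.cong refl) (use assms(3) in \<open>auto simp: diff_mult_distrib\<close>)
  then have "code \<beta> k ?\<kappa> = u - W i" using code_dgt[of \<beta> k u] assms(1,2) by simp
  then have "dgt \<beta> (u - W i) i = dgt \<beta> u i - 1" using dgt_code[of k ?\<kappa> \<beta> i] l assms(1) by simp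
  moreover have "dgt \<beta> u i < \<beta> i" by (rule dgt_less)
  ultimately show "dgt \<beta> (u - W i) i + 1 < \<beta> i" using assms(3) by linarith
  show "u - W i < W k" "u - W i + W i = u" using u assms(2) by auto
qed

text \<open>Multiplying by the monomial of class \<open>i\<close> increments digit \<open>i\<close>
  of \<open>u\<close>. If that digit is already maximal, the exponent becomes
  \<open>\<beta> i > lam i\<close> and the product is zero modulo the ideal; so restricting the
  series to \<open>u < W k\<close> loses nothing.\<close>

lemma ku_add_eqv:
  assumes "i < k" "u < W k"
  shows "sg (ku j u + ek j i) a \<doteq> (if dgt \<beta> u i + 1 < \<beta> i then sg (ku j (u + W i)) a else 0)"
proof (cases "dgt \<beta> u i + 1 < \<beta> i")
  case True
  have "ku j u + ek j i = ku j (u + W i)"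
  proof (rule ext)
    fix d
    consider "d < k" | "k \<le> d" "d < 2 * k" | "2 * k \<le> d" by linarith
    then show "(ku j u + ek j i) d = ku j (u + W i) d"
    proof cases
      case 1
      then show ?thesis using dgt_add(2)[OF assms True, of d] by (auto simp: ku_def ek_def)
    next
      case 2
      then have "d - k < k" "d = k + i \<longleftrightarrow> d - k = i" "d \<noteq> i" using assms(1) by auto
      then show ?thesis using dgt_add(2)[OF assms True, of "d - k"] 2 by (auto simp: ku_def ek_def algebra_simps)
    next
      case 3
      then show ?thesis using assms(1) by (auto simp: ku_def ek_def)
    qed
  qed
  then show ?thesis using True by (simp add: eqv_refl)
next
  case False
  have "dgt \<beta> u i < \<beta> i" by (rule dgt_less)
  then have "(ku j u + ek j i) i > lam i" using False assms(1) by (simp add: ku_def ek_def \<beta>_def)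
  then have "\<not> vk (ku j u + ek j i)" using assms(1) unfolding vk_def by (metis leD mult_2 trans_less_add1)
  then show ?thesis using False eqv_single_invalid by simp
qed

lemma shift_sum_eqv:
  assumes "i < k"
  shows "(\<Sum>u<W k. sg (ku j u + ek j i) (a * h j u)) \<doteq>
    (\<Sum>u<W k. sg (ku j u) (if 0 < dgt \<beta> u i then a * h j (u - W i) else 0))"
proof -
  let ?A = "{u\<in>{..<W k}. dgt \<beta> u i + 1 < \<beta> i}" and ?B = "{u\<in>{..<W k}. 0 < dgt \<beta> u i}"
  have "(\<Sum>u<W k. sg (ku j u + ek j i) (a * h j u)) \<doteq>
    (\<Sum>u<W k. if dgt \<beta> u i + 1 < \<beta> i then sg (ku j (u + W i)) (a * h j u) else 0)"
    using ku_add_eqv[OF assms] by (intro eqv_sum) auto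
  also have "(\<Sum>u<W k. if dgt \<beta> u i + 1 < \<beta> i then sg (ku j (u + W i)) (a * h j u) else 0) =
    (\<Sum>u\<in>?A. sg (ku j (u + W i)) (a * h j u))"
    by (rule sum.inter_filter[symmetric]) simp
  also have "\<dots> = (\<Sum>u\<in>?B. sg (ku j u) (a * h j (u - W i)))"
  proof (rule sum.reindex_bij_witness[of _ "\<lambda>u. u - W i" "\<lambda>u. u + W i"])
    fix u assume u: "u \<in> ?A"
    then show "u + W i \<in> ?B" using dgt_add[OF assms, of u] assms by auto
  next
    fix u assume u: "u \<in> ?B"
    then show "u - W i + W i = u" "u - W i \<in> ?A" using dgt_sub[OF assms, of u] by auto
  qed auto
  also have "\<dots> = (\<Sum>u<W k. if 0 < dgt \<beta> u i then sg (ku j u) (a * h j (u - W i)) else 0)"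
    by (rule sum.inter_filter) simp
  also have "\<dots> = (\<Sum>u<W k. sg (ku j u) (if 0 < dgt \<beta> u i then a * h j (u - W i) else 0))"
    by (intro sum.cong refl) simp
  finally show ?thesis .
qed

lemma sg_sum: "sg \<kappa> (\<Sum>x\<in>A. f x) = (\<Sum>x\<in>A. sg \<kappa> (f x :: int))"
  by (induction A rule: infinite_finite_induct) (simp_all add: single_add)

text \<open>The recurrence for \<open>h\<close> reads \<open>H = 1 - (f - 1) * H\<close>.\<close>

lemma fp_Hp: "fp j * Hp j \<doteq> 1"
proof -
  have "fp j * Hp j = Hp j + (\<Sum>i<k. \<Sum>u<W k. sg (ku j u + ek j i) (w (j * k + i) * h j u))"
  proof -
    have "sg (ek j i) a * Hp j = (\<Sum>u<W k. sg (ku j u + ek j i) (a * h j u))" for i a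
      unfolding Hp_def sum_distrib_left mult_single by (simp add: add.commute)
    then show ?thesis by (simp add: fp_def distrib_right sum_distrib_right)
  qed
  also have "\<dots> \<doteq> Hp j + (\<Sum>i<k. \<Sum>u<W k. sg (ku j u) (if 0 < dgt \<beta> u i then w (j * k + i) * h j (u - W i) else 0))"
    by (intro eqv_add eqv_refl eqv_sum shift_sum_eqv) simp
  also have "\<dots> = Hp j + (\<Sum>u<W k. sg (ku j u) (\<Sum>i<k. if 0 < dgt \<beta> u i then w (j * k + i) * h j (u - W i) else 0))"
    unfolding sg_sum by (subst sum.swap) (rule refl)
  also have "\<dots> = (\<Sum>u<W k. if u = 0 then sg (ku j u) 1 else 0)"
    unfolding Hp_def sum.distrib[symmetric] single_add[symmetric]
    by (intro sum.cong refl) (subst (1) h.simps, simp)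
  also have "\<dots> = sg (ku j 0) 1" using W_pos[of k] by simp
  also have "\<dots> = 1"
  proof -
    have "ku j 0 = 0" by (rule ext) (simp add: ku_def dgt_def)
    then show ?thesis by simp
  qed
  finally show ?thesis .
qed

lemma cd_ek: "i < k \<Longrightarrow> cd (ek j i) = sc j i"
proof -
  assume i: "i < k"
  have "cd (ek j i) = (\<Sum>d<2*k. (if d = i then W d else 0) + (if d = k + i then z j * W d else 0))"
    unfolding code_def ek_def by (intro sum.cong refl) (use i in auto)
  also have "\<dots> = sc j i" using i by (simp add: sum.distrib sc_def)
  finally show ?thesis .
qed

lemma theta_fp_Hp: "theta cd (fp j) * Hp j \<doteq> Gp j"
proof -
  have t1: "theta cd (1 :: (nat \<Rightarrow> nat) \<Rightarrow>\<^sub>0 int) = 0"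
    by (rule poly_mapping_eqI) (simp add: lookup_theta lookup_one when_def code_def)
  have tf: "theta cd (fp j) = (\<Sum>i<k. sg (ek j i) (int (sc j i) * w (j * k + i)))"
    unfolding fp_def theta_add t1 theta_sum theta_single by (simp add: cd_ek)
  have "theta cd (fp j) * Hp j = (\<Sum>i<k. \<Sum>u<W k. sg (ku j u + ek j i) ((int (sc j i) * w (j * k + i)) * h j u))"
  proof -
    have "sg (ek j i) a * Hp j = (\<Sum>u<W k. sg (ku j u + ek j i) (a * h j u))" for i a
      unfolding Hp_def sum_distrib_left mult_single by (simp add: add.commute)
    then show ?thesis using tf by (simp add: sum_distrib_right)
  qed
  also have "\<dots> \<doteq> (\<Sum>i<k. \<Sum>u<W k. sg (ku j u) (if 0 < dgt \<beta> u i then int (sc j i) * w (j * k + i) * h j (u - W i) else 0))"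
    by (intro eqv_sum shift_sum_eqv) simp
  also have "\<dots> = Gp j" unfolding Gp_def g_def sg_sum by (rule sum.swap)
  finally show ?thesis .
qed

text \<open>The logarithmic derivative without division: after the product rule the missing factor
  \<open>fp j\<close> is supplied by \<open>fp j * Hp j \<doteq> 1\<close>.\<close>

lemma theta_Fp: "theta cd Fp \<doteq> (\<Sum>j\<in>J. Gp j) * Fp"
proof -
  have "theta cd Fp = (\<Sum>j\<in>J. theta cd (fp j) * (\<Prod>y\<in>J - {j}. fp y))"
    unfolding Fp_def by (rule theta_prod[where c = cd, OF cd_add finJ])
  also have "\<dots> \<doteq> (\<Sum>j\<in>J. Gp j * Fp)"
  proof (rule eqv_sum)
    fix j assume j: "j \<in> J"
    let ?R = "\<Prod>y\<in>J - {j}. fp y"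
    have "theta cd (fp j) * ?R \<doteq> theta cd (fp j) * Hp j * Fp"
    proof -
      have "fp j * Hp j * (theta cd (fp j) * ?R) \<doteq> 1 * (theta cd (fp j) * ?R)"
        by (rule eqv_mult[OF fp_Hp])
      moreover have "fp j * Hp j * (theta cd (fp j) * ?R) = theta cd (fp j) * Hp j * Fp"
        unfolding Fp_def prod.remove[OF finJ j] by (simp add: mult_ac)
      ultimately show ?thesis using eqv_sym by simp
    qed
    also have "\<dots> \<doteq> Gp j * Fp" by (rule eqv_mult[OF theta_fp_Hp])
    finally show "theta cd (fp j) * ?R \<doteq> Gp j * Fp" .
  qed
  also have "\<dots> = (\<Sum>j\<in>J. Gp j) * Fp" by (simp add: sum_distrib_right)
  finally show ?thesis .
qed

section \<open>Coefficients indexed by codes, and their recurrence\<close>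

definition Fc :: "nat \<Rightarrow> int" where "Fc n = (if okc n then lk Fp (dec n) else 0)"

text \<open>The form in which the program accumulates the logarithmic derivative: invalid monomials
  are dropped, all others are added at their codes.\<close>

definition Gc :: "nat \<Rightarrow> int" where
  "Gc n = (\<Sum>j\<in>J. \<Sum>u<W k. if vk (ku j u) \<and> cd (ku j u) = n then g j u else 0)"

lemma Gc_eq: "lk (\<Sum>j\<in>J. Gp j) (dec n) = Gc n" if n: "okc n"
proof -
  have "ku j u = dec n \<longleftrightarrow> vk (ku j u) \<and> cd (ku j u) = n" for j u
    using n vk_dec[OF n] vk_cd[of "ku j u"] cd_dec[of n] by (auto simp: okc_def)
  then show ?thesis
    unfolding Gc_def Gp_def lookup_sum lookup_single when_def by simp
qed

lemma Gc_invalid: "\<not> okc n \<Longrightarrow> Gc n = 0"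
  unfolding Gc_def using vk_cd by (intro sum.neutral ballI) auto

lemma dec_0: "dec 0 = 0" by (rule ext) (simp add: dec_def dgt_def)

text \<open>A logarithmic derivative has no constant term; hence \<open>Fc n\<close> itself does not
  occur on the right-hand side of \<open>Fc_rec\<close>.\<close>

lemma Gc_0: "Gc 0 = 0"
proof -
  have "g j u = 0" if "vk (ku j u)" "cd (ku j u) = 0" "u < W k" for j u
  proof -
    have "ku j u = 0" using vk_cd[OF that(1)] that(2) dec_0 by simp
    have "dgt \<beta> u d = 0" if "d < k" for d
    proof -
      have "ku j u d = 0" using \<open>ku j u = 0\<close> by simp
      then show ?thesis using that by (simp add: ku_def)
    qed
    then show ?thesis unfolding g_def by (intro sum.neutral) auto
  qed
  then show ?thesis unfolding Gc_def by (intro sum.neutral ballI) auto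
qed

lemma okc_0: "okc 0" using W_pos by (simp add: okc_def dgt_def)

text \<open>Comparison of coefficients in \<open>theta_Fp\<close>. If \<open>m\<close> and
  \<open>n - m\<close> are both valid, their digits add up to at most
  \<open>2 * lam d < \<beta> d\<close>, so there is no carry and adding codes is adding exponents.
  All other \<open>m\<close> may be included, since \<open>Fc\<close> and \<open>Gc\<close> vanish
  at invalid codes.\<close>

lemma Fc_rec:
  assumes n: "okc n"
  shows "int n * Fc n = (\<Sum>m<n. Fc m * Gc (n - m))"
proof -
  let ?\<kappa> = "dec n"
  let ?M = "{m. m \<le> n \<and> okc m \<and> okc (n - m)}"
  let ?S = "(\<lambda>m. (dec (n - m), dec m)) ` ?M"
  have v: "vk ?\<kappa>" using vk_dec[OF n] .
  have cn: "cd ?\<kappa> = n" using cd_dec n by (simp add: okc_def)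
  have inj: "inj_on (\<lambda>m. (dec (n - m), dec m)) ?M"
    by (rule inj_onI) (metis (mono_tags, lifting) Pair_inject cd_dec mem_Collect_eq okc_def)
  have "finite ?M" by simp
  have S1: "(a, b) \<in> ?S" if ab: "a + b = ?\<kappa>" for a b
  proof -
    have "vk a" "vk b" using vk_addD[of a b] v ab by auto
    moreover have "cd a + cd b = n" using cd_add[of a b] ab cn by simp
    ultimately have "cd b \<in> ?M" "(a, b) = (dec (n - cd b), dec (cd b))"
      using vk_cd by auto
    then show ?thesis by (rule rev_image_eqI)
  qed
  have S2: "a + b = ?\<kappa>" if ab: "(a, b) \<in> ?S" for a b
  proof -
    obtain m where m: "m \<le> n" "okc m" "okc (n - m)" "a = dec (n - m)" "b = dec m" using ab by auto
    have "vk a" "vk b" using m vk_dec by auto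
    have "cd (a + b) = n" using m cd_dec by (simp add: cd_add okc_def)
    moreover have "dec (cd (a + b)) = a + b"
    proof (rule dec_cd)
      fix d assume "d < 2 * k"
      then have "a d \<le> lam d" "b d \<le> lam d" using \<open>vk a\<close> \<open>vk b\<close> by (auto simp: vk_def)
      then show "(a + b) d < \<beta> d" by (simp add: \<beta>_def)
    next
      fix d assume "2 * k \<le> d"
      then show "(a + b) d = 0" using \<open>vk a\<close> \<open>vk b\<close> by (auto simp: vk_def)
    qed
    ultimately show ?thesis by simp
  qed
  have "int n * Fc n = lk (theta cd Fp) ?\<kappa>" using n by (simp add: Fc_def lookup_theta cn)
  also have "\<dots> = lk ((\<Sum>j\<in>J. Gp j) * Fp) ?\<kappa>" using theta_Fp v by (simp add: eqv_def)
  also have "\<dots> = (\<Sum>(a, b)\<in>?S. lk (\<Sum>j\<in>J. Gp j) a * lk Fp b)"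
    by (rule lookup_mult_finite[OF finite_imageI[OF \<open>finite ?M\<close>] S1 S2])
  also have "\<dots> = (\<Sum>m\<in>?M. lk (\<Sum>j\<in>J. Gp j) (dec (n - m)) * lk Fp (dec m))"
    by (subst sum.reindex[OF inj]) simp
  also have "\<dots> = (\<Sum>m\<in>?M. Fc m * Gc (n - m))"
    by (intro sum.cong refl) (simp add: Gc_eq Fc_def)
  also have "\<dots> = (\<Sum>m\<le>n. Fc m * Gc (n - m))"
    by (intro sum.mono_neutral_left) (auto simp: Fc_def Gc_invalid)
  also have "\<dots> = (\<Sum>m<n. Fc m * Gc (n - m))"
    by (simp add: lessThan_Suc_atMost[symmetric] Gc_0)
  finally show ?thesis .
qed

section \<open>Assignments of items to classes, and the monomials in the weights\<close>

definition sel :: "(nat \<Rightarrow> nat) \<Rightarrow> nat \<Rightarrow> nat" where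
  "sel \<phi> d = (\<Sum>j\<in>{j\<in>J. \<phi> j < k}. ek j (\<phi> j) d)"

text \<open>The value \<open>k\<close> of \<open>\<phi>\<close> marks an item that is left
  out.\<close>

definition choices :: "(nat \<Rightarrow> nat) \<Rightarrow> (nat \<Rightarrow> nat) set" where
  "choices \<kappa> = {\<phi> \<in> PiE J (\<lambda>_. {..k}). sel \<phi> = \<kappa>}"

definition vars_of :: "(nat \<Rightarrow> nat) \<Rightarrow> nat set" where
  "vars_of \<phi> = (\<lambda>j. j * k + \<phi> j) ` {j\<in>J. \<phi> j < k}"

text \<open>Expanding the product chooses a class or none for every item. The index
  \<open>j * k + i\<close> determines item and class, so different choices give different sets of
  variables and nothing cancels.\<close>

lemma lk_Fp: "lk Fp \<kappa> = mlin (vars_of ` choices \<kappa>) w"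
proof -
  let ?P = "PiE J (\<lambda>_. {..k})"
  let ?t = "\<lambda>j i. if i < k then sg (ek j i) (w (j * k + i)) else 1"
  have fin: "finite ?P" using finJ by (intro finite_PiE) auto
  have f: "fp j = (\<Sum>i\<in>{..k}. ?t j i)" for j
    unfolding fp_def by (simp add: lessThan_Suc_atMost[symmetric] add.commute)
  have "Fp = (\<Sum>\<phi>\<in>?P. \<Prod>j\<in>J. ?t j (\<phi> j))"
    unfolding Fp_def f using finJ by (rule prod_sum_PiE) simp
  also have "\<dots> = (\<Sum>\<phi>\<in>?P. sg (sel \<phi>) (\<Prod>v\<in>vars_of \<phi>. w v))"
  proof (rule sum.cong[OF refl])
    fix \<phi> assume "\<phi> \<in> ?P"
    let ?A = "{j\<in>J. \<phi> j < k}"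
    have "(\<Prod>j\<in>J. ?t j (\<phi> j)) = (\<Prod>j\<in>?A. sg (ek j (\<phi> j)) (w (j * k + \<phi> j)))"
      by (rule prod.inter_filter[OF finJ, symmetric])
    also have "\<dots> = sg (\<Sum>j\<in>?A. ek j (\<phi> j)) (\<Prod>j\<in>?A. w (j * k + \<phi> j))"
      using finJ by (intro prod_single) auto
    also have "(\<Sum>j\<in>?A. ek j (\<phi> j)) = sel \<phi>" by (rule ext) (simp add: sel_def sum_fun_apply)
    also have "(\<Prod>j\<in>?A. w (j * k + \<phi> j)) = (\<Prod>v\<in>vars_of \<phi>. w v)"
    proof -
      have "inj_on (\<lambda>j. j * k + \<phi> j) ?A"
      proof (rule inj_onI)
        fix j j' assume a: "j \<in> ?A" "j' \<in> ?A" "j * k + \<phi> j = j' * k + \<phi> j'"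
        have "(j * k + \<phi> j) div k = j" "(j' * k + \<phi> j') div k = j'" using a(1,2) by auto
        then show "j = j'" using a(3) by metis
      qed
      then show ?thesis unfolding vars_of_def by (simp add: prod.reindex)
    qed
    finally show "(\<Prod>j\<in>J. ?t j (\<phi> j)) = sg (sel \<phi>) (\<Prod>v\<in>vars_of \<phi>. w v)" .
  qed
  finally have "lk Fp \<kappa> = (\<Sum>\<phi>\<in>?P. if sel \<phi> = \<kappa> then \<Prod>v\<in>vars_of \<phi>. w v else 0)"
    by (simp add: lookup_sum lookup_single when_def)
  also have "\<dots> = (\<Sum>\<phi>\<in>choices \<kappa>. \<Prod>v\<in>vars_of \<phi>. w v)"
    unfolding choices_def by (rule sum.inter_filter[OF fin, symmetric])
  also have "\<dots> = mlin (vars_of ` choices \<kappa>) w"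
  proof -
    have "inj_on vars_of (choices \<kappa>)"
    proof (rule inj_onI)
      fix \<phi> \<psi> assume a: "\<phi> \<in> choices \<kappa>" "\<psi> \<in> choices \<kappa>" "vars_of \<phi> = vars_of \<psi>"
      have key: "\<psi> j = \<phi> j" if "j \<in> J" "\<phi> j < k" "vars_of \<phi> = vars_of \<psi>" for j \<phi> \<psi>
      proof -
        have "j * k + \<phi> j \<in> vars_of \<psi>" using that by (auto simp: vars_of_def)
        then obtain j' where j': "j * k + \<phi> j = j' * k + \<psi> j'" "\<psi> j' < k" by (auto simp: vars_of_def)
        have "(j * k + \<phi> j) div k = j" "(j' * k + \<psi> j') div k = j'" using that(2) j'(2) by auto
        then have "j = j'" using j'(1) by metis
        then show ?thesis using j' by simp
      qed
      show "\<phi> = \<psi>"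
      proof (rule PiE_ext)
        show "\<phi> \<in> ?P" "\<psi> \<in> ?P" using a by (auto simp: choices_def)
        fix j assume j: "j \<in> J"
        then have "\<phi> j \<le> k" "\<psi> j \<le> k" using a by (auto simp: choices_def)
        then show "\<phi> j = \<psi> j" using key[OF j _ a(3)] key[OF j _ a(3)[symmetric]] by (metis le_neq_implies_less)
      qed
    qed
    then show ?thesis unfolding mlin_def by (simp add: sum.reindex)
  qed
  finally show ?thesis .
qed

lemma Fc_0: "Fc 0 = 1"
proof -
  have z: "sel \<phi> = 0 \<longleftrightarrow> (\<forall>j\<in>J. \<phi> j = k)" if P: "\<phi> \<in> PiE J (\<lambda>_. {..k})" for \<phi>
  proof
    assume s: "sel \<phi> = 0"
    show "\<forall>j\<in>J. \<phi> j = k"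
    proof (rule ccontr)
      assume "\<not> ?thesis"
      then obtain j where j: "j \<in> J" "\<phi> j < k" using P by (force simp: PiE_iff)
      have "ek j (\<phi> j) (\<phi> j) \<le> sel \<phi> (\<phi> j)"
        unfolding sel_def using finJ j by (intro member_le_sum) auto
      then show False using s by (simp add: ek_def)
    qed
  next
    assume "\<forall>j\<in>J. \<phi> j = k"
    then have "{j\<in>J. \<phi> j < k} = {}" by auto
    then show "sel \<phi> = 0" unfolding sel_def fun_eq_iff by (simp only: sum.empty zero_fun_apply simp_thms)
  qed
  have "choices 0 = {\<lambda>j\<in>J. k}"
  proof
    show "choices 0 \<subseteq> {\<lambda>j\<in>J. k}"
    proof
      fix \<phi> assume "\<phi> \<in> choices 0"
      then have p: "\<phi> \<in> PiE J (\<lambda>_. {..k})" "\<forall>j\<in>J. \<phi> j = k" using z by (auto simp: choices_def)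
      have "\<phi> = (\<lambda>j\<in>J. k)" by (rule PiE_ext[OF p(1)]) (use p(2) in auto)
      then show "\<phi> \<in> {\<lambda>j\<in>J. k}" by simp
    qed
    show "{\<lambda>j\<in>J. k} \<subseteq> choices 0" using z[of "\<lambda>j\<in>J. k"] by (auto simp: choices_def)
  qed
  moreover have "vars_of (\<lambda>j\<in>J. k) = {}" by (auto simp: vars_of_def)
  ultimately show ?thesis using okc_0 by (simp add: Fc_def dec_0 lk_Fp mlin_def)
qed

end

subsection \<open>A structured language and its compilation\<close>

datatype exp = V reg | N nat | Bin arith exp exp | Ld nat exp

datatype cmd =
    Asg reg exp
  | Sto nat exp exp
  | Inp reg exp
  | Coin reg
  | Seq cmd cmd
  | CIf exp cmd cmd
  | CWhile exp cmd

type_synonym store = "reg \<Rightarrow> nat"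
type_synonym arrays = "nat \<Rightarrow> nat \<Rightarrow> nat"
type_synonym state = "store \<times> arrays \<times> bool list \<times> nat"

fun aval :: "exp \<Rightarrow> store \<Rightarrow> arrays \<Rightarrow> nat" where
  "aval (V x) s A = s x"
| "aval (N c) s A = c"
| "aval (Bin f a b) s A = arith_val f (aval a s A) (aval b s A)"
| "aval (Ld j e) s A = A j (aval e s A)"

text \<open>Storing a value of \<open>U\<close> or more blocks execution, so a derivation also
  certifies that no variable or cell overflows; only intermediate values within an expression may be
  larger. The last component of a state is a clock.\<close>

inductive big :: "nat \<Rightarrow> nat list \<Rightarrow> cmd \<Rightarrow> state \<Rightarrow> state \<Rightarrow> bool" for U xs where
  Asg: "aval e s A < U \<Longrightarrow> big U xs (Asg x e) (s, A, bs, t) (s(x := aval e s A), A, bs, t + 1)"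
| Sto: "aval e2 s A < U \<Longrightarrow>
    big U xs (Sto j e1 e2) (s, A, bs, t) (s, A(j := (A j)(aval e1 s A := aval e2 s A)), bs, t + 1)"
| Inp: "aval e s A < length xs \<Longrightarrow>
    big U xs (Inp x e) (s, A, bs, t) (s(x := xs ! aval e s A), A, bs, t + 1)"
| Coin: "big U xs (Coin x) (s, A, b # bs, t) (s(x := of_bool b), A, bs, t + 1)"
| Seq: "big U xs c1 \<sigma> \<sigma>1 \<Longrightarrow> big U xs c2 \<sigma>1 \<sigma>2 \<Longrightarrow> big U xs (Seq c1 c2) \<sigma> \<sigma>2"
| IfT: "aval e s A \<noteq> 0 \<Longrightarrow> big U xs c1 (s, A, bs, t + 1) \<sigma> \<Longrightarrow> big U xs (CIf e c1 c2) (s, A, bs, t) \<sigma>"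
| IfF: "aval e s A = 0 \<Longrightarrow> big U xs c2 (s, A, bs, t + 1) \<sigma> \<Longrightarrow> big U xs (CIf e c1 c2) (s, A, bs, t) \<sigma>"
| WhT: "aval e s A \<noteq> 0 \<Longrightarrow> big U xs c (s, A, bs, t + 1) \<sigma>1 \<Longrightarrow> big U xs (CWhile e c) \<sigma>1 \<sigma>2 \<Longrightarrow>
    big U xs (CWhile e c) (s, A, bs, t) \<sigma>2"
| WhF: "aval e s A = 0 \<Longrightarrow> big U xs (CWhile e c) (s, A, bs, t) (s, A, bs, t + 1)"

text \<open>
  Source variables are registers below 60. Register 60 holds the length of the input, and registers
  from 61 on are temporaries. Cell \<open>i\<close> of array \<open>j\<close> lives at address \<open>length xs + (16 * i + j)\<close>,
  so that the arrays are pairwise disjoint and unbounded.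
\<close>

definition addr_code :: "nat \<Rightarrow> reg \<Rightarrow> com list" where
  "addr_code j d = [Const (d + 1) 16, Arith Times d d (d + 1), Const (d + 1) j,
     Arith Plus d d (d + 1), Arith Plus d d 60]"

fun compile_exp :: "exp \<Rightarrow> reg \<Rightarrow> com list" where
  "compile_exp (V x) d = [Const (d + 1) 0, Arith Plus d x (d + 1)]"
| "compile_exp (N c) d = [Const d c]"
| "compile_exp (Bin f a b) d = compile_exp a d @ compile_exp b (d + 1) @ [Arith f d d (d + 1)]"
| "compile_exp (Ld j e) d = compile_exp e d @ addr_code j d @ [Load d d]"

fun compile_cmd :: "cmd \<Rightarrow> com list" where
  "compile_cmd (Asg x e) = compile_exp e 61 @ [Const 62 0, Arith Plus x 61 62]"
| "compile_cmd (Sto j e1 e2) = compile_exp e1 61 @ addr_code j 61 @ compile_exp e2 62 @ [Store 61 62]"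
| "compile_cmd (Inp x e) = compile_exp e 61 @ [Load x 61]"
| "compile_cmd (Coin x) = [Flip x]"
| "compile_cmd (Seq a b) = compile_cmd a @ compile_cmd b"
| "compile_cmd (CIf e a b) = compile_exp e 61 @ [IfNZ 61 (compile_cmd a) (compile_cmd b)]"
| "compile_cmd (CWhile e c) = compile_exp e 61 @ [WhileNZ 61 (compile_cmd c @ compile_exp e 61)]"

text \<open>The value of \<open>e\<close> stays below \<open>U ^ exp_deg e\<close> if all stored
  values are below \<open>U \<ge> 2\<close>. The 10 of a load pays for its address, a multiplication
  by 16 and two offsets.\<close>

fun exp_deg :: "exp \<Rightarrow> nat" where
  "exp_deg (V x) = 1"
| "exp_deg (N c) = c + 1"
| "exp_deg (Bin f a b) = exp_deg a + exp_deg b + 1"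
| "exp_deg (Ld j e) = exp_deg e + 10"

fun wfe :: "exp \<Rightarrow> bool" where
  "wfe (V x) \<longleftrightarrow> x < 60"
| "wfe (N c) \<longleftrightarrow> True"
| "wfe (Bin f a b) \<longleftrightarrow> wfe a \<and> wfe b"
| "wfe (Ld j e) \<longleftrightarrow> j < 16 \<and> wfe e"

fun wfc :: "cmd \<Rightarrow> bool" where
  "wfc (Asg x e) \<longleftrightarrow> x < 60 \<and> wfe e"
| "wfc (Sto j a b) \<longleftrightarrow> j < 16 \<and> wfe a \<and> wfe b"
| "wfc (Inp x e) \<longleftrightarrow> x < 60 \<and> wfe e"
| "wfc (Coin x) \<longleftrightarrow> x < 60"
| "wfc (Seq a b) \<longleftrightarrow> wfc a \<and> wfc b"
| "wfc (CIf e a b) \<longleftrightarrow> wfe e \<and> wfc a \<and> wfc b"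
| "wfc (CWhile e a) \<longleftrightarrow> wfe e \<and> wfc a"

fun cmd_deg :: "cmd \<Rightarrow> nat" where
  "cmd_deg (Asg x e) = exp_deg e"
| "cmd_deg (Sto j a b) = exp_deg a + exp_deg b + 10"
| "cmd_deg (Inp x e) = exp_deg e"
| "cmd_deg (Coin x) = 0"
| "cmd_deg (Seq a b) = cmd_deg a + cmd_deg b"
| "cmd_deg (CIf e a b) = exp_deg e + cmd_deg a + cmd_deg b"
| "cmd_deg (CWhile e a) = exp_deg e + cmd_deg a"

text \<open>An upper bound for the machine steps per tick of the source clock.\<close>

fun cost_factor :: "cmd \<Rightarrow> nat" where
  "cost_factor (Asg x e) = length (compile_exp e 61) + 2"
| "cost_factor (Sto j a b) = length (compile_exp a 61) + length (compile_exp b 62) + 6"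
| "cost_factor (Inp x e) = length (compile_exp e 61) + 1"
| "cost_factor (Coin x) = 1"
| "cost_factor (Seq a b) = cost_factor a + cost_factor b"
| "cost_factor (CIf e a b) = length (compile_exp e 61) + 1 + cost_factor a + cost_factor b"
| "cost_factor (CWhile e a) = length (compile_exp e 61) + 1 + cost_factor a"

section \<open>Simulation of source programs by compiled code\<close>

definition steps :: "nat \<Rightarrow> nat \<Rightarrow> config \<times> bool list \<Rightarrow> config \<times> bool list \<Rightarrow> bool" where
  "steps w n c c' \<longleftrightarrow> (dstep w ^^ n) c = c'"

lemma steps_0: "steps w 0 c c" by (simp add: steps_def)

lemma steps_Suc: "steps w n (dstep w c) c' \<Longrightarrow> steps w (Suc n) c c'"
  by (simp add: steps_def funpow_Suc_right del: funpow.simps)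

lemma steps_trans: "steps w n c c' \<Longrightarrow> steps w m c' c'' \<Longrightarrow> steps w (n + m) c c''"
  by (simp add: steps_def funpow_add add.commute[of n m])

definition sim :: "nat \<Rightarrow> nat list \<Rightarrow> (reg \<Rightarrow> nat) \<Rightarrow> (nat \<Rightarrow> nat) \<Rightarrow> store \<Rightarrow> arrays \<Rightarrow> bool" where
  "sim U xs r m s A \<longleftrightarrow> (\<forall>x<60. r x = s x \<and> s x < U) \<and> r 60 = length xs \<and>
     (\<forall>a<length xs. m a = xs ! a) \<and>
     (\<forall>j<16. \<forall>i. m (length xs + (16 * i + j)) = A j i \<and> A j i < U)"

lemma deg_pos: "exp_deg e > 0" by (induction e) auto

lemma sim_temp: "sim U xs r m s A \<Longrightarrow> (\<And>x. x \<le> 60 \<Longrightarrow> r' x = r x) \<Longrightarrow> sim U xs r' m s A"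
  by (auto simp: sim_def)

lemma self_le_pow: "2 \<le> (U::nat) \<Longrightarrow> 0 < d \<Longrightarrow> U \<le> U ^ d"
  using power_increasing[of 1 d U] by simp

lemma aval_less:
  assumes "sim U xs r m s A" "wfe e" "2 \<le> U"
  shows "aval e s A < U ^ exp_deg e"
  using assms(2)
proof (induction e)
  case (V x)
  then show ?case using assms by (auto simp: sim_def)
next
  case (N c)
  have "c < 2 ^ (c + 1)" using less_exp[of "c + 1"] by linarith
  also have "\<dots> \<le> U ^ (c + 1)" using assms(3) by (rule power_mono) simp
  finally show ?case by simp
next
  case (Ld j e)
  then have "A j (aval e s A) < U" using assms(1) by (simp add: sim_def)
  also have "\<dots> \<le> U ^ exp_deg (Ld j e)" using assms(3) by (intro self_le_pow) simp_all
  finally show ?case by simp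
next
  case (Bin f a b)
  let ?x = "aval a s A" and ?y = "aval b s A"
  let ?p = "U ^ exp_deg a" and ?q = "U ^ exp_deg b"
  have xy: "?x < ?p" "?y < ?q" using Bin by auto
  have p: "2 \<le> ?p" "2 \<le> ?q"
    using self_le_pow[OF assms(3) deg_pos[of a]] self_le_pow[OF assms(3) deg_pos[of b]] assms(3) by linarith+
  have ge: "?p \<le> ?p * ?q" "?q \<le> ?p * ?q" using p by auto
  have "?x + ?y < 2 * (?p * ?q)" "?x * ?y < 2 * (?p * ?q)"
    using xy ge mult_strict_mono[of ?x ?p ?y ?q] by linarith+
  moreover have "?x - ?y \<le> ?x" "?x div ?y \<le> ?x" "?x mod ?y \<le> ?x" by auto
  moreover have "?x < 2 * (?p * ?q)" using xy ge by linarith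
  ultimately have "arith_val f ?x ?y < 2 * (?p * ?q)" by (cases f; simp only: arith_val.simps; linarith)
  also have "\<dots> \<le> U * (?p * ?q)" using assms(3) by (intro mult_right_mono) auto
  finally show ?case by (simp add: power_add)
qed

lemma addr_code_steps:
  assumes "61 \<le> d" "r 60 = l" "l + (16 * r d + j) < 2 ^ w" "(16 :: nat) < 2 ^ w"
  shows "\<exists>r'. steps w 5 ((addr_code j d @ K, r, m), bs) ((K, r', m), bs) \<and>
    r' d = l + (16 * r d + j) \<and> (\<forall>x<d. r' x = r x)"
proof -
  have a: "16 * r d < 2 ^ w" "j < 2 ^ w" "16 * r d + j < 2 ^ w" using assms by linarith+
  have "dstep w (dstep w (dstep w (dstep w (dstep w ((addr_code j d @ K, r, m), bs))))) =
    ((K, r(d := l + (16 * r d + j), d + 1 := j), m), bs)"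
    using assms a by (simp add: addr_code_def fun_upd_twist mult.commute add.commute)
  then show ?thesis using assms(1)
    by (intro exI[of _ "r(d := l + (16 * r d + j), d + 1 := j)"])
      (simp add: steps_def numeral_eq_Suc)
qed

text \<open>The registers from \<open>d\<close> on serve as an evaluation stack: the first operand
  waits in \<open>d\<close> while the second is computed from \<open>d + 1\<close> on.\<close>

lemma ce_steps:
  assumes "sim U xs r m s A" "wfe e" "2 \<le> U" "length xs < U" "U ^ exp_deg e \<le> 2 ^ w" "61 \<le> d"
  shows "\<exists>r'. steps w (length (compile_exp e d)) ((compile_exp e d @ K, r, m), bs) ((K, r', m), bs) \<and>
    r' d = aval e s A \<and> (\<forall>x<d. r' x = r x)"
  using assms
proof (induction e arbitrary: r d K)
  case (V x)
  then have "s x < 2 ^ w" "r x = s x" "x < d" by (auto simp: sim_def)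
  then show ?case by (auto simp: steps_def)
next
  case (N c)
  then have "c < 2 ^ w" using aval_less[OF N(1) N(2) N(3)] by simp
  then show ?case by (auto simp: steps_def)
next
  case (Bin f a b)
  have "U ^ exp_deg a \<le> U ^ exp_deg (Bin f a b)" "U ^ exp_deg b \<le> U ^ exp_deg (Bin f a b)"
    using Bin.prems(3) by (simp_all add: power_increasing del: power_Suc)
  then have da: "U ^ exp_deg a \<le> 2 ^ w" and db: "U ^ exp_deg b \<le> 2 ^ w" using Bin.prems(5) by auto
  obtain r1 where r1: "steps w (length (compile_exp a d)) ((compile_exp a d @ compile_exp b (d + 1) @ Arith f d d (d + 1) # K, r, m), bs)
      ((compile_exp b (d + 1) @ Arith f d d (d + 1) # K, r1, m), bs)" "r1 d = aval a s A" "\<forall>x<d. r1 x = r x"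
    using Bin.IH(1)[OF Bin.prems(1) _ Bin.prems(3,4) da Bin.prems(6), of "compile_exp b (d + 1) @ Arith f d d (d + 1) # K"]
      Bin.prems(2) by auto
  have "sim U xs r1 m s A" using sim_temp[OF Bin.prems(1)] r1(3) Bin.prems(6) by auto
  then obtain r2 where r2: "steps w (length (compile_exp b (d + 1))) ((compile_exp b (d + 1) @ Arith f d d (d + 1) # K, r1, m), bs)
      ((Arith f d d (d + 1) # K, r2, m), bs)" "r2 (d + 1) = aval b s A" "\<forall>x<d + 1. r2 x = r1 x"
    using Bin.IH(2)[of r1 "d + 1" "Arith f d d (d + 1) # K"] Bin.prems db by auto
  have v: "arith_val f (r2 d) (r2 (d + 1)) = aval (Bin f a b) s A" using r1 r2 by simp
  have "aval (Bin f a b) s A < 2 ^ w"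
    using aval_less[OF Bin.prems(1,2,3)] Bin.prems(5) by linarith
  then have "steps w 1 ((Arith f d d (d + 1) # K, r2, m), bs) ((K, r2(d := aval (Bin f a b) s A), m), bs)"
    using v by (simp add: steps_def del: aval.simps)
  from steps_trans[OF r1(1) steps_trans[OF r2(1) this]]
  have "steps w (length (compile_exp (Bin f a b) d)) ((compile_exp (Bin f a b) d @ K, r, m), bs)
    ((K, r2(d := aval (Bin f a b) s A), m), bs)" by (simp add: add.assoc)
  moreover have "(r2(d := aval (Bin f a b) s A)) d = aval (Bin f a b) s A"
    "\<forall>x<d. (r2(d := aval (Bin f a b) s A)) x = r x" using r1 r2 by auto
  ultimately show ?case by blast
next
  case (Ld j e)
  have "U ^ exp_deg e \<le> U ^ exp_deg (Ld j e)" using Ld.prems(3) by (auto intro!: power_increasing)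
  then have de: "U ^ exp_deg e \<le> 2 ^ w" using Ld.prems(5) by auto
  obtain r1 where r1: "steps w (length (compile_exp e d)) ((compile_exp e d @ addr_code j d @ Load d d # K, r, m), bs)
      ((addr_code j d @ Load d d # K, r1, m), bs)" "r1 d = aval e s A" "\<forall>x<d. r1 x = r x"
    using Ld.IH[OF Ld.prems(1) _ Ld.prems(3,4) de Ld.prems(6), of "addr_code j d @ Load d d # K"]
      Ld.prems(2) by auto
  \<comment> \<open>One power of \<open>U\<close> absorbs the length of the input; the other nine
    exceed the constants of the address computation.\<close>
  have U10: "2 ^ 9 * U \<le> U ^ 10"
  proof -
    have "(2::nat) ^ 9 * U \<le> U ^ 9 * U" using Ld.prems(3) by (intro mult_right_mono power_mono) auto
    also have "\<dots> = U ^ 10" by (simp add: numeral_eq_Suc)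
    finally show ?thesis .
  qed
  have E: "aval e s A < U ^ exp_deg e" using aval_less[of U xs r m s A e] Ld.prems by simp
  have "U ^ exp_deg e * (2 ^ 9 * U) \<le> U ^ exp_deg e * U ^ 10" using U10 by simp
  also have "\<dots> \<le> 2 ^ w" using Ld.prems(5) by (simp add: power_add)
  finally have big: "U ^ exp_deg e * (512 * U) \<le> 2 ^ w" by simp
  have U1: "1 \<le> U ^ exp_deg e" using Ld.prems(3) by simp
  have "length xs + (16 * aval e s A + j) < U + 16 * U ^ exp_deg e"
    using E Ld.prems(2,4) by simp
  also have "\<dots> \<le> U * U ^ exp_deg e + 16 * (U * U ^ exp_deg e)"
    using U1 Ld.prems(3) by (intro add_mono) auto
  also have "\<dots> \<le> U ^ exp_deg e * (512 * U)" by (simp add: mult.commute)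
  finally have A1: "length xs + (16 * aval e s A + j) < 2 ^ w" using big by linarith
  have "1 * (512 * 1) \<le> U ^ exp_deg e * (512 * U)" using U1 Ld.prems(3) by (intro mult_mono) auto
  then have A2: "16 < (2::nat) ^ w" using big by linarith
  have sim1: "sim U xs r1 m s A" using sim_temp[OF Ld.prems(1)] r1(3) Ld.prems(6) by auto
  obtain r2 where r2: "steps w 5 ((addr_code j d @ Load d d # K, r1, m), bs) ((Load d d # K, r2, m), bs)"
    "r2 d = length xs + (16 * aval e s A + j)" "\<forall>x<d. r2 x = r1 x"
    using addr_code_steps[of d r1 "length xs" j w "Load d d # K" m bs] A1 A2 Ld.prems(6) sim1 r1(2)
    by (auto simp: sim_def)
  have "m (r2 d) = A j (aval e s A)" "A j (aval e s A) < U"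
    using sim1 Ld.prems(2) r2(2) by (auto simp: sim_def)
  moreover have "U \<le> 2 ^ w" using self_le_pow[OF Ld.prems(3), of "exp_deg (Ld j e)"] Ld.prems(5) by simp
  ultimately have "steps w 1 ((Load d d # K, r2, m), bs) ((K, r2(d := A j (aval e s A)), m), bs)"
    by (simp add: steps_def)
  from steps_trans[OF r1(1) steps_trans[OF r2(1) this]]
  have "steps w (length (compile_exp (Ld j e) d)) ((compile_exp (Ld j e) d @ K, r, m), bs)
    ((K, r2(d := A j (aval e s A)), m), bs)" by (simp add: addr_code_def add.assoc numeral_eq_Suc)
  moreover have "(r2(d := A j (aval e s A))) d = aval (Ld j e) s A"
    "\<forall>x<d. (r2(d := A j (aval e s A))) x = r x" using r1 r2 by auto
  ultimately show ?case by blast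
qed

lemma le_of_power_Suc_le: "2 \<le> (U::nat) \<Longrightarrow> U ^ (d + 1) \<le> W \<Longrightarrow> U \<le> W"
  using self_le_pow[of U "d + 1"] by linarith

lemma power_deg_mono: "2 \<le> (U::nat) \<Longrightarrow> d \<le> d' \<Longrightarrow> U ^ d' \<le> W \<Longrightarrow> U ^ d \<le> W"
  using power_increasing[of d d' U] by linarith

lemma sim_addr_less:
  assumes "sim U xs r m s A" "wfe e" "2 \<le> U" "length xs < U" "U ^ (exp_deg e + 10) \<le> 2 ^ w" "j < 16"
  shows "length xs + (16 * aval e s A + j) < 2 ^ w" "16 < (2::nat) ^ w"
proof -
  have "(2::nat) ^ 9 * U \<le> U ^ 9 * U" using assms by (intro mult_right_mono power_mono) auto
  also have "\<dots> = U ^ 10" by (simp add: numeral_eq_Suc)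
  finally have U10: "2 ^ 9 * U \<le> U ^ 10" .
  have E: "aval e s A < U ^ exp_deg e" using aval_less assms by blast
  have "U ^ exp_deg e * (2 ^ 9 * U) \<le> U ^ exp_deg e * U ^ 10" using U10 by simp
  also have "\<dots> \<le> 2 ^ w" using assms(5) by (simp add: power_add)
  finally have big: "U ^ exp_deg e * (512 * U) \<le> 2 ^ w" by simp
  have U1: "1 \<le> U ^ exp_deg e" using assms(3) by simp
  have "length xs + (16 * aval e s A + j) < U + 16 * U ^ exp_deg e" using E assms by simp
  also have "\<dots> \<le> U * U ^ exp_deg e + 16 * (U * U ^ exp_deg e)"
    using U1 assms(3) by (intro add_mono) auto
  also have "\<dots> \<le> U ^ exp_deg e * (512 * U)" by (simp add: mult.commute)
  finally show "length xs + (16 * aval e s A + j) < 2 ^ w" using big by linarith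
  have "1 * (512 * 1) \<le> U ^ exp_deg e * (512 * U)" using U1 assms(3) by (intro mult_mono) auto
  then show "16 < (2::nat) ^ w" using big by linarith
qed

lemma interleave_inj:
  assumes "16 * i + j = 16 * i' + j'" "j < 16" "j' < 16"
  shows "i = i' \<and> j = (j' :: nat)"
proof -
  have "i = (16 * i + j) div 16" "i' = (16 * i' + j') div 16" using assms by simp_all
  then have "i = i'" unfolding assms(1) by simp
  moreover have "j = j'" using assms(1) unfolding \<open>i = i'\<close> by simp
  ultimately show ?thesis by blast
qed

text \<open>A fixed \<open>\<kappa>\<close> instead of \<open>cost_factor c\<close> passes unchanged
  to all parts of the program, so that the ticks simply add up. A loop body ends with the code of
  the test; hence after each round the remaining code is again that of the whole loop.\<close>

theorem big_steps:
  assumes "big U xs c \<sigma> \<sigma>'" "2 \<le> U" "length xs < U" "\<forall>x\<in>set xs. x < U"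
    "wfc c" "U ^ (cmd_deg c + 1) \<le> 2 ^ w" "cost_factor c \<le> \<kappa>"
    "\<sigma> = (s, A, bs, t)" "\<sigma>' = (s', A', bs', t')" "sim U xs r m s A"
  shows "\<exists>n r' m'. steps w n ((compile_cmd c @ K, r, m), bs) ((K, r', m'), bs') \<and> sim U xs r' m' s' A' \<and>
    t \<le> t' \<and> n \<le> \<kappa> * (t' - t)"
  using assms(1,5-)
proof (induction arbitrary: s A bs t s' A' bs' t' r m K rule: big.induct)
  case (Asg e s0 A0 x bs0 t0)
  then have eq: "s0 = s" "A0 = A" "bs0 = bs" "t0 = t" "s' = s(x := aval e s A)" "A' = A" "bs' = bs" "t' = t + 1" by auto
  have "U ^ exp_deg e \<le> 2 ^ w" using power_deg_mono[OF assms(2) _ Asg(3)] by simp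
  from ce_steps[OF Asg(7) _ assms(2,3) this, of 61 "[Const 62 0, Arith Plus x 61 62] @ K" bs] Asg(2)
  obtain r1 where r1: "steps w (length (compile_exp e 61)) ((compile_exp e 61 @ [Const 62 0, Arith Plus x 61 62] @ K, r, m), bs)
     (([Const 62 0, Arith Plus x 61 62] @ K, r1, m), bs)" "r1 61 = aval e s A" "\<forall>x<61. r1 x = r x" by auto
  have "U \<le> 2 ^ w" using le_of_power_Suc_le[OF assms(2) Asg(3)] .
  then have "aval e s A < 2 ^ w" using Asg(1) eq by simp
  then have "steps w 2 (([Const 62 0, Arith Plus x 61 62] @ K, r1, m), bs) ((K, r1(62 := 0, x := aval e s A), m), bs)"
    using r1(2) by (simp add: steps_def numeral_eq_Suc)
  from steps_trans[OF r1(1) this]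
  have "steps w (length (compile_exp e 61) + 2) ((compile_cmd (Asg x e) @ K, r, m), bs) ((K, r1(62 := 0, x := aval e s A), m), bs)"
    by simp
  moreover have "sim U xs (r1(62 := 0, x := aval e s A)) m s' A'"
    using Asg(7) r1(3) eq Asg(1) Asg(2) by (auto simp: sim_def)
  ultimately show ?case using Asg(4) eq by fastforce
next
  case (Sto e2 s0 A0 j e1 bs0 t0)
  let ?v = "aval e2 s A" and ?i = "aval e1 s A"
  have eq: "s0 = s" "A0 = A" "bs0 = bs" "t0 = t" "s' = s" "A' = A(j := (A j)(?i := ?v))" "bs' = bs" "t' = t + 1"
    using Sto by auto
  let ?K1 = "addr_code j 61 @ compile_exp e2 62 @ [Store 61 62] @ K"
  let ?K2 = "compile_exp e2 62 @ [Store 61 62] @ K"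
  have d: "U ^ exp_deg e1 \<le> 2 ^ w" "U ^ (exp_deg e1 + 10) \<le> 2 ^ w" "U ^ exp_deg e2 \<le> 2 ^ w"
    by (rule power_deg_mono[OF assms(2) _ Sto(3)]; simp)+
  from ce_steps[OF Sto(7) _ assms(2,3) d(1), of 61 ?K1 bs] Sto(2)
  obtain r1 where r1: "steps w (length (compile_exp e1 61)) ((compile_exp e1 61 @ ?K1, r, m), bs) ((?K1, r1, m), bs)"
    "r1 61 = ?i" "\<forall>x<61. r1 x = r x" by auto
  have sim1: "sim U xs r1 m s A" using sim_temp[OF Sto(7)] r1(3) by auto
  obtain r2 where r2: "steps w 5 ((?K1, r1, m), bs) ((?K2, r2, m), bs)"
    "r2 61 = length xs + (16 * ?i + j)" "\<forall>x<61. r2 x = r1 x"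
    using addr_code_steps[of 61 r1 "length xs" j w ?K2 m bs] sim1 r1(2)
      sim_addr_less[OF Sto(7) _ assms(2,3) d(2), of j] Sto(2) by (auto simp: sim_def)
  have sim2: "sim U xs r2 m s A" using sim_temp[OF sim1] r2(3) by auto
  from ce_steps[OF sim2 _ assms(2,3) d(3), of 62 "[Store 61 62] @ K" bs] Sto(2)
  obtain r3 where r3: "steps w (length (compile_exp e2 62)) ((?K2, r2, m), bs) (([Store 61 62] @ K, r3, m), bs)"
    "r3 62 = ?v" "\<forall>x<62. r3 x = r2 x" by auto
  let ?m = "m(length xs + (16 * ?i + j) := ?v)"
  have "steps w 1 (([Store 61 62] @ K, r3, m), bs) ((K, r3, ?m), bs)"
    using r3 r2 by (simp add: steps_def)
  from steps_trans[OF r1(1) steps_trans[OF r2(1) steps_trans[OF r3(1) this]]]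
  have S: "steps w (length (compile_exp e1 61) + (5 + (length (compile_exp e2 62) + 1))) ((compile_cmd (Sto j e1 e2) @ K, r, m), bs) ((K, r3, ?m), bs)"
    by simp
  have inj: "16 * i + j' = 16 * ?i + j \<Longrightarrow> j' < 16 \<Longrightarrow> i = ?i \<and> j' = j" for i j'
    using Sto(2) by (intro interleave_inj) auto
  have "sim U xs r3 ?m s' A'"
    unfolding sim_def
  proof (intro conjI allI impI)
    fix x :: nat assume "x < 60"
    then show "r3 x = s' x" "s' x < U" using sim2 r3(3) eq by (auto simp: sim_def)
  next
    show "r3 60 = length xs" using sim2 r3(3) by (auto simp: sim_def)
  next
    fix a assume "a < length xs"
    then show "?m a = xs ! a" using sim2 by (auto simp: sim_def)
  next
    fix j' i assume j': "j' < (16::nat)"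
    then have "m (length xs + (16 * i + j')) = A j' i" "A j' i < U" using sim2 by (auto simp: sim_def)
    then show "?m (length xs + (16 * i + j')) = A' j' i" "A' j' i < U"
      using inj[OF _ j', of i] Sto(1) eq by auto
  qed
  then show ?case using S Sto(4) eq by fastforce
next
  case (Inp e s0 A0 x bs0 t0)
  then have eq: "s0 = s" "A0 = A" "bs0 = bs" "t0 = t" "s' = s(x := xs ! aval e s A)" "A' = A" "bs' = bs" "t' = t + 1" by auto
  have "U ^ exp_deg e \<le> 2 ^ w" using power_deg_mono[OF assms(2) _ Inp(3)] by simp
  from ce_steps[OF Inp(7) _ assms(2,3) this, of 61 "[Load x 61] @ K" bs] Inp(2)
  obtain r1 where r1: "steps w (length (compile_exp e 61)) ((compile_exp e 61 @ [Load x 61] @ K, r, m), bs)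
     (([Load x 61] @ K, r1, m), bs)" "r1 61 = aval e s A" "\<forall>x<61. r1 x = r x" by auto
  have l: "aval e s A < length xs" using Inp(1) eq by simp
  then have xU: "xs ! aval e s A < U" "m (aval e s A) = xs ! aval e s A" using assms(4) Inp(7) by (auto simp: sim_def)
  moreover have "U \<le> 2 ^ w" using le_of_power_Suc_le[OF assms(2) Inp(3)] .
  ultimately have "steps w 1 (([Load x 61] @ K, r1, m), bs) ((K, r1(x := xs ! aval e s A), m), bs)"
    using r1(2) by (simp add: steps_def)
  from steps_trans[OF r1(1) this]
  have "steps w (length (compile_exp e 61) + 1) ((compile_cmd (Inp x e) @ K, r, m), bs) ((K, r1(x := xs ! aval e s A), m), bs)"
    by simp
  moreover have "sim U xs (r1(x := xs ! aval e s A)) m s' A'"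
    using Inp(7) r1(3) eq xU Inp(2) by (auto simp: sim_def)
  ultimately show ?case using Inp(4) eq by fastforce
next
  case (Coin x s0 A0 b bs0 t0)
  have eq: "s0 = s" "A0 = A" "bs = b # bs0" "t0 = t" "s' = s(x := of_bool b)" "A' = A" "bs' = bs0" "t' = t + 1"
    using Coin by auto
  have "U \<le> 2 ^ w" using le_of_power_Suc_le[OF assms(2) Coin(2)] .
  then have "of_bool b < (2::nat) ^ w" using assms(2) by (cases b) auto
  then have "steps w 1 ((compile_cmd (Coin x) @ K, r, m), bs) ((K, r(x := of_bool b), m), bs')"
    by (simp add: steps_def eq)
  moreover have "sim U xs (r(x := of_bool b)) m s' A'"
    using Coin(6) Coin(1) eq assms(2) by (auto simp: sim_def)
  ultimately show ?case using Coin(3) eq by fastforce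
next
  case (Seq c1 \<sigma> \<sigma>1 c2 \<sigma>2)
  obtain s1 A1 bs1 t1 where s1: "\<sigma>1 = (s1, A1, bs1, t1)" by (cases \<sigma>1) auto
  have d: "U ^ (cmd_deg c1 + 1) \<le> 2 ^ w" "U ^ (cmd_deg c2 + 1) \<le> 2 ^ w"
    by (rule power_deg_mono[OF assms(2) _ Seq(6)]; simp)+
  have k: "cost_factor c1 \<le> \<kappa>" "cost_factor c2 \<le> \<kappa>" using Seq(7) by auto
  obtain n1 r1 m1 where 1: "steps w n1 ((compile_cmd c1 @ compile_cmd c2 @ K, r, m), bs) ((compile_cmd c2 @ K, r1, m1), bs1)"
    "sim U xs r1 m1 s1 A1" "t \<le> t1" "n1 \<le> \<kappa> * (t1 - t)"
    using Seq.IH(1)[OF _ d(1) k(1) Seq(8) s1 Seq(10), of "compile_cmd c2 @ K"] Seq(5) by auto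
  obtain n2 r2 m2 where 2: "steps w n2 ((compile_cmd c2 @ K, r1, m1), bs1) ((K, r2, m2), bs')"
    "sim U xs r2 m2 s' A'" "t1 \<le> t'" "n2 \<le> \<kappa> * (t' - t1)"
    using Seq.IH(2)[OF _ d(2) k(2) s1 Seq(9) 1(2), of K] Seq(5) by auto
  have "n1 + n2 \<le> \<kappa> * (t1 - t) + \<kappa> * (t' - t1)" using 1 2 by simp
  also have "\<dots> = \<kappa> * (t' - t)" using 1(3) 2(3) by (simp add: distrib_left[symmetric])
  finally show ?case using steps_trans[OF 1(1) 2(1)] 1 2 by fastforce
next
  case (IfT e s0 A0 c1 bs0 t0 \<sigma> c2)
  have eq: "s0 = s" "A0 = A" "bs0 = bs" "t0 = t" using IfT by auto
  have d: "U ^ exp_deg e \<le> 2 ^ w" "U ^ (cmd_deg c1 + 1) \<le> 2 ^ w"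
    by (rule power_deg_mono[OF assms(2) _ IfT(5)]; simp)+
  from ce_steps[OF IfT(9) _ assms(2,3) d(1), of 61 "[IfNZ 61 (compile_cmd c1) (compile_cmd c2)] @ K" bs] IfT(4)
  obtain r1 where r1: "steps w (length (compile_exp e 61)) ((compile_exp e 61 @ [IfNZ 61 (compile_cmd c1) (compile_cmd c2)] @ K, r, m), bs)
     (([IfNZ 61 (compile_cmd c1) (compile_cmd c2)] @ K, r1, m), bs)" "r1 61 = aval e s A" "\<forall>x<61. r1 x = r x" by auto
  have i: "steps w 1 (([IfNZ 61 (compile_cmd c1) (compile_cmd c2)] @ K, r1, m), bs) ((compile_cmd c1 @ K, r1, m), bs)"
    using r1(2) IfT(1) eq by (simp add: steps_def)
  have sim1: "sim U xs r1 m s A" using sim_temp[OF IfT(9)] r1(3) by auto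
  obtain n2 r2 m2 where 2: "steps w n2 ((compile_cmd c1 @ K, r1, m), bs) ((K, r2, m2), bs')"
    "sim U xs r2 m2 s' A'" "t + 1 \<le> t'" "n2 \<le> \<kappa> * (t' - (t + 1))"
    using IfT.IH[OF _ d(2) _ _ IfT(8) sim1, of bs "t + 1" K] IfT(4,6) eq by auto
  have "length (compile_exp e 61) + 1 + n2 \<le> \<kappa> + \<kappa> * (t' - (t + 1))" using 2 IfT(6) by simp
  also have "\<dots> = \<kappa> * (1 + (t' - (t + 1)))" by (simp add: distrib_left)
  also have "1 + (t' - (t + 1)) = t' - t" using 2(3) by simp
  finally show ?case using steps_trans[OF r1(1) steps_trans[OF i 2(1)]] 2
    by (intro exI[of _ "length (compile_exp e 61) + (1 + n2)"] exI[of _ r2] exI[of _ m2]) simp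
next
  case (IfF e s0 A0 c2 bs0 t0 \<sigma> c1)
  have eq: "s0 = s" "A0 = A" "bs0 = bs" "t0 = t" using IfF by auto
  have d: "U ^ exp_deg e \<le> 2 ^ w" "U ^ (cmd_deg c2 + 1) \<le> 2 ^ w"
    by (rule power_deg_mono[OF assms(2) _ IfF(5)]; simp)+
  from ce_steps[OF IfF(9) _ assms(2,3) d(1), of 61 "[IfNZ 61 (compile_cmd c1) (compile_cmd c2)] @ K" bs] IfF(4)
  obtain r1 where r1: "steps w (length (compile_exp e 61)) ((compile_exp e 61 @ [IfNZ 61 (compile_cmd c1) (compile_cmd c2)] @ K, r, m), bs)
     (([IfNZ 61 (compile_cmd c1) (compile_cmd c2)] @ K, r1, m), bs)" "r1 61 = aval e s A" "\<forall>x<61. r1 x = r x" by auto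
  have i: "steps w 1 (([IfNZ 61 (compile_cmd c1) (compile_cmd c2)] @ K, r1, m), bs) ((compile_cmd c2 @ K, r1, m), bs)"
    using r1(2) IfF(1) eq by (simp add: steps_def)
  have sim1: "sim U xs r1 m s A" using sim_temp[OF IfF(9)] r1(3) by auto
  obtain n2 r2 m2 where 2: "steps w n2 ((compile_cmd c2 @ K, r1, m), bs) ((K, r2, m2), bs')"
    "sim U xs r2 m2 s' A'" "t + 1 \<le> t'" "n2 \<le> \<kappa> * (t' - (t + 1))"
    using IfF.IH[OF _ d(2) _ _ IfF(8) sim1, of bs "t + 1" K] IfF(4,6) eq by auto
  have "length (compile_exp e 61) + 1 + n2 \<le> \<kappa> + \<kappa> * (t' - (t + 1))" using 2 IfF(6) by simp
  also have "\<dots> = \<kappa> * (1 + (t' - (t + 1)))" by (simp add: distrib_left)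
  also have "1 + (t' - (t + 1)) = t' - t" using 2(3) by simp
  finally show ?case using steps_trans[OF r1(1) steps_trans[OF i 2(1)]] 2
    by (intro exI[of _ "length (compile_exp e 61) + (1 + n2)"] exI[of _ r2] exI[of _ m2]) simp
next
  case (WhF e s0 A0 c bs0 t0)
  have eq: "s0 = s" "A0 = A" "bs0 = bs" "t0 = t" "s' = s" "A' = A" "bs' = bs" "t' = t + 1" using WhF by auto
  let ?W = "WhileNZ 61 (compile_cmd c @ compile_exp e 61)"
  have d: "U ^ exp_deg e \<le> 2 ^ w" using power_deg_mono[OF assms(2) _ WhF(3)] by simp
  from ce_steps[OF WhF(7) _ assms(2,3) d(1), of 61 "[?W] @ K" bs] WhF(2)
  obtain r1 where r1: "steps w (length (compile_exp e 61)) ((compile_exp e 61 @ [?W] @ K, r, m), bs)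
     (([?W] @ K, r1, m), bs)" "r1 61 = aval e s A" "\<forall>x<61. r1 x = r x" by auto
  have i: "steps w 1 (([?W] @ K, r1, m), bs) ((K, r1, m), bs)"
    using r1(2) WhF(1) eq by (simp add: steps_def)
  have sim1: "sim U xs r1 m s A" using sim_temp[OF WhF(7)] r1(3) by auto
  show ?case using steps_trans[OF r1(1) i] sim1 eq WhF(4)
    by (intro exI[of _ "length (compile_exp e 61) + 1"] exI[of _ r1] exI[of _ m]) simp
next
  case (WhT e s0 A0 c bs0 t0 \<sigma>1 \<sigma>2)
  have eq: "s0 = s" "A0 = A" "bs0 = bs" "t0 = t" using WhT by auto
  let ?W = "WhileNZ 61 (compile_cmd c @ compile_exp e 61)"
  obtain s1 A1 bs1 t1 where s1: "\<sigma>1 = (s1, A1, bs1, t1)" by (cases \<sigma>1) auto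
  have d: "U ^ exp_deg e \<le> 2 ^ w" "U ^ (cmd_deg c + 1) \<le> 2 ^ w"
    by (rule power_deg_mono[OF assms(2) _ WhT(7)]; simp)+
  from ce_steps[OF WhT(11) _ assms(2,3) d(1), of 61 "[?W] @ K" bs] WhT(6)
  obtain r1 where r1: "steps w (length (compile_exp e 61)) ((compile_exp e 61 @ [?W] @ K, r, m), bs)
     (([?W] @ K, r1, m), bs)" "r1 61 = aval e s A" "\<forall>x<61. r1 x = r x" by auto
  have i: "steps w 1 (([?W] @ K, r1, m), bs) ((compile_cmd c @ compile_cmd (CWhile e c) @ K, r1, m), bs)"
    using r1(2) WhT(1) eq by (simp add: steps_def)
  have sim1: "sim U xs r1 m s A" using sim_temp[OF WhT(11)] r1(3) by auto
  obtain n2 r2 m2 where 2: "steps w n2 ((compile_cmd c @ compile_cmd (CWhile e c) @ K, r1, m), bs) ((compile_cmd (CWhile e c) @ K, r2, m2), bs1)"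
    "sim U xs r2 m2 s1 A1" "t + 1 \<le> t1" "n2 \<le> \<kappa> * (t1 - (t + 1))"
    using WhT.IH(1)[OF _ d(2) _ _ s1 sim1, of bs "t + 1" "compile_cmd (CWhile e c) @ K"] WhT(6,8) eq by auto
  obtain n3 r3 m3 where 3: "steps w n3 ((compile_cmd (CWhile e c) @ K, r2, m2), bs1) ((K, r3, m3), bs')"
    "sim U xs r3 m3 s' A'" "t1 \<le> t'" "n3 \<le> \<kappa> * (t' - t1)"
    using WhT.IH(2)[OF WhT(6,7,8) s1 WhT(10) 2(2), of K] by auto
  have "length (compile_exp e 61) + 1 + n2 + n3 \<le> \<kappa> + \<kappa> * (t1 - (t + 1)) + \<kappa> * (t' - t1)"
    using 2 3 WhT(8) by simp
  also have "\<dots> = \<kappa> * (1 + (t1 - (t + 1)) + (t' - t1))" by (simp add: distrib_left)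
  also have "1 + (t1 - (t + 1)) + (t' - t1) = t' - t" using 2(3) 3(3) by simp
  finally show ?case using steps_trans[OF r1(1) steps_trans[OF i steps_trans[OF 2(1) 3(1)]]] 2 3
    by (intro exI[of _ "length (compile_exp e 61) + (1 + (n2 + n3))"] exI[of _ r3] exI[of _ m3]) simp
qed

subsection \<open>Weakest preconditions\<close>

type_synonym assn = "store \<Rightarrow> arrays \<Rightarrow> bool list \<Rightarrow> nat \<Rightarrow> bool"

fun written_regs :: "cmd \<Rightarrow> reg set" where
  "written_regs (Asg x e) = {x}"
| "written_regs (Sto j a b) = {}"
| "written_regs (Inp x e) = {x}"
| "written_regs (Coin x) = {x}"
| "written_regs (Seq a b) = written_regs a \<union> written_regs b"
| "written_regs (CIf e a b) = written_regs a \<union> written_regs b"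
| "written_regs (CWhile e a) = written_regs a"

fun written_arrays :: "cmd \<Rightarrow> nat set" where
  "written_arrays (Asg x e) = {}"
| "written_arrays (Sto j a b) = {j}"
| "written_arrays (Inp x e) = {}"
| "written_arrays (Coin x) = {}"
| "written_arrays (Seq a b) = written_arrays a \<union> written_arrays b"
| "written_arrays (CIf e a b) = written_arrays a \<union> written_arrays b"
| "written_arrays (CWhile e a) = written_arrays a"

fun nocoin :: "cmd \<Rightarrow> bool" where
  "nocoin (Coin x) = False"
| "nocoin (Seq a b) = (nocoin a \<and> nocoin b)"
| "nocoin (CIf e a b) = (nocoin a \<and> nocoin b)"
| "nocoin (CWhile e a) = nocoin a"
| "nocoin _ = True"

text \<open>What a command leaves alone is read off its syntax once and for all, so that
  postconditions only have to mention what changes.\<close>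

definition frame :: "cmd \<Rightarrow> store \<Rightarrow> arrays \<Rightarrow> bool list \<Rightarrow> store \<Rightarrow> arrays \<Rightarrow> bool list \<Rightarrow> bool" where
  "frame c s A bs s' A' bs' \<longleftrightarrow> (\<forall>x. x \<notin> written_regs c \<longrightarrow> s' x = s x) \<and> (\<forall>j. j \<notin> written_arrays c \<longrightarrow> A' j = A j) \<and> (nocoin c \<longrightarrow> bs' = bs)"

lemma frame_refl: "frame c s A bs s A bs" by (simp add: frame_def)

lemma big_frame':
  "big U xs c \<sigma> \<sigma>' \<Longrightarrow> frame c (fst \<sigma>) (fst (snd \<sigma>)) (fst (snd (snd \<sigma>))) (fst \<sigma>') (fst (snd \<sigma>')) (fst (snd (snd \<sigma>')))"
  by (induction rule: big.induct) (auto simp: frame_def)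

lemma big_frame: "big U xs c (s, A, bs, t) (s', A', bs', t') \<Longrightarrow> frame c s A bs s' A' bs'"
  using big_frame'[of U xs c "(s, A, bs, t)" "(s', A', bs', t')"] by simp

notation Seq (infixr ";;" 60) and Asg (infix "::=" 61)
notation V ("\<acute>_" [1000] 1000) and N ("#_" [1000] 1000)

abbreviation e_plus (infixl "[+]" 65) where "a [+] b \<equiv> Bin Plus a b"
abbreviation e_minus (infixl "[-]" 65) where "a [-] b \<equiv> Bin Minus a b"
abbreviation e_times (infixl "[*]" 70) where "a [*] b \<equiv> Bin Times a b"
abbreviation e_div (infixl "[div]" 70) where "a [div] b \<equiv> Bin Div a b"
abbreviation e_mod (infixl "[mod]" 70) where "a [mod] b \<equiv> Bin Mod a b"

text \<open>Truncated subtraction tests \<open>x < e\<close>. The bound is evaluated anew in every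
  round, hence the premise of \<open>wp_For\<close> that its value remains \<open>n\<close>.\<close>

definition For :: "reg \<Rightarrow> exp \<Rightarrow> cmd \<Rightarrow> cmd" where
  "For x e c = (x ::= #0 ;; CWhile (e [-] \<acute>x) (c ;; x ::= \<acute>x [+] #1))"

lemma For_simps [simp]:
  "written_regs (For x e c) = insert x (written_regs c)" "written_arrays (For x e c) = written_arrays c" "nocoin (For x e c) = nocoin c"
  by (auto simp: For_def)

locale hl =
  fixes U :: nat and xs :: "nat list"
begin

definition wp :: "cmd \<Rightarrow> assn \<Rightarrow> assn" where
  "wp c Q s A bs t \<longleftrightarrow> (\<exists>s' A' bs' t'. big U xs c (s, A, bs, t) (s', A', bs', t') \<and> Q s' A' bs' t')"

lemma wp_Asg [simp]: "wp (x ::= e) Q s A bs t \<longleftrightarrow> aval e s A < U \<and> Q (s(x := aval e s A)) A bs (t + 1)"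
  using big.Asg[of e s A U xs x bs t] unfolding wp_def by (auto elim: big.cases)

lemma wp_Sto [simp]: "wp (Sto j a b) Q s A bs t \<longleftrightarrow>
    aval b s A < U \<and> Q s (A(j := (A j)(aval a s A := aval b s A))) bs (t + 1)"
  using big.Sto[of b s A U xs j a bs t] unfolding wp_def by (auto elim: big.cases)

lemma wp_Inp [simp]: "wp (Inp x e) Q s A bs t \<longleftrightarrow>
    aval e s A < length xs \<and> Q (s(x := xs ! aval e s A)) A bs (t + 1)"
  using big.Inp[of e s A xs U x bs t] unfolding wp_def by (auto elim: big.cases)

lemma wp_Coin [simp]: "wp (Coin x) Q s A (b # bs) t \<longleftrightarrow> Q (s(x := of_bool b)) A bs (t + 1)"
proof
  assume "wp (Coin x) Q s A (b # bs) t"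
  then obtain s' A' bs' t' where b: "big U xs (Coin x) (s, A, b # bs, t) (s', A', bs', t')" "Q s' A' bs' t'"
    unfolding wp_def by blast
  from b(1) show "Q (s(x := of_bool b)) A bs (t + 1)" by cases (use b(2) in simp)
next
  assume "Q (s(x := of_bool b)) A bs (t + 1)"
  then show "wp (Coin x) Q s A (b # bs) t" unfolding wp_def using big.Coin by blast
qed

lemma wp_Seq [simp]: "wp (c1 ;; c2) Q s A bs t \<longleftrightarrow> wp c1 (wp c2 Q) s A bs t"
proof
  assume "wp (c1 ;; c2) Q s A bs t"
  then obtain s' A' bs' t' \<sigma> where a: "big U xs c1 (s, A, bs, t) \<sigma>" "big U xs c2 \<sigma> (s', A', bs', t')" "Q s' A' bs' t'"
    unfolding wp_def by (auto elim: big.cases)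
  obtain s1 A1 bs1 t1 where "\<sigma> = (s1, A1, bs1, t1)" by (cases \<sigma>) auto
  then show "wp c1 (wp c2 Q) s A bs t" using a unfolding wp_def by blast
next
  assume "wp c1 (wp c2 Q) s A bs t"
  then show "wp (c1 ;; c2) Q s A bs t" unfolding wp_def by (blast intro: big.Seq)
qed

lemma wp_If [simp]: "wp (CIf e a b) Q s A bs t \<longleftrightarrow>
    (if aval e s A \<noteq> 0 then wp a Q s A bs (t + 1) else wp b Q s A bs (t + 1))"
proof (cases "aval e s A = 0")
  case True
  have "big U xs (CIf e a b) (s, A, bs, t) \<sigma> \<longleftrightarrow> big U xs b (s, A, bs, t + 1) \<sigma>" for \<sigma>
    using True by (auto intro: big.IfF elim: big.cases)
  then show ?thesis using True by (simp add: wp_def)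
next
  case False
  have "big U xs (CIf e a b) (s, A, bs, t) \<sigma> \<longleftrightarrow> big U xs a (s, A, bs, t + 1) \<sigma>" for \<sigma>
    using False by (auto intro: big.IfT elim: big.cases)
  then show ?thesis using False by (simp add: wp_def)
qed

lemma wp_frame:
  assumes "wp c Q s A bs t"
    "\<And>s' A' bs' t'. Q s' A' bs' t' \<Longrightarrow> frame c s A bs s' A' bs' \<Longrightarrow> R s' A' bs' t'"
  shows "wp c R s A bs t"
  using assms big_frame unfolding wp_def by blast

lemma wp_mono: "wp c Q s A bs t \<Longrightarrow> (\<And>s' A' bs' t'. Q s' A' bs' t' \<Longrightarrow> R s' A' bs' t') \<Longrightarrow> wp c R s A bs t"
  unfolding wp_def by blast

lemma wp_SeqI:
  assumes "wp c1 Q s A bs t"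
    "\<And>s' A' bs' t'. Q s' A' bs' t' \<Longrightarrow> frame c1 s A bs s' A' bs' \<Longrightarrow> wp c2 R s' A' bs' t'"
  shows "wp (c1 ;; c2) R s A bs t"
  using wp_frame[OF assms] by simp

lemma wp_While_unfold:
  assumes "aval e s A \<noteq> 0 \<Longrightarrow> wp c (wp (CWhile e c) Q) s A bs (t + 1)" "aval e s A = 0 \<Longrightarrow> Q s A bs (t + 1)"
  shows "wp (CWhile e c) Q s A bs t"
proof (cases "aval e s A = 0")
  case True
  then show ?thesis using assms(2) unfolding wp_def by (blast intro: big.WhF)
next
  case False
  then show ?thesis using assms(1) unfolding wp_def by (blast intro: big.WhT)
qed

lemma frame_trans: "frame c s A bs s1 A1 bs1 \<Longrightarrow> frame c s1 A1 bs1 s2 A2 bs2 \<Longrightarrow> frame c s A bs s2 A2 bs2"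
  by (auto simp: frame_def)

text \<open>The number \<open>n\<close> of rounds is given in advance, so termination is part of the
  conclusion, and the clock can be bounded in the invariant.\<close>

lemma wp_While:
  assumes "I 0 s A bs t"
    "\<And>i s' A' bs' t'. i < n \<Longrightarrow> I i s' A' bs' t' \<Longrightarrow> frame c s A bs s' A' bs' \<Longrightarrow>
      aval e s' A' \<noteq> 0 \<and> wp c (I (Suc i)) s' A' bs' (t' + 1)"
    "\<And>s' A' bs' t'. I n s' A' bs' t' \<Longrightarrow> frame c s A bs s' A' bs' \<Longrightarrow> aval e s' A' = 0 \<and> Q s' A' bs' (t' + 1)"
  shows "wp (CWhile e c) Q s A bs t"
proof -
  have "i \<le> n \<Longrightarrow> I i s' A' bs' t' \<Longrightarrow> frame c s A bs s' A' bs' \<Longrightarrow> wp (CWhile e c) Q s' A' bs' t'" for i s' A' bs' t'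
  proof (induction "n - i" arbitrary: i s' A' bs' t')
    case 0
    then have "i = n" by simp
    then show ?case using assms(3) 0 by (intro wp_While_unfold) auto
  next
    case (Suc m)
    then have i: "i < n" by simp
    have step: "aval e s' A' \<noteq> 0" "wp c (I (Suc i)) s' A' bs' (t' + 1)" using assms(2)[OF i Suc(4,5)] by auto
    show ?case
    proof (rule wp_While_unfold)
      show "wp c (wp (CWhile e c) Q) s' A' bs' (t' + 1)"
        using step(2)
      proof (rule wp_frame)
        fix s2 A2 bs2 t2 assume "I (Suc i) s2 A2 bs2 t2" "frame c s' A' bs' s2 A2 bs2"
        moreover have "m = n - Suc i" using Suc(2) by simp
        ultimately show "wp (CWhile e c) Q s2 A2 bs2 t2"
          using Suc(1)[of "Suc i"] i frame_trans[OF Suc(5)] by auto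
      qed
    qed (use step in simp)
  qed
  from this[of 0] show ?thesis using assms(1) frame_refl by simp
qed

lemma wp_For:
  assumes "n < U" "x \<notin> written_regs c"
    "I 0 (s(x := 0)) A bs (t + 1)"
    "\<And>s' A' bs'. frame (For x e c) s A bs s' A' bs' \<Longrightarrow> aval e s' A' = n"
    "\<And>i s' A' bs' t'. i < n \<Longrightarrow> s' x = i \<Longrightarrow> I i s' A' bs' t' \<Longrightarrow> frame (For x e c) s A bs s' A' bs' \<Longrightarrow>
      wp c (\<lambda>s2 A2 bs2 t2. I (Suc i) (s2(x := Suc i)) A2 bs2 (t2 + 1)) s' A' bs' (t' + 1)"
    "\<And>s' A' bs' t'. s' x = n \<Longrightarrow> I n s' A' bs' t' \<Longrightarrow> frame (For x e c) s A bs s' A' bs' \<Longrightarrow> Q s' A' bs' (t' + 1)"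
  shows "wp (For x e c) Q s A bs t"
proof -
  have fr: "frame (c ;; x ::= \<acute>x [+] #1) (s(x := 0)) A bs s' A' bs' \<Longrightarrow> frame (For x e c) s A bs s' A' bs'" for s' A' bs'
    by (auto simp: frame_def)
  have "wp (CWhile (e [-] \<acute>x) (c ;; x ::= \<acute>x [+] #1)) Q (s(x := 0)) A bs (t + 1)"
  proof (rule wp_While[where I = "\<lambda>i s' A' bs' t'. s' x = i \<and> I i s' A' bs' t'" and n = n])
    fix i s' A' bs' t'
    assume i: "i < n" and I: "s' x = i \<and> I i s' A' bs' t'" and f: "frame (c ;; x ::= \<acute>x [+] #1) (s(x := 0)) A bs s' A' bs'"
    have "aval e s' A' = n" using assms(4)[OF fr[OF f]] .
    moreover have "wp c (wp (x ::= \<acute>x [+] #1) (\<lambda>s' A' bs' t'. s' x = Suc i \<and> I (Suc i) s' A' bs' t')) s' A' bs' (t' + 1)"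
    proof (rule wp_frame)
      show "wp c (\<lambda>s2 A2 bs2 t2. I (Suc i) (s2(x := Suc i)) A2 bs2 (t2 + 1)) s' A' bs' (t' + 1)"
        using assms(5)[OF i _ _ fr[OF f]] I by blast
      fix s2 A2 bs2 t2
      assume "I (Suc i) (s2(x := Suc i)) A2 bs2 (t2 + 1)" "frame c s' A' bs' s2 A2 bs2"
      moreover have "s2 x = i" using \<open>frame c s' A' bs' s2 A2 bs2\<close> assms(2) I by (simp add: frame_def)
      ultimately show "wp (x ::= \<acute>x [+] #1) (\<lambda>s' A' bs' t'. s' x = Suc i \<and> I (Suc i) s' A' bs' t') s2 A2 bs2 t2"
        using i assms(1) by simp
    qed
    ultimately show "aval (e [-] \<acute>x) s' A' \<noteq> 0 \<and> wp (c ;; x ::= \<acute>x [+] #1)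
        (\<lambda>s' A' bs' t'. s' x = Suc i \<and> I (Suc i) s' A' bs' t') s' A' bs' (t' + 1)"
      using I i by (simp only: wp_Seq) simp
  next
    fix s' A' bs' t'
    assume I: "s' x = n \<and> I n s' A' bs' t'" and f: "frame (c ;; x ::= \<acute>x [+] #1) (s(x := 0)) A bs s' A' bs'"
    show "aval (e [-] \<acute>x) s' A' = 0 \<and> Q s' A' bs' (t' + 1)"
      using assms(4)[OF fr[OF f]] assms(6)[OF _ _ fr[OF f]] I by simp
  qed (use assms(3) in simp)
  then show ?thesis using assms(1) by (simp add: For_def)
qed

end

text \<open>Links a reduced machine number to an integer of the mathematical development; reduction
  modulo \<open>p\<close> is visible only in the program.\<close>

definition rz :: "nat \<Rightarrow> nat \<Rightarrow> int \<Rightarrow> bool" where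
  "rz p v a \<longleftrightarrow> v < p \<and> [int v = a] (mod int p)"

lemma rz_add: "rz p x a \<Longrightarrow> rz p y b \<Longrightarrow> rz p ((x + y) mod p) (a + b)"
  unfolding rz_def by (auto simp: cong_def zmod_int mod_add_eq intro: mod_add_cong)

lemma rz_mult: "rz p x a \<Longrightarrow> rz p y b \<Longrightarrow> rz p ((x * y) mod p) (a * b)"
  unfolding rz_def by (auto simp: cong_def zmod_int intro: mod_mult_cong)

lemma rz_sub: "rz p x a \<Longrightarrow> rz p y b \<Longrightarrow> rz p ((x + (p - y)) mod p) (a - b)"
  unfolding rz_def
proof (intro conjI)
  assume a: "x < p \<and> [int x = a] (mod int p)" "y < p \<and> [int y = b] (mod int p)"
  then show "(x + (p - y)) mod p < p" by simp
  have "int (x + (p - y)) = int x - int y + int p" using a by (simp add: of_nat_diff)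
  then have "int ((x + (p - y)) mod p) = (int x - int y + int p) mod int p" by (simp only: zmod_int)
  also have "\<dots> = (int x - int y) mod int p" by (rule mod_add_self2)
  finally show "[int ((x + (p - y)) mod p) = a - b] (mod int p)"
    using a cong_diff[of "int x" a "int p" "int y" b] by (simp add: cong_def)
qed

lemma rz_zero: "0 < p \<Longrightarrow> rz p 0 0" by (simp add: rz_def)

subsection \<open>Passes of the convolution\<close>

abbreviation (input) rP :: reg where "rP \<equiv> 10"
abbreviation (input) rInv2 :: reg where "rInv2 \<equiv> 11"
abbreviation (input) rS1 :: reg where "rS1 \<equiv> 20"
abbreviation (input) rTot :: reg where "rTot \<equiv> 21"
abbreviation (input) rLev :: reg where "rLev \<equiv> 22"
abbreviation (input) rSc :: reg where "rSc \<equiv> 23"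
abbreviation (input) rMm :: reg where "rMm \<equiv> 24"
abbreviation (input) rM :: reg where "rM \<equiv> 25"
abbreviation (input) rB :: reg where "rB \<equiv> 26"
abbreviation (input) rNn :: reg where "rNn \<equiv> 27"
abbreviation (input) rNb :: reg where "rNb \<equiv> 28"
abbreviation (input) rH :: reg where "rH \<equiv> 29"
abbreviation (input) rI :: reg where "rI \<equiv> 30"
abbreviation (input) rJ :: reg where "rJ \<equiv> 31"
abbreviation (input) rV :: reg where "rV \<equiv> 32"
abbreviation (input) rL :: reg where "rL \<equiv> 46"

abbreviation (input) aS :: nat where "aS \<equiv> 0"
abbreviation (input) aT :: nat where "aT \<equiv> 1"
abbreviation (input) aLv :: nat where "aLv \<equiv> 2"
abbreviation (input) aPw :: nat where "aPw \<equiv> 3"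

text \<open>The bodies follow \<open>pSplit\<close>, \<open>pFwd\<close>, \<open>pInv\<close>,
  \<open>pDec\<close> and \<open>pBase\<close> term by term; they take the index from
  \<open>rJ\<close> and leave the result in \<open>rV\<close>.\<close>

definition bSplit :: cmd where
  "bSplit = (33 ::= \<acute>rJ [mod] \<acute>rB ;; 34 ::= \<acute>rJ [div] \<acute>rB ;; 35 ::= \<acute>34 [div] (#2 [*] \<acute>rM) ;;
     36 ::= \<acute>34 [mod] (#2 [*] \<acute>rM) ;;
     CIf (\<acute>rM [-] \<acute>36) (rV ::= Ld aS (\<acute>35 [*] \<acute>rNn [+] \<acute>36 [+] \<acute>rM [*] \<acute>33)) (rV ::= #0))"

definition bFwd :: cmd where
  "bFwd = (33 ::= \<acute>rJ [mod] \<acute>rB ;; 34 ::= \<acute>rJ [div] \<acute>rB ;; 35 ::= \<acute>34 [div] (#2 [*] \<acute>rM) ;;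
     36 ::= \<acute>34 [mod] (#2 [*] \<acute>rM) ;; 37 ::= \<acute>36 [div] \<acute>rH ;; 38 ::= \<acute>36 [mod] \<acute>rH ;;
     39 ::= \<acute>37 [mod] \<acute>rNb ;; 40 ::= \<acute>37 [div] \<acute>rNb ;;
     41 ::= \<acute>35 [*] (#2 [*] \<acute>rM) [+] \<acute>39 [*] (#2 [*] \<acute>rH) [+] \<acute>38 ;;
     42 ::= \<acute>33 [+] \<acute>rB [-] (\<acute>rB [*] \<acute>39) [div] \<acute>rNb ;;
     43 ::= Ld aS (\<acute>41 [*] \<acute>rB [+] \<acute>33) ;;
     44 ::= Ld aS ((\<acute>41 [+] \<acute>rH) [*] \<acute>rB [+] \<acute>42 [mod] \<acute>rB) ;;
     CIf ((\<acute>42 [div] \<acute>rB [+] \<acute>40) [mod] #2) (rV ::= (\<acute>43 [+] \<acute>44) [mod] \<acute>rP)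
       (rV ::= (\<acute>43 [+] (\<acute>rP [-] \<acute>44)) [mod] \<acute>rP))"

definition bInv :: cmd where
  "bInv = (33 ::= \<acute>rJ [mod] \<acute>rB ;; 34 ::= \<acute>rJ [div] \<acute>rB ;; 35 ::= \<acute>34 [div] (#2 [*] \<acute>rM) ;;
     36 ::= \<acute>34 [mod] (#2 [*] \<acute>rM) ;; 37 ::= \<acute>36 [div] (#2 [*] \<acute>rH) ;; 38 ::= \<acute>36 [mod] (#2 [*] \<acute>rH) ;;
     39 ::= \<acute>38 [div] \<acute>rH ;; 40 ::= \<acute>38 [mod] \<acute>rH ;;
     41 ::= \<acute>35 [*] (#2 [*] \<acute>rM) [+] \<acute>37 [*] \<acute>rH [+] \<acute>40 ;; 42 ::= \<acute>41 [+] \<acute>rNb [*] \<acute>rH ;;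
     43 ::= \<acute>33 [+] (\<acute>rB [*] \<acute>37) [div] \<acute>rNb ;;
     CIf \<acute>39
       (44 ::= Ld aS (\<acute>41 [*] \<acute>rB [+] \<acute>43 [mod] \<acute>rB) ;; 45 ::= Ld aS (\<acute>42 [*] \<acute>rB [+] \<acute>43 [mod] \<acute>rB) ;;
        CIf (\<acute>43 [div] \<acute>rB) (rV ::= (\<acute>45 [+] (\<acute>rP [-] \<acute>44)) [mod] \<acute>rP) (rV ::= (\<acute>44 [+] (\<acute>rP [-] \<acute>45)) [mod] \<acute>rP))
       (rV ::= (Ld aS (\<acute>41 [*] \<acute>rB [+] \<acute>33) [+] Ld aS (\<acute>42 [*] \<acute>rB [+] \<acute>33)) [mod] \<acute>rP))"

definition bDec :: cmd where
  "bDec = (33 ::= \<acute>rJ [mod] \<acute>rNn ;; 34 ::= \<acute>rJ [div] \<acute>rNn ;; 35 ::= \<acute>33 [mod] \<acute>rM ;; 36 ::= \<acute>33 [div] \<acute>rM ;;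
     37 ::= \<acute>34 [*] (#2 [*] \<acute>rM) [+] \<acute>35 ;; 38 ::= Ld aS (\<acute>37 [*] \<acute>rB [+] \<acute>36) ;;
     CIf \<acute>36 (rV ::= (\<acute>38 [+] Ld aS ((\<acute>37 [+] \<acute>rM) [*] \<acute>rB [+] (\<acute>36 [-] #1))) [mod] \<acute>rP)
       (rV ::= (\<acute>38 [+] (\<acute>rP [-] Ld aS ((\<acute>37 [+] \<acute>rM) [*] \<acute>rB [+] (\<acute>rB [-] #1)))) [mod] \<acute>rP))"

definition bBase :: cmd where
  "bBase = (33 ::= \<acute>rJ [-] \<acute>rJ [mod] #2 ;;
     CIf (\<acute>rJ [mod] #2)
       (rV ::= (Ld aS \<acute>33 [*] Ld aS (\<acute>33 [+] #1 [+] \<acute>rTot) [+] Ld aS (\<acute>33 [+] #1) [*] Ld aS (\<acute>33 [+] \<acute>rTot)) [mod] \<acute>rP)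
       (34 ::= (Ld aS \<acute>33 [*] Ld aS (\<acute>33 [+] \<acute>rTot)) [mod] \<acute>rP ;;
        35 ::= (Ld aS (\<acute>33 [+] #1) [*] Ld aS (\<acute>33 [+] #1 [+] \<acute>rTot)) [mod] \<acute>rP ;;
        rV ::= (\<acute>34 [+] (\<acute>rP [-] \<acute>35)) [mod] \<acute>rP))"

text \<open>A second array receives the results, because old entries are still read after their
  positions have been computed.\<close>

definition pass :: "cmd \<Rightarrow> cmd" where
  "pass b = (For rJ \<acute>rTot (b ;; Sto aT \<acute>rJ \<acute>rV) ;; For rJ \<acute>rTot (Sto aS \<acute>rJ (Ld aT \<acute>rJ)))"

definition rs :: "nat \<Rightarrow> nat \<Rightarrow> (nat \<Rightarrow> int) \<Rightarrow> (nat \<Rightarrow> nat) \<Rightarrow> bool" where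
  "rs p n X f \<longleftrightarrow> (\<forall>j<n. rz p (f j) (X j))"

lemma rsD: "rs p n X f \<Longrightarrow> j < n \<Longrightarrow> rz p (f j) (X j)" by (simp add: rs_def)

lemma rz_less: "rz p v a \<Longrightarrow> v < p" by (simp add: rz_def)

lemma mod_less_bound: "(x::nat) < U \<Longrightarrow> x mod y < U" using mod_less_eq_dividend le_less_trans by blast
lemma mod_less_bound': "0 < p \<Longrightarrow> p < U \<Longrightarrow> (x::nat) mod p < U" using mod_less_divisor less_trans by blast
lemma div_less_bound: "(x::nat) < U \<Longrightarrow> x div y < U" using div_le_dividend le_less_trans by blast

context hl begin

lemma wp_pass:
  assumes T: "s rTot = T" "T < U"
    and wrb: "written_regs b \<subseteq> {32..45}" "written_arrays b = {}" "nocoin b"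
    and body: "\<And>j s' A' t'. j < T \<Longrightarrow> s' rJ = j \<Longrightarrow> (\<And>y. y \<notin> {31..45} \<Longrightarrow> s' y = s y) \<Longrightarrow> A' aS = A aS \<Longrightarrow>
      wp b (\<lambda>s2 A2 bs2 t2. t2 \<le> t' + c \<and> P j (s2 rV) \<and> s2 rV < U) s' A' bs t'"
  shows "wp (pass b) (\<lambda>s' A' bs' t'. (\<forall>j<T. P j (A' aS j)) \<and> t' \<le> t + T * (c + 8) + 10) s A bs t"
  unfolding pass_def
proof (rule wp_SeqI)
  let ?b = "b ;; Sto aT \<acute>rJ \<acute>rV"
  have rJb: "rJ \<notin> written_regs b" using wrb(1) by auto
  show "wp (For rJ \<acute>rTot ?b) (\<lambda>s' A' bs' t'. (\<forall>j<T. P j (A' aT j) \<and> A' aT j < U) \<and> t' \<le> t + T * (c + 4) + 4) s A bs t"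
  proof (rule wp_For[where n = T and I = "\<lambda>i s' A' bs' t'. (\<forall>j<i. P j (A' aT j) \<and> A' aT j < U) \<and> t' \<le> t + i * (c + 4) + 1"])
    show "rJ \<notin> written_regs ?b" using rJb by simp
    fix s' A' bs' assume "frame (For rJ \<acute>rTot ?b) s A bs s' A' bs'"
    moreover have "rTot \<notin> written_regs b" using wrb(1) by auto
    ultimately show "aval \<acute>rTot s' A' = T" using T by (simp add: frame_def)
  next
    fix i s' A' bs' t'
    assume i: "i < T" and s: "s' rJ = i" and I: "(\<forall>j<i. P j (A' aT j) \<and> A' aT j < U) \<and> t' \<le> t + i * (c + 4) + 1"
      and f: "frame (For rJ \<acute>rTot ?b) s A bs s' A' bs'"
    have "s' y = s y" if "y \<notin> {31..45}" for y
    proof -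
      have "y \<notin> written_regs b" "y \<noteq> rJ" using that wrb(1) by auto
      then show ?thesis using f by (simp add: frame_def)
    qed
    moreover have "A' aS = A aS" "bs' = bs" using f wrb by (auto simp: frame_def)
    ultimately have w: "wp b (\<lambda>s2 A2 bs2 t2. t2 \<le> t' + 1 + c \<and> P i (s2 rV) \<and> s2 rV < U) s' A' bs' (t' + 1)"
      using body[of i s' A' "t' + 1"] i s by blast
    show "wp ?b (\<lambda>s2 A2 bs2 t2. (\<forall>j<Suc i. P j (A2 aT j) \<and> A2 aT j < U) \<and> t2 + 1 \<le> t + Suc i * (c + 4) + 1) s' A' bs' (t' + 1)"
      by (rule wp_SeqI[OF w], use rJb s I wrb(2) in \<open>auto simp: frame_def less_Suc_eq\<close>)
  qed (use T in auto)
next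
  fix s1 A1 bs1 t1
  assume P1: "(\<forall>j<T. P j (A1 aT j) \<and> A1 aT j < U) \<and> t1 \<le> t + T * (c + 4) + 4"
    and f: "frame (For rJ \<acute>rTot (b ;; Sto aT \<acute>rJ \<acute>rV)) s A bs s1 A1 bs1"
  have "rTot \<notin> written_regs b" using wrb(1) by auto
  then have T1: "s1 rTot = T" using f T by (simp add: frame_def)
  show "wp (For rJ \<acute>rTot (Sto aS \<acute>rJ (Ld aT \<acute>rJ))) (\<lambda>s' A' bs' t'. (\<forall>j<T. P j (A' aS j)) \<and> t' \<le> t + T * (c + 8) + 10) s1 A1 bs1 t1"
  proof (rule wp_For[where n = T and I = "\<lambda>i s' A' bs' t'. (\<forall>j<i. P j (A' aS j)) \<and> t' \<le> t1 + i * 4 + 1"])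
    fix i s' A' bs' t'
    assume i: "i < T" and s: "s' rJ = i" and I: "(\<forall>j<i. P j (A' aS j)) \<and> t' \<le> t1 + i * 4 + 1"
      and f: "frame (For rJ \<acute>rTot (Sto aS \<acute>rJ (Ld aT \<acute>rJ))) s1 A1 bs1 s' A' bs'"
    have "A' aT = A1 aT" using f by (simp add: frame_def)
    then show "wp (Sto aS \<acute>rJ (Ld aT \<acute>rJ)) (\<lambda>s2 A2 bs2 t2. (\<forall>j<Suc i. P j (A2 aS j)) \<and> t2 + 1 \<le> t1 + Suc i * 4 + 1) s' A' bs' (t' + 1)"
      using s I P1 i by (auto simp: less_Suc_eq)
  qed (use T T1 P1 in \<open>auto simp: frame_def algebra_simps\<close>)
qed

lemma wp_bSplit:
  assumes X: "rs p (K * (M * B)) X (A aS)" and j: "j < K * (2 * M) * B"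
    and r: "s rJ = j" "s rB = B" "s rM = M" "s rNn = M * B" and U: "j < U" "p < U" "0 < p"
  shows "wp bSplit (\<lambda>s2 A2 bs2 t2. t2 \<le> t + 20 \<and> rz p (s2 rV) (pSplit M B X j) \<and> s2 rV < U) s A bs t"
proof -
  define l q \<kappa> pos where "l = j mod B" and "q = j div B" and "\<kappa> = q div (2 * M)" and "pos = q mod (2 * M)"
  note folds = l_def[symmetric] q_def[symmetric] \<kappa>_def[symmetric] pos_def[symmetric]
  have B: "0 < B" "0 < M" using j by (auto intro: gr0I)
  have "q < K * (2 * M)" unfolding q_def using j B by (simp add: div_less_iff_less_mult)
  then have k: "\<kappa> < K" unfolding \<kappa>_def using B by (simp add: div_less_iff_less_mult)
  have l: "l < B" unfolding l_def using B by simp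
  have lt: "l < U" "q < U" "\<kappa> < U" "pos < U"
    unfolding l_def q_def \<kappa>_def pos_def using U by (auto intro!: mod_less_bound div_less_bound)
  have v: "rz p (A aS (\<kappa> * (M * B) + pos + M * l)) (pSplit M B X j)" if "pos < M"
  proof -
    have "l * M + pos < B * M" using blk_less[OF l that] .
    then have "\<kappa> * (M * B) + (pos + M * l) < K * (M * B)" using blk_less[OF k, of "pos + M * l" "M * B"] by (simp add: mult.commute add.commute)
    then have "rz p (A aS (\<kappa> * (M * B) + pos + M * l)) (X (\<kappa> * (M * B) + pos + M * l))" using X by (simp add: rs_def add.assoc)
    then show ?thesis using that unfolding pSplit_def Let_def folds by simp
  qed
  have z: "rz p 0 (pSplit M B X j)" if "\<not> pos < M"
    using that U unfolding pSplit_def Let_def folds by (simp add: rz_zero)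
  show ?thesis unfolding bSplit_def
    using lt v z U v[THEN rz_less] less_trans[of _ p U] by (auto simp: r folds not_less)
qed

lemma wp_bFwd:
  assumes X: "rs p T X (A aS)" and j: "j < T" and T: "T = K * (2 * M) * B" and nb: "nb * h = M" "0 < nb"
    and r: "s rJ = j" "s rB = B" "s rM = M" "s rNb = nb" "s rH = h" "s rP = p" and U: "2 * T < U" "p < U"
  shows "wp bFwd (\<lambda>s2 A2 bs2 t2. t2 \<le> t + 20 \<and> rz p (s2 rV) (pFwd M B nb h X j) \<and> s2 rV < U) s A bs t"
proof -
  define l q \<kappa> pos where "l = j mod B" and "q = j div B" and "\<kappa> = q div (2 * M)" and "pos = q mod (2 * M)"
  define \<beta>' rr \<beta> e where "\<beta>' = pos div h" and "rr = pos mod h" and "\<beta> = \<beta>' mod nb" and "e = \<beta>' div nb"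
  define o' where "o' = \<kappa> * (2 * M) + \<beta> * (2 * h) + rr"
  define l' where "l' = l + B - B * \<beta> div nb"
  note folds = l_def[symmetric] q_def[symmetric] \<kappa>_def[symmetric] pos_def[symmetric] \<beta>'_def[symmetric]
    rr_def[symmetric] \<beta>_def[symmetric] e_def[symmetric] o'_def[symmetric] l'_def[symmetric]
  have B: "0 < B" "0 < M" using j T by (auto intro: gr0I)
  have h: "0 < h" using B nb by (auto intro: gr0I)
  have "q < K * (2 * M)" unfolding q_def using j T B by (simp add: div_less_iff_less_mult)
  then have k: "\<kappa> < K" unfolding \<kappa>_def using B by (simp add: div_less_iff_less_mult)
  have l: "l < B" unfolding l_def using B by simp
  have b: "\<beta> < nb" unfolding \<beta>_def using nb by simp
  have rr: "rr < h" unfolding rr_def using h by simp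
  have "\<beta> * (2 * h) + (rr + h) < nb * (2 * h)" using rr by (intro blk_less[OF b]) simp
  then have "\<kappa> * (2 * M) + (\<beta> * (2 * h) + (rr + h)) < K * (2 * M)" using nb by (intro blk_less[OF k]) (simp add: mult.left_commute)
  then have o: "o' + h < K * (2 * M)" by (simp add: o'_def)
  have ad: "(o' + h) * B + x < T" if "x < B" for x unfolding T using blk_less[OF o that] .
  have ad': "o' * B + x < T" if "x < B" for x using ad[OF that] by (simp add: distrib_right)
  have jU: "j < U" using j U by simp
  have lt: "l < U" "q < U" "\<kappa> < U" "pos < U" "\<beta>' < U" "rr < U" "\<beta> < U" "e < U"
    unfolding l_def q_def \<kappa>_def pos_def \<beta>'_def rr_def \<beta>_def e_def using jU by (auto intro!: mod_less_bound div_less_bound)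
  have "o' * 1 \<le> o' * B" using B by (intro mult_le_mono2) simp
  then have oU: "o' < U" using ad'[OF l] U by linarith
  have "1 * B \<le> K * (2 * M) * B" using k B by (intro mult_right_mono) auto
  then have "B \<le> T" using T by simp
  then have l'U: "l' < U" using l U unfolding l'_def by linarith
  have v: "rz p (A aS (o' * B + l)) (X (o' * B + l))"
    "rz p (A aS ((o' + h) * B + l' mod B)) (X ((o' + h) * B + l' mod B))"
    using X ad'[OF l] ad[of "l' mod B"] B by (auto simp: rs_def)
  have F: "pFwd M B nb h X j = (if (l' div B + e) mod 2 = 1 then X (o' * B + l) + X ((o' + h) * B + l' mod B)
     else X (o' * B + l) - X ((o' + h) * B + l' mod B))"
    unfolding pFwd_def Let_def folds ..
  show ?thesis unfolding bFwd_def F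
    using lt oU l'U v[THEN rz_less] U rz_add[OF v] rz_sub[OF v]
    by (simp add: r folds mod_less_bound) (auto simp: rz_def mod_less_bound')
qed

lemma wp_bInv:
  assumes X: "rs p T X (A aS)" and j: "j < T" and T: "T = K * (2 * M) * B" and nb: "nb * h = M" "0 < nb"
    and r: "s rJ = j" "s rB = B" "s rM = M" "s rNb = nb" "s rH = h" "s rP = p" and U: "2 * T < U" "p < U"
  shows "wp bInv (\<lambda>s2 A2 bs2 t2. t2 \<le> t + 20 \<and> rz p (s2 rV) (pInv M B nb h X j) \<and> s2 rV < U) s A bs t"
proof -
  define l q \<kappa> pos where "l = j mod B" and "q = j div B" and "\<kappa> = q div (2 * M)" and "pos = q mod (2 * M)"
  define \<beta> rr e ra where "\<beta> = pos div (2 * h)" and "rr = pos mod (2 * h)" and "e = rr div h" and "ra = rr mod h"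
  define u v where "u = \<kappa> * (2 * M) + \<beta> * h + ra" and "v = u + nb * h"
  define l' where "l' = l + B * \<beta> div nb"
  note folds = l_def[symmetric] q_def[symmetric] \<kappa>_def[symmetric] pos_def[symmetric] \<beta>_def[symmetric]
    rr_def[symmetric] e_def[symmetric] ra_def[symmetric] u_def[symmetric] v_def[symmetric] l'_def[symmetric]
  have B: "0 < B" "0 < M" using j T by (auto intro: gr0I)
  have h: "0 < h" using B nb by (auto intro: gr0I)
  have "q < K * (2 * M)" unfolding q_def using j T B by (simp add: div_less_iff_less_mult)
  then have k: "\<kappa> < K" unfolding \<kappa>_def using B by (simp add: div_less_iff_less_mult)
  have l: "l < B" unfolding l_def using B by simp
  have "pos < 2 * M" unfolding pos_def using B by simp
  then have "pos < nb * (2 * h)" using nb by (simp add: mult.left_commute)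
  then have b: "\<beta> < nb" unfolding \<beta>_def using h by (simp add: div_less_iff_less_mult)
  have ra: "ra < h" unfolding ra_def using h by simp
  have "\<beta> * h + ra < nb * h" using blk_less[OF b ra] .
  then have "\<beta> * h + ra + nb * h < 2 * M" using nb by linarith
  then have "\<kappa> * (2 * M) + (\<beta> * h + ra + nb * h) < K * (2 * M)" by (rule blk_less[OF k])
  then have o: "v < K * (2 * M)" by (simp add: u_def v_def)
  have ad: "v * B + x < T" if "x < B" for x unfolding T using blk_less[OF o that] .
  have ad': "u * B + x < T" if "x < B" for x using ad[OF that] by (simp add: v_def distrib_right)
  have jU: "j < U" using j U by simp
  have lt: "l < U" "q < U" "\<kappa> < U" "pos < U" "\<beta> < U" "rr < U" "e < U" "ra < U"
    unfolding l_def q_def \<kappa>_def pos_def \<beta>_def rr_def e_def ra_def using jU by (auto intro!: mod_less_bound div_less_bound)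
  have "u * 1 \<le> u * B" "v * 1 \<le> v * B" using B by (auto intro!: mult_le_mono2)
  then have oU: "u < U" "v < U" using ad'[OF l] ad[OF l] U by linarith+
  have "1 * B \<le> K * (2 * M) * B" using k B by (intro mult_right_mono) auto
  then have "B \<le> T" using T by simp
  moreover have "B * \<beta> div nb < B" using b B nb by (simp add: div_less_iff_less_mult)
  ultimately have l'U: "l' < U" using l U unfolding l'_def by linarith
  have w: "rz p (A aS (u * B + l)) (X (u * B + l))" "rz p (A aS (v * B + l)) (X (v * B + l))"
    "rz p (A aS (u * B + l' mod B)) (X (u * B + l' mod B))" "rz p (A aS (v * B + l' mod B)) (X (v * B + l' mod B))"
    using X ad'[OF l] ad[OF l] ad[of "l' mod B"] ad'[of "l' mod B"] B by (auto simp: rs_def)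
  have F: "pInv M B nb h X j = (if e = 0 then X (u * B + l) + X (v * B + l)
     else if l' div B = 0 then X (u * B + l' mod B) - X (v * B + l' mod B)
     else X (v * B + l' mod B) - X (u * B + l' mod B))"
    unfolding pInv_def Let_def folds ..
  show ?thesis unfolding bInv_def F
    using lt oU l'U w[THEN rz_less] U rz_add[OF w(1,2)] rz_sub[OF w(3,4)] rz_sub[OF w(4,3)]
    by (simp add: r folds mod_less_bound) (auto simp: rz_def mod_less_bound')
qed

lemma wp_bDec:
  assumes X: "rs p (2 * T) X (A aS)" and j: "j < T" and T: "T = K * (M * B)"
    and r: "s rJ = j" "s rB = B" "s rM = M" "s rNn = M * B" "s rP = p" and U: "2 * T < U" "p < U"
  shows "wp bDec (\<lambda>s2 A2 bs2 t2. t2 \<le> t + 20 \<and> rz p (s2 rV) (pDec M B X j) \<and> s2 rV < U) s A bs t"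
proof -
  define i \<kappa> i0 i1 where "i = j mod (M * B)" and "\<kappa> = j div (M * B)" and "i0 = i mod M" and "i1 = i div M"
  define o' where "o' = \<kappa> * (2 * M) + i0"
  note folds = i_def[symmetric] \<kappa>_def[symmetric] i0_def[symmetric] i1_def[symmetric] o'_def[symmetric]
  have B: "0 < B" "0 < M" using j T by (auto intro: gr0I)
  have k: "\<kappa> < K" unfolding \<kappa>_def using j T B by (simp add: div_less_iff_less_mult)
  have "i < M * B" unfolding i_def using B by simp
  then have i1: "i1 < B" unfolding i1_def using B by (simp add: div_less_iff_less_mult mult.commute)
  have i0: "i0 < M" unfolding i0_def using B by simp
  have "\<kappa> * (2 * M) + (i0 + M) < K * (2 * M)" using i0 by (intro blk_less[OF k]) simp
  then have o: "o' + M < K * (2 * M)" by (simp add: o'_def)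
  have T2: "2 * T = K * (2 * M) * B" using T by simp
  have ad: "(o' + M) * B + x < 2 * T" if "x < B" for x unfolding T2 using blk_less[OF o that] .
  have ad': "o' * B + x < 2 * T" if "x < B" for x using ad[OF that] by (simp add: distrib_right)
  have jU: "j < U" using j U by simp
  have lt: "i < U" "\<kappa> < U" "i0 < U" "i1 < U"
    unfolding i_def \<kappa>_def i0_def i1_def using jU by (auto intro!: mod_less_bound div_less_bound)
  have "o' * 1 \<le> o' * B" using B by (intro mult_le_mono2) simp
  then have oU: "o' < U" using ad'[OF i1] U by linarith
  have w: "rz p (A aS (o' * B + i1)) (X (o' * B + i1))" "rz p (A aS ((o' + M) * B + (i1 - 1))) (X ((o' + M) * B + (i1 - 1)))"
    "rz p (A aS ((o' + M) * B + (B - 1))) (X ((o' + M) * B + (B - 1)))"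
    using X ad'[OF i1] ad[of "i1 - 1"] ad[of "B - 1"] B i1 by (auto simp: rs_def)
  have F: "pDec M B X j = (if i1 = 0 then X (o' * B + i1) - X ((o' + M) * B + (B - 1))
     else X (o' * B + i1) + X ((o' + M) * B + (i1 - 1)))"
    unfolding pDec_def Let_def folds ..
  have lU: "A aS (o' * B + i1) < U" using rz_less[OF w(1)] U by simp
  note facts = lU lt oU w[THEN rz_less] U rz_add[OF w(1,2)] rz_sub[OF w(1,3)]
  show ?thesis
  proof (cases "i1 = 0")
    case True
    show ?thesis unfolding bDec_def F using facts True
      by (simp add: r folds mod_less_bound) (auto simp: rz_def mod_less_bound')
  next
    case False
    show ?thesis unfolding bDec_def F using facts False
      by (simp add: r folds mod_less_bound) (auto simp: rz_def mod_less_bound')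
  qed
qed

lemma wp_bBase:
  assumes X: "rs p (2 * T) X (A aS)" and j: "j < T" and T: "even T"
    and r: "s rJ = j" "s rTot = T" "s rP = p" and U: "2 * T < U" "p < U"
  shows "wp bBase (\<lambda>s2 A2 bs2 t2. t2 \<le> t + 20 \<and> rz p (s2 rV) (pBase T X j) \<and> s2 rV < U) s A bs t"
proof -
  define z where "z = j - j mod 2"
  have "z = 2 * (j div 2)" unfolding z_def by (rule minus_mod_eq_mult_div)
  moreover obtain a where "T = 2 * a" using T by (elim evenE)
  ultimately have z: "z + 1 < T" using j by presburger
  note fold = z_def[symmetric]
  have w: "rz p (A aS z) (X z)" "rz p (A aS (z + 1)) (X (z + 1))" "rz p (A aS (z + T)) (X (z + T))"
    "rz p (A aS (z + 1 + T)) (X (z + 1 + T))"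
    using X z by (auto simp: rs_def)
  have F: "pBase T X j = (if j mod 2 = 0 then X z * X (z + T) - X (z + 1) * X (z + 1 + T)
     else X z * X (z + 1 + T) + X (z + 1) * X (z + T))"
    unfolding pBase_def Let_def fold ..
  have p: "0 < p" using rz_less[OF w(1)] by simp
  have zU: "z < U" using z U by simp
  have a: "rz p ((A aS z * A aS (z + 1 + T) + A aS (z + 1) * A aS (z + T)) mod p) (X z * X (z + 1 + T) + X (z + 1) * X (z + T))"
    using rz_add[OF rz_mult[OF w(1,4)] rz_mult[OF w(2,3)]] by (simp add: mod_add_eq)
  note b = rz_sub[OF rz_mult[OF w(1,3)] rz_mult[OF w(2,4)]]
  show ?thesis
  proof (cases "j mod 2 = 0")
    case True
    then have "z = j" by (simp add: z_def)
    then show ?thesis unfolding bBase_def F using b zU p U True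
      by (simp add: r fold mod_less_bound')
  next
    case False
    then have "j = Suc z" unfolding z_def by presburger
    then show ?thesis unfolding bBase_def F using a zU p U False
      by (simp add: r fold mod_less_bound')
  qed
qed

end

subsection \<open>The convolution program\<close>

lemma bodies_frame [simp]:
  "written_regs bSplit = {33, 34, 35, 36, 32}" "written_arrays bSplit = {}" "nocoin bSplit"
  "written_regs bFwd = {33, 34, 35, 36, 37, 38, 39, 40, 41, 42, 43, 44, 32}" "written_arrays bFwd = {}" "nocoin bFwd"
  "written_regs bInv = {33, 34, 35, 36, 37, 38, 39, 40, 41, 42, 43, 44, 45, 32}" "written_arrays bInv = {}" "nocoin bInv"
  "written_regs bDec = {33, 34, 35, 36, 37, 38, 32}" "written_arrays bDec = {}" "nocoin bDec"
  "written_regs bBase = {33, 34, 35, 32}" "written_arrays bBase = {}" "nocoin bBase"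
  by (auto simp: bSplit_def bFwd_def bInv_def bDec_def bBase_def)

lemma pass_frame [simp]:
  "written_regs (pass b) = insert rJ (written_regs b)" "written_arrays (pass b) = {aS, aT} \<union> written_arrays b" "nocoin (pass b) = nocoin b"
  by (auto simp: pass_def)

definition lvl :: cmd where
  "lvl = (rMm ::= \<acute>rS1 [div] #2 ;; rM ::= Ld aPw \<acute>rMm ;; rB ::= Ld aPw (\<acute>rS1 [-] \<acute>rMm) ;; rNn ::= Ld aPw \<acute>rS1)"

definition fwdLoop :: cmd where
  "fwdLoop = For rI (\<acute>rMm [+] #1) (pass bFwd ;; rNb ::= #2 [*] \<acute>rNb ;; rH ::= \<acute>rH [div] #2)"

definition invLoop :: cmd where
  "invLoop = For rI (\<acute>rMm [+] #1) (pass bInv ;; rNb ::= \<acute>rNb [div] #2 ;; rH ::= #2 [*] \<acute>rH ;;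
     rSc ::= (\<acute>rSc [*] \<acute>rInv2) [mod] \<acute>rP)"

definition down1 :: cmd where
  "down1 = ((Sto aLv \<acute>rLev \<acute>rS1 ;; rLev ::= \<acute>rLev [+] #1 ;; lvl ;; rTot ::= #2 [*] \<acute>rTot) ;;
     pass bSplit ;; (rNb ::= #1 ;; rH ::= \<acute>rM) ;; fwdLoop ;; rS1 ::= \<acute>rS1 [-] \<acute>rMm)"

definition up1 :: cmd where
  "up1 = ((rS1 ::= Ld aLv (\<acute>rLev [-] #1 [-] \<acute>rL) ;; lvl ;; rNb ::= \<acute>rM ;; rH ::= #1) ;;
     invLoop ;; rTot ::= \<acute>rTot [div] #2 ;; pass bDec)"

text \<open>The recursion is a loop: all products of one level have the same size, so a pass serves
  all of them, and a level is described by one number, kept in \<open>aLv\<close> for the way back.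
  Rounding \<open>rMm\<close> down ensures \<open>m \<le> b\<close>, and products of length two end
  the descent. \<open>rSc\<close> collects the inverse of the scale.\<close>

definition conv :: cmd where
  "conv = ((rTot ::= #2 [*] Ld aPw \<acute>rS1 ;; rLev ::= #0 ;; rSc ::= #1) ;;
     CWhile (\<acute>rS1 [-] #1) down1 ;; rTot ::= \<acute>rTot [div] #2 ;; pass bBase ;; For rL \<acute>rLev up1)"

lemma lvl_frame [simp]: "written_regs lvl = {rMm, rM, rB, rNn}" "written_arrays lvl = {}" "nocoin lvl"
  by (auto simp: lvl_def)

lemma loops_frame [simp]:
  "written_regs fwdLoop = {28, 29, 30, 31, 32, 33, 34, 35, 36, 37, 38, 39, 40, 41, 42, 43, 44}" "written_arrays fwdLoop = {aS, aT}" "nocoin fwdLoop"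
  "written_regs invLoop = {23, 28, 29, 30, 31, 32, 33, 34, 35, 36, 37, 38, 39, 40, 41, 42, 43, 44, 45}" "written_arrays invLoop = {aS, aT}" "nocoin invLoop"
  by (auto simp: fwdLoop_def invLoop_def)

lemma levels_frame [simp]:
  "written_regs down1 = {20, 21, 22, 24, 25, 26, 27, 28, 29, 30, 31, 32, 33, 34, 35, 36, 37, 38, 39, 40, 41, 42, 43, 44}"
  "written_arrays down1 = {aLv, aS, aT}" "nocoin down1"
  "written_regs up1 = {20, 21, 23, 24, 25, 26, 27, 28, 29, 30, 31, 32, 33, 34, 35, 36, 37, 38, 39, 40, 41, 42, 43, 44, 45}"
  "written_arrays up1 = {aS, aT}" "nocoin up1"
  by (auto simp: down1_def up1_def)

lemma conv_frame:
  "written_regs conv = {20, 21, 22, 23, 24, 25, 26, 27, 28, 29, 30, 31, 32, 33, 34, 35, 36, 37, 38, 39, 40, 41, 42, 43, 44, 45, 46}"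
  "written_arrays conv = {aS, aT, aLv}" "nocoin conv"
  by (auto simp: conv_def)

context hl begin

lemma wp_pass_rs:
  assumes T: "s rTot = T" "T < U" and wrb: "written_regs b \<subseteq> {32..45}" "written_arrays b = {}" "nocoin b"
    and body: "\<And>j s' A' t'. j < T \<Longrightarrow> s' rJ = j \<Longrightarrow> (\<And>y. y \<notin> {31..45} \<Longrightarrow> s' y = s y) \<Longrightarrow> A' aS = A aS \<Longrightarrow>
      wp b (\<lambda>s2 A2 bs2 t2. t2 \<le> t' + 20 \<and> rz p (s2 rV) (Y j) \<and> s2 rV < U) s' A' bs t'"
  shows "wp (pass b) (\<lambda>s' A' bs' t'. rs p T Y (A' aS) \<and> t' \<le> t + T * 28 + 10) s A bs t"
proof -
  have "wp (pass b) (\<lambda>s' A' bs' t'. (\<forall>j<T. rz p (A' aS j) (Y j)) \<and> t' \<le> t + T * (20 + 8) + 10) s A bs t"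
    by (rule wp_pass[where P = "\<lambda>j v. rz p v (Y j)"]) (use T wrb body in auto)
  then show ?thesis by (simp add: rs_def)
qed

lemma wp_pass_fwd:
  assumes "rs p T X (A aS)" "T = K * (2 * M) * B" "nb * h = M" "0 < nb"
    "s rB = B" "s rM = M" "s rNb = nb" "s rH = h" "s rP = p" "2 * T < U" "p < U" "s rTot = T"
  shows "wp (pass bFwd) (\<lambda>s' A' bs' t'. rs p T (pFwd M B nb h X) (A' aS) \<and> t' \<le> t + T * 28 + 10) s A bs t"
  by (rule wp_pass_rs) (use assms in \<open>auto intro!: wp_bFwd[where T = T and K = K]\<close>)

lemma wp_pass_inv:
  assumes "rs p T X (A aS)" "T = K * (2 * M) * B" "nb * h = M" "0 < nb"
    "s rB = B" "s rM = M" "s rNb = nb" "s rH = h" "s rP = p" "2 * T < U" "p < U" "s rTot = T"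
  shows "wp (pass bInv) (\<lambda>s' A' bs' t'. rs p T (pInv M B nb h X) (A' aS) \<and> t' \<le> t + T * 28 + 10) s A bs t"
  by (rule wp_pass_rs) (use assms in \<open>auto intro!: wp_bInv[where T = T and K = K]\<close>)

lemma wp_pass_split:
  assumes "rs p (K * (M * B)) X (A aS)" "T = K * (2 * M) * B"
    "s rB = B" "s rM = M" "s rNn = M * B" "T < U" "p < U" "0 < p" "s rTot = T"
  shows "wp (pass bSplit) (\<lambda>s' A' bs' t'. rs p T (pSplit M B X) (A' aS) \<and> t' \<le> t + T * 28 + 10) s A bs t"
  by (rule wp_pass_rs) (use assms in \<open>auto intro!: wp_bSplit[where K = K]\<close>)

lemma wp_pass_dec:
  assumes "rs p (2 * T) X (A aS)" "T = K * (M * B)"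
    "s rB = B" "s rM = M" "s rNn = M * B" "s rP = p" "2 * T < U" "p < U" "s rTot = T"
  shows "wp (pass bDec) (\<lambda>s' A' bs' t'. rs p T (pDec M B X) (A' aS) \<and> t' \<le> t + T * 28 + 10) s A bs t"
  by (rule wp_pass_rs) (use assms in \<open>auto intro!: wp_bDec[where T = T and K = K]\<close>)

lemma wp_pass_base:
  assumes "rs p (2 * T) X (A aS)" "even T" "s rP = p" "2 * T < U" "p < U" "s rTot = T"
  shows "wp (pass bBase) (\<lambda>s' A' bs' t'. rs p T (pBase T X) (A' aS) \<and> t' \<le> t + T * 28 + 10) s A bs t"
proof (rule wp_pass_rs)
  fix j s' A' t'
  assume "j < T" "s' rJ = j" "\<And>y. y \<notin> {31..45} \<Longrightarrow> s' y = s y" "A' aS = A aS"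
  then show "wp bBase (\<lambda>s2 A2 bs2 t2. t2 \<le> t' + 20 \<and> rz p (s2 rV) (pBase T X j) \<and> s2 rV < U) s' A' bs t'"
    using assms by (intro wp_bBase) simp_all
qed (use assms in auto)

lemma wp_fwdLoop:
  assumes X: "rs p T (fwdL m b 0 X) (A aS)" and T: "T = K * (2 * 2 ^ m) * 2 ^ b"
    and r: "s rB = 2 ^ b" "s rM = 2 ^ m" "s rMm = m" "s rNb = 1" "s rH = 2 ^ m" "s rP = p" "s rTot = T"
    and U: "2 * T < U" "p < U" "2 * (2 * 2 ^ m) < U"
  shows "wp fwdLoop (\<lambda>s' A' bs' t'. rs p T (fwdL m b (m + 1) X) (A' aS) \<and> t' \<le> t + (m + 1) * (T * 28 + 15) + 3) s A bs t"
  unfolding fwdLoop_def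
\<comment> \<open>The last halving takes \<open>rH\<close> from 1 to 0, so its value is claimed for
  \<open>i \<le> m\<close> only.\<close>
proof (rule wp_For[where n = "m + 1" and I = "\<lambda>i s' A' bs' t'. rs p T (fwdL m b i X) (A' aS) \<and> s' rNb = 2 ^ i \<and>
    (i \<le> m \<longrightarrow> s' rH = 2 ^ (m - i)) \<and> t' \<le> t + i * (T * 28 + 15) + 1"])
  have "m < 2 ^ m" by (rule less_exp)
  then show "m + 1 < U" using U by linarith
  fix i s' A' bs' t'
  assume i: "i < m + 1" "s' rI = i" and I: "rs p T (fwdL m b i X) (A' aS) \<and> s' rNb = 2 ^ i \<and>
    (i \<le> m \<longrightarrow> s' rH = 2 ^ (m - i)) \<and> t' \<le> t + i * (T * 28 + 15) + 1"
    and f: "frame (For rI (\<acute>rMm [+] #1) (pass bFwd ;; rNb ::= #2 [*] \<acute>rNb ;; rH ::= \<acute>rH [div] #2)) s A bs s' A' bs'"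
  have im: "i \<le> m" using i by simp
  have nb: "2 ^ i * 2 ^ (m - i) = (2 ^ m :: nat)" using im by (simp add: power_add[symmetric])
  have "(2::nat) ^ i \<le> 2 ^ m" "(2::nat) ^ (m - i) \<le> 2 ^ m" using im by (auto intro: power_increasing)
  then have U2: "2 * 2 ^ i < U" "2 ^ (m - i) < U" using U by linarith+
  have hd: "2 ^ (m - i) div 2 = (2 ^ (m - Suc i) :: nat)" if "Suc i \<le> m"
    using that by (simp add: Suc_diff_Suc[symmetric])
  have r': "s' rB = 2 ^ b" "s' rM = 2 ^ m" "s' rP = p" "s' rTot = T" using f r by (simp_all add: frame_def)
  show "wp (pass bFwd ;; rNb ::= #2 [*] \<acute>rNb ;; rH ::= \<acute>rH [div] #2)
     (\<lambda>s2 A2 bs2 t2. rs p T (fwdL m b (Suc i) X) (A2 aS) \<and> (s2(rI := Suc i)) rNb = 2 ^ Suc i \<and>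
       (Suc i \<le> m \<longrightarrow> (s2(rI := Suc i)) rH = 2 ^ (m - Suc i)) \<and> t2 + 1 \<le> t + Suc i * (T * 28 + 15) + 1) s' A' bs' (t' + 1)"
  proof (rule wp_SeqI[OF wp_pass_fwd[OF _ T nb]])
    fix s2 A2 bs2 t2
    assume R: "rs p T (pFwd (2 ^ m) (2 ^ b) (2 ^ i) (2 ^ (m - i)) (fwdL m b i X)) (A2 aS) \<and> t2 \<le> t' + 1 + T * 28 + 10"
      and f2: "frame (pass bFwd) s' A' bs' s2 A2 bs2"
    have "s2 rNb = 2 ^ i" "s2 rH = 2 ^ (m - i)" using f2 I im by (simp_all add: frame_def)
    then show "wp (rNb ::= #2 [*] \<acute>rNb ;; rH ::= \<acute>rH [div] #2) (\<lambda>s2 A2 bs2 t2. rs p T (fwdL m b (Suc i) X) (A2 aS) \<and>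
       (s2(rI := Suc i)) rNb = 2 ^ Suc i \<and> (Suc i \<le> m \<longrightarrow> (s2(rI := Suc i)) rH = 2 ^ (m - Suc i)) \<and>
       t2 + 1 \<le> t + Suc i * (T * 28 + 15) + 1) s2 A2 bs2 t2"
      using R I U2 hd div_less_bound[OF U2(2), of 2] by (simp add: algebra_simps)
  qed (use I r' U im in auto)
qed (use X r in \<open>auto simp: frame_def\<close>)

text \<open>Every inverse pass doubles the scale, and one multiplication by the inverse of 2 keeps
  \<open>rSc\<close> its inverse modulo \<open>p\<close>.\<close>

lemma wp_invLoop:
  assumes X: "rs p T X (A aS)" and T: "T = K * (2 * 2 ^ m) * 2 ^ b"
    and r: "s rB = 2 ^ b" "s rM = 2 ^ m" "s rMm = m" "s rNb = 2 ^ m" "s rH = 1" "s rP = p" "s rTot = T" "s rInv2 = iv"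
    and U: "2 * T < U" "p < U" "4 * 2 ^ m < U" "0 < p" and iv: "[int iv * 2 = 1] (mod int p)"
    and S: "[int (s rSc) * int S = 1] (mod int p)"
  shows "wp invLoop (\<lambda>s' A' bs' t'. rs p T (invL m b (m + 1) X) (A' aS) \<and> [int (s' rSc) * int (S * (2 * 2 ^ m)) = 1] (mod int p) \<and>
     t' \<le> t + (m + 1) * (T * 28 + 16) + 3) s A bs t"
  unfolding invLoop_def
proof (rule wp_For[where n = "m + 1" and I = "\<lambda>i s' A' bs' t'. rs p T (invL m b i X) (A' aS) \<and> s' rH = 2 ^ i \<and>
    (i \<le> m \<longrightarrow> s' rNb = 2 ^ (m - i)) \<and> [int (s' rSc) * int (S * 2 ^ i) = 1] (mod int p) \<and> t' \<le> t + i * (T * 28 + 16) + 1"])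
  have "m < 2 ^ m" by (rule less_exp)
  then show "m + 1 < U" using U by linarith
  fix i s' A' bs' t'
  let ?body = "pass bInv ;; rNb ::= \<acute>rNb [div] #2 ;; rH ::= #2 [*] \<acute>rH ;; rSc ::= (\<acute>rSc [*] \<acute>rInv2) [mod] \<acute>rP"
  assume i: "i < m + 1" "s' rI = i" and I: "rs p T (invL m b i X) (A' aS) \<and> s' rH = 2 ^ i \<and>
    (i \<le> m \<longrightarrow> s' rNb = 2 ^ (m - i)) \<and> [int (s' rSc) * int (S * 2 ^ i) = 1] (mod int p) \<and> t' \<le> t + i * (T * 28 + 16) + 1"
    and f: "frame (For rI (\<acute>rMm [+] #1) ?body) s A bs s' A' bs'"
  have im: "i \<le> m" using i by simp
  have nb: "2 ^ (m - i) * 2 ^ i = (2 ^ m :: nat)" using im by (simp add: power_add[symmetric])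
  have "(2::nat) ^ i \<le> 2 ^ m" "(2::nat) ^ (m - i) \<le> 2 ^ m" using im by (auto intro: power_increasing)
  then have U2: "2 * 2 ^ i < U" "2 ^ (m - i) < U" using U by linarith+
  have hd: "2 ^ (m - i) div 2 = (2 ^ (m - Suc i) :: nat)" if "Suc i \<le> m"
    using that by (simp add: Suc_diff_Suc[symmetric])
  have r': "s' rB = 2 ^ b" "s' rM = 2 ^ m" "s' rP = p" "s' rTot = T" "s' rInv2 = iv" using f r by (simp_all add: frame_def)
  show "wp ?body
     (\<lambda>s2 A2 bs2 t2. rs p T (invL m b (Suc i) X) (A2 aS) \<and> (s2(rI := Suc i)) rH = 2 ^ Suc i \<and>
       (Suc i \<le> m \<longrightarrow> (s2(rI := Suc i)) rNb = 2 ^ (m - Suc i)) \<and> [int ((s2(rI := Suc i)) rSc) * int (S * 2 ^ Suc i) = 1] (mod int p) \<and>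
       t2 + 1 \<le> t + Suc i * (T * 28 + 16) + 1) s' A' bs' (t' + 1)"
  proof (rule wp_SeqI[OF wp_pass_inv[OF _ T nb]])
    fix s2 A2 bs2 t2
    assume R: "rs p T (pInv (2 ^ m) (2 ^ b) (2 ^ (m - i)) (2 ^ i) (invL m b i X)) (A2 aS) \<and> t2 \<le> t' + 1 + T * 28 + 10"
      and f2: "frame (pass bInv) s' A' bs' s2 A2 bs2"
    have s2: "s2 rNb = 2 ^ (m - i)" "s2 rH = 2 ^ i" "s2 rSc = s' rSc" "s2 rInv2 = iv" "s2 rP = p"
      using f2 I im r' by (simp_all add: frame_def)
    have "[(int (s' rSc) * int (S * 2 ^ i)) * (int iv * 2) = 1 * 1] (mod int p)" using I iv by (intro cong_mult) auto
    then have c1: "[int (s' rSc * iv) * int (S * 2 ^ Suc i) = 1] (mod int p)" by (simp add: mult_ac)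
    have "[int ((s' rSc * iv) mod p) = int (s' rSc * iv)] (mod int p)" by (simp add: cong_def zmod_int)
    then have c: "[int ((s' rSc * iv) mod p) * int (S * 2 ^ Suc i) = 1] (mod int p)"
      using c1 cong_trans cong_mult[OF _ cong_refl] by blast
    have pU: "(s' rSc * iv) mod p < U" using U by (intro mod_less_bound') auto
    show "wp (rNb ::= \<acute>rNb [div] #2 ;; rH ::= #2 [*] \<acute>rH ;; rSc ::= (\<acute>rSc [*] \<acute>rInv2) [mod] \<acute>rP)
       (\<lambda>s2 A2 bs2 t2. rs p T (invL m b (Suc i) X) (A2 aS) \<and> (s2(rI := Suc i)) rH = 2 ^ Suc i \<and>
       (Suc i \<le> m \<longrightarrow> (s2(rI := Suc i)) rNb = 2 ^ (m - Suc i)) \<and> [int ((s2(rI := Suc i)) rSc) * int (S * 2 ^ Suc i) = 1] (mod int p) \<and>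
       t2 + 1 \<le> t + Suc i * (T * 28 + 16) + 1) s2 A2 bs2 t2"
      using R I U2 hd pU c s2 div_less_bound[OF U2(2), of 2] by (simp add: algebra_simps)
  qed (use I r' U im in auto)
qed (use X r S in \<open>auto simp: frame_def\<close>)

lemma wp_down1:
  assumes X: "rs p T X (A aS)" and T: "T = K * 2 ^ \<sigma>" and s: "1 < \<sigma>" and m: "m = \<sigma> div 2" "b = \<sigma> - m"
    and r: "s rS1 = \<sigma>" "s rLev = i" "s rTot = T" "s rP = p" and tab: "\<And>i. i \<le> \<sigma> \<Longrightarrow> A aPw i = 2 ^ i"
    and U: "4 * T < U" "p < U" "0 < p" "4 * 2 ^ \<sigma> < U" "i + 1 < U"
  shows "wp down1 (\<lambda>s' A' bs' t'. s' rS1 = b \<and> s' rLev = i + 1 \<and> s' rTot = 2 * T \<and> A' aLv = (A aLv)(i := \<sigma>) \<and>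
    rs p (2 * T) (fwdL m b (m + 1) X) (A' aS) \<and> t' \<le> t + (\<sigma> + 2) * (2 * T * 28 + 16) + 30) s A bs t"
  unfolding down1_def
proof (rule wp_SeqI)
  have mb: "m \<le> \<sigma>" "b \<le> \<sigma>" "m + b = \<sigma>" using m by auto
  have pw: "(2::nat) ^ m \<le> 2 ^ \<sigma>" "(2::nat) ^ b \<le> 2 ^ \<sigma>" using mb by (auto intro: power_increasing)
  have "\<sigma> < 2 ^ \<sigma>" by (rule less_exp)
  then have su: "\<sigma> < U" "m < U" "2 ^ \<sigma> < U" "2 ^ m < U" "2 ^ b < U" "2 * T < U" "b < U" "1 < U" "4 * 2 ^ m < U" using U mb pw by linarith+
  have tab': "A aPw m = 2 ^ m" "A aPw b = 2 ^ b" "A aPw \<sigma> = 2 ^ \<sigma>" using tab mb by auto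
  let ?c1 = "Sto aLv \<acute>rLev \<acute>rS1 ;; rLev ::= \<acute>rLev [+] #1 ;; lvl ;; rTot ::= #2 [*] \<acute>rTot"
  show "wp ?c1 (\<lambda>s' A' bs' t'. s' rMm = m \<and> s' rM = 2 ^ m \<and> s' rB = 2 ^ b \<and> s' rNn = 2 ^ \<sigma> \<and> s' rTot = 2 * T \<and>
    s' rLev = i + 1 \<and> A' aLv = (A aLv)(i := \<sigma>) \<and> t' \<le> t + 10) s A bs t"
    unfolding lvl_def using r tab' su U by (simp add: m)
  fix s1 A1 bs1 t1
  assume P1: "s1 rMm = m \<and> s1 rM = 2 ^ m \<and> s1 rB = 2 ^ b \<and> s1 rNn = 2 ^ \<sigma> \<and> s1 rTot = 2 * T \<and>
    s1 rLev = i + 1 \<and> A1 aLv = (A aLv)(i := \<sigma>) \<and> t1 \<le> t + 10" and f1: "frame ?c1 s A bs s1 A1 bs1"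
  have T2: "2 * T = K * (2 * 2 ^ m) * 2 ^ b" "T = K * (2 ^ m * 2 ^ b)" "2 ^ \<sigma> = (2 ^ m * 2 ^ b :: nat)"
    using T mb(3) by (auto simp: power_add[symmetric] mult_ac)
  have f1': "A1 aS = A aS" "s1 rS1 = \<sigma>" "s1 rP = p" using f1 r by (simp_all add: frame_def)
  let ?Q = "\<lambda>s' A' bs' t'. s' rS1 = b \<and> s' rLev = i + 1 \<and> s' rTot = 2 * T \<and> A' aLv = (A aLv)(i := \<sigma>) \<and>
    rs p (2 * T) (fwdL m b (m + 1) X) (A' aS) \<and> t' \<le> t + (\<sigma> + 2) * (2 * T * 28 + 16) + 30"
  show "wp (pass bSplit ;; (rNb ::= #1 ;; rH ::= \<acute>rM) ;; fwdLoop ;; rS1 ::= \<acute>rS1 [-] \<acute>rMm) ?Q s1 A1 bs1 t1"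
  proof (rule wp_SeqI[OF wp_pass_split[where K = K and M = "2 ^ m" and B = "2 ^ b" and X = X and T = "2 * T"]])
    fix s2 A2 bs2 t2
    assume P2: "rs p (2 * T) (pSplit (2 ^ m) (2 ^ b) X) (A2 aS) \<and> t2 \<le> t1 + 2 * T * 28 + 10"
      and f2: "frame (pass bSplit) s1 A1 bs1 s2 A2 bs2"
    have f2': "s2 rS1 = \<sigma>" "s2 rP = p" "s2 rMm = m" "s2 rM = 2 ^ m" "s2 rB = 2 ^ b" "s2 rTot = 2 * T" "s2 rLev = i + 1"
      "A2 aLv = (A aLv)(i := \<sigma>)"
      using f2 P1 f1' by (simp_all add: frame_def)
    have "wp fwdLoop (wp (rS1 ::= \<acute>rS1 [-] \<acute>rMm) ?Q) (s2(rNb := 1, rH := 2 ^ m)) A2 bs2 (t2 + 2)"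
    proof (rule wp_frame[OF wp_fwdLoop[where m = m and b = b and X = X and p = p and T = "2 * T" and K = K]])
      fix s3 A3 bs3 t3
      assume P3: "rs p (2 * T) (fwdL m b (m + 1) X) (A3 aS) \<and> t3 \<le> t2 + 2 + (m + 1) * (2 * T * 28 + 15) + 3"
        and f3: "frame fwdLoop (s2(rNb := 1, rH := 2 ^ m)) A2 bs2 s3 A3 bs3"
      have f3': "s3 rS1 = \<sigma>" "s3 rMm = m" "s3 rTot = 2 * T" "s3 rLev = i + 1" "A3 aLv = (A aLv)(i := \<sigma>)"
        using f3 f2' by (simp_all add: frame_def)
      have "(m + 1) * (2 * T * 28 + 15) + (2 * T * 28 + 10) \<le> (m + 1) * (2 * T * 28 + 16) + 1 * (2 * T * 28 + 16)"
        by (intro add_mono mult_mono) auto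
      also have "\<dots> = (m + 2) * (2 * T * 28 + 16)" by (simp add: algebra_simps)
      also have "\<dots> \<le> (\<sigma> + 2) * (2 * T * 28 + 16)" using mb by (intro mult_right_mono) auto
      finally have "t3 + 1 \<le> t + (\<sigma> + 2) * (2 * T * 28 + 16) + 30" using P1 P2 P3 by linarith
      then show "wp (rS1 ::= \<acute>rS1 [-] \<acute>rMm) ?Q s3 A3 bs3 t3" using f3' P3 su m by simp
    qed (use P2 f2' T2 U(1-3) su in simp_all)
    then show "wp ((rNb ::= #1 ;; rH ::= \<acute>rM) ;; fwdLoop ;; rS1 ::= \<acute>rS1 [-] \<acute>rMm) ?Q s2 A2 bs2 t2"
      using su f2' by simp
  qed (use P1 f1' X T2 su U in auto)
qed

lemma wp_up1:
  assumes X: "rs p (2 * T) X (A aS)" and T: "T = K * 2 ^ \<sigma>" and s: "1 < \<sigma>" and m: "m = \<sigma> div 2" "b = \<sigma> - m"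
    and r: "A aLv (s rLev - 1 - s rL) = \<sigma>" "s rTot = 2 * T" "s rP = p" "s rInv2 = iv" and tab: "\<And>i. i \<le> \<sigma> \<Longrightarrow> A aPw i = 2 ^ i"
    and U: "4 * T < U" "p < U" "0 < p" "4 * 2 ^ \<sigma> < U" and iv: "[int iv * 2 = 1] (mod int p)"
    and S: "[int (s rSc) * int S = 1] (mod int p)"
  shows "wp up1 (\<lambda>s' A' bs' t'. s' rTot = T \<and> [int (s' rSc) * int (S * (2 * 2 ^ m)) = 1] (mod int p) \<and>
    rs p T (pDec (2 ^ m) (2 ^ b) (invL m b (m + 1) X)) (A' aS) \<and> t' \<le> t + (\<sigma> + 2) * (2 * T * 28 + 16) + 40) s A bs t"
  unfolding up1_def
proof (rule wp_SeqI)
  have mb: "m \<le> \<sigma>" "b \<le> \<sigma>" "m + b = \<sigma>" using m by auto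
  have pw: "(2::nat) ^ m \<le> 2 ^ \<sigma>" "(2::nat) ^ b \<le> 2 ^ \<sigma>" using mb by (auto intro: power_increasing)
  have "\<sigma> < 2 ^ \<sigma>" by (rule less_exp)
  then have su: "\<sigma> < U" "m < U" "2 ^ \<sigma> < U" "2 ^ m < U" "2 ^ b < U" "2 * T < U" "b < U" "1 < U" "4 * 2 ^ m < U" using U mb pw by linarith+
  have tab': "A aPw m = 2 ^ m" "A aPw b = 2 ^ b" "A aPw \<sigma> = 2 ^ \<sigma>" using tab mb by auto
  let ?c1 = "rS1 ::= Ld aLv (\<acute>rLev [-] #1 [-] \<acute>rL) ;; lvl ;; rNb ::= \<acute>rM ;; rH ::= #1"
  show "wp ?c1 (\<lambda>s' A' bs' t'. s' rMm = m \<and> s' rM = 2 ^ m \<and> s' rB = 2 ^ b \<and> s' rNn = 2 ^ \<sigma> \<and> s' rNb = 2 ^ m \<and> s' rH = 1 \<and>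
    t' \<le> t + 10) s A bs t"
    unfolding lvl_def using r tab' su U by (simp add: m)
  fix s1 A1 bs1 t1
  assume P1: "s1 rMm = m \<and> s1 rM = 2 ^ m \<and> s1 rB = 2 ^ b \<and> s1 rNn = 2 ^ \<sigma> \<and> s1 rNb = 2 ^ m \<and> s1 rH = 1 \<and> t1 \<le> t + 10"
    and f1: "frame ?c1 s A bs s1 A1 bs1"
  have T2: "2 * T = K * (2 * 2 ^ m) * 2 ^ b" "T = K * (2 ^ m * 2 ^ b)" "2 ^ \<sigma> = (2 ^ m * 2 ^ b :: nat)"
    using T mb(3) by (auto simp: power_add[symmetric] mult_ac)
  have f1': "A1 aS = A aS" "s1 rP = p" "s1 rInv2 = iv" "s1 rTot = 2 * T" "s1 rSc = s rSc"
    using f1 r by (simp_all add: frame_def)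
  let ?Q = "\<lambda>s' A' bs' t'. s' rTot = T \<and> [int (s' rSc) * int (S * (2 * 2 ^ m)) = 1] (mod int p) \<and>
    rs p T (pDec (2 ^ m) (2 ^ b) (invL m b (m + 1) X)) (A' aS) \<and> t' \<le> t + (\<sigma> + 2) * (2 * T * 28 + 16) + 40"
  show "wp (invLoop ;; rTot ::= \<acute>rTot [div] #2 ;; pass bDec) ?Q s1 A1 bs1 t1"
  proof (rule wp_SeqI[OF wp_invLoop[where m = m and b = b and X = X and p = p and T = "2 * T" and K = K and S = S and iv = iv]])
    fix s2 A2 bs2 t2
    assume P2: "rs p (2 * T) (invL m b (m + 1) X) (A2 aS) \<and> [int (s2 rSc) * int (S * (2 * 2 ^ m)) = 1] (mod int p) \<and>
      t2 \<le> t1 + (m + 1) * (2 * T * 28 + 16) + 3" and f2: "frame invLoop s1 A1 bs1 s2 A2 bs2"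
    have f2': "s2 rP = p" "s2 rM = 2 ^ m" "s2 rB = 2 ^ b" "s2 rNn = 2 ^ \<sigma>" "s2 rTot = 2 * T"
      using f2 P1 f1' by (simp_all add: frame_def)
    have "wp (pass bDec) ?Q (s2(rTot := T)) A2 bs2 (t2 + 1)"
    proof (rule wp_frame[OF wp_pass_dec[where T = T and K = K and M = "2 ^ m" and B = "2 ^ b" and X = "invL m b (m + 1) X" and p = p]])
      fix s3 A3 bs3 t3
      assume P3: "rs p T (pDec (2 ^ m) (2 ^ b) (invL m b (m + 1) X)) (A3 aS) \<and> t3 \<le> t2 + 1 + T * 28 + 10"
        and f3: "frame (pass bDec) (s2(rTot := T)) A2 bs2 s3 A3 bs3"
      have "(m + 1) * (2 * T * 28 + 16) + (T * 28 + 10) \<le> (m + 1) * (2 * T * 28 + 16) + 1 * (2 * T * 28 + 16)" by simp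
      also have "\<dots> = (m + 2) * (2 * T * 28 + 16)" by (simp add: algebra_simps)
      also have "\<dots> \<le> (\<sigma> + 2) * (2 * T * 28 + 16)" using mb by (intro mult_right_mono) auto
      finally have "t3 \<le> t + (\<sigma> + 2) * (2 * T * 28 + 16) + 40" using P1 P2 P3 by linarith
      moreover have "s3 rSc = s2 rSc" "s3 rTot = T" using f3 by (simp_all add: frame_def)
      ultimately show "?Q s3 A3 bs3 t3" using P2 P3 by simp
    qed (use P2 f2' T2 U su in auto)
    then show "wp (rTot ::= \<acute>rTot [div] #2 ;; pass bDec) ?Q s2 A2 bs2 t2" using f2' su U by simp
  qed (use P1 f1' X T2 su U(1-3) iv S in simp_all)
qed

end

text \<open>Level data of the descent: level \<open>i\<close> consists of \<open>Kq\<close> products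
  of length \<open>2 ^ sq\<close>, with the factors in \<open>Xq\<close>. The exponent is halved
  with rounding up.\<close>

fun sq :: "nat \<Rightarrow> nat \<Rightarrow> nat" where
  "sq \<sigma> 0 = \<sigma>"
| "sq \<sigma> (Suc i) = sq \<sigma> i - sq \<sigma> i div 2"

fun Kq :: "nat \<Rightarrow> nat \<Rightarrow> nat" where
  "Kq \<sigma> 0 = 1"
| "Kq \<sigma> (Suc i) = Kq \<sigma> i * (2 * 2 ^ (sq \<sigma> i div 2))"

fun Xq :: "nat \<Rightarrow> (nat \<Rightarrow> int) \<Rightarrow> nat \<Rightarrow> nat \<Rightarrow> int" where
  "Xq \<sigma> X 0 = X"
| "Xq \<sigma> X (Suc i) = fwdL (sq \<sigma> i div 2) (sq \<sigma> i - sq \<sigma> i div 2) (sq \<sigma> i div 2 + 1) (Xq \<sigma> X i)"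

text \<open>Zero padding doubles the amount of data once per level.\<close>

lemma Kq_sq: "Kq \<sigma> i * 2 ^ sq \<sigma> i = 2 ^ i * 2 ^ \<sigma>"
proof (induction i)
  case (Suc i)
  let ?m = "sq \<sigma> i div 2"
  have "(2::nat) ^ ?m * 2 ^ (sq \<sigma> i - ?m) = 2 ^ sq \<sigma> i" by (simp add: power_add[symmetric])
  then have "Kq \<sigma> (Suc i) * 2 ^ sq \<sigma> (Suc i) = 2 * (Kq \<sigma> i * 2 ^ sq \<sigma> i)" by (simp add: mult_ac)
  then show ?case unfolding Suc by simp
qed simp

lemma sq_le: "sq \<sigma> i \<le> \<sigma>"
  by (induction i) auto

lemma sq_shift: "sq (sq \<sigma> 1) i = sq \<sigma> (Suc i)"
  by (induction i) auto

text \<open>The depth is logarithmic in \<open>\<sigma>\<close>, so the data grow at most by the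
  factor \<open>2 * \<sigma>\<close>. Rounding up spoils an induction with this bound alone; the
  sharper one works because \<open>2 * (sq \<sigma> 1 - 1) \<le> \<sigma> - 1\<close>.\<close>

lemma sq_depth: "1 \<le> \<sigma> \<Longrightarrow> \<exists>r. (\<forall>i<r. 1 < sq \<sigma> i) \<and> sq \<sigma> r = 1 \<and> 2 ^ r \<le> 2 * \<sigma> \<and> (2 \<le> \<sigma> \<longrightarrow> 2 ^ r \<le> 2 * (\<sigma> - 1))"
proof (induction \<sigma> rule: less_induct)
  case (less \<sigma>)
  show ?case
  proof (cases "\<sigma> = 1")
    case True
    then show ?thesis by (intro exI[of _ 0]) simp
  next
    case False
    let ?\<tau> = "sq \<sigma> 1"
    have t: "?\<tau> < \<sigma>" "1 \<le> ?\<tau>" "2 * ?\<tau> \<le> \<sigma> + 1" using less.prems False by auto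
    then obtain r where r: "\<forall>i<r. 1 < sq ?\<tau> i" "sq ?\<tau> r = 1" "2 ^ r \<le> 2 * ?\<tau>" "2 \<le> ?\<tau> \<longrightarrow> 2 ^ r \<le> 2 * (?\<tau> - 1)"
      using less.IH by blast
    have "2 ^ Suc r \<le> 2 * (\<sigma> - 1)"
    proof (cases "2 \<le> ?\<tau>")
      case True
      then show ?thesis using r(4) t by simp
    next
      case False
      then have "?\<tau> = 1" using t by simp
      then have "r = 0" using r(1) by (cases r) auto
      then show ?thesis using less.prems \<open>\<sigma> \<noteq> 1\<close> by simp
    qed
    moreover have "1 < sq \<sigma> i" if "i < Suc r" for i
      using that r(1) False less.prems sq_shift[of \<sigma>] by (cases i) auto
    moreover have "sq \<sigma> (Suc r) = 1" using r(2) sq_shift by simp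
    ultimately show ?thesis by (intro exI[of _ "Suc r"]) auto
  qed
qed

lemma mulp_up:
  assumes "mulp S (sq \<sigma> (Suc i)) (Kq \<sigma> (Suc i)) (Xq \<sigma> X (Suc i)) Z"
  shows "mulp (S * (2 * 2 ^ (sq \<sigma> i div 2))) (sq \<sigma> i) (Kq \<sigma> i) (Xq \<sigma> X i)
    (pDec (2 ^ (sq \<sigma> i div 2)) (2 ^ (sq \<sigma> i - sq \<sigma> i div 2)) (invL (sq \<sigma> i div 2) (sq \<sigma> i - sq \<sigma> i div 2) (sq \<sigma> i div 2 + 1) Z))"
proof -
  have "sq \<sigma> i div 2 \<le> sq \<sigma> i - sq \<sigma> i div 2" by linarith
  from mulp_level[OF this, of S "Kq \<sigma> i" "Xq \<sigma> X i" Z] assms show ?thesis by simp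
qed

text \<open>At most \<open>4 * \<sigma> + 1\<close> stages, each with at most about
  \<open>\<sigma>\<close> passes over \<open>4 * \<sigma> * 2 ^ \<sigma>\<close> cells. The depth is
  bounded crudely by \<open>2 * \<sigma>\<close>, which costs only logarithmic factors.\<close>

definition conv_time :: "nat \<Rightarrow> nat" where
  "conv_time \<sigma> = (4 * \<sigma> + 1) * ((\<sigma> + 2) * (4 * \<sigma> * 2 ^ \<sigma> * 28 + 16) + 50) + 30"

context hl begin

lemma wp_conv:
  assumes X: "rs p (2 * 2 ^ \<sigma>) X (A aS)" and s: "1 \<le> \<sigma>" "s rS1 = \<sigma>" "s rP = p" "s rInv2 = iv"
    and tab: "\<And>i. i \<le> \<sigma> \<Longrightarrow> A aPw i = 2 ^ i"
    and U: "16 * \<sigma> * 2 ^ \<sigma> < U" "p < U" "0 < p" and iv: "[int iv * 2 = 1] (mod int p)"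
  shows "wp conv (\<lambda>s' A' bs' t'. (\<exists>S Z. mulp S \<sigma> 1 X Z \<and> rs p (2 ^ \<sigma>) Z (A' aS) \<and> [int (s' rSc) * int S = 1] (mod int p)) \<and>
    t' \<le> t + conv_time \<sigma>) s A bs t"
proof -
  obtain r where r: "\<forall>i<r. 1 < sq \<sigma> i" "sq \<sigma> r = 1" "2 ^ r \<le> 2 * \<sigma>" using sq_depth[OF s(1)] by blast
  define N where "N = (2::nat) ^ \<sigma>"
  have N1: "1 \<le> N" "\<sigma> < N" unfolding N_def using less_exp by auto
  define D where "D = (\<sigma> + 2) * (4 * \<sigma> * N * 28 + 16) + 50"
  let ?tot = "\<lambda>i. 2 * (2 ^ i * N)"
  have tot: "2 * (2 ^ i * N) = 2 * Kq \<sigma> i * 2 ^ sq \<sigma> i" for i using Kq_sq[of \<sigma> i] by (simp add: N_def mult.assoc)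
  have tot_le: "2 * (2 ^ i * N) \<le> 4 * \<sigma> * N" if "i \<le> r" for i
  proof -
    have "(2::nat) ^ i \<le> 2 ^ r" using that by (intro power_increasing) auto
    then have "2 ^ i \<le> 2 * \<sigma>" using r(3) by linarith
    then have "2 ^ i * N \<le> 2 * \<sigma> * N" by (intro mult_right_mono) auto
    then show ?thesis by simp
  qed
  have UN: "16 * \<sigma> * N < U" using U by (simp add: N_def)
  have "r < 2 ^ r" by (rule less_exp)
  then have r2: "r < 2 * \<sigma>" using r(3) by linarith
  have s4: "4 * 2 ^ sq \<sigma> i < U" for i
  proof -
    have "(2::nat) ^ sq \<sigma> i \<le> N" unfolding N_def using sq_le by (intro power_increasing) auto
    moreover have "4 * N \<le> 16 * \<sigma> * N" using s(1) by (intro mult_right_mono) auto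
    ultimately show ?thesis using UN by linarith
  qed
  have sN: "4 * \<sigma> \<le> 16 * \<sigma> * N" using N1 by simp
  then have rU: "r + 1 < U" "\<sigma> < U" using r2 UN by linarith+
  have D_ge: "(sq \<sigma> i + 2) * (2 * (2 * (2 ^ j * N)) * 28 + 16) + 42 \<le> D" if "Suc j \<le> r" for i j
  proof -
    have a: "sq \<sigma> i + 2 \<le> \<sigma> + 2" using sq_le by simp
    have "2 * (2 * (2 ^ j * N)) \<le> 4 * \<sigma> * N" using tot_le[OF that] by simp
    then have b: "2 * (2 * (2 ^ j * N)) * 28 + 16 \<le> 4 * \<sigma> * N * 28 + 16" by linarith
    have "(sq \<sigma> i + 2) * (2 * (2 * (2 ^ j * N)) * 28 + 16) \<le> (\<sigma> + 2) * (4 * \<sigma> * N * 28 + 16)"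
      by (rule mult_le_mono[OF a b])
    then show ?thesis by (simp add: D_def)
  qed
  let ?Q = "\<lambda>s' A' bs' t'. (\<exists>S Z. mulp S \<sigma> 1 X Z \<and> rs p (2 ^ \<sigma>) Z (A' aS) \<and> [int (s' rSc) * int S = 1] (mod int p)) \<and>
    t' \<le> t + conv_time \<sigma>"
  let ?I = "\<lambda>i s' A' bs' t'. s' rS1 = sq \<sigma> i \<and> s' rLev = i \<and> s' rTot = ?tot i \<and> (\<forall>l<i. A' aLv l = sq \<sigma> l) \<and>
     rs p (?tot i) (Xq \<sigma> X i) (A' aS) \<and> t' \<le> t + 3 + i * D"
  let ?s0 = "s(rTot := 2 * N, rLev := 0, rSc := 1)"
  let ?rest = "rTot ::= \<acute>rTot [div] #2 ;; pass bBase ;; For rL \<acute>rLev up1"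
  have "wp (CWhile (\<acute>rS1 [-] #1) down1 ;; ?rest) ?Q ?s0 A bs (t + 3)"
  proof (rule wp_SeqI)
    show "wp (CWhile (\<acute>rS1 [-] #1) down1) (\<lambda>s' A' bs' t'. s' rS1 = 1 \<and> s' rLev = r \<and> s' rTot = ?tot r \<and> (\<forall>l<r. A' aLv l = sq \<sigma> l) \<and>
     rs p (?tot r) (Xq \<sigma> X r) (A' aS) \<and> t' \<le> t + 4 + r * D) ?s0 A bs (t + 3)"
    proof (rule wp_While[where I = ?I and n = r])
      show "?I 0 ?s0 A bs (t + 3)" using s X by (simp add: N_def)
    next
      fix i s' A' bs' t'
      assume i: "i < r" and I: "?I i s' A' bs' t'" and f: "frame down1 ?s0 A bs s' A' bs'"
      let ?m = "sq \<sigma> i div 2" let ?b = "sq \<sigma> i - sq \<sigma> i div 2"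
      have p': "s' rP = p" "A' aPw = A aPw" using f s by (simp_all add: frame_def)
      have "2 * (2 ^ Suc i * N) \<le> 4 * \<sigma> * N" using i by (intro tot_le) simp
      then have u: "4 * ?tot i < U" using UN by (simp only: power_Suc mult.assoc)
      have w: "wp down1 (\<lambda>s2 A2 bs2 t2. s2 rS1 = ?b \<and> s2 rLev = i + 1 \<and> s2 rTot = 2 * ?tot i \<and> A2 aLv = (A' aLv)(i := sq \<sigma> i) \<and>
         rs p (2 * ?tot i) (fwdL ?m ?b (?m + 1) (Xq \<sigma> X i)) (A2 aS) \<and>
         t2 \<le> t' + 1 + (sq \<sigma> i + 2) * (2 * ?tot i * 28 + 16) + 30) s' A' bs' (t' + 1)"
        by (rule wp_down1[OF _ _ _ refl refl, where K = "2 * Kq \<sigma> i"])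
          (use I r i p' tab U u s4 rU sq_le[of \<sigma> i] tot[of i] in \<open>auto simp: mult.assoc\<close>)
      have "wp down1 (?I (Suc i)) s' A' bs' (t' + 1)"
        by (rule wp_mono[OF w]) (use I D_ge[of i i] i in \<open>auto simp: less_Suc_eq\<close>)
      then show "aval (\<acute>rS1 [-] #1) s' A' \<noteq> 0 \<and> wp down1 (?I (Suc i)) s' A' bs' (t' + 1)"
        using I r(1) i by auto
    qed (use r(2) in auto)
  next
    fix s1 A1 bs1 t1
    assume P1: "s1 rS1 = 1 \<and> s1 rLev = r \<and> s1 rTot = ?tot r \<and> (\<forall>l<r. A1 aLv l = sq \<sigma> l) \<and>
     rs p (?tot r) (Xq \<sigma> X r) (A1 aS) \<and> t1 \<le> t + 4 + r * D" and f1: "frame (CWhile (\<acute>rS1 [-] #1) down1) ?s0 A bs s1 A1 bs1"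
    have f1': "s1 rP = p" "A1 aPw = A aPw" "s1 rSc = 1" "s1 rInv2 = iv" using f1 s by (simp_all add: frame_def)
    have tr: "2 ^ r * N = 2 * Kq \<sigma> r" using Kq_sq[of \<sigma> r] r(2) by (simp add: N_def)
    have tU: "2 * (2 ^ r * N) < U" using tot_le[of r] UN by linarith
    have "wp (pass bBase ;; For rL \<acute>rLev up1) ?Q (s1(rTot := 2 ^ r * N)) A1 bs1 (t1 + 1)"
    proof (rule wp_SeqI[OF wp_pass_base[where T = "2 ^ r * N" and p = p and X = "Xq \<sigma> X r"]])
      fix s2 A2 bs2 t2
      assume P2: "rs p (2 ^ r * N) (pBase (2 ^ r * N) (Xq \<sigma> X r)) (A2 aS) \<and> t2 \<le> t1 + 1 + 2 ^ r * N * 28 + 10"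
        and f2: "frame (pass bBase) (s1(rTot := 2 ^ r * N)) A1 bs1 s2 A2 bs2"
      have f2': "s2 rP = p" "A2 aPw = A aPw" "s2 rSc = 1" "s2 rInv2 = iv" "s2 rTot = 2 ^ r * N" "s2 rLev = r" "A2 aLv = A1 aLv"
        using f2 f1' P1 by (simp_all add: frame_def)
      have base: "mulp 1 1 (Kq \<sigma> r) (Xq \<sigma> X r) (pBase (2 ^ r * N) (Xq \<sigma> X r))"
        unfolding tr by (rule mulp_base)
      \<comment> \<open>The scale \<open>S\<close> and the product \<open>Z\<close> exist only in
        the proof; the program knows \<open>S\<close> through its inverse in
        \<open>rSc\<close>.\<close>
      let ?J = "\<lambda>l s' A' bs' t'. s' rTot = 2 ^ (r - l) * N \<and> (\<exists>S Z. mulp S (sq \<sigma> (r - l)) (Kq \<sigma> (r - l)) (Xq \<sigma> X (r - l)) Z \<and>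
         rs p (2 ^ (r - l) * N) Z (A' aS) \<and> [int (s' rSc) * int S = 1] (mod int p)) \<and> t' \<le> t2 + 1 + l * D"
      show "wp (For rL \<acute>rLev up1) ?Q s2 A2 bs2 t2"
      proof (rule wp_For[where n = r and I = ?J])
        show "?J 0 (s2(rL := 0)) A2 bs2 (t2 + 1)" using P2 f2' base r(2) by fastforce
      next
        fix l s' A' bs' t'
        assume l: "l < r" "s' rL = l" and J: "?J l s' A' bs' t'" and f: "frame (For rL \<acute>rLev up1) s2 A2 bs2 s' A' bs'"
        define i where "i = r - Suc l"
        have i: "r - l = Suc i" "i < r" "r - 1 - l = i" using l by (auto simp: i_def)
        let ?m = "sq \<sigma> i div 2" let ?b = "sq \<sigma> i - sq \<sigma> i div 2"
        obtain S Z where Z: "mulp S (sq \<sigma> (Suc i)) (Kq \<sigma> (Suc i)) (Xq \<sigma> X (Suc i)) Z"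
          "rs p (2 ^ Suc i * N) Z (A' aS)" "[int (s' rSc) * int S = 1] (mod int p)" using J unfolding i by blast
        have f': "s' rP = p" "A' aPw = A aPw" "s' rInv2 = iv" "s' rLev = r" "A' aLv = A1 aLv"
          using f f2' by (simp_all add: frame_def)
        have "2 * (2 ^ Suc i * N) \<le> 4 * \<sigma> * N" using i by (intro tot_le) simp
        then have u: "4 * (2 ^ i * N) < U" using UN by (simp only: power_Suc mult.assoc)
        have w: "wp up1 (\<lambda>s3 A3 bs3 t3. s3 rTot = 2 ^ i * N \<and> [int (s3 rSc) * int (S * (2 * 2 ^ ?m)) = 1] (mod int p) \<and>
           rs p (2 ^ i * N) (pDec (2 ^ ?m) (2 ^ ?b) (invL ?m ?b (?m + 1) Z)) (A3 aS) \<and>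
           t3 \<le> t' + 1 + (sq \<sigma> i + 2) * (2 * (2 ^ i * N) * 28 + 16) + 40) s' A' bs' (t' + 1)"
        proof (rule wp_up1[OF _ _ _ refl refl, where K = "Kq \<sigma> i"])
          show "2 ^ i * N = Kq \<sigma> i * 2 ^ sq \<sigma> i" using Kq_sq[of \<sigma> i] by (simp add: N_def)
          show "A' aLv (s' rLev - 1 - s' rL) = sq \<sigma> i" using f' P1 l i by simp
          show "A' aPw j = 2 ^ j" if "j \<le> sq \<sigma> i" for j using f' tab that sq_le[of \<sigma> i] by simp
          show "rs p (2 * (2 ^ i * N)) Z (A' aS)" using Z(2) by (simp add: mult.assoc)
          show "s' rTot = 2 * (2 ^ i * N)" using J i by (simp add: mult.assoc)
        qed (use Z(3) f' r(1) i(2) U u s4 iv in auto)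
        have "(sq \<sigma> i + 2) * (2 * (2 ^ i * N) * 28 + 16) \<le> (sq \<sigma> i + 2) * (2 * (2 * (2 ^ i * N)) * 28 + 16)"
          by (intro mult_left_mono add_mono mult_right_mono) auto
        then have d: "(sq \<sigma> i + 2) * (2 * (2 ^ i * N) * 28 + 16) + 42 \<le> D" using D_ge[of i i] i by linarith
        show "wp up1 (\<lambda>s2 A2 bs2 t2. ?J (Suc l) (s2(rL := Suc l)) A2 bs2 (t2 + 1)) s' A' bs' (t' + 1)"
        proof (rule wp_mono[OF w])
          fix s3 A3 bs3 t3
          assume P3: "s3 rTot = 2 ^ i * N \<and> [int (s3 rSc) * int (S * (2 * 2 ^ ?m)) = 1] (mod int p) \<and>
           rs p (2 ^ i * N) (pDec (2 ^ ?m) (2 ^ ?b) (invL ?m ?b (?m + 1) Z)) (A3 aS) \<and>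
           t3 \<le> t' + 1 + (sq \<sigma> i + 2) * (2 * (2 ^ i * N) * 28 + 16) + 40"
          have "t3 + 1 \<le> t2 + 1 + Suc l * D" using P3 J d by simp
          moreover have "r - Suc l = i" by (simp add: i_def)
          ultimately show "?J (Suc l) (s3(rL := Suc l)) A3 bs3 (t3 + 1)"
            using P3 mulp_up[OF Z(1)] by (auto simp del: of_nat_mult)
        qed
      next
        fix s' A' bs' t'
        assume J: "?J r s' A' bs' t'"
        have "2 ^ r * N * 28 + 10 \<le> 4 * \<sigma> * N * 28 + 16" using tot_le[OF order_refl] by linarith
        also have "\<dots> \<le> (\<sigma> + 2) * (4 * \<sigma> * N * 28 + 16)" by simp
        finally have "2 ^ r * N * 28 + 10 \<le> D" by (simp add: D_def)
        moreover have "t' \<le> t2 + 1 + r * D" "t2 \<le> t1 + 1 + 2 ^ r * N * 28 + 10" "t1 \<le> t + 4 + r * D"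
          using J P2 P1 by auto
        ultimately have "t' + 1 \<le> t + 10 + r * D + D + r * D" by linarith
        also have "\<dots> = t + 10 + (2 * r + 1) * D" by (simp add: algebra_simps)
        also have "\<dots> \<le> t + 10 + (4 * \<sigma> + 1) * D" using r2 by (intro add_mono mult_right_mono) auto
        also have "\<dots> \<le> t + conv_time \<sigma>" by (simp add: conv_time_def D_def N_def)
        finally show "?Q s' A' bs' (t' + 1)" using J by (auto simp: N_def)
      qed (use f2' rU in \<open>auto simp: frame_def\<close>)
    qed (use P1 f1' tr tU U in auto)
    then show "wp ?rest ?Q s1 A1 bs1 t1" using P1 tU by simp
  qed
  moreover have "A aPw \<sigma> = N" "2 * N < U"
  proof -
    show "A aPw \<sigma> = N" using tab by (simp add: N_def)
    have "2 * N \<le> 16 * \<sigma> * N" using s(1) by (intro mult_right_mono) auto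
    then show "2 * N < U" using UN by linarith
  qed
  ultimately show ?thesis unfolding conv_def using s rU by (simp add: numeral_3_eq_3)
qed

end

subsection \<open>Random weights and the logarithmic derivative\<close>

abbreviation (input) rAns :: reg where "rAns \<equiv> 0"
abbreviation (input) rN :: reg where "rN \<equiv> 1"
abbreviation (input) rDv :: reg where "rDv \<equiv> 2"
abbreviation (input) rTm :: reg where "rTm \<equiv> 3"
abbreviation (input) rCm :: reg where "rCm \<equiv> 4"
abbreviation (input) rSize :: reg where "rSize \<equiv> 5"
abbreviation (input) rLog :: reg where "rLog \<equiv> 6"
abbreviation (input) rGoal :: reg where "rGoal \<equiv> 7"
abbreviation (input) rYk :: reg where "rYk \<equiv> 8"
abbreviation (input) rMax :: reg where "rMax \<equiv> 9"
abbreviation (input) rD :: reg where "rD \<equiv> 12"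
abbreviation (input) ri :: reg where "ri \<equiv> 13"
abbreviation (input) rj :: reg where "rj \<equiv> 14"
abbreviation (input) ru :: reg where "ru \<equiv> 15"
abbreviation (input) rz' :: reg where "rz' \<equiv> 16"

abbreviation (input) aW :: nat where "aW \<equiv> 4"
abbreviation (input) aBs :: nat where "aBs \<equiv> 5"
abbreviation (input) aLm :: nat where "aLm \<equiv> 6"
abbreviation (input) aMark :: nat where "aMark \<equiv> 7"
abbreviation (input) aInv :: nat where "aInv \<equiv> 8"
abbreviation (input) aWt :: nat where "aWt \<equiv> 9"
abbreviation (input) aG :: nat where "aG \<equiv> 10"
abbreviation (input) aAcc :: nat where "aAcc \<equiv> 11"
abbreviation (input) aF :: nat where "aF \<equiv> 12"
abbreviation (input) aH :: nat where "aH \<equiv> 13"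

definition skip :: cmd where "skip = (54 ::= #0)"

lemma skip_frame [simp]: "written_regs skip = {54}" "written_arrays skip = {}" "nocoin skip" by (simp_all add: skip_def)

text \<open>Items above \<open>t\<close> get weights too, so that every repetition uses exactly
  \<open>n * k * \<sigma>\<close> coins.\<close>

definition weights :: "nat \<Rightarrow> cmd" where
  "weights k = For rj (\<acute>rN [*] #k) (17 ::= #0 ;; For ru \<acute>rLog (Coin 18 ;; 17 ::= #2 [*] \<acute>17 [+] \<acute>18) ;; Sto aWt \<acute>rj \<acute>17)"

definition clear :: cmd where
  "clear = For ri \<acute>rSize (Sto aG \<acute>ri #0 ;; Sto aAcc \<acute>ri #0)"

text \<open>Registers 17 and 18 accumulate \<open>h\<close> and \<open>g\<close>, 19 the code of the
  monomial, and 47 records whether it is valid; 48 to 50 hold the digit, \<open>sc j i\<close>, and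
  weight times earlier \<open>h\<close>.\<close>

definition item1 :: "nat \<Rightarrow> cmd" where
  "item1 k = (48 ::= (\<acute>ru [div] Ld aW \<acute>ri) [mod] Ld aBs \<acute>ri ;;
     49 ::= Ld aW \<acute>ri [+] \<acute>rz' [*] Ld aW (#k [+] \<acute>ri) ;;
     19 ::= \<acute>19 [+] \<acute>48 [*] \<acute>49 ;;
     CIf (\<acute>48 [-] \<acute>rCm) (47 ::= #0) skip ;;
     CIf (\<acute>48 [*] \<acute>rz' [-] \<acute>rTm) (47 ::= #0) skip ;;
     CIf \<acute>48 (50 ::= (Ld aWt (\<acute>rj [*] #k [+] \<acute>ri) [*] Ld aH (\<acute>ru [-] Ld aW \<acute>ri)) [mod] \<acute>rP ;;
        17 ::= (\<acute>17 [+] (\<acute>rP [-] \<acute>50)) [mod] \<acute>rP ;;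
        18 ::= (\<acute>18 [+] \<acute>49 [*] \<acute>50) [mod] \<acute>rP) skip)"

definition item :: "nat \<Rightarrow> cmd" where
  "item k = ((17 ::= #1 [-] \<acute>ru ;; 18 ::= #0 ;; 19 ::= #0 ;; 47 ::= #1) ;;
     For ri #k (item1 k) ;;
     Sto aH \<acute>ru \<acute>17 ;; CIf \<acute>47 (Sto aG \<acute>19 ((Ld aG \<acute>19 [+] \<acute>18) [mod] \<acute>rP)) skip)"

definition gen :: "nat \<Rightarrow> cmd" where
  "gen k = For rj \<acute>rN (Inp rz' (#(2 + 2 * k) [+] \<acute>rj) ;;
     CIf (\<acute>rz' [-] \<acute>rTm) skip (For ru \<acute>rYk (item k)))"

lemma gen_frame [simp]:
  "written_regs (weights k) = {14, 15, 17, 18}" "written_arrays (weights k) = {aWt}"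
  "written_regs clear = {13}" "written_arrays clear = {aG, aAcc}" "nocoin clear"
  "written_regs (item1 k) = {17, 18, 19, 47, 48, 49, 50, 54}" "written_arrays (item1 k) = {}" "nocoin (item1 k)"
  "written_regs (item k) = {13, 17, 18, 19, 47, 48, 49, 50, 54}" "written_arrays (item k) = {aH, aG}" "nocoin (item k)"
  "written_regs (gen k) = {13, 14, 15, 16, 17, 18, 19, 47, 48, 49, 50, 54}" "written_arrays (gen k) = {aH, aG}" "nocoin (gen k)"
  by (auto simp: weights_def clear_def item1_def item_def gen_def)

text \<open>The weights stay a parameter, because every repetition instantiates the locale with the
  weights from its own coins. \<open>iv\<close> is the inverse of 2, and \<open>card_J\<close> is
  what bounds the cost of the logarithmic derivative.\<close>

locale prog = hl U xs + gf k lam J z w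
  for U xs k lam J z w +
  fixes n t c \<sigma> p iv goal :: nat
  assumes k1: "1 \<le> k" and t1: "1 \<le> t" and c1: "1 \<le> c"
    and lam: "\<And>d. lam d = (if d < k then c else t)"
    and J: "J = {j. j < n \<and> z j \<le> t}"
    and card_J: "\<And>m. card (J \<inter> {..<m}) \<le> t"
    and inp: "length xs = 2 + 2 * k + n" "\<And>j. j < n \<Longrightarrow> xs ! (2 + 2 * k + j) = z j"
    and prime: "prime p" and pN: "2 ^ \<sigma> < p" and s2: "2 \<le> \<sigma>"
    and DN: "W (2 * k) \<le> 2 ^ \<sigma>"
    and iv: "[int iv * 2 = 1] (mod int p)"
    and U: "p < U" "16 * (k + 1) * (\<sigma> + 1) * (2 ^ \<sigma> * 2 ^ \<sigma>) < U" "(n + 1) * (k + 1) < U" "length xs < U"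
begin

abbreviation Nz :: nat where "Nz \<equiv> 2 ^ \<sigma>"

text \<open>The part of the state that the setup produces and the repetitions only read.\<close>

definition stat :: "store \<Rightarrow> arrays \<Rightarrow> bool" where
  "stat s A \<longleftrightarrow> s rN = n \<and> s rTm = t \<and> s rCm = c \<and> s rSize = Nz \<and> s rLog = \<sigma> \<and> s rGoal = goal \<and> s rYk = W k \<and>
     s rD = W (2 * k) \<and> s rP = p \<and> s rInv2 = iv \<and> (\<forall>i\<le>\<sigma>. A aPw i = 2 ^ i) \<and>
     (\<forall>d<2 * k. A aW d = W d \<and> A aBs d = \<beta> d \<and> A aLm d = lam d) \<and>
     (\<forall>x. 0 < x \<and> x < Nz \<longrightarrow> [int (A aInv x) * int x = 1] (mod int p))"

lemma stat_cong:
  "stat s A \<Longrightarrow> (\<And>y. y \<in> {1, 3, 4, 5, 6, 7, 8, 10, 11, 12} \<Longrightarrow> s' y = s y) \<Longrightarrow> (\<And>j. j \<in> {3, 4, 5, 6, 8} \<Longrightarrow> A' j = A j) \<Longrightarrow> stat s' A'"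
  by (simp add: stat_def)

lemma Ubounds: "1 < U" "2 < U" "Nz < U" "k * (Nz * Nz) < U" "\<sigma> < U" "2 * k < U" "2 * Nz < U" "16 * \<sigma> * 2 ^ \<sigma> < U"
    "n < U" "n * k < U" "k < U" "2 * (Nz * Nz) < U"
proof -
  let ?X = "Nz * Nz"
  have N1: "1 \<le> Nz" by simp
  then have "Nz * 1 \<le> ?X" by (intro mult_le_mono2)
  then have NX: "Nz \<le> ?X" by simp
  have s: "\<sigma> < Nz" by (rule less_exp)
  have B: "16 * (k + 1) * (\<sigma> + 1) * ?X = 16 * (k * \<sigma> * ?X) + 16 * (k * ?X) + 16 * (\<sigma> * ?X) + 16 * ?X" by (simp add: algebra_simps)
  have a: "\<sigma> * Nz \<le> \<sigma> * ?X" "k * 1 \<le> k * ?X" using NX N1 by (intro mult_le_mono2; linarith)+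
  show "1 < U" "2 < U" "Nz < U" "k * (Nz * Nz) < U" "\<sigma> < U" "2 * k < U" "2 * Nz < U" "16 * \<sigma> * 2 ^ \<sigma> < U" "k < U" "2 * (Nz * Nz) < U"
    using U(2) B NX N1 s a by (simp_all only: mult.assoc)
  show "n < U" "n * k < U" using U(3) by (simp_all add: algebra_simps)
qed

lemma lam_y: "d < k \<Longrightarrow> lam d = c" and lam_x: "k \<le> d \<Longrightarrow> lam d = t"
  by (simp_all only: lam) simp_all

lemma \<beta>_y: "d < k \<Longrightarrow> \<beta> d = 2 * c + 2" and \<beta>_x: "k \<le> d \<Longrightarrow> \<beta> d = 2 * t + 2"
  by (simp_all add: \<beta>_def lam_y lam_x)

lemma p0: "0 < p" using prime by (simp add: prime_gt_0_nat)

lemma wp_weights: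
  assumes st: "stat s A" and bs: "n * k * \<sigma> \<le> length bs"
  shows "wp (weights k) (\<lambda>s' A' bs' t'. (\<forall>v<n * k. A' aWt v = bval (take \<sigma> (drop (v * \<sigma>) bs))) \<and>
    bs' = drop (n * k * \<sigma>) bs \<and> t' \<le> tt + n * k * (\<sigma> * 4 + 8) + 3) s A bs tt"
  unfolding weights_def
proof (rule wp_For[where n = "n * k" and I = "\<lambda>i s' A' bs' t'. (\<forall>v<i. A' aWt v = bval (take \<sigma> (drop (v * \<sigma>) bs))) \<and>
    bs' = drop (i * \<sigma>) bs \<and> t' \<le> tt + i * (\<sigma> * 4 + 8) + 1"])
  fix i s' A' bs' t'
  let ?in = "For ru \<acute>rLog (Coin 18 ;; 17 ::= #2 [*] \<acute>17 [+] \<acute>18)"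
  assume i: "i < n * k" "s' rj = i" and I: "(\<forall>v<i. A' aWt v = bval (take \<sigma> (drop (v * \<sigma>) bs))) \<and>
    bs' = drop (i * \<sigma>) bs \<and> t' \<le> tt + i * (\<sigma> * 4 + 8) + 1"
    and f: "frame (For rj (\<acute>rN [*] #k) (17 ::= #0 ;; ?in ;; Sto aWt \<acute>rj \<acute>17)) s A bs s' A' bs'"
  have st': "s' rLog = \<sigma>" using st f by (simp add: stat_def frame_def)
  have "(i + 1) * \<sigma> \<le> n * k * \<sigma>" using i by (intro mult_right_mono) auto
  then have len: "\<sigma> \<le> length bs'" using I bs by simp
  have "wp ?in (\<lambda>s2 A2 bs2 t2. s2 17 = bval (take \<sigma> bs') \<and> bs2 = drop \<sigma> bs' \<and> A2 = A' \<and> t2 \<le> t' + 2 + \<sigma> * 4 + 2)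
    (s'(17 := 0)) A' bs' (t' + 2)"
  proof (rule wp_For[where n = \<sigma> and I = "\<lambda>q s2 A2 bs2 t2. s2 17 = bval (take q bs') \<and> bs2 = drop q bs' \<and> A2 = A' \<and> t2 \<le> t' + 2 + q * 4 + 1"])
    fix q t2 :: nat and s2 :: store and A2 :: arrays and bs2 :: "bool list"
    assume q: "q < \<sigma>" and I2: "s2 17 = bval (take q bs') \<and> bs2 = drop q bs' \<and> A2 = A' \<and> t2 \<le> t' + 2 + q * 4 + 1"
    have d: "drop q bs' = (bs' ! q) # drop (Suc q) bs'" "take (Suc q) bs' = take q bs' @ [bs' ! q]"
      using q len by (simp_all add: Cons_nth_drop_Suc take_Suc_conv_app_nth)
    have "bval (take (Suc q) bs') < 2 ^ length (take (Suc q) bs')" by (rule bval_less)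
    also have "length (take (Suc q) bs') \<le> \<sigma>" using q by simp
    then have "2 ^ length (take (Suc q) bs') \<le> Nz" by (intro power_increasing) auto
    finally have "2 * bval (take q bs') + of_bool (bs' ! q) < U" using Ubounds by (simp add: d(2) bval_snoc)
    then show "wp (Coin 18 ;; 17 ::= #2 [*] \<acute>17 [+] \<acute>18)
      (\<lambda>s2 A2 bs2 t2. (s2(ru := Suc q)) 17 = bval (take (Suc q) bs') \<and> bs2 = drop (Suc q) bs' \<and> A2 = A' \<and> t2 + 1 \<le> t' + 2 + Suc q * 4 + 1) s2 A2 bs2 (t2 + 1)"
      using I2 by (simp add: d bval_snoc)
  qed (use st' Ubounds in \<open>auto simp: frame_def bval_def\<close>)
  then have w: "wp ?in (\<lambda>s2 A2 bs2 t2. s2 17 = bval (take \<sigma> bs') \<and> bs2 = drop \<sigma> bs' \<and> A2 = A' \<and> t2 \<le> t' + 2 + \<sigma> * 4 + 2)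
    (s'(17 := 0)) A' bs' (t' + 2)" .
  have "bval (take \<sigma> bs') < 2 ^ length (take \<sigma> bs')" by (rule bval_less)
  then have v: "bval (take \<sigma> bs') < U" using len Ubounds by simp
  have "wp (?in ;; Sto aWt \<acute>rj \<acute>17) (\<lambda>s2 A2 bs2 t2. (\<forall>v<Suc i. A2 aWt v = bval (take \<sigma> (drop (v * \<sigma>) bs))) \<and>
    bs2 = drop (Suc i * \<sigma>) bs \<and> t2 + 1 \<le> tt + Suc i * (\<sigma> * 4 + 8) + 1) (s'(17 := 0)) A' bs' (t' + 2)"
    by (rule wp_SeqI[OF w]) (use I i v in \<open>auto simp: frame_def less_Suc_eq add.commute\<close>)
  then show "wp (17 ::= #0 ;; ?in ;; Sto aWt \<acute>rj \<acute>17) (\<lambda>s2 A2 bs2 t2. (\<forall>v<Suc i. A2 aWt v = bval (take \<sigma> (drop (v * \<sigma>) bs))) \<and>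
    bs2 = drop (Suc i * \<sigma>) bs \<and> t2 + 1 \<le> tt + Suc i * (\<sigma> * 4 + 8) + 1) s' A' bs' (t' + 1)"
    using Ubounds by simp
qed (use st Ubounds in \<open>auto simp: frame_def stat_def\<close>)

lemma wp_clear:
  assumes st: "stat s A"
  shows "wp clear (\<lambda>s' A' bs' t'. (\<forall>x<Nz. A' aG x = 0 \<and> A' aAcc x = 0) \<and> t' \<le> tt + Nz * 4 + 3) s A bs tt"
  unfolding clear_def
  by (rule wp_For[where n = Nz and I = "\<lambda>i s' A' bs' t'. (\<forall>x<i. A' aG x = 0 \<and> A' aAcc x = 0) \<and> t' \<le> tt + i * 4 + 1"])
    (use st Ubounds in \<open>auto simp: frame_def stat_def less_Suc_eq\<close>)

lemma W_le: "d \<le> 2 * k \<Longrightarrow> W d \<le> W (2 * k)"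
  using radix_dvd[of d "2 * k" \<beta>] W_pos by (intro dvd_imp_le) auto

lemma radix_beta_const: "m \<le> k \<Longrightarrow> W m = (2 * c + 2) ^ m" "W (k + i) = (2 * c + 2) ^ k * (2 * t + 2) ^ i"
proof -
  show a: "m \<le> k \<Longrightarrow> W m = (2 * c + 2) ^ m" for m
    by (induction m) (simp_all add: radix_Suc \<beta>_y)
  show "W (k + i) = (2 * c + 2) ^ k * (2 * t + 2) ^ i"
  proof (induction i)
    case (Suc i)
    have "W (k + Suc i) = W (k + i) * \<beta> (k + i)" by (simp add: radix_Suc)
    then show ?case by (simp only: Suc \<beta>_x le_add1 power_Suc2 mult.assoc)
  qed (simp add: a)
qed

lemma W2k: "W (2 * k) = (2 * c + 2) ^ k * (2 * t + 2) ^ k"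
  using radix_beta_const(2)[of k] by (simp add: mult_2)

lemma digits_le_W: "(2 * c + 2) * (2 * t + 2) \<le> W (2 * k)"
proof -
  have "(2 * c + 2) ^ 1 \<le> (2 * c + 2) ^ k" "(2 * t + 2) ^ 1 \<le> (2 * t + 2) ^ k"
    using k1 by (intro power_increasing; simp)+
  then show ?thesis unfolding W2k by (metis mult_le_mono power_one_right)
qed

definition cdpart :: "nat \<Rightarrow> nat \<Rightarrow> nat \<Rightarrow> nat" where
  "cdpart j u m = (\<Sum>i<m. dgt \<beta> u i * sc j i)"

lemma cd_ku: "cd (ku j u) = cdpart j u k"
proof -
  have "cd (ku j u) = (\<Sum>d<k. ku j u d * W d) + (\<Sum>d=k..<2 * k. ku j u d * W d)"
    unfolding code_def lessThan_atLeast0 by (rule sum.atLeastLessThan_concat[symmetric]) auto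
  also have "(\<Sum>d=k..<2 * k. ku j u d * W d) = (\<Sum>d<k. ku j u (d + k) * W (d + k))"
    using sum.shift_bounds_nat_ivl[of "\<lambda>d. ku j u d * W d" 0 k k] by (simp add: lessThan_atLeast0 mult_2)
  also have "(\<Sum>d<k. ku j u d * W d) + \<dots> = cdpart j u k"
    unfolding cdpart_def sum.distrib[symmetric]
    by (intro sum.cong refl) (simp add: ku_def sc_def algebra_simps)
  finally show ?thesis .
qed

lemma vk_ku: "vk (ku j u) \<longleftrightarrow> (\<forall>i<k. dgt \<beta> u i \<le> c \<and> dgt \<beta> u i * z j \<le> t)"
proof
  assume v: "vk (ku j u)"
  show "\<forall>i<k. dgt \<beta> u i \<le> c \<and> dgt \<beta> u i * z j \<le> t"
  proof (intro allI impI)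
    fix i assume i: "i < k"
    have "ku j u i \<le> lam i" "ku j u (i + k) \<le> lam (i + k)" using v i by (simp_all add: vk_def)
    then show "dgt \<beta> u i \<le> c \<and> dgt \<beta> u i * z j \<le> t" using i by (simp add: ku_def lam_x lam_y)
  qed
next
  assume a: "\<forall>i<k. dgt \<beta> u i \<le> c \<and> dgt \<beta> u i * z j \<le> t"
  have "ku j u d \<le> lam d" if "d < 2 * k" for d
  proof (cases "d < k")
    case False
    then have "d - k < k" using that by simp
    then show ?thesis using a False that by (simp add: ku_def lam_x)
  qed (use a in \<open>simp add: ku_def lam_y\<close>)
  then show "vk (ku j u)" by (simp add: vk_def ku_def)
qed

text \<open>The code of a monomial is summed up even after the monomial has turned out to be
  invalid, and may then leave the table. Each summand is still at most \<open>Nz * Nz\<close>, which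
  is one reason for the size required of \<open>U\<close>.\<close>

lemma sc_bound: "i < k \<Longrightarrow> z j \<le> t \<Longrightarrow> dgt \<beta> u i * sc j i \<le> Nz * Nz" "i < k \<Longrightarrow> z j \<le> t \<Longrightarrow> sc j i \<le> Nz * Nz"
proof -
  assume i: "i < k" and z: "z j \<le> t"
  have "sc j i \<le> W (2 * k) + t * W (2 * k)" unfolding sc_def using i z W_le by (intro add_mono mult_mono) auto
  then have s: "sc j i \<le> (t + 1) * W (2 * k)" by simp
  have "dgt \<beta> u i \<le> 2 * c + 2" using dgt_less[of u i] i by (simp add: \<beta>_def lam_y)
  then have "dgt \<beta> u i * sc j i \<le> (2 * c + 2) * ((t + 1) * W (2 * k))" using s by (rule mult_le_mono)
  also have "\<dots> \<le> ((2 * c + 2) * (2 * t + 2)) * W (2 * k)"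
    unfolding mult.assoc[symmetric] by (intro mult_le_mono) auto
  also have "\<dots> \<le> Nz * Nz" using digits_le_W DN by (intro mult_le_mono) linarith+
  finally show "dgt \<beta> u i * sc j i \<le> Nz * Nz" .
  have "sc j i \<le> (2 * c + 2) * (2 * t + 2) * W (2 * k)"
  proof -
    have "(t + 1) * W (2 * k) \<le> (2 * c + 2) * (2 * t + 2) * W (2 * k)" by (intro mult_right_mono) auto
    then show ?thesis using s by linarith
  qed
  also have "\<dots> \<le> Nz * Nz" using digits_le_W DN by (intro mult_le_mono) linarith+
  finally show "sc j i \<le> Nz * Nz" .
qed

lemma wp_item:
  assumes st: "stat s A" and j: "s rj = j" "j < n" and zj: "s rz' = z j" "z j \<le> t" and u: "s ru = u" "u < W k"
    and wt: "\<And>v. v < n * k \<Longrightarrow> rz p (A aWt v) (w v)" and H: "\<And>u'. u' < u \<Longrightarrow> rz p (A aH u') (h j u')"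
    and G: "\<And>x. x < Nz \<Longrightarrow> rz p (A aG x) (Y x)"
  shows "wp (item k) (\<lambda>s' A' bs' t'. (\<forall>u'\<le>u. rz p (A' aH u') (h j u')) \<and>
     (\<forall>x<Nz. rz p (A' aG x) (Y x + (if vk (ku j u) \<and> cd (ku j u) = x then g j u else 0))) \<and> t' \<le> tt + 20 * k + 20) s A bs tt"
  unfolding item_def
proof (rule wp_SeqI)
  let ?hm = "\<lambda>m. (if u = 0 then 1 else 0) - (\<Sum>i<m. if 0 < dgt \<beta> u i then w (j * k + i) * h j (u - W i) else 0)"
  let ?gm = "\<lambda>m. \<Sum>i<m. if 0 < dgt \<beta> u i then int (sc j i) * w (j * k + i) * h j (u - W i) else 0"
  let ?ok = "\<lambda>m. \<forall>i<m. dgt \<beta> u i \<le> c \<and> dgt \<beta> u i * z j \<le> t"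
  let ?c1 = "17 ::= #1 [-] \<acute>ru ;; 18 ::= #0 ;; 19 ::= #0 ;; 47 ::= #1"
  have p1: "1 < p" using prime by (rule prime_gt_1_nat)
  \<comment> \<open>By truncated subtraction \<open>1 - u\<close> is the indicator of
    \<open>u = 0\<close>.\<close>
  have r0: "rz p (1 - u) (?hm 0)" using p1 by (cases "u = 0") (auto simp: rz_def)
  show "wp ?c1 (\<lambda>s' A' bs' t'. s' 17 = 1 - u \<and> s' 18 = 0 \<and> s' 19 = 0 \<and> s' 47 = 1 \<and> A' = A \<and> t' \<le> tt + 4) s A bs tt"
    using u Ubounds by simp
  fix s1 A1 bs1 t1
  assume P1: "s1 17 = 1 - u \<and> s1 18 = 0 \<and> s1 19 = 0 \<and> s1 47 = 1 \<and> A1 = A \<and> t1 \<le> tt + 4" and f1: "frame ?c1 s A bs s1 A1 bs1"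
  have st1: "stat s1 A" by (rule stat_cong[OF st]) (use f1 in \<open>auto simp: frame_def\<close>)
  have f1': "s1 rj = j" "s1 rz' = z j" "s1 ru = u" using f1 j zj u by (simp_all add: frame_def)
  let ?Q = "\<lambda>s' A' bs' t'. (\<forall>u'\<le>u. rz p (A' aH u') (h j u')) \<and>
     (\<forall>x<Nz. rz p (A' aG x) (Y x + (if vk (ku j u) \<and> cd (ku j u) = x then g j u else 0))) \<and> t' \<le> tt + 20 * k + 20"
  show "wp (For ri #k (item1 k) ;; Sto aH \<acute>ru \<acute>17 ;; CIf \<acute>47 (Sto aG \<acute>19 ((Ld aG \<acute>19 [+] \<acute>18) [mod] \<acute>rP)) skip) ?Q s1 A1 bs1 t1"
  proof (rule wp_SeqI)
    show "wp (For ri #k (item1 k)) (\<lambda>s' A' bs' t'. rz p (s' 17) (?hm k) \<and> rz p (s' 18) (?gm k) \<and> s' 19 = cdpart j u k \<and>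
       (s' 47 = (if ?ok k then 1 else 0)) \<and> A' = A \<and> t' \<le> t1 + k * 16 + 3) s1 A1 bs1 t1"
    proof (rule wp_For[where n = k and I = "\<lambda>m s' A' bs' t'. rz p (s' 17) (?hm m) \<and> rz p (s' 18) (?gm m) \<and> s' 19 = cdpart j u m \<and>
       (s' 47 = (if ?ok m then 1 else 0)) \<and> A' = A \<and> t' \<le> t1 + m * 16 + 1"])
      show "rz p ((s1(ri := 0)) 17) (?hm 0) \<and> rz p ((s1(ri := 0)) 18) (?gm 0) \<and> (s1(ri := 0)) 19 = cdpart j u 0 \<and>
       ((s1(ri := 0)) 47 = (if ?ok 0 then 1 else 0)) \<and> A1 = A \<and> t1 + 1 \<le> t1 + 0 * 16 + 1"
        using P1 r0 p0 by (simp add: rz_zero cdpart_def)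
    next
      fix m s' A' bs' t'
      assume m: "m < k" "s' ri = m" and I: "rz p (s' 17) (?hm m) \<and> rz p (s' 18) (?gm m) \<and> s' 19 = cdpart j u m \<and>
       (s' 47 = (if ?ok m then 1 else 0)) \<and> A' = A \<and> t' \<le> t1 + m * 16 + 1"
        and f: "frame (For ri #k (item1 k)) s1 A1 bs1 s' A' bs'"
      have st': "stat s' A" by (rule stat_cong[OF st1]) (use f in \<open>auto simp: frame_def\<close>)
      have f': "s' rj = j" "s' rz' = z j" "s' ru = u" using f f1' by (simp_all add: frame_def)
      define a where "a = dgt \<beta> u m"
      have "a \<le> u" unfolding a_def dgt_def by (rule le_trans[OF mod_less_eq_dividend div_le_dividend])
      then have aU: "a < U" using u(2) W_le[of k] DN Ubounds(3) by linarith
      have tabs: "A aW m = W m" "A aBs m = \<beta> m" "A aW (k + m) = W (k + m)" using st m by (simp_all add: stat_def)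
      have a_eq: "u div W m mod \<beta> m = a" by (simp add: a_def dgt_def)
      have sc_eq: "W m + z j * W (k + m) = sc j m" by (simp add: sc_def)
      have sb: "sc j m < U" using sc_bound(2)[OF m(1) zj(2)] Ubounds by linarith
      have "cdpart j u (Suc m) \<le> (\<Sum>i<Suc m. Nz * Nz)" unfolding cdpart_def
        using sc_bound(1)[OF _ zj(2)] m by (intro sum_mono) auto
      also have "\<dots> \<le> k * (Nz * Nz)" 
      proof -
        have "(\<Sum>i<Suc m. Nz * Nz) = Suc m * (Nz * Nz)" by simp
        also have "\<dots> \<le> k * (Nz * Nz)" using m by (intro mult_right_mono) auto
        finally show ?thesis .
      qed
      finally have cb: "cdpart j u m + a * sc j m < U" using Ubounds by (simp add: cdpart_def a_def)
      have reg: "s' rP = p" "s' rCm = c" "s' rTm = t" using st' by (simp_all add: stat_def)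
      have jk: "j * k + m < n * k" using blk_less[OF j(2) m(1)] .
      have q: "rz p ((A aWt (j * k + m) * A aH (u - W m)) mod p) (w (j * k + m) * h j (u - W m))" if "0 < a"
        using dgt_pos[of u m] that W_pos[of m] unfolding a_def by (intro rz_mult wt jk H) auto
      have q1: "rz p ((s' 17 + (p - (A aWt (j * k + m) * A aH (u - W m)) mod p)) mod p) (?hm (Suc m))" if "0 < a"
        using rz_sub[OF conjunct1[OF I] q[OF that]] that by (simp add: a_def[symmetric] algebra_simps)
      \<comment> \<open>\<open>sc j m\<close> may exceed \<open>p\<close>, whereas \<open>rz\<close>
        speaks of reduced numbers; it therefore enters through its residue.\<close>
      have scz: "rz p (sc j m mod p) (int (sc j m))" using p0 by (simp add: rz_def cong_def zmod_int)
      have "rz p ((s' 18 + ((sc j m mod p) * ((A aWt (j * k + m) * A aH (u - W m)) mod p)) mod p) mod p)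
          (?gm m + int (sc j m) * (w (j * k + m) * h j (u - W m)))" if "0 < a"
        using I by (intro rz_add rz_mult scz q that) simp
      then have q2: "rz p ((s' 18 + sc j m * ((A aWt (j * k + m) * A aH (u - W m)) mod p)) mod p) (?gm (Suc m))" if "0 < a"
        using that by (simp add: a_def[symmetric] mod_add_right_eq mod_mult_left_eq mult.assoc)
      have z1: "?hm (Suc m) = ?hm m" "?gm (Suc m) = ?gm m" if "a = 0" using that by (simp_all add: a_def)
      have ok: "?ok (Suc m) \<longleftrightarrow> ?ok m \<and> a \<le> c \<and> a * z j \<le> t" by (auto simp: less_Suc_eq a_def)
      have cdS: "cdpart j u (Suc m) = cdpart j u m + a * sc j m" by (simp add: cdpart_def a_def)
      have lU: "x mod p < U" for x using mod_less_bound'[OF p0 U(1)] .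
      show "wp (item1 k) (\<lambda>s2 A2 bs2 t2. rz p ((s2(ri := Suc m)) 17) (?hm (Suc m)) \<and> rz p ((s2(ri := Suc m)) 18) (?gm (Suc m)) \<and>
          (s2(ri := Suc m)) 19 = cdpart j u (Suc m) \<and> ((s2(ri := Suc m)) 47 = (if ?ok (Suc m) then 1 else 0)) \<and> A2 = A \<and>
          t2 + 1 \<le> t1 + Suc m * 16 + 1) s' A' bs' (t' + 1)"
      proof (cases "a = 0")
        case True
        then show ?thesis
          unfolding item1_def ok cdS skip_def z1[OF True]
          using I m(2) f' reg tabs a_eq sc_eq sb cb aU Ubounds(1) by simp
      next
        case False
        then have a: "0 < a" by simp
        show ?thesis
          unfolding item1_def ok cdS skip_def
          using I m(2) f' reg tabs a_eq sc_eq sb cb aU Ubounds(1) lU a q1[OF a] q2[OF a] by (simp add: not_le)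
      qed
    qed (use Ubounds in simp_all)
  next
    fix s2 A2 bs2 t2
    assume P2: "rz p (s2 17) (?hm k) \<and> rz p (s2 18) (?gm k) \<and> s2 19 = cdpart j u k \<and>
       (s2 47 = (if ?ok k then 1 else 0)) \<and> A2 = A \<and> t2 \<le> t1 + k * 16 + 3"
      and f2: "frame (For ri #k (item1 k)) s1 A1 bs1 s2 A2 bs2"
    have f2': "s2 ru = u" "s2 rP = p" using f2 f1' st1 by (simp_all add: frame_def stat_def)
    have hk: "?hm k = h j u" by (subst (2) h.simps) simp
    have gk: "?gm k = g j u" by (simp add: g_def)
    have "s2 17 < U" using P2 U rz_less by (meson less_trans)
    moreover have "rz p ((A aG (cdpart j u k) + s2 18) mod p) (Y (cdpart j u k) + g j u)" if "?ok k"
    proof -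
      have "okc (cdpart j u k)" using vk_cd[of "ku j u"] that by (simp add: vk_ku cd_ku)
      then have "cdpart j u k < Nz" using DN by (simp add: okc_def)
      then show ?thesis using rz_add[OF G] P2 gk by simp
    qed
    moreover have "x mod p < U" for x using mod_less_bound'[OF p0 U(1)] .
    ultimately show "wp (Sto aH \<acute>ru \<acute>17 ;; CIf \<acute>47 (Sto aG \<acute>19 ((Ld aG \<acute>19 [+] \<acute>18) [mod] \<acute>rP)) skip) ?Q s2 A2 bs2 t2"
      using P2 f2' P1 H G hk Ubounds(1) unfolding vk_ku cd_ku skip_def by (auto simp: le_less)
  qed
qed

text \<open>Every item costs a constant, and only the at most \<open>t\<close> items in
  \<open>J\<close> cost another \<open>W k\<close> rounds; this keeps \<open>n\<close> and the table
  size additive in the running time.\<close>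

lemma wp_gen:
  assumes st: "stat s A" and wt: "\<And>v. v < n * k \<Longrightarrow> rz p (A aWt v) (w v)" and G: "\<And>x. x < Nz \<Longrightarrow> A aG x = 0"
  shows "wp (gen k) (\<lambda>s' A' bs' t'. (\<forall>x<Nz. rz p (A' aG x) (Gc x)) \<and> t' \<le> tt + n * 8 + t * W k * (20 * k + 26) + 3) s A bs tt"
proof -
  define cost where "cost = W k * (20 * k + 26)"
  define Y where "Y m x = (\<Sum>j\<in>J \<inter> {..<m}. \<Sum>u<W k. if vk (ku j u) \<and> cd (ku j u) = x then g j u else 0)" for m x
  have Y0: "Y 0 x = 0" for x by (simp add: Y_def)
  have YS: "Y (Suc m) x = (if m \<in> J then Y m x + (\<Sum>u<W k. if vk (ku m u) \<and> cd (ku m u) = x then g m u else 0) else Y m x)" for m x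
  proof -
    have "J \<inter> {..<Suc m} = (if m \<in> J then insert m (J \<inter> {..<m}) else J \<inter> {..<m})" by (auto simp: less_Suc_eq)
    then show ?thesis using finJ by (simp add: Y_def add.commute)
  qed
  have Yn: "Y n x = Gc x" for x
  proof -
    have "J \<inter> {..<n} = J" unfolding J by auto
    then show ?thesis by (simp add: Y_def Gc_def)
  qed
  let ?cnt = "\<lambda>m. card (J \<inter> {..<m})"
  have cntS: "?cnt (Suc m) = (if m \<in> J then Suc (?cnt m) else ?cnt m)" for m
  proof -
    have "J \<inter> {..<Suc m} = (if m \<in> J then insert m (J \<inter> {..<m}) else J \<inter> {..<m})" by (auto simp: less_Suc_eq)
    then show ?thesis using finJ by simp
  qed
  let ?body = "Inp rz' (#(2 + 2 * k) [+] \<acute>rj) ;; CIf (\<acute>rz' [-] \<acute>rTm) skip (For ru \<acute>rYk (item k))"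
  have "wp (gen k) (\<lambda>s' A' bs' t'. (\<forall>x<Nz. rz p (A' aG x) (Y n x)) \<and> t' \<le> tt + n * 8 + ?cnt n * cost + 3) s A bs tt"
    unfolding gen_def
  proof (rule wp_For[where n = n and I = "\<lambda>m s' A' bs' t'. (\<forall>x<Nz. rz p (A' aG x) (Y m x)) \<and> t' \<le> tt + m * 8 + ?cnt m * cost + 1"])
    fix m s' A' bs' t'
    assume m: "m < n" "s' rj = m" and I: "(\<forall>x<Nz. rz p (A' aG x) (Y m x)) \<and> t' \<le> tt + m * 8 + ?cnt m * cost + 1"
      and f: "frame (For rj \<acute>rN ?body) s A bs s' A' bs'"
    have st': "stat s' A'" by (rule stat_cong[OF st]) (use f in \<open>auto simp: frame_def\<close>)
    have wt': "A' aWt = A aWt" using f by (simp add: frame_def)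
    let ?R = "\<lambda>s2 A2 bs2 t2. (\<forall>x<Nz. rz p (A2 aG x) (Y (Suc m) x)) \<and> t2 + 1 \<le> tt + Suc m * 8 + ?cnt (Suc m) * cost + 1"
    show "wp ?body ?R s' A' bs' (t' + 1)"
    proof (cases "z m \<le> t")
      case False
      then have "m \<notin> J" by (simp add: J)
      then have "t' + 5 \<le> tt + Suc m * 8 + ?cnt (Suc m) * cost + 1" using I cntS by simp
      then show ?thesis using False m st' I inp U Ubounds \<open>m \<notin> J\<close> YS by (simp add: stat_def skip_def)
    next
      case True
      then have mJ: "m \<in> J" using m by (simp add: J)
      define s1 where "s1 = s'(rz' := z m)"
      have st1: "stat s1 A'" by (rule stat_cong[OF st']) (auto simp: s1_def)
      have r1: "s1 rj = m" "s1 rz' = z m" using m by (simp_all add: s1_def)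
      let ?Yu = "\<lambda>v x. Y m x + (\<Sum>u<v. if vk (ku m u) \<and> cd (ku m u) = x then g m u else 0)"
      have "wp (For ru \<acute>rYk (item k)) (\<lambda>s2 A2 bs2 t2. (\<forall>x<Nz. rz p (A2 aG x) (?Yu (W k) x)) \<and> t2 \<le> t' + 3 + W k * (20 * k + 26) + 3) s1 A' bs' (t' + 3)"
      proof (rule wp_For[where n = "W k" and I = "\<lambda>v s2 A2 bs2 t2. (\<forall>u<v. rz p (A2 aH u) (h m u)) \<and>
          (\<forall>x<Nz. rz p (A2 aG x) (?Yu v x)) \<and> t2 \<le> t' + 3 + v * (20 * k + 26) + 1"])
        show "W k < U" using W_le[of k] DN Ubounds(3) by linarith
      next
        fix v s2 A2 bs2 t2
        assume v: "v < W k" "s2 ru = v" and I2: "(\<forall>u<v. rz p (A2 aH u) (h m u)) \<and>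
          (\<forall>x<Nz. rz p (A2 aG x) (?Yu v x)) \<and> t2 \<le> t' + 3 + v * (20 * k + 26) + 1"
          and f2: "frame (For ru \<acute>rYk (item k)) s1 A' bs' s2 A2 bs2"
        have st2: "stat s2 A2" by (rule stat_cong[OF st1]) (use f2 in \<open>auto simp: frame_def\<close>)
        have f2': "s2 rj = m" "s2 rz' = z m" "A2 aWt = A aWt" using f2 r1 wt' by (simp_all add: frame_def)
        have "wp (item k) (\<lambda>s3 A3 bs3 t3. (\<forall>u'\<le>v. rz p (A3 aH u') (h m u')) \<and>
          (\<forall>x<Nz. rz p (A3 aG x) (?Yu v x + (if vk (ku m v) \<and> cd (ku m v) = x then g m v else 0))) \<and> t3 \<le> t2 + 1 + 20 * k + 20) s2 A2 bs2 (t2 + 1)"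
          by (rule wp_item[OF st2 f2'(1) m(1) f2'(2) True v(2,1)]) (use I2 f2' wt in auto)
        then show "wp (item k) (\<lambda>s3 A3 bs3 t3. (\<forall>u<Suc v. rz p (A3 aH u) (h m u)) \<and>
          (\<forall>x<Nz. rz p (A3 aG x) (?Yu (Suc v) x)) \<and> t3 + 1 \<le> t' + 3 + Suc v * (20 * k + 26) + 1) s2 A2 bs2 (t2 + 1)"
          by (rule wp_mono) (use I2 in \<open>auto simp: less_Suc_eq_le add.assoc\<close>)
      next
        fix s2 A2 bs2 assume "frame (For ru \<acute>rYk (item k)) s1 A' bs' s2 A2 bs2"
        then show "aval \<acute>rYk s2 A2 = W k" using st1 by (simp add: frame_def stat_def)
      qed (use I in auto)
      then have "wp (For ru \<acute>rYk (item k)) ?R s1 A' bs' (t' + 3)"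
        by (rule wp_mono) (use I mJ YS cntS in \<open>auto simp: cost_def\<close>)
      then show ?thesis using True m st' inp U Ubounds by (simp add: stat_def s1_def numeral_3_eq_3)
    qed
  next
    fix s' A' bs' assume "frame (For rj \<acute>rN ?body) s A bs s' A' bs'"
    then show "aval \<acute>rN s' A' = n" using st by (simp add: frame_def stat_def)
  qed (use st Ubounds G Y0 p0 in \<open>auto simp: stat_def rz_zero\<close>)
  then show ?thesis
  proof (rule wp_mono)
    fix s' A' bs' t'
    assume a: "(\<forall>x<Nz. rz p (A' aG x) (Y n x)) \<and> t' \<le> tt + n * 8 + ?cnt n * cost + 3"
    have "?cnt n * cost \<le> t * cost" using card_J by (intro mult_right_mono) auto
    then have "t' \<le> tt + n * 8 + t * cost + 3" using a by linarith
    then show "(\<forall>x<Nz. rz p (A' aG x) (Gc x)) \<and> t' \<le> tt + n * 8 + t * W k * (20 * k + 26) + 3"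
      using a by (simp add: Yn cost_def mult.assoc)
  qed
qed

end

subsection \<open>Online solution of the recurrence\<close>

text \<open>Register 51 is the current index, 52 becomes its block length, and \<open>rS1\<close>
  the logarithm of the convolution length, twice the block length.\<close>

definition val2 :: cmd where
  "val2 = (52 ::= #1 ;; rS1 ::= #1 ;; CWhile (#1 [-] (\<acute>51 [div] \<acute>52) [mod] #2) (52 ::= #2 [*] \<acute>52 ;; rS1 ::= \<acute>rS1 [+] #1))"

text \<open>The zeros above the block of \<open>F\<close> are what \<open>mulp_upper_half\<close>
  requires; the factor from \<open>G\<close> needs twice the block length, since targets and sources
  together span that many differences.\<close>

definition fill :: cmd where
  "fill = For rj (#2 [*] \<acute>52) (CIf (\<acute>52 [-] \<acute>rj) (Sto aS \<acute>rj (Ld aF (\<acute>51 [-] \<acute>52 [+] \<acute>rj))) (Sto aS \<acute>rj #0) ;;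
     Sto aS (#2 [*] \<acute>52 [+] \<acute>rj) (Ld aG \<acute>rj))"

text \<open>Only the upper half of the product is free of wrapped terms, and it belongs to the
  targets from index 51 on. Multiplication by \<open>rSc\<close> removes the scale.\<close>

definition addback :: cmd where
  "addback = For rj \<acute>52 (Sto aAcc (\<acute>51 [+] \<acute>rj) ((Ld aAcc (\<acute>51 [+] \<acute>rj) [+] \<acute>rSc [*] Ld aS (\<acute>52 [+] \<acute>rj)) [mod] \<acute>rP))"

text \<open>\<open>Fc_rec\<close> is available at valid codes only; elsewhere \<open>F\<close> has
  to be zero, whatever the accumulator contains.\<close>

definition valid :: "nat \<Rightarrow> cmd" where
  "valid k = (53 ::= #1 ;; For rj #(2 * k) (CIf ((\<acute>51 [div] Ld aW \<acute>rj) [mod] Ld aBs \<acute>rj [-] Ld aLm \<acute>rj) (53 ::= #0) skip) ;;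
     CIf (\<acute>rD [-] \<acute>51) skip (53 ::= #0))"

definition online1 :: "nat \<Rightarrow> cmd" where
  "online1 k = (51 ::= \<acute>ri [+] #1 ;; val2 ;; fill ;; conv ;; addback ;; valid k ;;
     CIf \<acute>53 (Sto aF \<acute>51 ((Ld aAcc \<acute>51 [*] Ld aInv \<acute>51) [mod] \<acute>rP)) (Sto aF \<acute>51 #0))"

definition online :: "nat \<Rightarrow> cmd" where
  "online k = (Sto aF #0 #1 ;; For ri (\<acute>rSize [-] #1) (online1 k))"

lemma online_frame [simp]:
  "written_regs val2 = {52, 20}" "written_arrays val2 = {}" "nocoin val2"
  "written_regs fill = {14}" "written_arrays fill = {aS}" "nocoin fill"
  "written_regs addback = {14}" "written_arrays addback = {aAcc}" "nocoin addback"
  "written_regs (valid k) = {53, 14, 54}" "written_arrays (valid k) = {}" "nocoin (valid k)"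
  by (auto simp: val2_def fill_def addback_def valid_def)

lemma online1_frame [simp]:
  "written_regs (online1 k) = written_regs conv \<union> {14, 51, 52, 53, 54}" "written_arrays (online1 k) = {0, 1, 2, aAcc, aF}" "nocoin (online1 k)"
  "written_regs (online k) = written_regs conv \<union> {13, 14, 51, 52, 53, 54}" "written_arrays (online k) = {0, 1, 2, aAcc, aF}" "nocoin (online k)"
  by (auto simp: online1_def online_def conv_frame)

lemma v2_step: "0 < i \<Longrightarrow> (i div 2 ^ q) mod 2 = 0 \<longleftrightarrow> q < v2 i" if "q \<le> v2 i"
proof -
  assume i: "0 < i"
  have "2 ^ q dvd i" using that i by (simp add: v2_ge)
  then have "2 ^ Suc q dvd i \<longleftrightarrow> 2 dvd i div 2 ^ q"
    by (metis dvd_div_iff_mult mult.commute power_Suc power_not_zero zero_neq_numeral)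
  then show ?thesis using v2_ge[OF i, of "Suc q"] by (simp add: even_iff_mod_2_eq_zero Suc_le_eq)
qed

context hl begin

lemma wp_val2:
  assumes i: "s 51 = i" "0 < i" "i < U" and U: "2 < U"
  shows "wp val2 (\<lambda>s' A' bs' t'. s' 52 = 2 ^ v2 i \<and> s' rS1 = v2 i + 1 \<and> A' = A \<and> t' \<le> t + 3 * v2 i + 3) s A bs t"
proof -
  let ?c = "52 ::= #2 [*] \<acute>52 ;; rS1 ::= \<acute>rS1 [+] #1"
  have "wp (CWhile (#1 [-] (\<acute>51 [div] \<acute>52) [mod] #2) ?c)
    (\<lambda>s' A' bs' t'. s' 52 = 2 ^ v2 i \<and> s' rS1 = v2 i + 1 \<and> A' = A \<and> t' \<le> t + 3 * v2 i + 3) (s(52 := 1, rS1 := 1)) A bs (t + 2)"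
  proof (rule wp_While[where n = "v2 i" and I = "\<lambda>q s' A' bs' t'. s' 52 = 2 ^ q \<and> s' rS1 = q + 1 \<and> A' = A \<and> t' \<le> t + 2 + 3 * q"])
    fix q s' A' bs' t'
    assume q: "q < v2 i" and I: "s' 52 = 2 ^ q \<and> s' rS1 = q + 1 \<and> A' = A \<and> t' \<le> t + 2 + 3 * q"
      and f: "frame ?c (s(52 := 1, rS1 := 1)) A bs s' A' bs'"
    have s: "s' 51 = i" using f i by (simp add: frame_def)
    have "(2::nat) ^ Suc q \<le> 2 ^ v2 i" using q by (intro power_increasing) auto
    also have "\<dots> \<le> i" using v2_le[OF i(2)] .
    finally have b: "2 * 2 ^ q < U" using i(3) by simp
    moreover have "Suc (Suc q) \<le> 2 * 2 ^ q" using less_exp[of "Suc q"] by simp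
    ultimately show "aval (#1 [-] (\<acute>51 [div] \<acute>52) [mod] #2) s' A' \<noteq> 0 \<and>
        wp ?c (\<lambda>s' A' bs' t'. s' 52 = 2 ^ Suc q \<and> s' rS1 = Suc q + 1 \<and> A' = A \<and> t' \<le> t + 2 + 3 * Suc q) s' A' bs' (t' + 1)"
      using I s v2_step[of q i] q i(2) by simp
  next
    fix s' A' bs' t'
    assume I: "s' 52 = 2 ^ v2 i \<and> s' rS1 = v2 i + 1 \<and> A' = A \<and> t' \<le> t + 2 + 3 * v2 i"
      and f: "frame ?c (s(52 := 1, rS1 := 1)) A bs s' A' bs'"
    have "(i div 2 ^ v2 i) mod 2 \<noteq> 0" using v2_step[of "v2 i" i] i(2) by simp
    then have "(i div 2 ^ v2 i) mod 2 = 1" by presburger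
    then show "aval (#1 [-] (\<acute>51 [div] \<acute>52) [mod] #2) s' A' = 0 \<and> s' 52 = 2 ^ v2 i \<and> s' rS1 = v2 i + 1 \<and> A' = A \<and> t' + 1 \<le> t + 3 * v2 i + 3"
      using I f i by (simp add: frame_def)
  qed simp
  then show ?thesis unfolding val2_def using U by (simp add: numeral_2_eq_2)
qed

end

context prog begin

text \<open>Cost of a convolution per element of the block, polylogarithmic in the table
  size.\<close>

definition CT :: nat where "CT = (4 * \<sigma> + 1) * ((\<sigma> + 2) * (8 * \<sigma> * 28 + 16) + 50) + 30"

lemma conv_time_le: "q < \<sigma> \<Longrightarrow> conv_time (q + 1) \<le> 2 ^ q * CT"
proof -
  assume q: "q < \<sigma>"
  have Q: "1 \<le> (2::nat) ^ q" by simp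
  have a: "4 * (q + 1) * 2 ^ (q + 1) * 28 + 16 \<le> 2 ^ q * (8 * \<sigma> * 28 + 16)"
  proof -
    have "(q + 1) * 2 ^ q \<le> \<sigma> * 2 ^ q" using q by (intro mult_right_mono) auto
    moreover have "4 * (q + 1) * 2 ^ (q + 1) * 28 = 224 * ((q + 1) * 2 ^ q)" by (simp add: algebra_simps)
    moreover have "2 ^ q * (8 * \<sigma> * 28 + 16) = 224 * (\<sigma> * 2 ^ q) + 16 * 2 ^ q" by (simp add: algebra_simps)
    ultimately show ?thesis using Q by linarith
  qed
  have "(q + 1 + 2) * (4 * (q + 1) * 2 ^ (q + 1) * 28 + 16) + 50 \<le> (\<sigma> + 2) * (2 ^ q * (8 * \<sigma> * 28 + 16)) + 2 ^ q * 50"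
    using q Q by (intro add_mono mult_le_mono a) auto
  also have "\<dots> = 2 ^ q * ((\<sigma> + 2) * (8 * \<sigma> * 28 + 16) + 50)" by (simp add: algebra_simps)
  finally have b: "(q + 1 + 2) * (4 * (q + 1) * 2 ^ (q + 1) * 28 + 16) + 50 \<le> 2 ^ q * ((\<sigma> + 2) * (8 * \<sigma> * 28 + 16) + 50)" .
  have "conv_time (q + 1) \<le> (4 * \<sigma> + 1) * (2 ^ q * ((\<sigma> + 2) * (8 * \<sigma> * 28 + 16) + 50)) + 2 ^ q * 30"
    unfolding conv_time_def using q Q by (intro add_mono mult_le_mono b) auto
  also have "\<dots> = 2 ^ q * CT" unfolding CT_def by (simp only: distrib_left mult.left_commute)
  finally show ?thesis .
qed

text \<open>What accumulator \<open>x\<close> has received after the rounds up to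
  \<open>r\<close>.\<close>

definition accX :: "nat \<Rightarrow> nat \<Rightarrow> int" where
  "accX r x = (\<Sum>i=1..r. if i \<le> x \<and> x < i + 2 ^ v2 i then (\<Sum>m=i - 2 ^ v2 i..<i. Fc m * Gc (x - m)) else 0)"

lemma accX_0: "accX 0 x = 0" by (simp add: accX_def)

lemma accX_Suc: "accX (Suc r) x = accX r x +
    (if Suc r \<le> x \<and> x < Suc r + 2 ^ v2 (Suc r) then (\<Sum>m=Suc r - 2 ^ v2 (Suc r)..<Suc r. Fc m * Gc (x - m)) else 0)"
  by (simp add: accX_def)

text \<open>Accumulator \<open>i\<close> is complete exactly when \<open>F\<close> at
  \<open>i\<close> is to be computed.\<close>

lemma accX_diag: "okc i \<Longrightarrow> accX i i = int i * Fc i"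
proof -
  assume i: "okc i"
  have "accX i i = (\<Sum>i'=1..i. if i < i' + 2 ^ v2 i' then (\<Sum>m=i' - 2 ^ v2 i'..<i'. Fc m * Gc (i - m)) else 0)"
    unfolding accX_def by (intro sum.cong refl) auto
  then show ?thesis using sum_dyadic_blocks[of i "\<lambda>m. Fc m * Gc (i - m)"] Fc_rec[OF i] by simp
qed

definition K1 :: nat where "K1 = CT + 60 + 6 * \<sigma> + 20 * k"

lemma wp_online1:
  assumes st: "stat s A" and i: "s ri = r" "Suc r < Nz"
    and G: "\<And>x. x < Nz \<Longrightarrow> rz p (A aG x) (Gc x)" and F: "\<And>x. x \<le> r \<Longrightarrow> rz p (A aF x) (Fc x)"
    and acc: "\<And>x. r < x \<Longrightarrow> x < Nz \<Longrightarrow> rz p (A aAcc x) (accX r x)"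
  shows "wp (online1 k) (\<lambda>s' A' bs' t'. (\<forall>x\<le>Suc r. rz p (A' aF x) (Fc x)) \<and>
     (\<forall>x. Suc r < x \<longrightarrow> x < Nz \<longrightarrow> rz p (A' aAcc x) (accX (Suc r) x)) \<and> t' \<le> tt + 2 ^ v2 (Suc r) * K1) s A bs tt"
proof -
  define i where "i = Suc r"
  define q where "q = v2 i"
  define Q where "Q = (2::nat) ^ q"
  have i0: "0 < i" "i < Nz" using i(2) by (auto simp: i_def)
  have q\<sigma>: "q < \<sigma>" unfolding q_def using v2_less[OF i0] .
  have Qi: "Q \<le> i" unfolding Q_def q_def using v2_le[OF i0(1)] .
  have Qe: "i + Q \<le> Nz" unfolding Q_def q_def using v2_block_end[OF i0] .
  have Q1: "1 \<le> Q" by (simp add: Q_def)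
  have Q2: "2 * Q \<le> Nz" using Qi Qe by linarith
  note UB = Ubounds
  let ?Qf = "\<lambda>s' A' bs' t'. (\<forall>x\<le>Suc r. rz p (A' aF x) (Fc x)) \<and>
     (\<forall>x. Suc r < x \<longrightarrow> x < Nz \<longrightarrow> rz p (A' aAcc x) (accX (Suc r) x)) \<and> t' \<le> tt + 2 ^ v2 (Suc r) * K1"
  let ?last = "CIf \<acute>53 (Sto aF \<acute>51 ((Ld aAcc \<acute>51 [*] Ld aInv \<acute>51) [mod] \<acute>rP)) (Sto aF \<acute>51 #0)"
  define s0 where "s0 = s(51 := i)"
  have st0: "stat s0 A" by (rule stat_cong[OF st]) (auto simp: s0_def)
  have s051: "s0 51 = i" by (simp add: s0_def)
  have "wp (val2 ;; fill ;; conv ;; addback ;; valid k ;; ?last) ?Qf s0 A bs (tt + 1)"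
  proof (rule wp_SeqI[OF wp_val2[of s0 i]])
    show "s0 51 = i" "0 < i" "i < U" "2 < U" using s051 i0 UB by auto
    fix s1 A1 bs1 t1
    assume P1: "s1 52 = 2 ^ v2 i \<and> s1 rS1 = v2 i + 1 \<and> A1 = A \<and> t1 \<le> tt + 1 + 3 * v2 i + 3" and f1: "frame val2 s0 A bs s1 A1 bs1"
    have st1: "stat s1 A" by (rule stat_cong[OF st0]) (use f1 in \<open>auto simp: frame_def\<close>)
    have r1: "s1 51 = i" "s1 52 = Q" "s1 rS1 = q + 1" "A1 = A" "t1 \<le> tt + 4 + 3 * \<sigma>"
      using P1 f1 s051 q\<sigma> by (auto simp: frame_def Q_def q_def)
    \<comment> \<open>The block of \<open>F\<close> that ends just before \<open>i\<close>, as many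
      zeros, and then \<open>G\<close> from index 0 on.\<close>
    define X where "X j = (if j < Q then Fc (i - Q + j) else if j < 2 * Q then 0 else Gc (j - 2 * Q))" for j
    have XG: "X (2 * Q + j) = Gc j" for j by (simp add: X_def)
    show "wp (fill ;; conv ;; addback ;; valid k ;; ?last) ?Qf s1 A1 bs1 t1"
    proof (rule wp_SeqI)
      show "wp fill (\<lambda>s' A' bs' t'. rs p (2 * 2 ^ (q + 1)) X (A' aS) \<and> t' \<le> t1 + 2 * Q * 6 + 3) s1 A1 bs1 t1"
        unfolding fill_def
      proof (rule wp_For[where n = "2 * Q" and I = "\<lambda>j s' A' bs' t'. (\<forall>l<j. rz p (A' aS l) (X l) \<and> rz p (A' aS (2 * Q + l)) (X (2 * Q + l))) \<and>
          t' \<le> t1 + j * 6 + 1"])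
        show "2 * Q < U" using Q2 UB by linarith
      next
        fix j s' A' bs' t'
        let ?b = "CIf (\<acute>52 [-] \<acute>rj) (Sto aS \<acute>rj (Ld aF (\<acute>51 [-] \<acute>52 [+] \<acute>rj))) (Sto aS \<acute>rj #0) ;; Sto aS (#2 [*] \<acute>52 [+] \<acute>rj) (Ld aG \<acute>rj)"
        assume j: "j < 2 * Q" "s' rj = j" and I: "(\<forall>l<j. rz p (A' aS l) (X l) \<and> rz p (A' aS (2 * Q + l)) (X (2 * Q + l))) \<and> t' \<le> t1 + j * 6 + 1"
          and f: "frame (For rj (#2 [*] \<acute>52) ?b) s1 A1 bs1 s' A' bs'"
        have r': "s' 51 = i" "s' 52 = Q" "A' aF = A aF" "A' aG = A aG" using f r1 by (simp_all add: frame_def)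
        have g: "rz p (A aG j) (X (2 * Q + j))" unfolding XG using j Q2 by (intro G) simp
        have a: "rz p (A aF (i - Q + j)) (X j)" if "j < Q"
        proof -
          have "i - Q + j \<le> r" using that Qi by (simp add: i_def)
          then show ?thesis using F that by (simp add: X_def)
        qed
        have b: "rz p 0 (X j)" if "\<not> j < Q" using that j p0 by (simp add: X_def rz_zero)
        have U': "A aG j < U" "j < Q \<Longrightarrow> A aF (i - Q + j) < U" using rz_less[OF g] rz_less[OF a] U by auto
        show "wp ?b (\<lambda>s2 A2 bs2 t2. (\<forall>l<Suc j. rz p (A2 aS l) (X l) \<and> rz p (A2 aS (2 * Q + l)) (X (2 * Q + l))) \<and> t2 + 1 \<le> t1 + Suc j * 6 + 1) s' A' bs' (t' + 1)"
        proof (cases "j < Q")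
          case True
          then show ?thesis using I r' j(2) j(1) U' g a by (auto simp: less_Suc_eq)
        next
          case False
          then show ?thesis using I r' j(2) j(1) U' g b UB(1) by (auto simp: less_Suc_eq)
        qed
      next
        fix s' A' bs' t'
        assume I: "(\<forall>l<2 * Q. rz p (A' aS l) (X l) \<and> rz p (A' aS (2 * Q + l)) (X (2 * Q + l))) \<and> t' \<le> t1 + 2 * Q * 6 + 1"
        have "rz p (A' aS l) (X l)" if "l < 2 * (2 * Q)" for l
        proof (cases "l < 2 * Q")
          case False
          then have "l - 2 * Q < 2 * Q" using that by simp
          then have "rz p (A' aS (2 * Q + (l - 2 * Q))) (X (2 * Q + (l - 2 * Q)))" using I by blast
          then show ?thesis using False by simp
        qed (use I in simp)
        then show "rs p (2 * 2 ^ (q + 1)) X (A' aS) \<and> t' + 1 \<le> t1 + 2 * Q * 6 + 3" using I by (simp add: rs_def Q_def)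
      qed (use r1 in \<open>auto simp: frame_def\<close>)
      fix s2 A2 bs2 t2
      assume P2: "rs p (2 * 2 ^ (q + 1)) X (A2 aS) \<and> t2 \<le> t1 + 2 * Q * 6 + 3" and f2: "frame fill s1 A1 bs1 s2 A2 bs2"
      have st2: "stat s2 A2" by (rule stat_cong[OF st1]) (use f2 r1 in \<open>auto simp: frame_def\<close>)
      have r2: "s2 51 = i" "s2 52 = Q" "s2 rS1 = q + 1" "A2 aAcc = A aAcc" "A2 aF = A aF" using f2 r1 by (simp_all add: frame_def)
      show "wp (conv ;; addback ;; valid k ;; ?last) ?Qf s2 A2 bs2 t2"
      proof (rule wp_SeqI[OF wp_conv[where p = p and \<sigma> = "q + 1" and X = X and iv = iv]])
        show "rs p (2 * 2 ^ (q + 1)) X (A2 aS)" using P2 by simp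
        show "s2 rP = p" "s2 rInv2 = iv" "s2 rS1 = q + 1" using st2 r2 by (auto simp: stat_def)
        show "A2 aPw l = 2 ^ l" if "l \<le> q + 1" for l using st2 that q\<sigma> by (simp add: stat_def)
        have "(q + 1) * 2 ^ (q + 1) \<le> \<sigma> * Nz" using q\<sigma> by (intro mult_le_mono power_increasing) auto
        then show "16 * (q + 1) * 2 ^ (q + 1) < U" using UB(8) by (simp only: mult.assoc)
        fix s3 A3 bs3 t3
        assume P3: "(\<exists>S Z. mulp S (q + 1) 1 X Z \<and> rs p (2 ^ (q + 1)) Z (A3 aS) \<and> [int (s3 rSc) * int S = 1] (mod int p)) \<and> t3 \<le> t2 + conv_time (q + 1)"
          and f3: "frame conv s2 A2 bs2 s3 A3 bs3"
        obtain S Z where Z: "mulp S (Suc q) 1 X Z" "rs p (2 * Q) Z (A3 aS)" "[int (s3 rSc) * int S = 1] (mod int p)"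
          using P3 by (auto simp: Q_def)
        have st3: "stat s3 A3" by (rule stat_cong[OF st2]) (use f3 in \<open>auto simp: frame_def conv_frame\<close>)
        have r3: "s3 51 = i" "s3 52 = Q" "A3 aAcc = A aAcc" "A3 aF = A aF" using f3 r2 by (simp_all add: frame_def conv_frame)
        \<comment> \<open>The block of \<open>F\<close> starts at \<open>i - Q\<close>, so output
          \<open>Q + l\<close> of the convolution belongs to index \<open>i + l\<close>.\<close>
        have Zv: "Z (Q + l) = int S * (\<Sum>m=i - Q..<i. Fc m * Gc (i + l - m))" if "l < Q" for l
        proof -
          have "Z (2 ^ q + l) = int S * (\<Sum>j<2 ^ q. X j * X (2 ^ Suc q + (2 ^ q + l - j)))"
            by (rule mulp_upper_half[OF Z(1)]) (use that in \<open>auto simp: X_def Q_def\<close>)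
          then have "Z (Q + l) = int S * (\<Sum>j<Q. X j * X (2 * Q + (Q + l - j)))" by (simp add: Q_def)
          also have "(\<Sum>j<Q. X j * X (2 * Q + (Q + l - j))) = (\<Sum>j<Q. Fc (j + (i - Q)) * Gc (i + l - (j + (i - Q))))"
          proof (intro sum.cong refl)
            fix j assume j: "j \<in> {..<Q}"
            have "i + l - (j + (i - Q)) = Q + l - j" using Qi by simp
            then show "X j * X (2 * Q + (Q + l - j)) = Fc (j + (i - Q)) * Gc (i + l - (j + (i - Q)))"
              using j unfolding XG by (simp add: X_def add.commute)
          qed
          also have "\<dots> = (\<Sum>m=i - Q..<i. Fc m * Gc (i + l - m))"
            using sum.shift_bounds_nat_ivl[of "\<lambda>m. Fc m * Gc (i + l - m)" 0 "i - Q" Q] Qi by (simp add: lessThan_atLeast0)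
          finally show ?thesis .
        qed
        have contrib: "rz p ((A aAcc (i + l) + s3 rSc * A3 aS (Q + l)) mod p) (accX i (i + l))" if l: "l < Q" for l
        proof -
          let ?v = "\<Sum>m=i - Q..<i. Fc m * Gc (i + l - m)"
          have "rz p (A3 aS (Q + l)) (int S * ?v)" using rsD[OF Z(2), of "Q + l"] l Zv[OF l] by simp
          then have "[int (s3 rSc) * int (A3 aS (Q + l)) = int (s3 rSc) * (int S * ?v)] (mod int p)"
            by (intro cong_mult cong_refl) (simp add: rz_def)
          moreover have "[(int (s3 rSc) * int S) * ?v = 1 * ?v] (mod int p)" using Z(3) by (intro cong_mult cong_refl)
          ultimately have c: "[int (s3 rSc) * int (A3 aS (Q + l)) = ?v] (mod int p)"
            using cong_trans by (simp add: mult.assoc) 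
          have "accX i (i + l) = accX r (i + l) + ?v" using l unfolding i_def accX_Suc by (simp add: Q_def q_def i_def)
          moreover have "rz p (A aAcc (i + l)) (accX r (i + l))" using l Qe by (intro acc) (auto simp: i_def)
          ultimately show ?thesis using c p0 unfolding rz_def
            by (auto simp: cong_def zmod_int intro: mod_add_cong)
        qed
        show "wp (addback ;; valid k ;; ?last) ?Qf s3 A3 bs3 t3"
        proof (rule wp_SeqI)
          show "wp addback (\<lambda>s' A' bs' t'. (\<forall>x. r < x \<longrightarrow> x < Nz \<longrightarrow> rz p (A' aAcc x) (accX i x)) \<and> t' \<le> t3 + Q * 4 + 3) s3 A3 bs3 t3"
            unfolding addback_def
          proof (rule wp_For[where n = Q and I = "\<lambda>l s' A' bs' t'. (\<forall>l'<l. rz p (A' aAcc (i + l')) (accX i (i + l'))) \<and>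
             (\<forall>x. i + l \<le> x \<longrightarrow> A' aAcc x = A aAcc x) \<and> t' \<le> t3 + l * 4 + 1"])
            show "Q < U" using Q2 UB by linarith
          next
            fix l s' A' bs' t'
            let ?b = "Sto aAcc (\<acute>51 [+] \<acute>rj) ((Ld aAcc (\<acute>51 [+] \<acute>rj) [+] \<acute>rSc [*] Ld aS (\<acute>52 [+] \<acute>rj)) [mod] \<acute>rP)"
            assume l: "l < Q" "s' rj = l" and I: "(\<forall>l'<l. rz p (A' aAcc (i + l')) (accX i (i + l'))) \<and>
             (\<forall>x. i + l \<le> x \<longrightarrow> A' aAcc x = A aAcc x) \<and> t' \<le> t3 + l * 4 + 1" and f: "frame (For rj \<acute>52 ?b) s3 A3 bs3 s' A' bs'"
            have r': "s' 51 = i" "s' 52 = Q" "s' rSc = s3 rSc" "s' rP = p" "A' aS = A3 aS"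
              using f r3 st3 by (simp_all add: frame_def stat_def)
            show "wp ?b (\<lambda>s2 A2 bs2 t2. (\<forall>l'<Suc l. rz p (A2 aAcc (i + l')) (accX i (i + l'))) \<and>
               (\<forall>x. i + Suc l \<le> x \<longrightarrow> A2 aAcc x = A aAcc x) \<and> t2 + 1 \<le> t3 + Suc l * 4 + 1) s' A' bs' (t' + 1)"
              using I r' l contrib[OF l(1)] mod_less_bound'[OF p0 U(1)] by (simp add: less_Suc_eq)
          next
            fix s' A' bs' t'
            assume I: "(\<forall>l'<Q. rz p (A' aAcc (i + l')) (accX i (i + l'))) \<and>
             (\<forall>x. i + Q \<le> x \<longrightarrow> A' aAcc x = A aAcc x) \<and> t' \<le> t3 + Q * 4 + 1"
            have "rz p (A' aAcc x) (accX i x)" if x: "r < x" "x < Nz" for x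
            proof (cases "x < i + Q")
              case True
              then have "x - i < Q" using x by (simp add: i_def)
              then have "rz p (A' aAcc (i + (x - i))) (accX i (i + (x - i)))" using I by blast
              then show ?thesis using x by (simp add: i_def)
            next
              case False
              then have "accX i x = accX r x" unfolding i_def accX_Suc by (simp add: Q_def q_def i_def)
              then show ?thesis using I False acc[OF x] by simp
            qed
            then show "(\<forall>x. r < x \<longrightarrow> x < Nz \<longrightarrow> rz p (A' aAcc x) (accX i x)) \<and> t' + 1 \<le> t3 + Q * 4 + 3" using I by simp
          qed (use r3 in \<open>auto simp: frame_def\<close>)
          fix s4 A4 bs4 t4
          assume P4: "(\<forall>x. r < x \<longrightarrow> x < Nz \<longrightarrow> rz p (A4 aAcc x) (accX i x)) \<and> t4 \<le> t3 + Q * 4 + 3" and f4: "frame addback s3 A3 bs3 s4 A4 bs4"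
          have st4: "stat s4 A4" by (rule stat_cong[OF st3]) (use f4 in \<open>auto simp: frame_def\<close>)
          have r4: "s4 51 = i" "A4 aF = A aF" using f4 r3 by (simp_all add: frame_def)
          show "wp (valid k ;; ?last) ?Qf s4 A4 bs4 t4"
          proof (rule wp_SeqI)
            show "wp (valid k) (\<lambda>s' A' bs' t'. s' 53 = (if okc i then 1 else 0) \<and> t' \<le> t4 + 2 * k * 5 + 8) s4 A4 bs4 t4"
            proof -
              let ?b = "CIf ((\<acute>51 [div] Ld aW \<acute>rj) [mod] Ld aBs \<acute>rj [-] Ld aLm \<acute>rj) (53 ::= #0) skip"
              let ?e = "CIf (\<acute>rD [-] \<acute>51) skip (53 ::= #0)"
              have "wp (For rj #(2 * k) ?b ;; ?e) (\<lambda>s' A' bs' t'. s' 53 = (if okc i then 1 else 0) \<and> t' \<le> t4 + 2 * k * 5 + 8) (s4(53 := 1)) A4 bs4 (t4 + 1)"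
              proof (rule wp_SeqI)
                show "wp (For rj #(2 * k) ?b) (\<lambda>s' A' bs' t'. s' 53 = (if \<forall>d<2 * k. dgt \<beta> i d \<le> lam d then 1 else 0) \<and> t' \<le> t4 + 1 + 2 * k * 5 + 3) (s4(53 := 1)) A4 bs4 (t4 + 1)"
                proof (rule wp_For[where n = "2 * k" and I = "\<lambda>m s' A' bs' t'. s' 53 = (if \<forall>d<m. dgt \<beta> i d \<le> lam d then 1 else 0) \<and> t' \<le> t4 + 1 + m * 5 + 1"])
                  fix m s' A' bs' t'
                  assume m: "m < 2 * k" "s' rj = m" and I: "s' 53 = (if \<forall>d<m. dgt \<beta> i d \<le> lam d then 1 else 0) \<and> t' \<le> t4 + 1 + m * 5 + 1"
                    and f: "frame (For rj #(2 * k) ?b) (s4(53 := 1)) A4 bs4 s' A' bs'"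
                  have r': "s' 51 = i" "A' aW m = W m" "A' aBs m = \<beta> m" "A' aLm m = lam m"
                    using f r4 st4 m by (simp_all add: frame_def stat_def)
                  show "wp ?b (\<lambda>s2 A2 bs2 t2. (s2(rj := Suc m)) 53 = (if \<forall>d<Suc m. dgt \<beta> i d \<le> lam d then 1 else 0) \<and> t2 + 1 \<le> t4 + 1 + Suc m * 5 + 1) s' A' bs' (t' + 1)"
                    using I r' m(2) UB(1) unfolding dgt_def[of \<beta> i m, symmetric] skip_def
                    by (auto simp: less_Suc_eq dgt_def not_le)
                qed (use UB in auto)
                fix s5 A5 bs5 t5
                assume P5: "s5 53 = (if \<forall>d<2 * k. dgt \<beta> i d \<le> lam d then 1 else 0) \<and> t5 \<le> t4 + 1 + 2 * k * 5 + 3"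
                  and f5: "frame (For rj #(2 * k) ?b) (s4(53 := 1)) A4 bs4 s5 A5 bs5"
                have "s5 51 = i" "s5 rD = W (2 * k)" using f5 r4 st4 by (simp_all add: frame_def stat_def)
                then show "wp ?e (\<lambda>s' A' bs' t'. s' 53 = (if okc i then 1 else 0) \<and> t' \<le> t4 + 2 * k * 5 + 8) s5 A5 bs5 t5"
                  using P5 UB(1) by (auto simp: okc_def skip_def not_less)
              qed
              then show ?thesis unfolding valid_def using UB(1) by simp
            qed
            fix s5 A5 bs5 t5
            assume P5: "s5 53 = (if okc i then 1 else 0) \<and> t5 \<le> t4 + 2 * k * 5 + 8" and f5: "frame (valid k) s4 A4 bs4 s5 A5 bs5"
            have st5: "stat s5 A5" by (rule stat_cong[OF st4]) (use f5 in \<open>auto simp: frame_def\<close>)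
            have r5: "s5 51 = i" "A5 aF = A aF" "A5 aAcc = A4 aAcc" "s5 rP = p" using f5 r4 st5 by (simp_all add: frame_def stat_def)
            have new: "rz p ((A4 aAcc i * A5 aInv i) mod p) (Fc i)" if "okc i"
            proof -
              have "rz p (A4 aAcc i) (int i * Fc i)" using P4 i0 accX_diag[OF that] by (auto simp: i_def)
              moreover have inv: "[int (A5 aInv i) * int i = 1] (mod int p)" using st5 i0 by (simp add: stat_def)
              ultimately have "[int (A4 aAcc i) * int (A5 aInv i) = (int i * Fc i) * int (A5 aInv i)] (mod int p)"
                by (intro cong_mult cong_refl) (simp add: rz_def)
              moreover have "[Fc i * (int (A5 aInv i) * int i) = Fc i * 1] (mod int p)" using inv by (intro cong_mult cong_refl)
              ultimately have "[int (A4 aAcc i * A5 aInv i) = Fc i] (mod int p)" using cong_trans by (simp add: mult_ac)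
              then show ?thesis using p0 by (simp add: rz_def cong_def zmod_int)
            qed
            have old: "Fc i = 0" if "\<not> okc i" using that by (simp add: Fc_def)
            have "t5 + 3 \<le> tt + Q * K1"
            proof -
              have "t5 + 3 \<le> tt + (30 + 3 * \<sigma> + 10 * k) + Q * 16 + conv_time (q + 1)" using P5 P4 P3 P2 r1(5) by simp
              also have "\<dots> \<le> tt + Q * (30 + 3 * \<sigma> + 10 * k) + Q * 16 + Q * CT"
                using conv_time_le[OF q\<sigma>] Q1 by (intro add_mono) (auto simp: Q_def)
              also have "\<dots> = tt + Q * (CT + 46 + 3 * \<sigma> + 10 * k)" by (simp add: algebra_simps)
              also have "\<dots> \<le> tt + Q * K1" unfolding K1_def by (intro add_left_mono mult_le_mono2) simp
              finally show ?thesis .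
            qed
            then have tm: "t5 + 2 \<le> tt + 2 ^ v2 (Suc r) * K1" by (simp add: Q_def q_def i_def)
            have acc': "rz p (A5 aAcc x) (accX (Suc r) x)" if "Suc r < x" "x < Nz" for x using P4 r5 that by (simp add: i_def)
            have Fo: "rz p (A5 aF x) (Fc x)" if "x \<le> r" for x using F[OF that] r5 by simp
            show "wp ?last ?Qf s5 A5 bs5 t5"
            proof (cases "okc i")
              case True
              then show ?thesis using P5 r5 new[OF True] tm acc' Fo mod_less_bound'[OF p0 U(1)]
                by (auto simp: i_def le_Suc_eq)
            next
              case False
              then show ?thesis using P5 r5 old[OF False] tm acc' Fo UB(1) rz_zero[OF p0]
                by (auto simp: i_def le_Suc_eq)
            qed
          qed
        qed
      qed (use U iv in \<open>auto simp: p0\<close>)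
    qed
  qed
  then show ?thesis unfolding online1_def using i i0 UB by (simp add: s0_def i_def)
qed

lemma wp_online:
  assumes st: "stat s A" and G: "\<And>x. x < Nz \<Longrightarrow> rz p (A aG x) (Gc x)" and acc: "\<And>x. x < Nz \<Longrightarrow> A aAcc x = 0"
  shows "wp (online k) (\<lambda>s' A' bs' t'. (\<forall>x<Nz. rz p (A' aF x) (Fc x)) \<and> t' \<le> tt + \<sigma> * Nz * (K1 + 2) + 4) s A bs tt"
proof -
  define A0 where "A0 = A(aF := (A aF)(0 := 1))"
  have st0: "stat s A0" by (rule stat_cong[OF st]) (auto simp: A0_def)
  let ?cst = "\<lambda>r. \<Sum>i=1..r. 2 ^ v2 i * (K1 + 2)"
  have p1: "1 < p" using prime by (rule prime_gt_1_nat)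
  have Nk: "Nz - 1 < Nz" by simp
  have "wp (For ri (\<acute>rSize [-] #1) (online1 k)) (\<lambda>s' A' bs' t'. (\<forall>x<Nz. rz p (A' aF x) (Fc x)) \<and> t' \<le> tt + ?cst (Nz - 1) + 4) s A0 bs (tt + 1)"
  proof (rule wp_For[where n = "Nz - 1" and I = "\<lambda>r s' A' bs' t'. (\<forall>x\<le>r. rz p (A' aF x) (Fc x)) \<and>
     (\<forall>x. r < x \<longrightarrow> x < Nz \<longrightarrow> rz p (A' aAcc x) (accX r x)) \<and> t' \<le> tt + ?cst r + 2"])
    show "Nz - 1 < U" using Ubounds(3) by simp
    show "ri \<notin> written_regs (online1 k)" by (simp add: conv_frame)
    show "(\<forall>x\<le>0. rz p (A0 aF x) (Fc x)) \<and> (\<forall>x. 0 < x \<longrightarrow> x < Nz \<longrightarrow> rz p (A0 aAcc x) (accX 0 x)) \<and> tt + 1 + 1 \<le> tt + ?cst 0 + 2"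
      using acc p1 Fc_0 by (auto simp: A0_def accX_0 rz_def)
  next
    fix s' A' bs' assume "frame (For ri (\<acute>rSize [-] #1) (online1 k)) s A0 bs s' A' bs'"
    then show "aval (\<acute>rSize [-] #1) s' A' = Nz - 1" using st by (simp add: frame_def stat_def conv_frame)
  next
    fix r s' A' bs' t'
    assume r: "r < Nz - 1" "s' ri = r" and I: "(\<forall>x\<le>r. rz p (A' aF x) (Fc x)) \<and>
     (\<forall>x. r < x \<longrightarrow> x < Nz \<longrightarrow> rz p (A' aAcc x) (accX r x)) \<and> t' \<le> tt + ?cst r + 2"
      and f: "frame (For ri (\<acute>rSize [-] #1) (online1 k)) s A0 bs s' A' bs'"
    have st': "stat s' A'" by (rule stat_cong[OF st0]) (use f in \<open>auto simp: frame_def conv_frame\<close>)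
    have G': "A' aG = A aG" using f by (simp add: frame_def conv_frame A0_def)
    have w: "wp (online1 k) (\<lambda>s2 A2 bs2 t2. (\<forall>x\<le>Suc r. rz p (A2 aF x) (Fc x)) \<and>
     (\<forall>x. Suc r < x \<longrightarrow> x < Nz \<longrightarrow> rz p (A2 aAcc x) (accX (Suc r) x)) \<and> t2 \<le> t' + 1 + 2 ^ v2 (Suc r) * K1) s' A' bs' (t' + 1)"
      by (rule wp_online1[OF st' r(2)]) (use r I G G' in auto)
    have "1 \<le> (2::nat) ^ v2 (Suc r)" by simp
    then have c: "2 ^ v2 (Suc r) * K1 + 2 \<le> 2 ^ v2 (Suc r) * (K1 + 2)" by (simp only: distrib_left)
    show "wp (online1 k) (\<lambda>s2 A2 bs2 t2. (\<forall>x\<le>Suc r. rz p (A2 aF x) (Fc x)) \<and>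
     (\<forall>x. Suc r < x \<longrightarrow> x < Nz \<longrightarrow> rz p (A2 aAcc x) (accX (Suc r) x)) \<and> t2 + 1 \<le> tt + ?cst (Suc r) + 2) s' A' bs' (t' + 1)"
    proof (rule wp_mono[OF w])
      fix s2 A2 bs2 t2
      assume a: "(\<forall>x\<le>Suc r. rz p (A2 aF x) (Fc x)) \<and>
     (\<forall>x. Suc r < x \<longrightarrow> x < Nz \<longrightarrow> rz p (A2 aAcc x) (accX (Suc r) x)) \<and> t2 \<le> t' + 1 + 2 ^ v2 (Suc r) * K1"
      have "?cst (Suc r) = ?cst r + 2 ^ v2 (Suc r) * (K1 + 2)" by simp
      then have "t2 + 1 \<le> tt + ?cst (Suc r) + 2" using a I c by linarith
      then show "(\<forall>x\<le>Suc r. rz p (A2 aF x) (Fc x)) \<and>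
     (\<forall>x. Suc r < x \<longrightarrow> x < Nz \<longrightarrow> rz p (A2 aAcc x) (accX (Suc r) x)) \<and> t2 + 1 \<le> tt + ?cst (Suc r) + 2" using a by blast
    qed
  qed auto
  moreover have "?cst (Nz - 1) \<le> \<sigma> * Nz * (K1 + 2)"
  proof -
    have "{1..Nz - 1} = {1..<Nz}" by auto
    then have "?cst (Nz - 1) = (\<Sum>i=1..<Nz. 2 ^ v2 i) * (K1 + 2)" by (simp only: sum_distrib_right)
    then show ?thesis using sum_power_v2[of \<sigma>] by (simp only: mult_le_mono1)
  qed
  ultimately have "wp (For ri (\<acute>rSize [-] #1) (online1 k)) (\<lambda>s' A' bs' t'. (\<forall>x<Nz. rz p (A' aF x) (Fc x)) \<and> t' \<le> tt + \<sigma> * Nz * (K1 + 2) + 4) s A0 bs (tt + 1)"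
    by (elim wp_mono) auto
  then show ?thesis unfolding online_def using Ubounds(1) by (simp add: A0_def)
qed

end

subsection \<open>Tables, primes and repetitions\<close>

definition trial :: "nat \<Rightarrow> cmd" where
  "trial k = (weights k ;; clear ;; gen k ;; online k ;; CIf (Ld aF \<acute>rGoal) (rAns ::= #1) skip)"

text \<open>Halving \<open>rDv\<close> until it vanishes makes as many rounds as
  \<open>\<lceil>1 / \<delta>\<rceil>\<close> has binary digits. A single success fixes the answer,
  because a trial never resets \<open>rAns\<close>.\<close>

definition trials :: "nat \<Rightarrow> cmd" where
  "trials k = (rAns ::= #0 ;; CWhile \<acute>rDv (rDv ::= \<acute>rDv [div] #2 ;; trial k))"

definition tables :: "nat \<Rightarrow> cmd" where
  "tables k = (rD ::= #1 ;; For ri #(2 * k) (CIf (#k [-] \<acute>ri) (17 ::= \<acute>rCm) (17 ::= \<acute>rTm) ;; Sto aLm \<acute>ri \<acute>17 ;;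
     18 ::= #2 [*] \<acute>17 [+] #2 ;; Sto aBs \<acute>ri \<acute>18 ;; Sto aW \<acute>ri \<acute>rD ;; rD ::= \<acute>rD [*] \<acute>18) ;; rYk ::= Ld aW #k)"

definition goalc :: "nat \<Rightarrow> cmd" where
  "goalc k = (rGoal ::= #0 ;; For ri #k (Inp 17 (#2 [+] \<acute>ri) ;; rGoal ::= \<acute>rGoal [+] \<acute>17 [*] Ld aW (#k [+] \<acute>ri) ;;
     Inp 17 (#(2 + k) [+] \<acute>ri) ;; rGoal ::= \<acute>rGoal [+] \<acute>17 [*] Ld aW \<acute>ri))"

definition sizeN :: cmd where
  "sizeN = (rSize ::= #1 ;; rLog ::= #0 ;; Sto aPw #0 #1 ;;
     CWhile (\<acute>rD [-] \<acute>rSize) (rSize ::= #2 [*] \<acute>rSize ;; rLog ::= \<acute>rLog [+] #1 ;; Sto aPw \<acute>rLog \<acute>rSize))"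

text \<open>The multiples of every number are marked, not only those of primes; the harmonic sum
  keeps this within a logarithmic factor of \<open>rMax\<close>. Marks beyond \<open>rMax\<close>
  are never read.\<close>

definition sieve :: cmd where
  "sieve = (rMax ::= #4 [*] \<acute>rLog [*] \<acute>rSize ;;
     For ri \<acute>rMax (For rj (\<acute>rMax [div] (\<acute>ri [+] #2)) (Sto aMark ((\<acute>ri [+] #2) [*] (\<acute>rj [+] #2)) #1)))"

definition findp :: cmd where
  "findp = (rP ::= \<acute>rSize [+] #1 ;; CWhile (Ld aMark \<acute>rP) (rP ::= \<acute>rP [+] #1) ;; rInv2 ::= (\<acute>rP [+] #1) [div] #2)"

text \<open>From \<open>p = q * x + y\<close> with \<open>y < x\<close> follows
  \<open>1 / x = - q / y\<close> modulo \<open>p\<close>, and the inverse of \<open>y\<close> is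
  already in the table.\<close>

definition invs :: cmd where
  "invs = (Sto aInv #1 #1 ;; For ri (\<acute>rSize [-] #2) (17 ::= \<acute>ri [+] #2 ;;
     Sto aInv \<acute>17 (((\<acute>rP [-] \<acute>rP [div] \<acute>17) [*] Ld aInv (\<acute>rP [mod] \<acute>17)) [mod] \<acute>rP)))"

lemma trial_frame [simp]:
  "written_regs (trial k) = written_regs conv \<union> {0, 13, 14, 15, 16, 17, 18, 19, 47, 48, 49, 50, 51, 52, 53, 54}"
  "written_arrays (trial k) = {0, 1, 2, aWt, aG, aAcc, aF, aH}"
  by (auto simp: trial_def)

lemma trial_keeps:
  assumes "y = 1 \<or> y = 2 \<or> y = 3 \<or> y = 4 \<or> y = 5 \<or> y = 6 \<or> y = 7 \<or> y = 8 \<or> y = 10 \<or> y = 11 \<or> y = 12"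
  shows "y \<notin> written_regs (trial k)"
  using assms by (elim disjE) (simp_all add: conv_frame)

lemma setup_frame [simp]:
  "written_regs (tables k) = {8, 12, 13, 17, 18}" "written_arrays (tables k) = {aLm, aBs, aW}" "nocoin (tables k)"
  "written_regs (goalc k) = {7, 13, 17}" "written_arrays (goalc k) = {}" "nocoin (goalc k)"
  "written_regs sizeN = {5, 6}" "written_arrays sizeN = {aPw}" "nocoin sizeN"
  "written_regs sieve = {9, 13, 14}" "written_arrays sieve = {aMark}" "nocoin sieve"
  "written_regs findp = {10, 11}" "written_arrays findp = {}" "nocoin findp"
  "written_regs invs = {13, 17}" "written_arrays invs = {aInv}" "nocoin invs"
  by (auto simp: tables_def goalc_def sizeN_def sieve_def findp_def invs_def)

context prog begin

lemma other_weights: "prog U xs k lam J z n t c \<sigma> p iv"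
  by (rule prog_axioms)

definition trial_time :: nat where
  "trial_time = n * k * (\<sigma> * 4 + 8) + Nz * 4 + n * 8 + t * W k * (20 * k + 26) + \<sigma> * Nz * (K1 + 2) + 20"

lemma wp_trial:
  assumes st: "stat s A" and bs: "n * k * \<sigma> \<le> length bs" and w: "\<And>v. v < n * k \<Longrightarrow> w v = wt \<sigma> bs v" and gl: "goal < Nz"
  shows "wp (trial k) (\<lambda>s' A' bs' t'. s' rAns = (if int p dvd Fc goal then s rAns else 1) \<and> bs' = drop (n * k * \<sigma>) bs \<and>
     t' \<le> tt + trial_time) s A bs tt"
  unfolding trial_def
proof (rule wp_SeqI[OF wp_weights[OF st bs]])
  fix s1 A1 bs1 t1
  assume P1: "(\<forall>v<n * k. A1 aWt v = bval (take \<sigma> (drop (v * \<sigma>) bs))) \<and> bs1 = drop (n * k * \<sigma>) bs \<and> t1 \<le> tt + n * k * (\<sigma> * 4 + 8) + 3"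
    and f1: "frame (weights k) s A bs s1 A1 bs1"
  have st1: "stat s1 A1" by (rule stat_cong[OF st]) (use f1 in \<open>auto simp: frame_def\<close>)
  have W1: "rz p (A1 aWt v) (w v)" if "v < n * k" for v
  proof -
    let ?b = "take \<sigma> (drop (v * \<sigma>) bs)"
    have "bval ?b < 2 ^ length ?b" by (rule bval_less)
    also have "\<dots> \<le> Nz" by (intro power_increasing) auto
    finally show ?thesis using P1 w[OF that] that pN by (simp add: rz_def wt_def)
  qed
  have a1: "s1 rAns = s rAns" using f1 by (simp add: frame_def)
  let ?Q = "\<lambda>s' A' bs' t'. s' rAns = (if int p dvd Fc goal then s rAns else 1) \<and> bs' = drop (n * k * \<sigma>) bs \<and> t' \<le> tt + trial_time"
  show "wp (clear ;; gen k ;; online k ;; CIf (Ld aF \<acute>rGoal) (rAns ::= #1) skip) ?Q s1 A1 bs1 t1"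
  proof (rule wp_SeqI[OF wp_clear[OF st1]])
    fix s2 A2 bs2 t2
    assume P2: "(\<forall>x<Nz. A2 aG x = 0 \<and> A2 aAcc x = 0) \<and> t2 \<le> t1 + Nz * 4 + 3" and f2: "frame clear s1 A1 bs1 s2 A2 bs2"
    have st2: "stat s2 A2" by (rule stat_cong[OF st1]) (use f2 in \<open>auto simp: frame_def\<close>)
    have a2: "s2 rAns = s rAns" "A2 aWt = A1 aWt" "bs2 = bs1" using f2 a1 by (simp_all add: frame_def)
    show "wp (gen k ;; online k ;; CIf (Ld aF \<acute>rGoal) (rAns ::= #1) skip) ?Q s2 A2 bs2 t2"
    proof (rule wp_SeqI[OF wp_gen[OF st2]])
      show "rz p (A2 aWt v) (w v)" if "v < n * k" for v using W1[OF that] a2 by simp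
      show "A2 aG x = 0" if "x < Nz" for x using P2 that by simp
      fix s3 A3 bs3 t3
      assume P3: "(\<forall>x<Nz. rz p (A3 aG x) (Gc x)) \<and> t3 \<le> t2 + n * 8 + t * W k * (20 * k + 26) + 3" and f3: "frame (gen k) s2 A2 bs2 s3 A3 bs3"
      have st3: "stat s3 A3" by (rule stat_cong[OF st2]) (use f3 in \<open>auto simp: frame_def\<close>)
      have a3: "s3 rAns = s rAns" "A3 aAcc = A2 aAcc" "bs3 = bs1" using f3 a2 by (simp_all add: frame_def)
      show "wp (online k ;; CIf (Ld aF \<acute>rGoal) (rAns ::= #1) skip) ?Q s3 A3 bs3 t3"
      proof (rule wp_SeqI[OF wp_online[OF st3]])
        show "rz p (A3 aG x) (Gc x)" if "x < Nz" for x using P3 that by simp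
        show "A3 aAcc x = 0" if "x < Nz" for x using P2 a3 that by simp
        fix s4 A4 bs4 t4
        assume P4: "(\<forall>x<Nz. rz p (A4 aF x) (Fc x)) \<and> t4 \<le> t3 + \<sigma> * Nz * (K1 + 2) + 4" and f4: "frame (online k) s3 A3 bs3 s4 A4 bs4"
        have a4: "s4 rAns = s rAns" "bs4 = bs1" "s4 rGoal = goal" using f4 a3 st3 by (simp_all add: frame_def conv_frame stat_def)
        have r: "rz p (A4 aF goal) (Fc goal)" using P4 gl by simp
        then have "int p dvd Fc goal \<longleftrightarrow> p dvd A4 aF goal"
          unfolding rz_def by (metis cong_dvd_iff cong_sym dvd_refl cong_0_iff cong_trans of_nat_dvd_iff)
        also have "\<dots> \<longleftrightarrow> A4 aF goal = 0" using r by (auto simp: rz_def dest: dvd_imp_le)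
        finally have e: "int p dvd Fc goal \<longleftrightarrow> A4 aF goal = 0" .
        have "t4 + 5 \<le> tt + trial_time" using P1 P2 P3 P4 unfolding trial_time_def by linarith
        moreover have "bs4 = drop (n * k * \<sigma>) bs" using P1 a4 by simp
        ultimately show "wp (CIf (Ld aF \<acute>rGoal) (rAns ::= #1) skip) ?Q s4 A4 bs4 t4"
          unfolding e skip_def using a4 Ubounds(1) by simp
      qed
    qed
  qed
qed

text \<open>A property of a segment of coins alone, independent of the weights \<open>w\<close> of
  the locale.\<close>

definition good :: "bool list \<Rightarrow> bool" where
  "good bits \<longleftrightarrow> \<not> int p dvd gf.Fc k lam J z (wt \<sigma> bits) goal"

abbreviation L :: nat where "L \<equiv> n * k * \<sigma>"

lemma wp_trials:
  assumes st: "stat s A" and dv: "\<And>i. i < R \<Longrightarrow> dv div 2 ^ i \<noteq> 0" "dv div 2 ^ R = 0" "s rDv = dv" "dv < U"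
    and bs: "R * L \<le> length bs" and gl: "goal < Nz"
  shows "wp (trials k) (\<lambda>s' A' bs' t'. (s' rAns \<noteq> 0 \<longleftrightarrow> (\<exists>\<rho><R. good (take L (drop (\<rho> * L) bs)))) \<and>
     t' \<le> tt + R * (trial_time + 5) + 5) s A bs tt"
proof -
  let ?b = "rDv ::= \<acute>rDv [div] #2 ;; trial k"
  let ?a = "\<lambda>i. (if \<exists>\<rho><i. good (take L (drop (\<rho> * L) bs)) then 1 else 0) :: nat"
  have "wp (CWhile \<acute>rDv ?b) (\<lambda>s' A' bs' t'. s' rAns = ?a R \<and> t' \<le> tt + R * (trial_time + 5) + 5) (s(rAns := 0)) A bs (tt + 1)"
  proof (rule wp_While[where n = R and I = "\<lambda>i s' A' bs' t'. s' rDv = dv div 2 ^ i \<and> s' rAns = ?a i \<and>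
     bs' = drop (i * L) bs \<and> t' \<le> tt + 1 + i * (trial_time + 5)"])
    show "(s(rAns := 0)) rDv = dv div 2 ^ 0 \<and> (s(rAns := 0)) rAns = ?a 0 \<and> bs = drop (0 * L) bs \<and> tt + 1 \<le> tt + 1 + 0 * (trial_time + 5)"
      using dv by simp
  next
    fix i s' A' bs' t'
    assume i: "i < R" and I: "s' rDv = dv div 2 ^ i \<and> s' rAns = ?a i \<and> bs' = drop (i * L) bs \<and> t' \<le> tt + 1 + i * (trial_time + 5)"
      and f: "frame ?b (s(rAns := 0)) A bs s' A' bs'"
    define bits where "bits = take L bs'"
    have "Suc i * L \<le> R * L" using i by (intro mult_right_mono) auto
    then have len: "L \<le> length bs'" using I bs by simp
    have lb: "length bits = n * k * \<sigma>" using len by (simp add: bits_def)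
    \<comment> \<open>Each round has its own weights and hence its own instance of the
      locale.\<close>
    interpret P: prog U xs k lam J z "wt \<sigma> bits" n t c \<sigma> p iv goal by (rule other_weights)
    have st': "stat (s'(rDv := dv div 2 ^ Suc i)) A'"
    proof (rule stat_cong[OF st])
      fix y :: nat assume "y \<in> {1, 3, 4, 5, 6, 7, 8, 10, 11, 12}"
      then have y: "y = 1 \<or> y = 3 \<or> y = 4 \<or> y = 5 \<or> y = 6 \<or> y = 7 \<or> y = 8 \<or> y = 10 \<or> y = 11 \<or> y = 12" by simp
      have "y \<notin> written_regs (trial k)" by (rule trial_keeps) (use y in blast)
      moreover have "y \<noteq> 0" "y \<noteq> 2" using y by (elim disjE; simp)+
      ultimately have "y \<notin> written_regs (trial k)" "y \<noteq> 0" "y \<noteq> 2" by blast+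
      then show "(s'(rDv := dv div 2 ^ Suc i)) y = s y" using f unfolding frame_def by (simp del: trial_frame)
    next
      fix j :: nat assume "j \<in> {3, 4, 5, 6, 8}"
      then have "j \<notin> written_arrays ?b" by (elim insertE emptyE) simp_all
      then show "A' j = A j" using f unfolding frame_def by blast
    qed
    have w: "wp (trial k) (\<lambda>s2 A2 bs2 t2. s2 rAns = (if int p dvd P.Fc goal then (s'(rDv := dv div 2 ^ Suc i)) rAns else 1) \<and> bs2 = drop (n * k * \<sigma>) bs' \<and>
      t2 \<le> t' + 2 + trial_time) (s'(rDv := dv div 2 ^ Suc i)) A' bs' (t' + 2)"
    proof (rule P.wp_trial[OF st' len _ gl])
      fix v assume v: "v < n * k"
      have "bs' = bits @ drop L bs'" by (simp add: bits_def)
      then show "wt \<sigma> bits v = wt \<sigma> bs' v" using wt_append[OF lb v, of "drop L bs'"] by simp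
    qed
    have g: "int p dvd P.Fc goal \<longleftrightarrow> \<not> good (take L (drop (i * L) bs))" using I by (simp add: good_def bits_def)
    have "wp (trial k) (\<lambda>s' A' bs' t'. s' rDv = dv div 2 ^ Suc i \<and> s' rAns = ?a (Suc i) \<and>
      bs' = drop (Suc i * L) bs \<and> t' \<le> tt + 1 + Suc i * (trial_time + 5)) (s'(rDv := dv div 2 ^ Suc i)) A' bs' (t' + 2)"
    proof (rule wp_frame[OF w])
      fix s2 A2 bs2 t2
      assume P: "s2 rAns = (if int p dvd P.Fc goal then (s'(rDv := dv div 2 ^ Suc i)) rAns else 1) \<and> bs2 = drop (n * k * \<sigma>) bs' \<and> t2 \<le> t' + 2 + trial_time"
        and f2: "frame (trial k) (s'(rDv := dv div 2 ^ Suc i)) A' bs' s2 A2 bs2"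
      have "rDv \<notin> written_regs (trial k)" by (rule trial_keeps) simp
      then have 1: "s2 rDv = dv div 2 ^ Suc i" using f2 unfolding frame_def by (simp del: trial_frame)
      have 2: "s2 rAns = ?a (Suc i)" using P I unfolding g less_Suc_eq by auto
      have 3: "bs2 = drop (Suc i * L) bs" using P I by (simp add: add.commute)
      have "t2 \<le> tt + 1 + Suc i * (trial_time + 5)" using P I by simp
      then show "s2 rDv = dv div 2 ^ Suc i \<and> s2 rAns = ?a (Suc i) \<and> bs2 = drop (Suc i * L) bs \<and> t2 \<le> tt + 1 + Suc i * (trial_time + 5)"
        using 1 2 3 by blast
    qed
    moreover have "dv div 2 ^ i div 2 = dv div 2 ^ Suc i" by (simp add: div_mult2_eq[symmetric] mult.commute)
    moreover have "dv div 2 ^ Suc i < U" using dv(4) by (rule div_less_bound)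
    ultimately show "aval \<acute>rDv s' A' \<noteq> 0 \<and> wp ?b (\<lambda>s' A' bs' t'. s' rDv = dv div 2 ^ Suc i \<and> s' rAns = ?a (Suc i) \<and>
      bs' = drop (Suc i * L) bs \<and> t' \<le> tt + 1 + Suc i * (trial_time + 5)) s' A' bs' (t' + 1)"
      using I dv(1)[OF i] by simp
  qed (use dv in auto)
  then have "wp (CWhile \<acute>rDv ?b) (\<lambda>s' A' bs' t'. (s' rAns \<noteq> 0 \<longleftrightarrow> (\<exists>\<rho><R. good (take L (drop (\<rho> * L) bs)))) \<and>
     t' \<le> tt + R * (trial_time + 5) + 5) (s(rAns := 0)) A bs (tt + 1)"
    by (rule wp_mono) (simp split: if_splits)
  then show ?thesis unfolding trials_def using Ubounds(1) by simp
qed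

end

text \<open>The harmonic sum by dyadic groups: each group of denominators between consecutive powers
  of two contributes at most \<open>X\<close>.\<close>

lemma harmonic_div: "(\<Sum>i<2 ^ l. X div (i + 2)) \<le> X * (l + 1)" for X :: nat
proof (induction l)
  case (Suc l)
  have "(\<Sum>i<(2::nat) ^ Suc l. X div (i + 2)) = (\<Sum>i<(2::nat) ^ l. X div (i + 2)) + (\<Sum>i=2 ^ l..<(2::nat) ^ Suc l. X div (i + 2))"
    unfolding lessThan_atLeast0 by (rule sum.atLeastLessThan_concat[symmetric]) auto
  also have "(\<Sum>i=2 ^ l..<(2::nat) ^ Suc l. X div (i + 2)) \<le> (\<Sum>i=2 ^ l..<(2::nat) ^ Suc l. X div 2 ^ l)"
    by (intro sum_mono div_le_mono2) auto
  also have "\<dots> = 2 ^ l * (X div 2 ^ l)" by simp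
  also have "\<dots> \<le> X" by (rule times_div_less_eq_dividend)
  finally show ?case using Suc by simp
qed simp

text \<open>Adds what the setup needs. Table size and prime are found by searches that stop at the
  first success, hence the minimality of \<open>\<sigma>\<close> and \<open>p\<close>.\<close>

locale prog2 = prog U xs k lam J z w n t c \<sigma> p iv goal
  for U xs k lam J z w n t c \<sigma> p iv goal +
  assumes smin: "\<And>i. i < \<sigma> \<Longrightarrow> 2 ^ i < W (2 * k)"
    and pmin: "\<And>q. 2 ^ \<sigma> < q \<Longrightarrow> q < p \<Longrightarrow> \<not> prime q" and pM: "p \<le> 4 * \<sigma> * 2 ^ \<sigma>"
    and ivp: "iv = (p + 1) div 2"
    and goal: "goal = (\<Sum>i<k. xs ! (2 + i) * W (k + i) + xs ! (2 + k + i) * W i)"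
    and tcs: "\<And>i. i < k \<Longrightarrow> xs ! (2 + i) \<le> t" "\<And>i. i < k \<Longrightarrow> xs ! (2 + k + i) \<le> c"
begin

lemma wp_tables:
  assumes r: "s rTm = t" "s rCm = c"
  shows "wp (tables k) (\<lambda>s' A' bs' t'. (\<forall>d<2 * k. A' aW d = W d \<and> A' aBs d = \<beta> d \<and> A' aLm d = lam d) \<and>
    s' rD = W (2 * k) \<and> s' rYk = W k \<and> t' \<le> tt + k * 20 + 10) s A bs tt"
proof -
  let ?b = "CIf (#k [-] \<acute>ri) (17 ::= \<acute>rCm) (17 ::= \<acute>rTm) ;; Sto aLm \<acute>ri \<acute>17 ;;
     18 ::= #2 [*] \<acute>17 [+] #2 ;; Sto aBs \<acute>ri \<acute>18 ;; Sto aW \<acute>ri \<acute>rD ;; rD ::= \<acute>rD [*] \<acute>18"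
  have WU: "W d < U" if "d \<le> 2 * k" for d using W_le[OF that] DN Ubounds(3) by linarith
  have "\<beta> d \<le> W (2 * k)" for d
  proof -
    have "(2 * c + 2) * 1 \<le> (2 * c + 2) * (2 * t + 2)" "1 * (2 * t + 2) \<le> (2 * c + 2) * (2 * t + 2)" by (intro mult_le_mono; simp)+
    then have "2 * c + 2 \<le> W (2 * k)" "2 * t + 2 \<le> W (2 * k)" using digits_le_W unfolding mult_1 mult_1_right by (blast intro: le_trans)+
    then show ?thesis by (cases "d < k") (simp_all only: \<beta>_y \<beta>_x not_less)
  qed
  then have bU: "\<beta> d < U" for d using WU[of "2 * k"] by (meson le_less_trans order_refl)
  then have lU: "lam d < U" "2 * lam d + 2 < U" for d using bU[of d] unfolding \<beta>_def by linarith+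
  have "wp (For ri #(2 * k) ?b ;; rYk ::= Ld aW #k) (\<lambda>s' A' bs' t'. (\<forall>d<2 * k. A' aW d = W d \<and> A' aBs d = \<beta> d \<and> A' aLm d = lam d) \<and>
    s' rD = W (2 * k) \<and> s' rYk = W k \<and> t' \<le> tt + k * 20 + 10) (s(rD := 1)) A bs (tt + 1)"
  proof (rule wp_SeqI)
    show "wp (For ri #(2 * k) ?b) (\<lambda>s' A' bs' t'. (\<forall>d<2 * k. A' aW d = W d \<and> A' aBs d = \<beta> d \<and> A' aLm d = lam d) \<and>
      s' rD = W (2 * k) \<and> t' \<le> tt + 1 + 2 * k * 10 + 3) (s(rD := 1)) A bs (tt + 1)"
    proof (rule wp_For[where n = "2 * k" and I = "\<lambda>m s' A' bs' t'. (\<forall>d<m. A' aW d = W d \<and> A' aBs d = \<beta> d \<and> A' aLm d = lam d) \<and>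
      s' rD = W m \<and> t' \<le> tt + 1 + m * 10 + 1"])
      fix m s' A' bs' t'
      assume m: "m < 2 * k" "s' ri = m" and I: "(\<forall>d<m. A' aW d = W d \<and> A' aBs d = \<beta> d \<and> A' aLm d = lam d) \<and> s' rD = W m \<and> t' \<le> tt + 1 + m * 10 + 1"
        and f: "frame (For ri #(2 * k) ?b) (s(rD := 1)) A bs s' A' bs'"
      have r': "s' rCm = c" "s' rTm = t" using f r by (simp_all add: frame_def)
      have WS: "W m * \<beta> m = W (Suc m)" by (simp add: radix_Suc)
      have WSU: "W (Suc m) < U" using m by (intro WU) simp
      have \<beta>m: "2 * lam m + 2 = \<beta> m" by (simp add: \<beta>_def)
      show "wp ?b (\<lambda>s2 A2 bs2 t2. (\<forall>d<Suc m. A2 aW d = W d \<and> A2 aBs d = \<beta> d \<and> A2 aLm d = lam d) \<and>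
        (s2(ri := Suc m)) rD = W (Suc m) \<and> t2 + 1 \<le> tt + 1 + Suc m * 10 + 1) s' A' bs' (t' + 1)"
      proof (cases "m < k")
        case True
        have "lam m = c" using True by (rule lam_y)
        then show ?thesis using True I m r' lU[of m] bU[of m] WS WSU WU[of m] \<beta>m by (auto simp: less_Suc_eq)
      next
        case False
        then have "lam m = t" by (intro lam_x) simp
        then show ?thesis using False I m r' lU[of m] bU[of m] WS WSU WU[of m] \<beta>m by (auto simp: less_Suc_eq)
      qed
    qed (use Ubounds in auto)
    fix s1 A1 bs1 t1
    assume "(\<forall>d<2 * k. A1 aW d = W d \<and> A1 aBs d = \<beta> d \<and> A1 aLm d = lam d) \<and> s1 rD = W (2 * k) \<and> t1 \<le> tt + 1 + 2 * k * 10 + 3"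
    then show "wp (rYk ::= Ld aW #k) (\<lambda>s' A' bs' t'. (\<forall>d<2 * k. A' aW d = W d \<and> A' aBs d = \<beta> d \<and> A' aLm d = lam d) \<and>
      s' rD = W (2 * k) \<and> s' rYk = W k \<and> t' \<le> tt + k * 20 + 10) s1 A1 bs1 t1"
      using k1 WU[of k] by simp
  qed
  then show ?thesis unfolding tables_def using Ubounds(1) by simp
qed

lemma goal_valid: "goal = cd (\<lambda>d. if d < k then xs ! (2 + k + d) else if d < 2 * k then xs ! (2 + (d - k)) else 0)"
proof -
  let ?\<kappa> = "\<lambda>d. if d < k then xs ! (2 + k + d) else if d < 2 * k then xs ! (2 + (d - k)) else 0"
  have "cd ?\<kappa> = (\<Sum>d<k. ?\<kappa> d * W d) + (\<Sum>d=k..<2 * k. ?\<kappa> d * W d)"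
    unfolding code_def lessThan_atLeast0 by (rule sum.atLeastLessThan_concat[symmetric]) auto
  also have "(\<Sum>d=k..<2 * k. ?\<kappa> d * W d) = (\<Sum>d<k. ?\<kappa> (d + k) * W (d + k))"
    using sum.shift_bounds_nat_ivl[of "\<lambda>d. ?\<kappa> d * W d" 0 k k] by (simp add: lessThan_atLeast0 mult_2)
  finally show ?thesis unfolding goal by (simp add: sum.distrib[symmetric] add.commute)
qed

lemma vk_goal: "vk (\<lambda>d. if d < k then xs ! (2 + k + d) else if d < 2 * k then xs ! (2 + (d - k)) else 0)"
  unfolding vk_def using tcs lam_x lam_y by auto

lemma goal_less: "goal < Nz"
  using vk_cd[OF vk_goal] DN by (simp add: goal_valid okc_def)

lemma wp_goalc:
  assumes "\<And>d. d < 2 * k \<Longrightarrow> A aW d = W d"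
  shows "wp (goalc k) (\<lambda>s' A' bs' t'. s' rGoal = goal \<and> t' \<le> tt + k * 8 + 5) s A bs tt"
proof -
  let ?g = "\<lambda>m. \<Sum>i<m. xs ! (2 + i) * W (k + i) + xs ! (2 + k + i) * W i"
  let ?b = "Inp 17 (#2 [+] \<acute>ri) ;; rGoal ::= \<acute>rGoal [+] \<acute>17 [*] Ld aW (#k [+] \<acute>ri) ;;
     Inp 17 (#(2 + k) [+] \<acute>ri) ;; rGoal ::= \<acute>rGoal [+] \<acute>17 [*] Ld aW \<acute>ri"
  have gU: "?g m < U" if "m \<le> k" for m
  proof -
    have "?g m \<le> goal" unfolding goal using that by (intro sum_mono2) auto
    then show ?thesis using goal_less Ubounds(3) by linarith
  qed
  have "wp (For ri #k ?b) (\<lambda>s' A' bs' t'. s' rGoal = goal \<and> t' \<le> tt + k * 8 + 5) (s(rGoal := 0)) A bs (tt + 1)"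
  proof (rule wp_For[where n = k and I = "\<lambda>m s' A' bs' t'. s' rGoal = ?g m \<and> t' \<le> tt + 1 + m * 8 + 1"])
    fix m s' A' bs' t'
    assume m: "m < k" "s' ri = m" and I: "s' rGoal = ?g m \<and> t' \<le> tt + 1 + m * 8 + 1" and f: "frame (For ri #k ?b) (s(rGoal := 0)) A bs s' A' bs'"
    have "A' aW (k + m) = W (k + m)" "A' aW m = W m" using f assms m by (simp_all add: frame_def)
    then show "wp ?b (\<lambda>s2 A2 bs2 t2. (s2(ri := Suc m)) rGoal = ?g (Suc m) \<and> t2 + 1 \<le> tt + 1 + Suc m * 8 + 1) s' A' bs' (t' + 1)"
      using I m gU[of "Suc m"] inp(1) by (simp add: add.commute add.left_commute)
  qed (use Ubounds goal in auto)
  then show ?thesis unfolding goalc_def using Ubounds(1) by simp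
qed

lemma wp_sizeN:
  assumes r: "s rD = W (2 * k)"
  shows "wp sizeN (\<lambda>s' A' bs' t'. s' rSize = Nz \<and> s' rLog = \<sigma> \<and> (\<forall>i\<le>\<sigma>. A' aPw i = 2 ^ i) \<and> t' \<le> tt + \<sigma> * 4 + 5) s A bs tt"
proof -
  let ?b = "rSize ::= #2 [*] \<acute>rSize ;; rLog ::= \<acute>rLog [+] #1 ;; Sto aPw \<acute>rLog \<acute>rSize"
  define A0 where "A0 = A(aPw := (A aPw)(0 := 1))"
  have "wp (CWhile (\<acute>rD [-] \<acute>rSize) ?b) (\<lambda>s' A' bs' t'. s' rSize = Nz \<and> s' rLog = \<sigma> \<and> (\<forall>i\<le>\<sigma>. A' aPw i = 2 ^ i) \<and> t' \<le> tt + \<sigma> * 4 + 5)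
    (s(rSize := 1, rLog := 0)) A0 bs (tt + 3)"
  proof (rule wp_While[where n = \<sigma> and I = "\<lambda>m s' A' bs' t'. s' rSize = 2 ^ m \<and> s' rLog = m \<and> (\<forall>i\<le>m. A' aPw i = 2 ^ i) \<and> t' \<le> tt + 3 + m * 4"])
    fix m s' A' bs' t'
    assume m: "m < \<sigma>" and I: "s' rSize = 2 ^ m \<and> s' rLog = m \<and> (\<forall>i\<le>m. A' aPw i = 2 ^ i) \<and> t' \<le> tt + 3 + m * 4"
      and f: "frame ?b (s(rSize := 1, rLog := 0)) A0 bs s' A' bs'"
    have "s' rD = W (2 * k)" using f r by (simp add: frame_def)
    moreover have "(2::nat) ^ Suc m \<le> Nz" using m by (intro power_increasing) auto
    then have "2 * 2 ^ m < U" using Ubounds(3) by simp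
    moreover have "Suc m < U" using m Ubounds(5) by simp
    ultimately show "aval (\<acute>rD [-] \<acute>rSize) s' A' \<noteq> 0 \<and>
      wp ?b (\<lambda>s' A' bs' t'. s' rSize = 2 ^ Suc m \<and> s' rLog = Suc m \<and> (\<forall>i\<le>Suc m. A' aPw i = 2 ^ i) \<and> t' \<le> tt + 3 + Suc m * 4) s' A' bs' (t' + 1)"
      using I smin[OF m] by (auto simp: le_Suc_eq)
  qed (use r DN in \<open>auto simp: frame_def A0_def\<close>)
  then show ?thesis unfolding sizeN_def using Ubounds(1) by (simp add: A0_def numeral_3_eq_3)
qed

abbreviation Mx :: nat where "Mx \<equiv> 4 * \<sigma> * Nz"

lemma wp_sieve:
  assumes r: "s rSize = Nz" "s rLog = \<sigma>" and A: "\<And>x. A aMark x = 0"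
  shows "wp sieve (\<lambda>s' A' bs' t'. (\<forall>x. 2 \<le> x \<longrightarrow> x \<le> Mx \<longrightarrow> (A' aMark x = 0 \<longleftrightarrow> prime x)) \<and>
     t' \<le> tt + Mx * (2 * \<sigma> + 2) * 3 + Mx * 6 + 5) s A bs tt"
proof -
  let ?i = "For rj (\<acute>rMax [div] (\<acute>ri [+] #2)) (Sto aMark ((\<acute>ri [+] #2) [*] (\<acute>rj [+] #2)) #1)"
  have MU: "Mx < U" using Ubounds(8) by (simp only: mult.assoc)
  let ?D = "\<lambda>m. \<Sum>i<m. Mx div (i + 2)"
  let ?comp = "\<lambda>x. \<exists>a b. 2 \<le> a \<and> 2 \<le> b \<and> x = a * (b :: nat)"
  have "wp (For ri \<acute>rMax ?i) (\<lambda>s' A' bs' t'. (\<forall>x. A' aMark x \<noteq> 0 \<longrightarrow> ?comp x) \<and>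
     (\<forall>i<Mx. \<forall>j<Mx div (i + 2). A' aMark ((i + 2) * (j + 2)) \<noteq> 0) \<and> t' \<le> tt + ?D Mx * 3 + Mx * 6 + 4) (s(rMax := Mx)) A bs (tt + 1)"
  proof (rule wp_For[where n = Mx and I = "\<lambda>m s' A' bs' t'. (\<forall>x. A' aMark x \<noteq> 0 \<longrightarrow> ?comp x) \<and>
     (\<forall>i<m. \<forall>j<Mx div (i + 2). A' aMark ((i + 2) * (j + 2)) \<noteq> 0) \<and> t' \<le> tt + ?D m * 3 + m * 6 + 2"])
    fix m s' A' bs' t'
    assume m: "m < Mx" "s' ri = m" and I: "(\<forall>x. A' aMark x \<noteq> 0 \<longrightarrow> ?comp x) \<and>
     (\<forall>i<m. \<forall>j<Mx div (i + 2). A' aMark ((i + 2) * (j + 2)) \<noteq> 0) \<and> t' \<le> tt + ?D m * 3 + m * 6 + 2"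
      and f: "frame (For ri \<acute>rMax ?i) (s(rMax := Mx)) A bs s' A' bs'"
    have rM: "s' rMax = Mx" using f by (simp add: frame_def)
    show "wp ?i (\<lambda>s2 A2 bs2 t2. (\<forall>x. A2 aMark x \<noteq> 0 \<longrightarrow> ?comp x) \<and>
     (\<forall>i<Suc m. \<forall>j<Mx div (i + 2). A2 aMark ((i + 2) * (j + 2)) \<noteq> 0) \<and> t2 + 1 \<le> tt + ?D (Suc m) * 3 + Suc m * 6 + 2) s' A' bs' (t' + 1)"
    proof (rule wp_For[where n = "Mx div (m + 2)" and I = "\<lambda>j s2 A2 bs2 t2. (\<forall>x. A2 aMark x \<noteq> 0 \<longrightarrow> ?comp x) \<and>
       (\<forall>i<m. \<forall>j<Mx div (i + 2). A2 aMark ((i + 2) * (j + 2)) \<noteq> 0) \<and> (\<forall>j'<j. A2 aMark ((m + 2) * (j' + 2)) \<noteq> 0) \<and> t2 \<le> t' + 1 + j * 3 + 1"])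
      show "Mx div (m + 2) < U" using MU by (rule div_less_bound)
    next
      fix j s2 A2 bs2 t2
      assume j: "j < Mx div (m + 2)" "s2 rj = j" and I2: "(\<forall>x. A2 aMark x \<noteq> 0 \<longrightarrow> ?comp x) \<and>
       (\<forall>i<m. \<forall>j<Mx div (i + 2). A2 aMark ((i + 2) * (j + 2)) \<noteq> 0) \<and> (\<forall>j'<j. A2 aMark ((m + 2) * (j' + 2)) \<noteq> 0) \<and> t2 \<le> t' + 1 + j * 3 + 1"
        and f2: "frame ?i s' A' bs' s2 A2 bs2"
      have ri: "s2 ri = m" using f2 m by (simp add: frame_def)
      define y where "y = (m + 2) * (j + 2)"
      have cy: "?comp y" unfolding y_def by (intro exI[of _ "m + 2"] exI[of _ "j + 2"]) simp
      let ?A3 = "A2(aMark := (A2 aMark)(y := 1))"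
      have "(\<forall>x. ?A3 aMark x \<noteq> 0 \<longrightarrow> ?comp x) \<and> (\<forall>i<m. \<forall>j<Mx div (i + 2). ?A3 aMark ((i + 2) * (j + 2)) \<noteq> 0) \<and>
        (\<forall>j'<Suc j. ?A3 aMark ((m + 2) * (j' + 2)) \<noteq> 0)"
        using I2 cy by (auto simp: less_Suc_eq y_def simp del: mult_Suc mult_Suc_right add_2_eq_Suc')
      moreover have "aval ((\<acute>ri [+] #2) [*] (\<acute>rj [+] #2)) s2 A2 = y" by (simp add: y_def ri j)
      ultimately show "wp (Sto aMark ((\<acute>ri [+] #2) [*] (\<acute>rj [+] #2)) #1) (\<lambda>s2 A2 bs2 t2. (\<forall>x. A2 aMark x \<noteq> 0 \<longrightarrow> ?comp x) \<and>
       (\<forall>i<m. \<forall>j<Mx div (i + 2). A2 aMark ((i + 2) * (j + 2)) \<noteq> 0) \<and> (\<forall>j'<Suc j. A2 aMark ((m + 2) * (j' + 2)) \<noteq> 0) \<and>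
       t2 + 1 \<le> t' + 1 + Suc j * 3 + 1) s2 A2 bs2 (t2 + 1)"
        unfolding wp_Sto using I2 Ubounds(1) by simp
    next
      fix s2 A2 bs2 t2
      assume I2: "(\<forall>x. A2 aMark x \<noteq> 0 \<longrightarrow> ?comp x) \<and>
       (\<forall>i<m. \<forall>j<Mx div (i + 2). A2 aMark ((i + 2) * (j + 2)) \<noteq> 0) \<and> (\<forall>j'<Mx div (m + 2). A2 aMark ((m + 2) * (j' + 2)) \<noteq> 0) \<and>
       t2 \<le> t' + 1 + Mx div (m + 2) * 3 + 1"
      have *: "t' \<le> tt + e1 * 3 + m * 6 + 2 \<Longrightarrow> t2 \<le> t' + 1 + e2 * 3 + 1 \<Longrightarrow>
        t2 + 1 + 1 \<le> tt + (e1 + e2) * 3 + Suc m * 6 + 2" for e1 e2 :: nat by simp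
      have "t2 + 1 + 1 \<le> tt + (?D m + Mx div (m + 2)) * 3 + Suc m * 6 + 2" by (rule *) (use I I2 in blast)+
      then have "t2 + 1 + 1 \<le> tt + ?D (Suc m) * 3 + Suc m * 6 + 2" by (simp only: sum.lessThan_Suc)
      then show "(\<forall>x. A2 aMark x \<noteq> 0 \<longrightarrow> ?comp x) \<and>
       (\<forall>i<Suc m. \<forall>j<Mx div (i + 2). A2 aMark ((i + 2) * (j + 2)) \<noteq> 0) \<and> t2 + 1 + 1 \<le> tt + ?D (Suc m) * 3 + Suc m * 6 + 2"
        using I2 less_Suc_eq by metis
    qed (use I rM m in \<open>auto simp: frame_def\<close>)
  qed (use MU A in \<open>auto simp: frame_def\<close>)
  then have "wp (For ri \<acute>rMax ?i) (\<lambda>s' A' bs' t'. (\<forall>x. 2 \<le> x \<longrightarrow> x \<le> Mx \<longrightarrow> (A' aMark x = 0 \<longleftrightarrow> prime x)) \<and>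
     t' \<le> tt + Mx * (2 * \<sigma> + 2) * 3 + Mx * 6 + 5) (s(rMax := Mx)) A bs (tt + 1)"
  proof (rule wp_mono)
    fix s' A' bs' t'
    assume a: "(\<forall>x. A' aMark x \<noteq> 0 \<longrightarrow> ?comp x) \<and>
     (\<forall>i<Mx. \<forall>j<Mx div (i + 2). A' aMark ((i + 2) * (j + 2)) \<noteq> 0) \<and> t' \<le> tt + ?D Mx * 3 + Mx * 6 + 4"
    have "A' aMark x = 0 \<longleftrightarrow> prime x" if x: "2 \<le> x" "x \<le> Mx" for x
    proof
      assume z: "A' aMark x = 0"
      show "prime x"
      proof (rule ccontr)
        assume "\<not> prime x"
        then obtain m where m: "m dvd x" "m \<noteq> 1" "m \<noteq> x" using x by (auto simp: prime_nat_iff)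
        then obtain b where b: "x = m * b" by (elim dvdE)
        have "m \<noteq> 0" "b \<noteq> 1" using m b x by auto
        moreover have "b \<noteq> 0" using b x by (intro notI) simp
        ultimately have mb: "2 \<le> m" "2 \<le> b" using m(2) by linarith+
        have "m < x" using b mb x by simp
        then have 1: "m - 2 < Mx" using x by simp
        have "b \<le> Mx div m" using b x mb by (simp add: less_eq_div_iff_mult_less_eq mult.commute)
        then have "b - 2 < Mx div m" using mb by simp
        moreover have m2: "m - 2 + 2 = m" "b - 2 + 2 = b" using mb by simp_all
        ultimately have "b - 2 < Mx div (m - 2 + 2)" by (simp only:)
        then have "A' aMark ((m - 2 + 2) * (b - 2 + 2)) \<noteq> 0" using a 1 by blast
        then show False using z b unfolding m2 by simp
      qed
    next
      assume "prime x"
      show "A' aMark x = 0"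
      proof (rule ccontr)
        assume "A' aMark x \<noteq> 0"
        then obtain a' b where ab: "2 \<le> a'" "2 \<le> b" "x = a' * b" using a by blast
        then show False using \<open>prime x\<close> prime_product[of a' b] by auto
      qed
    qed
    moreover have "?D Mx \<le> Mx * (2 * \<sigma> + 2)"
    proof -
      \<comment> \<open>\<open>Mx\<close> is at most \<open>2 ^ (2 * \<sigma> + 1)\<close>, which
        gives the number of groups for \<open>harmonic_div\<close>.\<close>
      have "2 * \<sigma> \<le> Nz" using s2 by (induction \<sigma> rule: dec_induct) auto
      then have "Mx \<le> 2 * Nz * Nz" by (intro mult_right_mono) auto
      also have "\<dots> = 2 ^ (2 * \<sigma> + 1)" by (simp add: power_add mult_2 distrib_right)
      finally have "?D Mx \<le> (\<Sum>i<2 ^ (2 * \<sigma> + 1). Mx div (i + 2))" by (intro sum_mono2) auto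
      then show ?thesis using harmonic_div[of Mx "2 * \<sigma> + 1"] by simp
    qed
    ultimately show "(\<forall>x. 2 \<le> x \<longrightarrow> x \<le> Mx \<longrightarrow> (A' aMark x = 0 \<longleftrightarrow> prime x)) \<and> t' \<le> tt + Mx * (2 * \<sigma> + 2) * 3 + Mx * 6 + 5"
      using a by (auto simp: algebra_simps)
  qed
  then show ?thesis unfolding sieve_def using r MU by simp
qed

lemma wp_findp:
  assumes r: "s rSize = Nz" and A: "\<And>x. 2 \<le> x \<Longrightarrow> x \<le> Mx \<Longrightarrow> A aMark x = 0 \<longleftrightarrow> prime x"
  shows "wp findp (\<lambda>s' A' bs' t'. s' rP = p \<and> s' rInv2 = iv \<and> t' \<le> tt + Mx * 2 + 5) s A bs tt"
proof -
  let ?b = "rP ::= \<acute>rP [+] #1"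
  have Nz1: "1 \<le> Nz" by simp
  have "wp (CWhile (Ld aMark \<acute>rP) ?b ;; rInv2 ::= (\<acute>rP [+] #1) [div] #2) (\<lambda>s' A' bs' t'. s' rP = p \<and> s' rInv2 = iv \<and> t' \<le> tt + Mx * 2 + 5)
    (s(rP := Nz + 1)) A bs (tt + 1)"
  proof (rule wp_SeqI)
    show "wp (CWhile (Ld aMark \<acute>rP) ?b) (\<lambda>s' A' bs' t'. s' rP = p \<and> t' \<le> tt + Mx * 2 + 2) (s(rP := Nz + 1)) A bs (tt + 1)"
    proof (rule wp_While[where n = "p - (Nz + 1)" and I = "\<lambda>m s' A' bs' t'. s' rP = Nz + 1 + m \<and> t' \<le> tt + 1 + m * 2"])
      fix m s' A' bs' t'
      assume m: "m < p - (Nz + 1)" and I: "s' rP = Nz + 1 + m \<and> t' \<le> tt + 1 + m * 2" and f: "frame ?b (s(rP := Nz + 1)) A bs s' A' bs'"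
      have "\<not> prime (Nz + 1 + m)" using m by (intro pmin) auto
      moreover have "Nz + 1 + m \<le> Mx" using m pM by simp
      moreover have "A' = A" using f by (auto simp: frame_def)
      ultimately show "aval (Ld aMark \<acute>rP) s' A' \<noteq> 0 \<and> wp ?b (\<lambda>s' A' bs' t'. s' rP = Nz + 1 + Suc m \<and> t' \<le> tt + 1 + Suc m * 2) s' A' bs' (t' + 1)"
        using I A[of "Nz + 1 + m"] Nz1 m U(1) by simp
    next
      fix s' A' bs' t'
      assume I: "s' rP = Nz + 1 + (p - (Nz + 1)) \<and> t' \<le> tt + 1 + (p - (Nz + 1)) * 2" and f: "frame ?b (s(rP := Nz + 1)) A bs s' A' bs'"
      have e: "Nz + 1 + (p - (Nz + 1)) = p" using pN by simp
      have "2 \<le> p" using prime by (rule prime_ge_2_nat)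
      moreover have "A' = A" using f by (auto simp: frame_def)
      ultimately show "aval (Ld aMark \<acute>rP) s' A' = 0 \<and> s' rP = p \<and> t' + 1 \<le> tt + Mx * 2 + 2"
        using I A[of p] pM prime unfolding e by auto
    qed auto
    fix s1 A1 bs1 t1 assume "s1 rP = p \<and> t1 \<le> tt + Mx * 2 + 2"
    moreover have "(p + 1) div 2 < U"
    proof -
      have "(p + 1) div 2 \<le> p" using p0 by simp
      then show ?thesis using U(1) by simp
    qed
    ultimately show "wp (rInv2 ::= (\<acute>rP [+] #1) [div] #2) (\<lambda>s' A' bs' t'. s' rP = p \<and> s' rInv2 = iv \<and> t' \<le> tt + Mx * 2 + 5) s1 A1 bs1 t1"
      by (simp add: ivp)
  qed
  moreover have "Nz + 1 < U" using pN U(1) by simp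
  ultimately show ?thesis unfolding findp_def using r by simp
qed

lemma wp_invs:
  assumes r: "s rSize = Nz" "s rP = p"
  shows "wp invs (\<lambda>s' A' bs' t'. (\<forall>x. 0 < x \<longrightarrow> x < Nz \<longrightarrow> [int (A' aInv x) * int x = 1] (mod int p)) \<and> t' \<le> tt + Nz * 5 + 5) s A bs tt"
proof -
  let ?b = "17 ::= \<acute>ri [+] #2 ;; Sto aInv \<acute>17 (((\<acute>rP [-] \<acute>rP [div] \<acute>17) [*] Ld aInv (\<acute>rP [mod] \<acute>17)) [mod] \<acute>rP)"
  define A0 where "A0 = A(aInv := (A aInv)(1 := 1))"
  have N4: "2 \<le> Nz" using power_increasing[of 1 \<sigma> "2::nat"] s2 by simp
  have "wp (For ri (\<acute>rSize [-] #2) ?b) (\<lambda>s' A' bs' t'. (\<forall>x. 0 < x \<longrightarrow> x < Nz \<longrightarrow> [int (A' aInv x) * int x = 1] (mod int p)) \<and> t' \<le> tt + Nz * 5 + 5) s A0 bs (tt + 1)"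
  proof (rule wp_For[where n = "Nz - 2" and I = "\<lambda>m s' A' bs' t'. (\<forall>x. 0 < x \<longrightarrow> x < m + 2 \<longrightarrow> [int (A' aInv x) * int x = 1] (mod int p)) \<and> t' \<le> tt + 2 + m * 5"])
    show "Nz - 2 < U" using Ubounds(3) by simp
  next
    show "(\<forall>x. 0 < x \<longrightarrow> x < 0 + 2 \<longrightarrow> [int (A0 aInv x) * int x = 1] (mod int p)) \<and> tt + 1 + 1 \<le> tt + 2 + 0 * 5"
    proof -
      have "x = 1" if "0 < x" "x < 0 + 2" for x :: nat using that by simp
      then have "\<forall>x. 0 < x \<longrightarrow> x < 0 + 2 \<longrightarrow> [int (A0 aInv x) * int x = 1] (mod int p)" unfolding A0_def by (metis fun_upd_same mult_1 of_nat_1 cong_refl)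
      then show ?thesis by simp
    qed
  next
    fix m s' A' bs' t'
    assume m: "m < Nz - 2" "s' ri = m" and I: "(\<forall>x. 0 < x \<longrightarrow> x < m + 2 \<longrightarrow> [int (A' aInv x) * int x = 1] (mod int p)) \<and> t' \<le> tt + 2 + m * 5"
      and f: "frame (For ri (\<acute>rSize [-] #2) ?b) s A0 bs s' A' bs'"
    have rP: "s' rP = p" using f r by (simp add: frame_def)
    define x where "x = m + 2"
    define q where "q = p div x"
    define y where "y = p mod x"
    have x: "2 \<le> x" "x < Nz" using m by (auto simp: x_def)
    then have xp: "x < p" using pN by simp
    have pq: "p = q * x + y" by (simp add: q_def y_def)
    \<comment> \<open>\<open>p\<close> is prime and \<open>2 \<le> x < p\<close>, so the remainder
      is not zero and its inverse has been computed before.\<close>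
    have y: "0 < y" "y < x"
    proof -
      have "\<not> x dvd p" using prime x xp by (auto simp: prime_nat_iff)
      then show "0 < y" by (simp add: y_def dvd_eq_mod_eq_0)
      show "y < x" using x by (simp add: y_def)
    qed
    have iy: "[int (A' aInv y) * int y = 1] (mod int p)" using I y by (simp add: x_def)
    have qp: "q \<le> p" by (simp add: q_def)
    have "int y = int p - int q * int x"
      using pq by (metis add_diff_cancel_left' of_nat_add of_nat_mult)
    then have "[int (A' aInv y) * (int p - int q * int x) = 1] (mod int p)" using iy by simp
    moreover have "[(int p - int q) * int (A' aInv y) * int x = int (A' aInv y) * (int p - int q * int x)] (mod int p)"
      unfolding cong_iff_dvd_diff by (rule dvdI[of _ _ "int (A' aInv y) * int x - int (A' aInv y)"]) (simp add: algebra_simps)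
    ultimately have "[(int p - int q) * int (A' aInv y) * int x = 1] (mod int p)" using cong_trans by blast
    then have c1: "[int ((p - q) * A' aInv y) * int x = 1] (mod int p)" using qp by (simp add: of_nat_diff)
    have "[int ((p - q) * A' aInv y mod p) = int ((p - q) * A' aInv y)] (mod int p)" by (simp add: cong_def zmod_int)
    then have c: "[int ((p - q) * A' aInv y mod p) * int x = 1] (mod int p)" using c1 cong_trans cong_mult[OF _ cong_refl] by blast
    have v: "aval (((\<acute>rP [-] \<acute>rP [div] \<acute>17) [*] Ld aInv (\<acute>rP [mod] \<acute>17)) [mod] \<acute>rP) (s'(17 := x)) A' = (p - q) * A' aInv y mod p"
      using rP by (simp add: q_def y_def)
    have "x < U" using x Ubounds(3) by simp
    have "wp (Sto aInv \<acute>17 (((\<acute>rP [-] \<acute>rP [div] \<acute>17) [*] Ld aInv (\<acute>rP [mod] \<acute>17)) [mod] \<acute>rP))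
      (\<lambda>s2 A2 bs2 t2. (\<forall>x. 0 < x \<longrightarrow> x < Suc m + 2 \<longrightarrow> [int (A2 aInv x) * int x = 1] (mod int p)) \<and> t2 + 1 \<le> tt + 2 + Suc m * 5)
      (s'(17 := x)) A' bs' (t' + 2)"
      unfolding wp_Sto v using I c mod_less_bound'[OF p0 U(1)] by (auto simp: x_def less_Suc_eq)
    then show "wp ?b (\<lambda>s2 A2 bs2 t2. (\<forall>x. 0 < x \<longrightarrow> x < Suc m + 2 \<longrightarrow> [int (A2 aInv x) * int x = 1] (mod int p)) \<and> t2 + 1 \<le> tt + 2 + Suc m * 5) s' A' bs' (t' + 1)"
      using m \<open>x < U\<close> by (simp add: x_def)
  next
    fix s' A' bs' t'
    assume I: "(\<forall>x. 0 < x \<longrightarrow> x < Nz - 2 + 2 \<longrightarrow> [int (A' aInv x) * int x = 1] (mod int p)) \<and> t' \<le> tt + 2 + (Nz - 2) * 5"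
    have "Nz - 2 + 2 = Nz" using N4 by simp
    moreover have "(Nz - 2) * 5 \<le> Nz * 5" by simp
    then have "t' + 1 \<le> tt + Nz * 5 + 5" using I by linarith
    ultimately show "(\<forall>x. 0 < x \<longrightarrow> x < Nz \<longrightarrow> [int (A' aInv x) * int x = 1] (mod int p)) \<and> t' + 1 \<le> tt + Nz * 5 + 5"
      using I by simp
  qed (use r in \<open>auto simp: frame_def\<close>)
  then show ?thesis unfolding invs_def using Ubounds(1) by (simp add: A0_def)
qed

end

subsection \<open>Correctness of the program\<close>

definition max_input :: "reg \<Rightarrow> nat \<Rightarrow> nat \<Rightarrow> cmd" where
  "max_input r off k = (r ::= #0 ;; For ri #k (Inp 17 (#off [+] \<acute>ri) ;; CIf (\<acute>17 [-] \<acute>r) (r ::= \<acute>17) skip))"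

definition solver_main :: "nat \<Rightarrow> cmd" where
  "solver_main k = (tables k ;; goalc k ;; sizeN ;; sieve ;; findp ;; invs ;; trials k)"

text \<open>The main algorithm presupposes \<open>t\<close> and \<open>c\<close> positive. If one of
  them is zero, then, the elements being positive, a class is empty iff its sum or its cardinality
  is zero; so the answer is yes iff both maxima vanish.\<close>

definition solver :: "nat \<Rightarrow> cmd" where
  "solver k = (Inp rN #0 ;; Inp rDv #1 ;; max_input rTm 2 k ;; max_input rCm (2 + k) k ;;
     CIf (\<acute>rTm [*] \<acute>rCm) (solver_main k) (rAns ::= #1 [-] (\<acute>rTm [+] \<acute>rCm)))"

text \<open>The prologue computes the length \<open>2 + 2 * k + n\<close> of the input in register
  60, the base address of the arrays.\<close>

definition program :: "nat \<Rightarrow> cmd \<Rightarrow> com list" where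
  "program k c = [Const 61 0, Load 60 61, Const 61 (2 + 2 * k), Arith Plus 60 60 61] @ compile_cmd c"

lemma max_input_frame [simp]: "written_regs (max_input r off k) = {r, 13, 17, 54}" "written_arrays (max_input r off k) = {}" "nocoin (max_input r off k)"
  by (auto simp: max_input_def)

lemma wfc_solver: "wfc (solver k)"
  by (simp add: solver_def max_input_def solver_main_def tables_def goalc_def sizeN_def sieve_def findp_def invs_def trials_def trial_def
      weights_def clear_def gen_def item_def item1_def online_def online1_def val2_def fill_def addback_def valid_def
      skip_def For_def conv_def
      down1_def up1_def pass_def lvl_def fwdLoop_def invLoop_def bSplit_def bFwd_def bInv_def bDec_def bBase_def)

context hl begin

lemma wp_max_input:
  assumes r: "r \<noteq> 13" "r \<noteq> 17" "r \<noteq> 54" and ts: "length ts = k" "1 \<le> k" "\<And>i. i < k \<Longrightarrow> xs ! (off + i) = ts ! i"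
    and xs: "off + k \<le> length xs" "length xs < U" "\<forall>x\<in>set xs. x < U"
  shows "wp (max_input r off k) (\<lambda>s' A' bs' t'. s' r = Max (set ts) \<and> t' \<le> tt + k * 6 + 5) s A bs tt"
proof -
  let ?M = "\<lambda>m. Max (insert 0 (set (take m ts)))"
  let ?b = "Inp 17 (#off [+] \<acute>ri) ;; CIf (\<acute>17 [-] \<acute>r) (r ::= \<acute>17) skip"
  have "wp (For ri #k ?b) (\<lambda>s' A' bs' t'. s' r = Max (set ts) \<and> t' \<le> tt + k * 6 + 5) (s(r := 0)) A bs (tt + 1)"
  proof (rule wp_For[where n = k and I = "\<lambda>m s' A' bs' t'. s' r = ?M m \<and> t' \<le> tt + 2 + m * 5"])
    fix m s' A' bs' t'
    assume m: "m < k" "s' ri = m" and I: "s' r = ?M m \<and> t' \<le> tt + 2 + m * 5"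
    have "take (Suc m) ts = take m ts @ [ts ! m]" using m ts by (simp add: take_Suc_conv_app_nth)
    then have "?M (Suc m) = Max (insert (ts ! m) (insert 0 (set (take m ts))))" by (simp add: insert_commute)
    then have M: "?M (Suc m) = max (ts ! m) (?M m)" by simp
    have "xs ! (off + m) \<in> set xs" using m xs by simp
    then have "ts ! m < U" using xs(3) ts(3)[OF m(1)] by auto
    then show "wp ?b (\<lambda>s2 A2 bs2 t2. (s2(ri := Suc m)) r = ?M (Suc m) \<and> t2 + 1 \<le> tt + 2 + Suc m * 5) s' A' bs' (t' + 1)"
      unfolding M using I m r xs ts(3)[OF m(1)] by (simp add: skip_def max_def)
  next
    fix s' A' bs' t' assume I: "s' r = ?M k \<and> t' \<le> tt + 2 + k * 5"
    have "set ts \<noteq> {}" using ts by auto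
    then show "s' r = Max (set ts) \<and> t' + 1 \<le> tt + k * 6 + 5" using I ts by simp
  qed (use r xs in auto)
  then show ?thesis unfolding max_input_def using xs by simp
qed

lemma wp_solver:
  assumes xs: "length xs = 2 + 2 * k + n" "xs ! 0 = n" "xs ! 1 = dv" "length xs < U" "\<forall>x\<in>set xs. x < U"
    and ts: "length ts = k" "\<And>i. i < k \<Longrightarrow> xs ! (2 + i) = ts ! i" and cs: "length cs = k" "\<And>i. i < k \<Longrightarrow> xs ! (2 + k + i) = cs ! i"
    and k: "1 \<le> k" and t: "t = Max (set ts)" and c: "c = Max (set cs)"
    and solver_main: "\<And>s tt. t \<noteq> 0 \<Longrightarrow> c \<noteq> 0 \<Longrightarrow> s rN = n \<Longrightarrow> s rDv = dv \<Longrightarrow> s rTm = t \<Longrightarrow> s rCm = c \<Longrightarrow>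
      wp (solver_main k) (\<lambda>s' A' bs' t'. (s' rAns \<noteq> 0 \<longleftrightarrow> ac) \<and> t' \<le> tt + \<tau>) s (\<lambda>_ _. 0) bs tt"
    and triv: "t = 0 \<or> c = 0 \<Longrightarrow> t + c = 0 \<longleftrightarrow> ac"
  shows "wp (solver k) (\<lambda>s' A' bs' t'. (s' rAns \<noteq> 0 \<longleftrightarrow> ac) \<and> t' \<le> 12 * k + 20 + \<tau>) s (\<lambda>_ _. 0) bs 0"
proof -
  let ?Q = "\<lambda>s' A' bs' t'. (s' rAns \<noteq> 0 \<longleftrightarrow> ac) \<and> t' \<le> 12 * k + 20 + \<tau>"
  let ?if = "CIf (\<acute>rTm [*] \<acute>rCm) (solver_main k) (rAns ::= #1 [-] (\<acute>rTm [+] \<acute>rCm))"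
  define s0 where "s0 = s(rN := n, rDv := dv)"
  have "wp (max_input rTm 2 k ;; max_input rCm (2 + k) k ;; ?if) ?Q s0 (\<lambda>_ _. 0) bs 2"
  proof (rule wp_SeqI)
    show "wp (max_input rTm 2 k) (\<lambda>s' A' bs' t'. s' rTm = Max (set ts) \<and> t' \<le> 2 + k * 6 + 5) s0 (\<lambda>_ _. 0) bs 2"
      by (rule wp_max_input) (use ts k xs in auto)
    fix s1 A1 bs1 t1
    assume P1: "s1 rTm = Max (set ts) \<and> t1 \<le> 2 + k * 6 + 5" and f1: "frame (max_input rTm 2 k) s0 (\<lambda>_ _. 0) bs s1 A1 bs1"
    show "wp (max_input rCm (2 + k) k ;; ?if) ?Q s1 A1 bs1 t1"
    proof (rule wp_SeqI)
      show "wp (max_input rCm (2 + k) k) (\<lambda>s' A' bs' t'. s' rCm = Max (set cs) \<and> t' \<le> t1 + k * 6 + 5) s1 A1 bs1 t1"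
        by (rule wp_max_input) (use cs k xs in auto)
      fix s2 A2 bs2 t2
      assume P2: "s2 rCm = Max (set cs) \<and> t2 \<le> t1 + k * 6 + 5" and f2: "frame (max_input rCm (2 + k) k) s1 A1 bs1 s2 A2 bs2"
      have r: "s2 rN = n" "s2 rDv = dv" "s2 rTm = t" "s2 rCm = c" "bs2 = bs"
        using f1 f2 P1 P2 by (simp_all add: frame_def s0_def t c)
      have A: "A2 = (\<lambda>_ _. 0)" using f1 f2 by (simp add: frame_def fun_eq_iff)
      have t2: "t2 \<le> 12 * k + 12" using P1 P2 by linarith
      have U: "1 < U" using xs by linarith
      show "wp ?if ?Q s2 A2 bs2 t2"
      proof (cases "t = 0 \<or> c = 0")
        case True
        then have "1 - (t + c) \<noteq> 0 \<longleftrightarrow> ac" using triv by linarith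
        then show ?thesis using True r t2 U by auto
      next
        case False
        have "wp (solver_main k) (\<lambda>s' A' bs' t'. (s' rAns \<noteq> 0 \<longleftrightarrow> ac) \<and> t' \<le> t2 + 1 + \<tau>) s2 A2 bs2 (t2 + 1)"
          unfolding A r(5) by (rule solver_main) (use False r in auto)
        then have "wp (solver_main k) ?Q s2 A2 bs2 (t2 + 1)" by (rule wp_mono) (use t2 in auto)
        then show ?thesis using False r by simp
      qed
    qed
  qed
  then show ?thesis unfolding solver_def using xs by (simp add: s0_def numeral_2_eq_2)
qed

end

lemma dstep_halted: "(dstep w ^^ n) (([], r, m), bs) = (([], r, m), bs)"
  by (induction n) auto

text \<open>The 4 counts the instructions of the prologue. \<open>T\<close> may exceed the real
  number of steps, since a halted configuration does not move.\<close>

lemma program_run: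
  assumes U: "2 \<le> U" "length xs < U" "\<forall>x\<in>set xs. x < U" "U ^ (cmd_deg c + 1) \<le> 2 ^ w" and c: "wfc c"
    and len: "length xs = 2 + 2 * k + xs ! 0"
    and wp: "hl.wp U xs c (\<lambda>s' A' bs' t'. (s' rAns \<noteq> 0 \<longleftrightarrow> ac) \<and> t' \<le> \<tau>) (\<lambda>_. 0) (\<lambda>_ _. 0) bs 0"
    and T: "4 + cost_factor c * \<tau> \<le> T"
  shows "halted (fst ((dstep w ^^ T) (initial (program k c) xs, bs))) \<and>
    (answer (fst ((dstep w ^^ T) (initial (program k c) xs, bs))) \<longleftrightarrow> ac)"
proof -
  define m where "m i = (if i < length xs then xs ! i else 0)" for i
  define r where "r = (\<lambda>_ :: reg. 0 :: nat)(61 := 0, 60 := xs ! 0, 61 := 2 + 2 * k, 60 := xs ! 0 + (2 + 2 * k))"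
  have Uw: "U \<le> 2 ^ w" using self_le_pow[OF U(1), of "cmd_deg c + 1"] U(4) by linarith
  have w: "xs ! 0 < 2 ^ w" "2 + 2 * k < 2 ^ w" "length xs < 2 ^ w" using Uw U len by linarith+
  have pro: "steps w 4 (initial (program k c) xs, bs) ((compile_cmd c @ [], r, m), bs)"
  proof -
    let ?i = "(initial (program k c) xs, bs)"
    have "dstep w (dstep w (dstep w (dstep w ?i))) = ((compile_cmd c @ [], r, m), bs)"
      using w len by (simp add: initial_def program_def m_def[abs_def] r_def add.commute)
    moreover have "steps w (Suc (Suc (Suc (Suc 0)))) ?i (dstep w (dstep w (dstep w (dstep w ?i))))"
      by (intro steps_Suc steps_0)
    moreover have "(4::nat) = Suc (Suc (Suc (Suc 0)))" by simp
    ultimately show ?thesis by (simp only:)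
  qed
  obtain s' A' bs' t' where b: "big U xs c (\<lambda>_. 0, \<lambda>_ _. 0, bs, 0) (s', A', bs', t')" "s' rAns \<noteq> 0 \<longleftrightarrow> ac" "t' \<le> \<tau>"
    using wp unfolding hl.wp_def by blast
  have "sim U xs r m (\<lambda>_. 0) (\<lambda>_ _. 0)" unfolding sim_def r_def m_def using U(1) len by simp
  from big_steps[OF b(1) U(1,2,3) c U(4) order_refl refl refl this, of "[]"]
  obtain N r' m' where N: "steps w N ((compile_cmd c @ [], r, m), bs) (([], r', m'), bs')" "sim U xs r' m' s' A'" "N \<le> cost_factor c * t'"
    by auto
  have "N \<le> cost_factor c * \<tau>" using N(3) mult_le_mono2[OF b(3)] le_trans by blast
  then have T': "T = (T - 4 - N) + (4 + N)" using T by simp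
  have "(dstep w ^^ (4 + N)) (initial (program k c) xs, bs) = (([], r', m'), bs')"
    using steps_trans[OF pro N(1)] unfolding steps_def .
  then have "(dstep w ^^ T) (initial (program k c) xs, bs) = (([], r', m'), bs')"
    by (subst T', subst funpow_add) (simp add: dstep_halted)
  then show ?thesis using b(2) N(2) by (simp add: halted_def answer_def sim_def)
qed

text \<open>Halting is shown for every list of \<open>T\<close> coins; the success probability
  becomes a count of the lists with a wrong answer.\<close>

lemma program_answers_within:
  assumes U: "2 \<le> U" "length xs < U" "\<forall>x\<in>set xs. x < U" "U ^ (cmd_deg c + 1) \<le> 2 ^ w" and c: "wfc c"
    and len: "length xs = 2 + 2 * k + xs ! 0"
    and wp: "\<And>bs. length bs = T \<Longrightarrow> hl.wp U xs c (\<lambda>s' A' bs' t'. (s' rAns \<noteq> 0 \<longleftrightarrow> ac bs) \<and> t' \<le> \<tau>) (\<lambda>_. 0) (\<lambda>_ _. 0) bs 0"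
    and T: "4 + cost_factor c * \<tau> \<le> T"
    and err: "real (card {bs. length bs = T \<and> ac bs \<noteq> b}) \<le> \<delta> * 2 ^ T"
  shows "answers_within w (program k c) xs b (1 - \<delta>) T"
proof -
  let ?f = "\<lambda>bs. fst ((dstep w ^^ T) (initial (program k c) xs, bs))"
  have R: "halted (?f bs) \<and> (answer (?f bs) \<longleftrightarrow> ac bs)" if "length bs = T" for bs
    by (rule program_run[OF U c len wp[OF that] T])
  have run: "run w T (initial (program k c) xs) = map_pmf ?f (coins T)" by (rule run_eq_coins) simp
  have "length bs = T" if "bs \<in> set_pmf (coins T)" for bs
    using that by (auto simp: set_pmf_iff pmf_coins split: if_splits)
  then have 1: "\<forall>cfg\<in>set_pmf (run w T (initial (program k c) xs)). halted cfg" unfolding run using R by auto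
  have "measure_pmf.prob (run w T (initial (program k c) xs)) {cfg. answer cfg = b}
    = real (card {bs. length bs = T \<and> answer (?f bs) = b}) / 2 ^ T"
    unfolding run measure_map_pmf prob_coins by simp
  also have "{bs. length bs = T \<and> answer (?f bs) = b} = {bs. length bs = T} - {bs. length bs = T \<and> ac bs \<noteq> b}"
    using R by auto
  also have "card \<dots> = card {bs :: bool list. length bs = T} - card {bs. length bs = T \<and> ac bs \<noteq> b}"
    by (intro card_Diff_subset) (auto intro: finite_subset[OF _ finite_bool_lists])
  also have "real \<dots> = 2 ^ T - real (card {bs. length bs = T \<and> ac bs \<noteq> b})"
  proof -
    have "card {bs. length bs = T \<and> ac bs \<noteq> b} \<le> card {bs :: bool list. length bs = T}"
      by (intro card_mono finite_bool_lists) auto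
    then show ?thesis by (simp add: of_nat_diff card_bool_lists)
  qed
  also have "\<dots> / 2 ^ T \<ge> 1 - \<delta>" using err by (simp add: field_simps)
  finally show ?thesis unfolding answers_within_def using 1 by simp
qed

section \<open>Choices correspond to solutions of the subset sum problem\<close>

context gf begin

lemma sel_count: "i < k \<Longrightarrow> sel \<phi> i = card {j\<in>J. \<phi> j = i}"
proof -
  assume i: "i < k"
  have "sel \<phi> i = (\<Sum>j\<in>{j\<in>J. \<phi> j < k}. if \<phi> j = i then 1 else 0)"
    unfolding sel_def ek_def using i by (intro sum.cong refl) auto
  also have "\<dots> = (\<Sum>j\<in>{j\<in>{j\<in>J. \<phi> j < k}. \<phi> j = i}. 1)"
    by (rule sum.inter_filter[symmetric]) (use finJ in auto)
  also have "{j\<in>{j\<in>J. \<phi> j < k}. \<phi> j = i} = {j\<in>J. \<phi> j = i}" using i by auto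
  finally show ?thesis by simp
qed

lemma sel_sum: "i < k \<Longrightarrow> sel \<phi> (k + i) = (\<Sum>j\<in>{j\<in>J. \<phi> j = i}. z j)"
proof -
  assume i: "i < k"
  have "sel \<phi> (k + i) = (\<Sum>j\<in>{j\<in>J. \<phi> j < k}. if \<phi> j = i then z j else 0)"
    unfolding sel_def ek_def using i by (intro sum.cong refl) auto
  also have "\<dots> = (\<Sum>j\<in>{j\<in>{j\<in>J. \<phi> j < k}. \<phi> j = i}. z j)"
    by (rule sum.inter_filter[symmetric]) (use finJ in auto)
  also have "{j\<in>{j\<in>J. \<phi> j < k}. \<phi> j = i} = {j\<in>J. \<phi> j = i}" using i by auto
  finally show ?thesis .
qed

lemma sel_out: "2 * k \<le> d \<Longrightarrow> sel \<phi> d = 0"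
  unfolding sel_def ek_def by (intro sum.neutral) auto

text \<open>A choice and a solution are related by \<open>\<phi> j = i\<close> iff
  \<open>z j \<in> S i\<close>. An element of \<open>S i\<close> is at most the sum of
  \<open>S i\<close>, hence at most \<open>t\<close>, so leaving out the items above
  \<open>t\<close> loses no solution.\<close>

lemma choices_iff:
  assumes \<kappa>: "\<And>i. i < k \<Longrightarrow> \<kappa> i = cs ! i" "\<And>i. i < k \<Longrightarrow> \<kappa> (k + i) = ts ! i" "\<And>d. 2 * k \<le> d \<Longrightarrow> \<kappa> d = 0"
    and zs: "distinct zs" "\<And>j. j < length zs \<Longrightarrow> z j = zs ! j" and J: "J = {j. j < length zs \<and> z j \<le> t}"
    and ts: "\<And>i. i < k \<Longrightarrow> ts ! i \<le> t"
  shows "choices \<kappa> \<noteq> {} \<longleftrightarrow> k_subset_sum_card k (set zs) ts cs"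
proof
  have inj: "inj_on z J" using zs unfolding J inj_on_def by (auto simp: nth_eq_iff_index_eq)
  have sel_eq: "sel \<phi> = \<kappa> \<longleftrightarrow> (\<forall>i<k. card {j\<in>J. \<phi> j = i} = cs ! i \<and> (\<Sum>j\<in>{j\<in>J. \<phi> j = i}. z j) = ts ! i)" for \<phi>
  proof
    show "\<forall>i<k. card {j\<in>J. \<phi> j = i} = cs ! i \<and> (\<Sum>j\<in>{j\<in>J. \<phi> j = i}. z j) = ts ! i" if "sel \<phi> = \<kappa>"
      using that \<kappa> sel_count[of _ \<phi>] sel_sum[of _ \<phi>] by auto
    assume a: "\<forall>i<k. card {j\<in>J. \<phi> j = i} = cs ! i \<and> (\<Sum>j\<in>{j\<in>J. \<phi> j = i}. z j) = ts ! i"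
    show "sel \<phi> = \<kappa>"
    proof
      fix d
      consider "d < k" | i where "d = k + i" "i < k" | "2 * k \<le> d"
        by (metis add_less_cancel_left le_add_diff_inverse mult_2 not_le)
      then show "sel \<phi> d = \<kappa> d" by cases (use a \<kappa> sel_count[of _ \<phi>] sel_sum[of _ \<phi>] sel_out in auto)
    qed
  qed
  {
    assume "choices \<kappa> \<noteq> {}"
    then obtain \<phi> where "sel \<phi> = \<kappa>" by (auto simp: choices_def)
    then have \<phi>: "card {j\<in>J. \<phi> j = i} = cs ! i" "(\<Sum>j\<in>{j\<in>J. \<phi> j = i}. z j) = ts ! i" if "i < k" for i
      using that sel_eq by auto
    define S where "S i = z ` {j\<in>J. \<phi> j = i}" for i
    have inj': "inj_on z {j\<in>J. \<phi> j = i}" for i using inj by (rule inj_on_subset) auto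
    have "disjoint_family_on S {..<k}"
      unfolding disjoint_family_on_def S_def using inj by (auto simp: inj_on_def)
    moreover have "S i \<subseteq> set zs" for i unfolding S_def J using zs by auto
    moreover have "\<Sum>(S i) = ts ! i \<and> card (S i) = cs ! i" if "i < k" for i
      using \<phi>[OF that] inj'[of i] by (simp add: S_def sum.reindex card_image)
    ultimately show "k_subset_sum_card k (set zs) ts cs" unfolding k_subset_sum_card_def by blast
  next
    assume "k_subset_sum_card k (set zs) ts cs"
    then obtain S where S: "disjoint_family_on S {..<k}" "\<And>i. i < k \<Longrightarrow> S i \<subseteq> set zs \<and> \<Sum>(S i) = ts ! i \<and> card (S i) = cs ! i"
      unfolding k_subset_sum_card_def by blast
    \<comment> \<open>By disjointness \<open>SOME\<close> has only one candidate; an item in no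
      \<open>S i\<close> gets the value \<open>k\<close>.\<close>
    define \<phi> where "\<phi> = (\<lambda>j\<in>J. if \<exists>i<k. z j \<in> S i then SOME i. i < k \<and> z j \<in> S i else k)"
    have uni: "i = i'" if "x \<in> S i" "x \<in> S i'" "i < k" "i' < k" for x i i'
      using S(1) that unfolding disjoint_family_on_def by blast
    have \<phi>: "\<phi> j = i \<longleftrightarrow> z j \<in> S i" if "j \<in> J" "i < k" for i j
    proof (cases "\<exists>i<k. z j \<in> S i")
      case True
      then have "(SOME i. i < k \<and> z j \<in> S i) < k \<and> z j \<in> S (SOME i. i < k \<and> z j \<in> S i)" by (rule someI_ex)
      then show ?thesis using True that uni unfolding \<phi>_def by auto
    next
      case False
      then show ?thesis using that unfolding \<phi>_def by auto
    qed
    have bij: "bij_betw z {j\<in>J. \<phi> j = i} (S i)" if i: "i < k" for i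
      unfolding bij_betw_def
    proof
      show "inj_on z {j\<in>J. \<phi> j = i}" using inj by (rule inj_on_subset) auto
      show "z ` {j\<in>J. \<phi> j = i} = S i"
      proof (rule Set.set_eqI)
        fix x
        show "x \<in> z ` {j\<in>J. \<phi> j = i} \<longleftrightarrow> x \<in> S i"
        proof
          assume "x \<in> S i"
          moreover have "finite (S i)" using S(2)[OF i] finite_subset by blast
          ultimately have "x \<le> \<Sum>(S i)" by (intro member_le_sum) auto
          then have "x \<le> t" using S(2)[OF i] ts[OF i] by simp
          obtain j where j: "j < length zs" "x = z j"
            using S(2)[OF i] \<open>x \<in> S i\<close> zs(2) by (metis in_set_conv_nth subsetD)
          then have "j \<in> J" using \<open>x \<le> t\<close> by (simp add: J)
          then show "x \<in> z ` {j\<in>J. \<phi> j = i}" using j \<phi> i \<open>x \<in> S i\<close> by blast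
        qed (use \<phi> i in auto)
      qed
    qed
    have "sel \<phi> = \<kappa>"
      unfolding sel_eq using bij S(2) bij_betw_same_card[OF bij] sum.reindex_bij_betw[OF bij, of _ "\<lambda>x. x"] by auto
    moreover have "\<phi> j \<le> k" if "j \<in> J" for j
    proof (cases "\<exists>i<k. z j \<in> S i")
      case True
      then show ?thesis using \<phi>[OF that] less_imp_le by blast
    qed (use that in \<open>auto simp: \<phi>_def\<close>)
    then have "\<phi> \<in> PiE J (\<lambda>_. {..k})" by (intro PiE_I) (auto simp: \<phi>_def)
    ultimately show "choices \<kappa> \<noteq> {}" by (auto simp: choices_def)
  }
qed

text \<open>The number of variables of a monomial is the number of chosen items, that is, the sum of
  the cardinalities; it is the degree in the Schwartz--Zippel bound.\<close>

lemma vars_of_bound: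
  assumes "\<phi> \<in> choices \<kappa>" "J \<subseteq> {..<n}" "\<And>i. i < k \<Longrightarrow> \<kappa> i \<le> c"
  shows "vars_of \<phi> \<subseteq> {..<n * k}" "card (vars_of \<phi>) \<le> k * c"
proof -
  have "j * k + \<phi> j < n * k" if "j \<in> J" "\<phi> j < k" for j
  proof -
    have "j * k + \<phi> j < (j + 1) * k" using that by simp
    also have "\<dots> \<le> n * k" using that assms(2) by (intro mult_right_mono) auto
    finally show ?thesis .
  qed
  then show "vars_of \<phi> \<subseteq> {..<n * k}" unfolding vars_of_def by auto
  have "card (vars_of \<phi>) \<le> card {j\<in>J. \<phi> j < k}" unfolding vars_of_def using finJ by (intro card_image_le) auto
  also have "{j\<in>J. \<phi> j < k} = (\<Union>i\<in>{..<k}. {j\<in>J. \<phi> j = i})" by auto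
  also have "card \<dots> \<le> (\<Sum>i<k. card {j\<in>J. \<phi> j = i})" by (rule card_UN_le) simp
  also have "\<dots> = (\<Sum>i<k. \<kappa> i)" using assms(1) sel_count[of _ \<phi>] by (intro sum.cong refl) (auto simp: choices_def)
  also have "\<dots> \<le> (\<Sum>i<k. c)" using assms(3) by (intro sum_mono) auto
  finally show "card (vars_of \<phi>) \<le> k * c" by simp
qed

end

section \<open>Total time and error probability of the main algorithm\<close>

context prog2 begin

definition setup_time :: nat where
  "setup_time = 28 * k + 4 * \<sigma> + 40 + Mx * (2 * \<sigma> + 2) * 3 + Mx * 8 + Nz * 5"

lemma wp_solver_main:
  assumes r: "s rN = n" "s rDv = dv" "s rTm = t" "s rCm = c" and A: "\<And>x. A aMark x = 0"
    and dv: "\<And>i. i < R \<Longrightarrow> dv div 2 ^ i \<noteq> 0" "dv div 2 ^ R = 0" "dv < U" and bs: "R * L \<le> length bs"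
  shows "wp (solver_main k) (\<lambda>s' A' bs' t'. (s' rAns \<noteq> 0 \<longleftrightarrow> (\<exists>\<rho><R. good (take L (drop (\<rho> * L) bs)))) \<and>
     t' \<le> tt + (setup_time + R * (trial_time + 5))) s A bs tt"
  unfolding solver_main_def
proof (rule wp_SeqI[OF wp_tables[OF r(3,4)]])
  let ?Q = "\<lambda>s' A' bs' t'. (s' rAns \<noteq> 0 \<longleftrightarrow> (\<exists>\<rho><R. good (take L (drop (\<rho> * L) bs)))) \<and> t' \<le> tt + (setup_time + R * (trial_time + 5))"
  fix s1 A1 bs1 t1
  assume P1: "(\<forall>d<2 * k. A1 aW d = W d \<and> A1 aBs d = \<beta> d \<and> A1 aLm d = lam d) \<and>
    s1 rD = W (2 * k) \<and> s1 rYk = W k \<and> t1 \<le> tt + k * 20 + 10" and f1: "frame (tables k) s A bs s1 A1 bs1"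
  show "wp (goalc k ;; sizeN ;; sieve ;; findp ;; invs ;; trials k) ?Q s1 A1 bs1 t1"
  proof (rule wp_SeqI[OF wp_goalc])
    show "A1 aW d = W d" if "d < 2 * k" for d using P1 that by simp
    fix s2 A2 bs2 t2
    assume P2: "s2 rGoal = goal \<and> t2 \<le> t1 + k * 8 + 5" and f2: "frame (goalc k) s1 A1 bs1 s2 A2 bs2"
    show "wp (sizeN ;; sieve ;; findp ;; invs ;; trials k) ?Q s2 A2 bs2 t2"
    proof (rule wp_SeqI[OF wp_sizeN])
      show "s2 rD = W (2 * k)" using P1 f2 by (simp add: frame_def)
      fix s3 A3 bs3 t3
      assume P3: "s3 rSize = Nz \<and> s3 rLog = \<sigma> \<and> (\<forall>i\<le>\<sigma>. A3 aPw i = 2 ^ i) \<and> t3 \<le> t2 + \<sigma> * 4 + 5" and f3: "frame sizeN s2 A2 bs2 s3 A3 bs3"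
      have "A3 aMark = A aMark" using f1 f2 f3 by (simp add: frame_def)
      then have m3: "A3 aMark x = 0" for x using A by simp
      show "wp (sieve ;; findp ;; invs ;; trials k) ?Q s3 A3 bs3 t3"
      proof (rule wp_SeqI[OF wp_sieve])
        show "s3 rSize = Nz" "s3 rLog = \<sigma>" using P3 by auto
        show "A3 aMark x = 0" for x by (rule m3)
        fix s4 A4 bs4 t4
        assume P4: "(\<forall>x. 2 \<le> x \<longrightarrow> x \<le> Mx \<longrightarrow> (A4 aMark x = 0 \<longleftrightarrow> prime x)) \<and> t4 \<le> t3 + Mx * (2 * \<sigma> + 2) * 3 + Mx * 6 + 5"
          and f4: "frame sieve s3 A3 bs3 s4 A4 bs4"
        show "wp (findp ;; invs ;; trials k) ?Q s4 A4 bs4 t4"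
        proof (rule wp_SeqI[OF wp_findp])
          show "s4 rSize = Nz" using P3 f4 by (simp add: frame_def)
          show "A4 aMark x = 0 \<longleftrightarrow> prime x" if "2 \<le> x" "x \<le> Mx" for x using P4 that by blast
          fix s5 A5 bs5 t5
          assume P5: "s5 rP = p \<and> s5 rInv2 = iv \<and> t5 \<le> t4 + Mx * 2 + 5" and f5: "frame findp s4 A4 bs4 s5 A5 bs5"
          show "wp (invs ;; trials k) ?Q s5 A5 bs5 t5"
          proof (rule wp_SeqI[OF wp_invs])
            show "s5 rSize = Nz" using P3 f4 f5 by (simp add: frame_def)
            show "s5 rP = p" using P5 by simp
            fix s6 A6 bs6 t6
            assume P6: "(\<forall>x. 0 < x \<longrightarrow> x < Nz \<longrightarrow> [int (A6 aInv x) * int x = 1] (mod int p)) \<and> t6 \<le> t5 + Nz * 5 + 5"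
              and f6: "frame invs s5 A5 bs5 s6 A6 bs6"
            note fs = f1 f2 f3 f4 f5 f6
            have rs: "s6 rN = s rN" "s6 rTm = s rTm" "s6 rCm = s rCm" "s6 rDv = s rDv" "s6 rSize = s3 rSize" "s6 rLog = s3 rLog"
              "s6 rGoal = s2 rGoal" "s6 rYk = s1 rYk" "s6 rD = s1 rD" "s6 rP = s5 rP" "s6 rInv2 = s5 rInv2"
              using fs unfolding frame_def by simp_all
            have as: "A6 aPw = A3 aPw" "A6 aW = A1 aW" "A6 aBs = A1 aBs" "A6 aLm = A1 aLm" "bs6 = bs"
              using fs unfolding frame_def by simp_all
            have st: "stat s6 A6" unfolding stat_def rs as using P1 P2 P3 P5 P6 r by blast
            have "t6 + R * (trial_time + 5) + 5 \<le> tt + (setup_time + R * (trial_time + 5))"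
              using P1 P2 P3 P4 P5 P6 unfolding setup_time_def by linarith
            moreover have "wp (trials k) (\<lambda>s' A' bs' t'. (s' rAns \<noteq> 0 \<longleftrightarrow> (\<exists>\<rho><R. good (take L (drop (\<rho> * L) bs)))) \<and>
              t' \<le> t6 + R * (trial_time + 5) + 5) s6 A6 bs6 t6"
              unfolding as by (rule wp_trials[OF st]) (use dv bs goal_less rs r in auto)
            ultimately show "wp (trials k) ?Q s6 A6 bs6 t6" by (elim wp_mono) auto
          qed
        qed
      qed
    qed
  qed
qed

text \<open>The terms of all series together do not outnumber the table, because already
  \<open>t \<le> (2 * t + 2) ^ k\<close>.\<close>

lemma t_W_le: "t * W k \<le> Nz"
proof -
  have "t * 1 \<le> (2 * t + 2) ^ k" using self_le_pow[of "2 * t + 2" k] k1 by linarith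
  then have "t * W k \<le> (2 * t + 2) ^ k * W k" by (intro mult_right_mono) auto
  also have "\<dots> = W (2 * k)" using radix_beta_const(1)[of k] W2k by simp
  finally show ?thesis using DN by linarith
qed

text \<open>The exponent 4: one factor from the total length of the online blocks and three from the
  cost \<open>CT\<close> of a convolution per element.\<close>

lemma time_bound:
  "12 * k + 20 + (setup_time + R * (trial_time + 5)) \<le> (R + 1) * ((n + Nz) * (\<sigma> + 1) ^ 4 * (100 * k + 3000))"
proof -
  define Y where "Y = (\<sigma> + 1) ^ 4"
  define M where "M = Nz * Y"
  have Y4: "Y = (\<sigma> + 1) * (\<sigma> + 1) ^ 3" by (simp add: Y_def numeral_eq_Suc)
  have s1: "\<sigma> + 1 \<le> Y" unfolding Y_def by (rule self_le_power) auto
  have Y2: "(\<sigma> + 1) * (\<sigma> + 1) \<le> Y"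
    using power_increasing[of 2 4 "\<sigma> + 1"] by (simp add: Y_def power2_eq_square)
  have Y1: "1 \<le> Y" using s1 by linarith
  have N1: "1 \<le> Nz" by simp
  have "CT \<le> 2022 * (\<sigma> + 1) ^ 3" unfolding CT_def by (simp add: algebra_simps power3_eq_cube)
  moreover have s3: "\<sigma> + 1 \<le> (\<sigma> + 1) ^ 3" by (rule self_le_power) auto
  moreover have "20 * k * 1 \<le> 20 * k * (\<sigma> + 1) ^ 3" by (intro mult_le_mono2) simp
  moreover have "(20 * k + 2090) * (\<sigma> + 1) ^ 3 = 20 * k * (\<sigma> + 1) ^ 3 + 2090 * (\<sigma> + 1) ^ 3" by (rule distrib_right)
  \<comment> \<open>2090 is 2022 + 68, and \<open>68 * (\<sigma> + 1)\<close> covers the remaining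
    \<open>62 + 6 * \<sigma>\<close>.\<close>
  ultimately have "K1 + 2 \<le> (20 * k + 2090) * (\<sigma> + 1) ^ 3" unfolding K1_def by linarith
  then have "\<sigma> * Nz * (K1 + 2) \<le> (\<sigma> + 1) * Nz * ((20 * k + 2090) * (\<sigma> + 1) ^ 3)" by (intro mult_le_mono) auto
  then have a1: "\<sigma> * Nz * (K1 + 2) \<le> M * (20 * k + 2090)" unfolding M_def Y4 by (simp only: ac_simps)
  have a2: "n * k * (\<sigma> * 4 + 8) \<le> n * Y * (8 * k)"
  proof -
    have "n * k * (\<sigma> * 4 + 8) \<le> n * k * (8 * Y)" using s1 by (intro mult_le_mono2) simp
    then show ?thesis by (simp add: ac_simps)
  qed
  have M1: "Nz \<le> M" "Y \<le> M" "1 \<le> M" using Y1 N1 by (simp_all add: M_def)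
  have a3: "t * W k * (20 * k + 26) \<le> M * (20 * k + 26)" using t_W_le M1 by (intro mult_le_mono1) linarith
  have a4: "n * 8 \<le> n * Y * 8" using Y1 by simp
  have "trial_time + 5 \<le> n * Y * (8 * k) + n * Y * 8 + M * (20 * k + 26) + M * (20 * k + 2090) + M * 29"
    unfolding trial_time_def using a1 a2 a3 a4 M1 by linarith
  also have "\<dots> = n * Y * (8 * k + 8) + M * (40 * k + 2145)" by (simp add: algebra_simps)
  also have "\<dots> \<le> n * Y * (100 * k + 3000) + M * (100 * k + 3000)" by (intro add_mono mult_le_mono2) auto
  finally have b: "trial_time + 5 \<le> (n + Nz) * Y * (100 * k + 3000)" by (simp add: M_def distrib_right)
  have "Mx * (2 * \<sigma> + 2) * 3 = 24 * (Nz * (\<sigma> * (\<sigma> + 1)))" by (simp add: algebra_simps)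
  also have "\<dots> \<le> 24 * (Nz * ((\<sigma> + 1) * (\<sigma> + 1)))" by (intro mult_le_mono2 mult_le_mono1) simp
  also have "\<dots> \<le> 24 * M" unfolding M_def using Y2 by (intro mult_le_mono2)
  finally have c1: "Mx * (2 * \<sigma> + 2) * 3 \<le> 24 * M" .
  have "\<sigma> * Nz \<le> M" unfolding M_def using s1 by (subst mult.commute) (intro mult_le_mono2, linarith)
  then have c2: "Mx * 8 \<le> 32 * M" by simp
  have "k * 1 \<le> k * M" using M1 by (intro mult_le_mono2)
  then have "12 * k + 20 + setup_time \<le> 40 * (k * M) + 125 * M"
    unfolding setup_time_def using c1 c2 M1 s1 by linarith
  also have "\<dots> \<le> M * (100 * k + 3000)" by (simp add: algebra_simps)
  also have "\<dots> \<le> (n + Nz) * Y * (100 * k + 3000)" unfolding M_def by (intro mult_le_mono1) simp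
  finally have d: "12 * k + 20 + setup_time \<le> (n + Nz) * Y * (100 * k + 3000)" .
  have "R * (trial_time + 5) \<le> R * ((n + Nz) * Y * (100 * k + 3000))" using b by (rule mult_le_mono2)
  then show ?thesis using d unfolding Y_def[symmetric] by (simp only: distrib_right mult_1 add.assoc[symmetric])
qed

abbreviation \<kappa>g :: "nat \<Rightarrow> nat" where
  "\<kappa>g \<equiv> \<lambda>d. if d < k then xs ! (2 + k + d) else if d < 2 * k then xs ! (2 + (d - k)) else 0"

lemma good_iff: "good bits \<longleftrightarrow> \<not> int p dvd mlin (vars_of ` choices \<kappa>g) (wt \<sigma> bits)"
proof -
  interpret B: gf k lam J z "wt \<sigma> bits" by (rule gf_axioms)
  have "B.Fc goal = lk B.Fp \<kappa>g" unfolding B.Fc_def using vk_cd[OF vk_goal] unfolding goal_valid by simp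
  then show ?thesis unfolding good_def B.lk_Fp by simp
qed

text \<open>The degree is at most \<open>k * c\<close>, a weight takes \<open>2 ^ \<sigma>\<close>
  values, and the radices of the table leave room for twice the degree.\<close>

lemma half_good:
  assumes "choices \<kappa>g \<noteq> {}"
  shows "2 * card {bs. length bs = L \<and> bs \<in> {bits. \<not> good bits}} \<le> 2 ^ L"
proof -
  have "J \<subseteq> {..<n}" by (auto simp: J)
  note v = vars_of_bound[OF _ this, of _ \<kappa>g c]
  let ?B = "{bs. length bs = n * k * \<sigma> \<and> int p dvd mlin (vars_of ` choices \<kappa>g) (wt \<sigma> bs)}"
  have "card ?B * 2 ^ \<sigma> \<le> k * c * 2 ^ (n * k * \<sigma>)"
    by (rule schwartz_zippel_bits) (use prime pN assms v tcs in auto)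
  moreover have "2 * (k * c) \<le> Nz"
  proof -
    have "k \<le> (2 * t + 2) ^ k" using less_exp[of k] power_mono[of 2 "2 * t + 2" k] by linarith
    moreover have "2 * c \<le> (2 * c + 2) ^ k" using self_le_pow[of "2 * c + 2" k] k1 by linarith
    ultimately have "2 * c * k \<le> (2 * c + 2) ^ k * (2 * t + 2) ^ k" by (intro mult_le_mono)
    then show ?thesis using DN unfolding W2k by (simp add: ac_simps)
  qed
  then have "2 * (k * c) * 2 ^ (n * k * \<sigma>) \<le> Nz * 2 ^ (n * k * \<sigma>)" by (rule mult_le_mono1)
  moreover have "Nz * (2 * card ?B) = 2 * (card ?B * Nz)" "2 * (k * c) * 2 ^ (n * k * \<sigma>) = 2 * (k * c * 2 ^ (n * k * \<sigma>))"
    by (simp_all only: ac_simps)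
  ultimately have "Nz * (2 * card ?B) \<le> Nz * 2 ^ (n * k * \<sigma>)" by linarith
  then have "2 * card ?B \<le> 2 ^ (n * k * \<sigma>)" by simp
  then show ?thesis by (simp add: good_iff)
qed

text \<open>The error is one-sided. Without a solution the polynomial has no monomials and no coins
  are good; with a solution, \<open>R\<close> independent trials all fail with probability at most
  \<open>1 / 2 ^ R\<close>, hence at most \<open>\<delta>\<close>.\<close>

lemma error_bound:
  assumes "choices \<kappa>g \<noteq> {} \<longleftrightarrow> b" "R * L \<le> T" "1 \<le> \<delta> * 2 ^ R" "0 < \<delta>"
  shows "real (card {bs. length bs = T \<and> (\<exists>\<rho><R. good (take L (drop (\<rho> * L) bs))) \<noteq> b}) \<le> \<delta> * 2 ^ T"
proof (cases b)
  case True
  then have ne: "choices \<kappa>g \<noteq> {}" using assms(1) by simp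
  let ?X = "{bs. length bs = T \<and> (\<forall>\<rho><R. take L (drop (\<rho> * L) bs) \<in> {bits. \<not> good bits})}"
  have "real (card ?X) * 1 \<le> real (card ?X) * (\<delta> * 2 ^ R)" using assms by (intro mult_left_mono) auto
  also have "\<dots> = \<delta> * real (card ?X * 2 ^ R)" by simp
  also have "\<dots> \<le> \<delta> * real (2 ^ T)"
    using card_repeat_failures[OF half_good[OF ne] assms(2)] assms(4) by (intro mult_left_mono) (simp_all only: of_nat_le_iff less_imp_le)
  finally have "real (card ?X) \<le> \<delta> * 2 ^ T" by simp
  moreover have "{bs. length bs = T \<and> (\<exists>\<rho><R. good (take L (drop (\<rho> * L) bs))) \<noteq> b} = ?X" using True by auto
  ultimately show ?thesis by simp
next
  case False
  then have "choices \<kappa>g = {}" using assms(1) by simp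
  then have "\<not> good bits" for bits by (simp add: good_iff mlin_def)
  then have e: "{bs. length bs = T \<and> (\<exists>\<rho><R. good (take L (drop (\<rho> * L) bs))) \<noteq> b} = {}" using False by auto
  show ?thesis unfolding e using assms by simp
qed

end

subsection \<open>Running time\<close>

text \<open>Origin of \<open>12 * k + 7\<close>: \<open>2 ^ \<sigma>\<close> and
  \<open>\<sigma> + 1\<close> are at most \<open>X ^ (4 * k + 1)\<close> and occur three times in
  the largest quantity, \<open>16 \<le> X ^ 2\<close> and \<open>k + 1 < X\<close> add three to the
  exponent, and one more makes the inequality strict.\<close>

lemma word_bounds:
  fixes X k n \<sigma> :: nat
  assumes X: "2 ^ (k + 1) \<le> X" and k: "1 \<le> k" and n: "n \<le> X" and \<sigma>: "2 ^ \<sigma> \<le> 2 * 16 ^ k * X ^ (2 * k)"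
  defines "U \<equiv> X ^ (12 * k + 7)"
  shows "16 * (k + 1) * (\<sigma> + 1) * (2 ^ \<sigma> * 2 ^ \<sigma>) < U" "(n + 1) * (k + 1) < U" "2 + 2 * k + n < U" "X < U" "2 \<le> U"
    "4 * \<sigma> * 2 ^ \<sigma> < U"
proof -
  have kX: "k + 1 < X" using less_exp[of "k + 1"] X by linarith
  have "(2::nat) ^ 2 \<le> 2 ^ (k + 1)" using k by (intro power_increasing) auto
  then have X4: "4 \<le> X" using X by simp
  then have pos: "1 \<le> X" by simp
  have U: "U = X ^ (12 * k + 6) * X" by (simp add: U_def numeral_eq_Suc ac_simps)
  have lt: "y < U" if "y \<le> X ^ (12 * k + 6)" for y
  proof -
    have "1 \<le> X ^ (12 * k + 6)" using pos by simp
    then have "X ^ (12 * k + 6) * 1 < U" unfolding U using X4 by (intro mult_strict_left_mono) auto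
    then show ?thesis using that by linarith
  qed
  have le: "X ^ 3 \<le> X ^ (12 * k + 6)" using pos by (intro power_increasing) auto
  have sq: "4 * X \<le> X ^ 2" using X4 by (simp add: power2_eq_square)
  have X23: "X ^ 2 \<le> X ^ 3" using pos by (intro power_increasing) auto
  have "16 ^ k \<le> X ^ (2 * k)"
  proof -
    have "(4::nat) ^ (2 * k) \<le> X ^ (2 * k)" using X4 by (rule power_mono) simp
    then show ?thesis by (simp add: power_mult)
  qed
  then have "2 * 16 ^ k \<le> X * X ^ (2 * k)" using X4 by (intro mult_le_mono) auto
  then have "2 * 16 ^ k * X ^ (2 * k) \<le> X * X ^ (2 * k) * X ^ (2 * k)" by (rule mult_le_mono1)
  also have "\<dots> = X ^ (4 * k + 1)" by (simp add: power_add[symmetric])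
  finally have N: "2 ^ \<sigma> \<le> X ^ (4 * k + 1)" using \<sigma> by linarith
  have "\<sigma> + 1 \<le> 2 ^ \<sigma>" using less_exp[of \<sigma>] by linarith
  then have s: "\<sigma> + 1 \<le> X ^ (4 * k + 1)" using N by linarith
  have "16 \<le> X ^ 2" using power_mono[OF X4, of 2] by simp
  then have "16 * (k + 1) * (\<sigma> + 1) * (2 ^ \<sigma> * 2 ^ \<sigma>) \<le> X ^ 2 * X * X ^ (4 * k + 1) * (X ^ (4 * k + 1) * X ^ (4 * k + 1))"
    using kX s N by (intro mult_le_mono) auto
  also have "\<dots> = X ^ (2 + 1 + (4 * k + 1) + ((4 * k + 1) + (4 * k + 1)))" by (simp only: power_add power_one_right)
  also have "2 + 1 + (4 * k + 1) + ((4 * k + 1) + (4 * k + 1)) = 12 * k + 6" by simp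
  finally have b: "16 * (k + 1) * (\<sigma> + 1) * (2 ^ \<sigma> * 2 ^ \<sigma>) \<le> X ^ (12 * k + 6)" .
  then show b': "16 * (k + 1) * (\<sigma> + 1) * (2 ^ \<sigma> * 2 ^ \<sigma>) < U" by (rule lt)
  have "(n + 1) * (k + 1) \<le> X ^ 2 * X" using n kX sq X4 by (intro mult_le_mono) linarith+
  also have "\<dots> = X ^ 3" by (simp add: numeral_eq_Suc)
  finally show "(n + 1) * (k + 1) < U" using le by (intro lt) linarith
  show "2 + 2 * k + n < U" using n kX sq X23 le by (intro lt) linarith
  show XU: "X < U" using sq X23 le by (intro lt) linarith
  show "2 \<le> U" using XU X4 by linarith
  have "16 * 1 * (\<sigma> + 1) \<le> 16 * (k + 1) * (\<sigma> + 1)" by (intro mult_le_mono) auto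
  moreover have "4 * \<sigma> \<le> 16 * 1 * (\<sigma> + 1)" by simp
  ultimately have "4 * \<sigma> \<le> 16 * (k + 1) * (\<sigma> + 1)" by (rule le_trans[rotated])
  moreover have "(2::nat) ^ \<sigma> * 1 \<le> 2 ^ \<sigma> * 2 ^ \<sigma>" by (intro mult_le_mono2) simp
  ultimately have "4 * \<sigma> * (2 ^ \<sigma> * 1) \<le> 16 * (k + 1) * (\<sigma> + 1) * (2 ^ \<sigma> * 2 ^ \<sigma>)" by (rule mult_le_mono)
  then show "4 * \<sigma> * 2 ^ \<sigma> < U" unfolding mult_1_right using b' by (rule le_less_trans)
qed

text \<open>The factors bound, in this order, the repetitions, the power of
  \<open>\<sigma> + 1\<close>, the table size, and the constant of
  \<open>time_bound\<close>.\<close>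

definition time_const :: "nat \<Rightarrow> nat" where
  "time_const k = 3 * (6 * k + 2) ^ 4 * (2 * 16 ^ k) * (100 * k + 3000)"

text \<open>Origin of the exponent 5: the table size is polynomial in \<open>t\<close> and
  \<open>c\<close>, so \<open>\<sigma> + 1\<close> is at most a constant times the logarithm and
  contributes its fourth power; the repetitions contribute one more factor.\<close>

lemma time_estimate:
  fixes k n t c \<sigma> R :: nat and x :: real
  assumes k: "1 \<le> k" and \<sigma>: "2 ^ \<sigma> \<le> 2 * 16 ^ k * (t ^ k * c ^ k)" and R: "1 \<le> R" "2 ^ (R - 1) \<le> 2 + x" and x: "real t \<le> x" "real c \<le> x"
  shows "real ((R + 1) * ((n + 2 ^ \<sigma>) * (\<sigma> + 1) ^ 4 * (100 * k + 3000))) \<le>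
    soft_O_bound (time_const k) 5 x (real n + real t ^ k * real c ^ k)"
proof -
  define \<Lambda> where "\<Lambda> = log 2 (2 + x)"
  define F where "F = real n + real t ^ k * real c ^ k"
  have x0: "0 \<le> x" using x by linarith
  have L1: "1 \<le> \<Lambda>" unfolding \<Lambda>_def using x0 log_le_cancel_iff[of 2 2 "2 + x"] by simp
  have F0: "0 \<le> F" by (simp add: F_def)
  have "real m \<le> \<Lambda>" if "2 ^ m \<le> 2 + x" for m
    unfolding \<Lambda>_def using that x0 by (subst le_log_iff) (auto simp: powr_realpow)
  from this[of "R - 1"] have "real (R - 1) \<le> \<Lambda>" using R by simp
  then have R3: "real (R + 1) \<le> 3 * \<Lambda>" using R L1 by (simp add: of_nat_diff)
  have s: "real (\<sigma> + 1) \<le> (6 * k + 2) * \<Lambda>"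
  proof -
    have "real (2 ^ \<sigma>) \<le> real (2 * 16 ^ k * (t ^ k * c ^ k))" using \<sigma> by (simp only: of_nat_le_iff)
    also have "\<dots> = 2 ^ (1 + 4 * k) * (real t ^ k * real c ^ k)" by (simp add: power_mult power_add)
    also have "\<dots> \<le> 2 ^ (1 + 4 * k) * ((2 + x) ^ k * (2 + x) ^ k)"
    proof -
      have "real t ^ k \<le> (2 + x) ^ k" "real c ^ k \<le> (2 + x) ^ k" using x by (intro power_mono; simp)+
      then have "real t ^ k * real c ^ k \<le> (2 + x) ^ k * (2 + x) ^ k" using x0 by (intro mult_mono) simp_all
      then show ?thesis by (rule mult_left_mono) simp
    qed
    also have "\<dots> = 2 ^ (1 + 4 * k) * (2 + x) ^ (2 * k)" by (simp only: power_add mult_2)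
    finally have "2 ^ \<sigma> \<le> 2 ^ (1 + 4 * k) * (2 + x) ^ (2 * k)" by (simp only: of_nat_power of_nat_numeral)
    then have "log 2 (2 ^ \<sigma>) \<le> log 2 (2 ^ (1 + 4 * k) * (2 + x) ^ (2 * k))" using x0 by (subst log_le_cancel_iff) auto
    also have "\<dots> = log 2 (2 ^ (1 + 4 * k)) + log 2 ((2 + x) ^ (2 * k))" using x0 by (intro log_mult_pos) auto
    also have "log 2 (2 ^ (1 + 4 * k)) = real (1 + 4 * k)" by (rule log_pow_cancel) auto
    also have "log 2 ((2 + x) ^ (2 * k)) = (2 * k) * \<Lambda>" using x0 by (simp add: \<Lambda>_def log_nat_power)
    also have "log 2 (2 ^ \<sigma>) = real \<sigma>" by (simp add: log_nat_power)
    finally have "real (\<sigma> + 1) \<le> (2 + 4 * k) * 1 + (2 * k) * \<Lambda>" by simp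
    also have "\<dots> \<le> (2 + 4 * k) * \<Lambda> + (2 * k) * \<Lambda>" using L1 by (intro add_mono mult_left_mono) auto
    also have "\<dots> = (6 * k + 2) * \<Lambda>" by (simp add: algebra_simps)
    finally show ?thesis .
  qed
  have "real (n + 2 ^ \<sigma>) \<le> real n + 2 * 16 ^ k * (real t ^ k * real c ^ k)"
  proof -
    have "real (2 ^ \<sigma>) \<le> real (2 * 16 ^ k * (t ^ k * c ^ k))" using \<sigma> by (simp only: of_nat_le_iff)
    then show ?thesis by simp
  qed
  also have "\<dots> \<le> 2 * 16 ^ k * real n + 2 * 16 ^ k * (real t ^ k * real c ^ k)"
  proof -
    have "1 \<le> 2 * (16::real) ^ k" using one_le_power[of "16::real" k] by linarith
    then have "1 * real n \<le> 2 * 16 ^ k * real n" by (intro mult_right_mono) auto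
    then show ?thesis by simp
  qed
  also have "\<dots> = 2 * 16 ^ k * F" by (simp add: F_def distrib_left)
  also have "\<dots> \<le> 2 * 16 ^ k * (1 + F)" by simp
  finally have N: "real (n + 2 ^ \<sigma>) \<le> 2 * 16 ^ k * (1 + F)" .
  have "real (\<sigma> + 1) ^ 4 \<le> ((6 * k + 2) * \<Lambda>) ^ 4" using s by (intro power_mono) auto
  then have "real (R + 1) * (real (n + 2 ^ \<sigma>) * real (\<sigma> + 1) ^ 4 * real (100 * k + 3000)) \<le>
    (3 * \<Lambda>) * ((2 * 16 ^ k * (1 + F)) * ((6 * k + 2) * \<Lambda>) ^ 4 * real (100 * k + 3000))"
    using R3 N F0 L1 by (intro mult_mono mult_nonneg_nonneg) auto
  also have "\<dots> = real (time_const k) * (1 + F) * \<Lambda> ^ 5"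
  proof -
    have "\<Lambda> ^ 5 = \<Lambda> * \<Lambda> ^ 4" by (simp add: numeral_eq_Suc)
    moreover have "real (time_const k) = 3 * real (6 * k + 2) ^ 4 * (2 * 16 ^ k) * real (100 * k + 3000)"
      by (simp only: time_const_def of_nat_mult of_nat_power of_nat_numeral)
    ultimately show ?thesis unfolding power_mult_distrib by (simp only: ac_simps)
  qed
  finally show ?thesis unfolding soft_O_bound_def \<Lambda>_def F_def by (simp only: of_nat_mult of_nat_power)
qed

lemma soft_O_bound_mult: "real a * soft_O_bound C d x f = soft_O_bound (real a * C) d x f"
  by (simp add: soft_O_bound_def)

text \<open>\<open>R\<close> is the number of binary digits of
  \<open>\<lceil>1 / \<delta>\<rceil>\<close>: large enough for the error, small enough to be
  logarithmic.\<close>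

lemma repetitions:
  fixes \<delta> :: real
  assumes "0 < \<delta>" "\<delta> \<le> 1"
  obtains R where "\<And>i. i < R \<Longrightarrow> nat \<lceil>1 / \<delta>\<rceil> div 2 ^ i \<noteq> 0" "nat \<lceil>1 / \<delta>\<rceil> div 2 ^ R = 0" "1 \<le> \<delta> * 2 ^ R" "1 \<le> R"
    "2 ^ (R - 1) \<le> 2 + 1 / \<delta>"
proof -
  define dv where "dv = nat \<lceil>1 / \<delta>\<rceil>"
  define R where "R = (LEAST i. dv < 2 ^ i)"
  have "dv < 2 ^ dv" by (rule less_exp)
  then have R: "dv < 2 ^ R" unfolding R_def by (rule LeastI)
  have min: "2 ^ i \<le> dv" if "i < R" for i using not_less_Least[of i "\<lambda>i. dv < 2 ^ i"] that unfolding R_def by simp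
  have p: "1 \<le> 1 / \<delta>" using assms by simp
  have d: "1 / \<delta> \<le> real dv" "real dv \<le> 1 / \<delta> + 1" unfolding dv_def using p by linarith+
  have "1 \<le> R" using R d p by (cases R) auto
  moreover have "2 ^ (R - 1) \<le> 2 + 1 / \<delta>"
  proof -
    have "2 ^ (R - 1) \<le> dv" using min[of "R - 1"] \<open>1 \<le> R\<close> by simp
    then have "2 ^ (R - 1) \<le> real dv" by (metis of_nat_le_iff of_nat_numeral of_nat_power)
    then show ?thesis using d by linarith
  qed
  moreover have "1 \<le> \<delta> * 2 ^ R"
  proof -
    have "1 / \<delta> \<le> real (2 ^ R)" using d(1) R by (meson less_imp_le of_nat_le_iff order_trans)
    then show ?thesis using assms by (simp add: field_simps)
  qed
  moreover have "dv div 2 ^ i \<noteq> 0" if "i < R" for i using min[OF that] by (simp add: div_eq_0_iff not_less)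
  moreover have "dv div 2 ^ R = 0" using R by simp
  ultimately show ?thesis using that unfolding dv_def by blast
qed

text \<open>Proved outside \<open>prog\<close>, because \<open>\<sigma>\<close> is chosen from this
  value before \<open>prog\<close> can be interpreted.\<close>

lemma (in gf) radix_twice:
  assumes "\<And>d. lam d = (if d < k then c else t)"
  shows "W (2 * k) = (2 * c + 2) ^ k * (2 * t + 2) ^ k"
proof -
  have "W (2 * k) = (\<Prod>d<k. \<beta> d) * (\<Prod>d=k..<2 * k. \<beta> d)"
    unfolding radix_def lessThan_atLeast0 by (rule prod.atLeastLessThan_concat[symmetric]) auto
  also have "(\<Prod>d<k. \<beta> d) = (2 * c + 2) ^ k" by (simp add: \<beta>_def assms)
  also have "(\<Prod>d=k..<2 * k. \<beta> d) = (\<Prod>d=k..<2 * k. 2 * t + 2)" by (intro prod.cong) (auto simp: \<beta>_def assms)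
  finally show ?thesis by simp
qed

text \<open>All elements are positive, so a finite subset has sum zero iff it is empty iff it has
  cardinality zero; the two lists therefore vanish at the same indices.\<close>

lemma k_subset_sum_card_zero:
  assumes "\<forall>z\<in>Z. 0 < z" "finite Z" "length ts = k" "length cs = k" "1 \<le> k" "Max (set ts) = 0 \<or> Max (set cs) = 0"
  shows "Max (set ts) + Max (set cs) = 0 \<longleftrightarrow> k_subset_sum_card k Z ts cs"
proof -
  have z: "Max (set xs) = 0 \<longleftrightarrow> (\<forall>i<k. xs ! i = 0)" if "length xs = k" for xs :: "nat list"
  proof -
    have "set xs \<noteq> {}" using that assms(5) by auto
    then have "Max (set xs) = 0 \<longleftrightarrow> (\<forall>x\<in>set xs. x = 0)"
      using Max_ge[of "set xs"] Max_in[of "set xs"] by (metis List.finite_set le_zero_eq)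
    then show ?thesis unfolding all_set_conv_all_nth that .
  qed
  show ?thesis
  proof
    assume "Max (set ts) + Max (set cs) = 0"
    then have "\<forall>i<k. ts ! i = 0" "\<forall>i<k. cs ! i = 0" using z assms by auto
    then show "k_subset_sum_card k Z ts cs"
      unfolding k_subset_sum_card_def by (intro exI[of _ "\<lambda>_. {}"]) (auto simp: disjoint_family_on_def)
  next
    assume "k_subset_sum_card k Z ts cs"
    then obtain S where S: "\<And>i. i < k \<Longrightarrow> S i \<subseteq> Z \<and> \<Sum>(S i) = ts ! i \<and> card (S i) = cs ! i"
      unfolding k_subset_sum_card_def by blast
    have "ts ! i = 0 \<longleftrightarrow> cs ! i = 0" if i: "i < k" for i
    proof -
      have f: "finite (S i)" using S[OF i] assms(2) finite_subset by blast
      have "\<Sum>(S i) = 0 \<longleftrightarrow> (\<forall>x\<in>S i. x = 0)" using f by (simp add: sum_eq_0_iff)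
      also have "\<dots> \<longleftrightarrow> S i = {}" using S[OF i] assms(1) by fastforce
      also have "\<dots> \<longleftrightarrow> card (S i) = 0" using f by simp
      finally show ?thesis using S[OF i] by simp
    qed
    then show "Max (set ts) + Max (set cs) = 0" using assms z by auto
  qed
qed

text \<open>The indices inject into \<open>{1..t}\<close>; this supplies
  \<open>card_J\<close>.\<close>

lemma card_distinct_bounded:
  assumes "distinct zs" "\<forall>z\<in>set zs. (0::nat) < z"
  shows "card ({j. j < length zs \<and> zs ! j \<le> t} \<inter> A) \<le> t"
proof -
  have "card ({j. j < length zs \<and> zs ! j \<le> t} \<inter> A) = card ((!) zs ` ({j. j < length zs \<and> zs ! j \<le> t} \<inter> A))"
    using assms(1) by (intro card_image[symmetric]) (auto simp: inj_on_def nth_eq_iff_index_eq)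
  also have "\<dots> \<le> card {1..t}"
    by (intro card_mono) (use assms(2) in \<open>auto simp: Suc_le_eq\<close>)
  finally show ?thesis by simp
qed

lemma program_correct:
  fixes zs ts cs :: "nat list" and \<delta> :: real
  assumes k: "1 \<le> k" and zs: "distinct zs" "\<forall>z\<in>set zs. 0 < z" and l: "length ts = k" "length cs = k" and sc: "sum_list cs \<le> length zs"
    and \<delta>: "0 < \<delta>" "\<delta> \<le> 1 / 2 ^ (k + 1)" and w: "word_length_ok ((12 * k + 7) * (cmd_deg (solver k) + 1)) w (encode zs ts cs \<delta>)"
  defines "n \<equiv> length zs" and "t \<equiv> Max (set ts)" and "c \<equiv> Max (set cs)"
  shows "\<exists>T. real T \<le> soft_O_bound ((4 + cost_factor (solver k)) * time_const k) 5 (real n + real t + 1 / \<delta>) (real n + real t ^ k * real c ^ k) \<and>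
    answers_within w (program k (solver k)) (encode zs ts cs \<delta>) (k_subset_sum_card k (set zs) ts cs) (1 - \<delta>) T"
proof -
  define xs where "xs = encode zs ts cs \<delta>"
  define dv where "dv = nat \<lceil>1 / \<delta>\<rceil>"
  define X where "X = Max (set xs)"
  define U where "U = X ^ (12 * k + 7)"
  define b where "b = k_subset_sum_card k (set zs) ts cs"
  define x where "x = real n + real t + 1 / \<delta>"
  define f where "f = real n + real t ^ k * real c ^ k"
  have xs: "length xs = 2 + 2 * k + n" "xs ! 0 = n" "xs ! 1 = dv"
    using l by (simp_all add: xs_def encode_def n_def dv_def)
  have xts: "xs ! (2 + i) = ts ! i" and xcs: "xs ! (2 + k + i) = cs ! i" if "i < k" for i
    using that l by (simp_all add: xs_def encode_def nth_append)
  have xzs: "xs ! (2 + 2 * k + j) = zs ! j" if "j < n" for j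
    using that l by (simp add: xs_def encode_def nth_append n_def)
  have leX: "y \<le> X" if "y \<in> set xs" for y unfolding X_def using that by simp
  have ne: "set ts \<noteq> {}" "set cs \<noteq> {}" using l k by auto
  have tmax: "ts ! i \<le> t" "cs ! i \<le> c" if "i < k" for i using that l by (simp_all add: t_def c_def)
  have "t \<in> set ts" "c \<in> set cs" using ne by (simp_all add: t_def c_def)
  then have tcX: "t \<le> X" "c \<le> X" by (auto intro!: leX simp: xs_def encode_def)
  have "n \<in> set xs" "dv \<in> set xs" by (simp_all add: xs_def encode_def n_def dv_def)
  then have nX: "n \<le> X" and dX: "dv \<le> X" by (auto intro: leX)
  have "c \<le> n" using \<open>c \<in> set cs\<close> member_le_sum_list[of c cs] sc by (simp add: n_def)
  \<comment> \<open>Through \<open>dv\<close> the upper bound on \<open>\<delta>\<close> puts a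
    number of at least \<open>2 ^ (k + 1)\<close> into the input, so that constants depending on
    \<open>k\<close> can be absorbed by powers of \<open>X\<close>.\<close>
  have d2: "2 ^ (k + 1) \<le> 1 / \<delta>" using \<delta> by (simp add: field_simps)
  then have "real (2 ^ (k + 1)) \<le> real dv" unfolding dv_def by (simp only: of_nat_power of_nat_numeral) linarith
  then have X2: "2 ^ (k + 1) \<le> X" using dX by (simp only: of_nat_le_iff)
  have "(1 / 2) ^ (k + 1) \<le> (1::real)" by (rule power_le_one) auto
  then have "1 / 2 ^ (k + 1) \<le> (1::real)" unfolding power_one_over .
  then have \<delta>1: "\<delta> \<le> 1" using \<delta>(2) by (rule order_trans[rotated])
  have x0: "0 \<le> x" using \<delta> by (simp add: x_def)
  have "0 \<le> 1 / \<delta>" using \<delta> by simp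
  then have bt: "real t \<le> x" "real c \<le> x" using \<open>c \<le> n\<close> unfolding x_def by linarith+
  have pw: "U ^ (cmd_deg (solver k) + 1) \<le> 2 ^ w"
    using w unfolding word_length_ok_def U_def X_def xs_def by (simp only: power_mult)
  have len: "length xs = 2 + 2 * k + xs ! 0" using xs by simp
  \<comment> \<open>Both cases deliver a time bound and an acceptance condition on the coins, so
    that the passage to the machine is made once.\<close>
  have "\<exists>\<tau> acc. real \<tau> \<le> soft_O_bound (time_const k) 5 x f \<and> 1 \<le> \<tau> \<and> 2 \<le> U \<and> length xs < U \<and> X < U \<and>
    (\<forall>bs. \<tau> \<le> length bs \<longrightarrow> hl.wp U xs (solver k) (\<lambda>s' A' bs' t'. (s' rAns \<noteq> 0 \<longleftrightarrow> acc bs) \<and> t' \<le> \<tau>) (\<lambda>_. 0) (\<lambda>_ _. 0) bs 0) \<and>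
    (\<forall>T\<ge>\<tau>. real (card {bs. length bs = T \<and> acc bs \<noteq> b}) \<le> \<delta> * 2 ^ T)"
  proof (cases "t = 0 \<or> c = 0")
    case True
    have "(2::nat) ^ 0 \<le> 2 ^ (k + 1)" by (intro power_increasing) auto
    then have "1 \<le> X" using X2 unfolding power_0 by (rule le_trans)
    then have "2 ^ 0 \<le> 2 * 16 ^ k * X ^ (2 * k)" by (simp add: Suc_le_eq)
    note B = word_bounds[OF X2 k nX this, folded U_def]
    have xsU: "length xs < U" "\<forall>y\<in>set xs. y < U" using B xs leX by (auto intro: le_less_trans)
    have trv: "t + c = 0 \<longleftrightarrow> b"
      unfolding b_def t_def c_def by (rule k_subset_sum_card_zero) (use zs l k True in \<open>auto simp: t_def c_def\<close>)
    have "hl.wp U xs (solver k) (\<lambda>s' A' bs' t'. (s' rAns \<noteq> 0 \<longleftrightarrow> b) \<and> t' \<le> 12 * k + 20 + 0) (\<lambda>_. 0) (\<lambda>_ _. 0) bs 0" for bs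
      by (rule hl.wp_solver[OF xs xsU l(1) xts l(2) xcs k t_def[THEN meta_eq_to_obj_eq] c_def[THEN meta_eq_to_obj_eq]]) (use True trv in auto)
    moreover have "real (12 * k + 20) \<le> soft_O_bound (time_const k) 5 x f"
    proof -
      have "1 * 1 * 1 * (12 * k + 20) \<le> time_const k" unfolding time_const_def by (intro mult_le_mono) auto
      then have "real (12 * k + 20) \<le> real (time_const k)" by simp
      also have "\<dots> = real (time_const k) * 1 * 1 ^ 5" by simp
      also have "\<dots> \<le> real (time_const k) * (1 + f) * log 2 (2 + x) ^ 5"
        using x0 log_le_cancel_iff[of 2 2 "2 + x"] by (intro mult_mono power_mono) (auto simp: f_def)
      finally show ?thesis unfolding soft_O_bound_def .
    qed
    ultimately show ?thesis using B xsU \<delta> by (intro exI[of _ "12 * k + 20"] exI[of _ "\<lambda>_. b"]) simp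
  next
    case False
    then have t1: "1 \<le> t" and c1: "1 \<le> c" by auto
    define lam where "lam d = (if d < k then c else t)" for d
    define J where "J = {j. j < n \<and> zs ! j \<le> t}"
    have "finite J" by (simp add: J_def)
    \<comment> \<open>Radices, codes and choices do not depend on the weights; zero is a
      placeholder.\<close>
    then interpret G: gf k lam J "(!) zs" "\<lambda>_. 0" by unfold_locales
    have W2: "G.W (2 * k) = (2 * c + 2) ^ k * (2 * t + 2) ^ k" by (rule G.radix_twice) (simp add: lam_def)
    define \<sigma> where "\<sigma> = (LEAST m. G.W (2 * k) \<le> 2 ^ m)"
    have DN: "G.W (2 * k) \<le> 2 ^ \<sigma>" unfolding \<sigma>_def by (rule LeastI[of _ "G.W (2 * k)"]) (use less_exp less_imp_le in blast)
    have smin: "2 ^ i < G.W (2 * k)" if "i < \<sigma>" for i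
      using not_less_Least[of i "\<lambda>m. G.W (2 * k) \<le> 2 ^ m"] that unfolding \<sigma>_def by simp
    \<comment> \<open>A table of size at least 16 gives \<open>2 \<le> \<sigma>\<close> and, through
      \<open>p > 16\<close>, an odd prime.\<close>
    have "4 * 4 \<le> (2 * c + 2) ^ k * (2 * t + 2) ^ k"
      using self_le_pow[of "2 * c + 2" k] self_le_pow[of "2 * t + 2" k] t1 c1 k by (intro mult_le_mono) linarith+
    then have N16: "16 \<le> (2::nat) ^ \<sigma>" using DN W2 by linarith
    have \<sigma>2: "2 \<le> \<sigma>"
    proof (rule ccontr)
      assume "\<not> 2 \<le> \<sigma>"
      then have "(2::nat) ^ \<sigma> \<le> 2 ^ 1" by (intro power_increasing) auto
      then show False using N16 by simp
    qed
    \<comment> \<open>\<open>2 * c + 2 \<le> 4 * c\<close> and \<open>2 * t + 2 \<le> 4 * t\<close>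
      give \<open>16 ^ k\<close>; rounding up to a power of two gives the 2.\<close>
    have Nb: "2 ^ \<sigma> \<le> 2 * 16 ^ k * (t ^ k * c ^ k)"
    proof -
      have "(2 * c + 2) ^ k * (2 * t + 2) ^ k \<le> (4 * c) ^ k * (4 * t) ^ k" using t1 c1 by (intro mult_le_mono power_mono) auto
      also have "\<dots> = 4 ^ k * 4 ^ k * (t ^ k * c ^ k)" by (simp only: power_mult_distrib ac_simps)
      also have "(4::nat) ^ k * 4 ^ k = 16 ^ k" by (simp flip: power_mult_distrib)
      finally have "2 ^ (\<sigma> - 1) \<le> 16 ^ k * (t ^ k * c ^ k)" using smin[of "\<sigma> - 1"] \<sigma>2 unfolding W2 by linarith
      moreover have "(2::nat) ^ \<sigma> = 2 * 2 ^ (\<sigma> - 1)" using \<sigma>2 by (simp flip: power_Suc)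
      ultimately show ?thesis by simp
    qed
    have "t ^ k * c ^ k \<le> X ^ k * X ^ k" using tcX by (intro mult_le_mono power_mono) auto
    then have "2 * 16 ^ k * (t ^ k * c ^ k) \<le> 2 * 16 ^ k * X ^ (2 * k)" by (simp add: mult_2 power_add)
    then have "2 ^ \<sigma> \<le> 2 * 16 ^ k * X ^ (2 * k)" using Nb by linarith
    note B = word_bounds[OF X2 k nX this, folded U_def]
    have xsU: "length xs < U" "\<forall>y\<in>set xs. y < U" using B xs leX by (auto intro: le_less_trans)
    define p where "p = (LEAST q :: nat. prime q \<and> 2 ^ \<sigma> < q)"
    obtain q :: nat where q: "prime q" "2 ^ \<sigma> < q" "q \<le> 4 * \<sigma> * 2 ^ \<sigma>" using prime_between[OF \<sigma>2] by blast
    then have p: "prime p" "2 ^ \<sigma> < p" "p \<le> 4 * \<sigma> * 2 ^ \<sigma>"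
      unfolding p_def using LeastI[of "\<lambda>q :: nat. prime q \<and> 2 ^ \<sigma> < q" q] Least_le[of "\<lambda>q :: nat. prime q \<and> 2 ^ \<sigma> < q" q] by auto
    have pmin: "\<not> prime q'" if "2 ^ \<sigma> < q'" "q' < p" for q'
      using not_less_Least[of q' "\<lambda>q :: nat. prime q \<and> 2 ^ \<sigma> < q"] that unfolding p_def by blast
    define iv where "iv = (p + 1) div 2"
    have iv: "[int iv * 2 = 1] (mod int p)"
    proof -
      have "odd p" using prime_odd_nat[of p] p N16 by simp
      then have "iv * 2 = p + 1" unfolding iv_def by (auto elim!: oddE)
      then have "int iv * 2 = int p + 1" by linarith
      then show ?thesis by (simp add: cong_def)
    qed
    define goal where "goal = (\<Sum>i<k. xs ! (2 + i) * G.W (k + i) + xs ! (2 + k + i) * G.W i)"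
    interpret P: prog2 U xs k lam J "(!) zs" "\<lambda>_. 0" n t c \<sigma> p iv goal
    proof unfold_locales
      show "card (J \<inter> {..<m}) \<le> t" for m unfolding J_def n_def by (rule card_distinct_bounded[OF zs])
      show "p < U" using p B by linarith
      show "1 \<le> k" "1 \<le> t" "1 \<le> c" "2 \<le> \<sigma>" by fact+
      show "lam d = (if d < k then c else t)" for d by (rule lam_def)
      show "J = {j. j < n \<and> zs ! j \<le> t}" by (rule J_def)
      show "length xs = 2 + 2 * k + n" by (rule xs(1))
      show "xs ! (2 + 2 * k + j) = zs ! j" if "j < n" for j using that by (rule xzs)
      show "prime p" "2 ^ \<sigma> < p" "p \<le> 4 * \<sigma> * 2 ^ \<sigma>" by (fact p)+
      show "G.W (2 * k) \<le> 2 ^ \<sigma>" "[int iv * 2 = 1] (mod int p)" by fact+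
      show "16 * (k + 1) * (\<sigma> + 1) * (2 ^ \<sigma> * 2 ^ \<sigma>) < U" "(n + 1) * (k + 1) < U" by (fact B)+
      show "length xs < U" by (fact xsU)
      show "2 ^ i < G.W (2 * k)" if "i < \<sigma>" for i using that by (rule smin)
      show "\<not> prime q" if "2 ^ \<sigma> < q" "q < p" for q using that by (rule pmin)
      show "iv = (p + 1) div 2" by (rule iv_def)
      show "goal = (\<Sum>i<k. xs ! (2 + i) * G.W (k + i) + xs ! (2 + k + i) * G.W i)" by (rule goal_def)
      show "xs ! (2 + i) \<le> t" "xs ! (2 + k + i) \<le> c" if "i < k" for i
        unfolding xts[OF that] xcs[OF that] by (fact tmax[OF that])+
    qed
    obtain R where R: "\<And>i. i < R \<Longrightarrow> dv div 2 ^ i \<noteq> 0" "dv div 2 ^ R = 0" "1 \<le> \<delta> * 2 ^ R" "1 \<le> R" "2 ^ (R - 1) \<le> 2 + 1 / \<delta>"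
      unfolding dv_def using repetitions[OF \<delta>(1) \<delta>1] by blast
    define acc where "acc bs \<longleftrightarrow> (\<exists>\<rho><R. P.good (take P.L (drop (\<rho> * P.L) bs)))" for bs
    define \<tau> where "\<tau> = 12 * k + 20 + (P.setup_time + R * (P.trial_time + 5))"
    \<comment> \<open>The time bound pays for every coin, so a list as long as the running time
      contains all \<open>R\<close> segments.\<close>
    have RL: "R * P.L \<le> \<tau>"
    proof -
      have "P.L \<le> n * k * (\<sigma> * 4 + 8)" by simp
      then have "P.L \<le> P.trial_time + 5" unfolding P.trial_time_def by linarith
      then have "R * P.L \<le> R * (P.trial_time + 5)" by (rule mult_le_mono2)
      then show ?thesis unfolding \<tau>_def by linarith
    qed
    have dU: "dv < U" using dX B by linarith
    have "hl.wp U xs (solver k) (\<lambda>s' A' bs' t'. (s' rAns \<noteq> 0 \<longleftrightarrow> acc bs) \<and> t' \<le> \<tau>) (\<lambda>_. 0) (\<lambda>_ _. 0) bs 0" if bs: "\<tau> \<le> length bs" for bs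
      unfolding \<tau>_def
    proof (rule P.wp_solver[OF xs xsU l(1) xts l(2) xcs k t_def[THEN meta_eq_to_obj_eq] c_def[THEN meta_eq_to_obj_eq]])
      fix s :: store and tt assume s: "s rN = n" "s rDv = dv" "s rTm = t" "s rCm = c"
      show "P.wp (solver_main k) (\<lambda>s' A' bs' t'. (s' rAns \<noteq> 0 \<longleftrightarrow> acc bs) \<and> t' \<le> tt + (P.setup_time + R * (P.trial_time + 5))) s (\<lambda>_ _. 0) bs tt"
        unfolding acc_def by (rule P.wp_solver_main[OF s _ R(1,2) dU]) (use RL bs in auto)
    qed (use False in auto)
    moreover have "real (card {bs. length bs = T \<and> acc bs \<noteq> b}) \<le> \<delta> * 2 ^ T" if "\<tau> \<le> T" for T
      unfolding acc_def
    proof (rule P.error_bound)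
      show "G.choices P.\<kappa>g \<noteq> {} \<longleftrightarrow> b"
        unfolding b_def by (rule G.choices_iff[where t = t]) (use xts xcs zs tmax in \<open>auto simp: J_def n_def\<close>)
    qed (use RL that R \<delta> in auto)
    moreover have "real \<tau> \<le> soft_O_bound (time_const k) 5 x f"
    proof -
      have "2 ^ (R - 1) \<le> 2 + x" using R(5) by (simp add: x_def)
      then have "real ((R + 1) * ((n + 2 ^ \<sigma>) * (\<sigma> + 1) ^ 4 * (100 * k + 3000))) \<le> soft_O_bound (time_const k) 5 x f"
        unfolding f_def by (rule time_estimate[OF k Nb R(4) _ bt])
      moreover have "real \<tau> \<le> real ((R + 1) * ((n + 2 ^ \<sigma>) * (\<sigma> + 1) ^ 4 * (100 * k + 3000)))"
        unfolding \<tau>_def by (subst of_nat_le_iff) (rule P.time_bound)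
      ultimately show ?thesis by (rule order_trans[rotated])
    qed
    moreover have "1 \<le> \<tau>" by (simp add: \<tau>_def)
    ultimately show ?thesis using B xsU by blast
  qed
  then obtain \<tau> acc where \<tau>: "real \<tau> \<le> soft_O_bound (time_const k) 5 x f" "1 \<le> \<tau>" "2 \<le> U" "length xs < U" "X < U"
    "\<And>bs. \<tau> \<le> length bs \<Longrightarrow> hl.wp U xs (solver k) (\<lambda>s' A' bs' t'. (s' rAns \<noteq> 0 \<longleftrightarrow> acc bs) \<and> t' \<le> \<tau>) (\<lambda>_. 0) (\<lambda>_ _. 0) bs 0"
    "\<And>T. \<tau> \<le> T \<Longrightarrow> real (card {bs. length bs = T \<and> acc bs \<noteq> b}) \<le> \<delta> * 2 ^ T" by blast
  \<comment> \<open>As \<open>1 \<le> \<tau>\<close>, the summand 4 pays for the prologue and also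
    makes \<open>T\<close> at least \<open>\<tau>\<close>.\<close>
  define T where "T = (4 + cost_factor (solver k)) * \<tau>"
  have T: "4 + cost_factor (solver k) * \<tau> \<le> T" "\<tau> \<le> T" using \<tau>(2) unfolding T_def distrib_right by linarith+
  have "answers_within w (program k (solver k)) xs b (1 - \<delta>) T"
    by (rule program_answers_within[OF \<tau>(3,4) _ pw wfc_solver len _ T(1)]) (use \<tau>(5-) T leX in \<open>auto intro: le_less_trans\<close>)
  moreover have "real T \<le> real (4 + cost_factor (solver k)) * soft_O_bound (time_const k) 5 x f"
    unfolding T_def of_nat_mult using \<tau>(1) by (rule mult_left_mono) simp
  ultimately show ?thesis unfolding soft_O_bound_mult x_def f_def xs_def b_def by (intro exI[of _ T]) simp
qed

theorem theorem8:
  fixes k :: nat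
  assumes "k \<ge> 1"
  shows "\<exists>(P :: com list) (C :: real) (d :: nat) (e :: nat).
    \<forall>(zs :: nat list) (ts :: nat list) (cs :: nat list) (\<delta> :: real) (w :: nat).
      distinct zs \<and> (\<forall>z \<in> set zs. 0 < z) \<and>
      length ts = k \<and> length cs = k \<and> sum_list cs \<le> length zs \<and>
      0 < \<delta> \<and> \<delta> \<le> 1 / 2 ^ (k + 1) \<and>
      word_length_ok e w (encode zs ts cs \<delta>) \<longrightarrow>
      (let n = length zs; t = Max (set ts); c = Max (set cs) in
        \<exists>T :: nat.
          real T \<le> soft_O_bound C d (real n + real t + 1 / \<delta>) (real n + real t ^ k * real c ^ k) \<and>
          answers_within w P (encode zs ts cs \<delta>) (k_subset_sum_card k (set zs) ts cs) (1 - \<delta>) T)"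
  unfolding Let_def
proof (rule exI[of _ "program k (solver k)"], rule exI[of _ "real ((4 + cost_factor (solver k)) * time_const k)"], rule exI[of _ 5],
    rule exI[of _ "(12 * k + 7) * (cmd_deg (solver k) + 1)"], intro allI impI, elim conjE)
qed (rule program_correct[OF assms])

end
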